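(* Let $V\subseteq\mathbb{P}^N$ be a smooth Fano variety which is the generic point on its component in the Hilbert scheme of $\mathbb{P}^N$. Let $\mathcal{K}$ be a combinatorial sphere with $T^2_{A_{\mathcal{K}}}=0$ and assume that $V$ degenerates to $\mathbb{P}(\mathcal{K}*\Delta_m)$. If $\nabla$ is a lattice polytope having a unimodular regular triangulation of the form $\mathcal{K}*\Delta_m$, then $V$ degenerates to $\mathbb{P}(\nabla)$.
   Context: Over $\mathbb{C}$. For a finite simplicial complex $\mathcal{K}$, the Stanley--Reisner ring is $A_{\mathcal{K}}=\mathbb{C}[x_v:v\in V(\mathcal{K})]/\langle\prod_{v\in p}x_v:p\notin\mathcal{K}\rangle$ and $\mathbb{P}(\mathcal{K})=\operatorname{Proj}A_{\mathcal{K}}$ with its natural embedding in $\operatorname{Proj}\mathbb{C}[x_v]$. $\Delta_m$ ($m\ge0$) is the full simplex on $m+1$ vertices and $*$ denotes join. A combinatorial $n$-sphere is a simplicial complex whose geometric realization is PL-homeomorphic to the boundary of the $(n+1)$-simplex. $T^2_A=T^2(A/\mathbb{C};A)$ is the second cotangent (André--Quillen) cohomology module. For a lattice $M$ and a lattice polytope $\nabla\subset M_{\mathbb{Q}}$, $\mathbb{P}(\nabla)=\operatorname{Proj}\mathbb{C}[S_\nabla]$ where $S_\nabla\subset M\times\mathbb{Z}$ is the semigroup generated by $(u,1)$, $u\in\nabla\cap M$. A triangulation of $\nabla$ is unimodular if all its maximal simplices have normalized volume one, and regular if it is induced by a height function; it is of the form $\mathcal{L}$ if it is isomorphic to $\mathcal{L}$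 as an abstract simplicial complex. "$V$ degenerates to $W$" means there is a flat family of closed subschemes of $\mathbb{P}^N$ with general fibre $V$ and special fibre $W$. "$V$ is the generic point on its component" means that $V$ is a general member of its irreducible component of the Hilbert scheme; correspondingly, degenerations of $V$ are families whose general fibre is a general member of that component. *)

theory Defs
  imports "HOL-Analysis.Analysis" "HOL-Library.Poly_Mapping"
begin

section \<open>Polynomials and ideals\<close>

text \<open>
  Polynomials over \<open>'a\<close> in variables indexed by \<open>'x\<close> are finitely supported functions from
  monomials \<open>'x \<Rightarrow>\<^sub>0 nat\<close> to \<open>'a\<close>.  Ideals and submodules are \<^const>\<open>module.subspace\<close>,
  generated ideals and submodules are \<^const>\<open>module.span\<close> (a ring being a module over itself).
\<close>

type_synonym ('x, 'a) polynomial = "('x \<Rightarrow>\<^sub>0 nat) \<Rightarrow>\<^sub>0 'a"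

abbreviation is_ideal :: "'a::comm_ring_1 set \<Rightarrow> bool"
  where "is_ideal \<equiv> module.subspace (*)"

abbreviation ideal_gen :: "'a::comm_ring_1 set \<Rightarrow> 'a set"
  where "ideal_gen \<equiv> module.span (*)"

definition prime_ideal :: "'a::comm_ring_1 set \<Rightarrow> bool"
  where "prime_ideal p \<longleftrightarrow> is_ideal p \<and> 1 \<notin> p \<and> (\<forall>a b. a * b \<in> p \<longrightarrow> a \<in> p \<or> b \<in> p)"

definition Var :: "'x \<Rightarrow> ('x, 'a::comm_ring_1) polynomial"
  where "Var i = Poly_Mapping.single (Poly_Mapping.single i 1) 1"

definition Const :: "'a::comm_ring_1 \<Rightarrow> ('x, 'a) polynomial"
  where "Const c = Poly_Mapping.single 0 c"

definition smul :: "'r::comm_ring_1 \<Rightarrow> ('i \<Rightarrow>\<^sub>0 'r) \<Rightarrow> ('i \<Rightarrow>\<^sub>0 'r)"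
  where "smul c g = Poly_Mapping.map (\<lambda>x. c * x) g"

text \<open>The ring homomorphism extending \<open>emb\<close> on coefficients and sending the variable \<open>i\<close> to \<open>h i\<close>.\<close>

definition subst_hom :: "('a::zero \<Rightarrow> 'b::comm_ring_1) \<Rightarrow> ('x \<Rightarrow> 'b) \<Rightarrow> ('x, 'a) polynomial \<Rightarrow> 'b"
  where "subst_hom emb h f =
    (\<Sum>\<mu>\<in>Poly_Mapping.keys f. emb (Poly_Mapping.lookup f \<mu>) *
      (\<Prod>i\<in>Poly_Mapping.keys \<mu>. h i ^ Poly_Mapping.lookup \<mu> i))"

abbreviation peval :: "('x \<Rightarrow> 'a::comm_ring_1) \<Rightarrow> ('x, 'a) polynomial \<Rightarrow> 'a"
  where "peval \<equiv> subst_hom (\<lambda>c. c)"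

definition pdiff :: "'x \<Rightarrow> ('x, 'a::comm_ring_1) polynomial \<Rightarrow> ('x, 'a) polynomial"
  where "pdiff i f =
    (\<Sum>\<mu>\<in>Poly_Mapping.keys f. Poly_Mapping.single (\<mu> - Poly_Mapping.single i 1)
      (of_nat (Poly_Mapping.lookup \<mu> i) * Poly_Mapping.lookup f \<mu>))"

definition homogeneous :: "nat \<Rightarrow> ('x, 'a::comm_ring_1) polynomial \<Rightarrow> bool"
  where "homogeneous d f \<longleftrightarrow>
    (\<forall>\<mu>\<in>Poly_Mapping.keys f. (\<Sum>i\<in>Poly_Mapping.keys \<mu>. Poly_Mapping.lookup \<mu> i) = d)"

definition homogeneous_ideal :: "('x, 'a::comm_ring_1) polynomial set \<Rightarrow> bool"
  where "homogeneous_ideal I \<longleftrightarrow> is_ideal I \<and> I = ideal_gen {f \<in> I. \<exists>d. homogeneous d f}"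


section \<open>Topological notions\<close>

definition irreducible_in :: "'a topology \<Rightarrow> 'a set \<Rightarrow> bool"
  where "irreducible_in X S \<longleftrightarrow> S \<subseteq> topspace X \<and> S \<noteq> {} \<and>
    (\<forall>A B. closedin X A \<and> closedin X B \<and> S \<subseteq> A \<union> B \<longrightarrow> S \<subseteq> A \<or> S \<subseteq> B)"

definition irreducible_component :: "'a topology \<Rightarrow> 'a set \<Rightarrow> bool"
  where "irreducible_component X H \<longleftrightarrow> irreducible_in X H \<and>
    (\<forall>S. irreducible_in X S \<and> H \<subseteq> S \<longrightarrow> S = H)"

text \<open>Used only for nonempty spaces of finite dimension, where the maximum exists.\<close>

definition krull_dim :: "'a topology \<Rightarrow> nat"
  where "krull_dim X = (GREATEST k. \<exists>Z :: nat \<Rightarrow> 'a set.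
    (\<forall>i\<le>k. closedin X (Z i) \<and> irreducible_in X (Z i)) \<and> (\<forall>i<k. Z i \<subset> Z (Suc i)))"


section \<open>Closed subschemes of projective space\<close>

text \<open>
  The homogeneous coordinates of \<open>P^N\<close> are indexed by a finite type \<open>'n\<close> with \<open>N + 1\<close> elements.
  A closed subscheme is given by its saturated homogeneous ideal; \<open>Proj_sub I\<close> is the one
  representing \<open>Proj (C[x] / I)\<close>.
\<close>

type_synonym 'n cpoly = "('n, complex) polynomial"

definition Proj_sub :: "('n::finite) cpoly set \<Rightarrow> 'n cpoly set"
  where "Proj_sub I = {f. \<forall>i. \<exists>k. Var i ^ k * f \<in> I}"

definition closed_subschemes :: "('n::finite) cpoly set set"
  where "closed_subschemes = {I. homogeneous_ideal I \<and> Proj_sub I = I}"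

text \<open>
  Closed points are represented by nonzero vectors.  Proportional vectors are not identified; all
  sets below that come from homogeneous polynomials are unions of punctured lines.
\<close>

definition proj_zariski :: "(complex ^ 'n::finite) topology"
  where "proj_zariski = topology_generated_by
    {{a. a \<noteq> 0 \<and> peval (($) a) f \<noteq> 0} | f. \<exists>d. homogeneous d f}"

definition proj_zeros :: "('n::finite) cpoly set \<Rightarrow> (complex ^ 'n) set"
  where "proj_zeros I = {a. a \<noteq> 0 \<and> (\<forall>f\<in>I. peval (($) a) f = 0)}"

abbreviation var_topology :: "('n::finite) cpoly set \<Rightarrow> (complex ^ 'n) topology"
  where "var_topology V \<equiv> subtopology proj_zariski (proj_zeros V)"

definition projective_variety :: "('n::finite) cpoly set \<Rightarrow> bool"
  where "projective_variety V \<longleftrightarrow> V \<in> closed_subschemes \<and> prime_ideal V"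

text \<open>Jacobian criterion: the gradients at each point span a space of dimension \<open>N - dim V\<close>.\<close>

definition smooth_variety :: "('n::finite) cpoly set \<Rightarrow> bool"
  where "smooth_variety V \<longleftrightarrow> projective_variety V \<and>
    (\<forall>a\<in>proj_zeros V. vec.dim ((\<lambda>f. \<chi> i. peval (($) a) (pdiff i f)) ` V)
        + krull_dim (var_topology V) + 1 = CARD('n))"


section \<open>The anticanonical sheaf and Fano varieties\<close>

text \<open>Regular functions on an open subset are extended by 0 outside of it.\<close>

definition regular_funs :: "('n::finite) cpoly set \<Rightarrow> (complex ^ 'n) set \<Rightarrow> (complex ^ 'n \<Rightarrow> complex) set"
  where "regular_funs V W = {f. (\<forall>a. a \<notin> W \<longrightarrow> f a = 0) \<and>
    (\<forall>a\<in>W. \<exists>W'. openin (var_topology V) W' \<and> a \<in> W' \<and> W' \<subseteq> W \<and>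
      (\<exists>d g h. homogeneous d g \<and> homogeneous d h \<and>
        (\<forall>b\<in>W'. peval (($) b) h \<noteq> 0 \<and> f b = peval (($) b) g / peval (($) b) h)))}"

definition fun_restrict :: "'a set \<Rightarrow> ('a \<Rightarrow> complex) \<Rightarrow> ('a \<Rightarrow> complex)"
  where "fun_restrict W f = (\<lambda>a. if a \<in> W then f a else 0)"

text \<open>
  Global sections of the \<open>k\<close>-th power of the anticanonical sheaf of a smooth variety of dimension
  \<open>d\<close>.  As \<open>Hom(\<Omega>, O) = Der(O)\<close> and \<open>\<omega> = \<Lambda>^d \<Omega>\<close> is invertible, a section of
  \<open>\<omega>^(-k) = Hom(\<omega>^k, O)\<close> is a map of sheaves taking \<open>k\<close> blocks of \<open>d\<close> functions to a function,
  which is a \<open>C\<close>-derivation in each argument and alternating within each block.  The argument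
  \<open>\<phi> (j, i)\<close> is the \<open>i\<close>-th function in the \<open>j\<close>-th block, and \<open>D W\<close> is the map over the open
  set \<open>W\<close>.
\<close>

definition args_on ::
  "('n::finite) cpoly set \<Rightarrow> nat \<Rightarrow> nat \<Rightarrow> (complex ^ 'n) set \<Rightarrow> (nat \<times> nat \<Rightarrow> complex ^ 'n \<Rightarrow> complex) set"
  where "args_on V d k W = {\<phi>. \<forall>j<k. \<forall>i<d. \<phi> (j, i) \<in> regular_funs V W}"

definition anticanonical_sections ::
  "('n::finite) cpoly set \<Rightarrow> nat \<Rightarrow>
    ((complex ^ 'n) set \<Rightarrow> (nat \<times> nat \<Rightarrow> complex ^ 'n \<Rightarrow> complex) \<Rightarrow> complex ^ 'n \<Rightarrow> complex) set"
  where "anticanonical_sections V k = (let d = krull_dim (var_topology V) in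
    {D. \<forall>W. openin (var_topology V) W \<longrightarrow> (\<forall>\<phi>\<in>args_on V d k W.
      D W \<phi> \<in> regular_funs V W \<and>
      (\<forall>\<psi>. (\<forall>j<k. \<forall>i<d. \<psi> (j, i) = \<phi> (j, i)) \<longrightarrow> D W \<psi> = D W \<phi>) \<and>
      (\<forall>W'. openin (var_topology V) W' \<and> W' \<subseteq> W \<longrightarrow>
        fun_restrict W' (D W \<phi>) = D W' (\<lambda>s. fun_restrict W' (\<phi> s))) \<and>
      (\<forall>j<k. \<forall>i<d. \<forall>f\<in>regular_funs V W. \<forall>g\<in>regular_funs V W. \<forall>c.
        D W (\<phi>((j, i) := (\<lambda>a. f a + g a))) = (\<lambda>a. D W (\<phi>((j, i) := f)) a + D W (\<phi>((j, i) := g)) a) \<and>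
        D W (\<phi>((j, i) := (\<lambda>a. c * f a))) = (\<lambda>a. c * D W (\<phi>((j, i) := f)) a) \<and>
        D W (\<phi>((j, i) := (\<lambda>a. f a * g a))) =
          (\<lambda>a. f a * D W (\<phi>((j, i) := g)) a + g a * D W (\<phi>((j, i) := f)) a)) \<and>
      (\<forall>j<k. \<forall>i<d. \<forall>i'<d. i \<noteq> i' \<and> \<phi> (j, i) = \<phi> (j, i') \<longrightarrow> D W \<phi> = (\<lambda>a. 0)))})"

definition nonvanishing_locus ::
  "('n::finite) cpoly set \<Rightarrow> nat \<Rightarrow>
    ((complex ^ 'n) set \<Rightarrow> (nat \<times> nat \<Rightarrow> complex ^ 'n \<Rightarrow> complex) \<Rightarrow> complex ^ 'n \<Rightarrow> complex) \<Rightarrow>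
    (complex ^ 'n) set"
  where "nonvanishing_locus V k D = {a. \<exists>W. openin (var_topology V) W \<and> a \<in> W \<and>
    (\<exists>\<phi>\<in>args_on V (krull_dim (var_topology V)) k W. D W \<phi> a \<noteq> 0)}"

text \<open>
  Ampleness in the sense of EGA II, 4.5.2--4.5.3: the nonvanishing loci of the global sections of
  the positive powers form a base of the Zariski topology.
\<close>

definition anticanonical_ample :: "('n::finite) cpoly set \<Rightarrow> bool"
  where "anticanonical_ample V \<longleftrightarrow>
    (\<forall>W a. openin (var_topology V) W \<and> a \<in> W \<longrightarrow>
      (\<exists>k\<ge>1. \<exists>D\<in>anticanonical_sections V k.
        a \<in> nonvanishing_locus V k D \<and> nonvanishing_locus V k D \<subseteq> W))"

definition smooth_Fano :: "('n::finite) cpoly set \<Rightarrow> bool"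
  where "smooth_Fano V \<longleftrightarrow> smooth_variety V \<and> anticanonical_ample V"


section \<open>Flatness\<close>

text \<open>
  Modules are presented as subquotients.  \<open>(Q/Z) \<otimes> (M/J)\<close>, where \<open>M\<close> is the whole type
  \<open>'m\<close>, is the free abelian group on \<open>Q \<times> M\<close> modulo \<open>tensor_relations sx sm Q Z J\<close>.
\<close>

definition tensor_relations ::
  "('r \<Rightarrow> 'x \<Rightarrow> 'x) \<Rightarrow> ('r \<Rightarrow> 'm \<Rightarrow> 'm) \<Rightarrow> 'x::ab_group_add set \<Rightarrow> 'x set \<Rightarrow> 'm::ab_group_add set \<Rightarrow>
    (('x \<times> 'm) \<Rightarrow>\<^sub>0 int) set"
  where "tensor_relations sx sm Q Z J = module.span frag_cmul
    ({frag_of (x + y, m) - frag_of (x, m) - frag_of (y, m) | x y m. x \<in> Q \<and> y \<in> Q} \<union>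
     {frag_of (x, m + m') - frag_of (x, m) - frag_of (x, m') | x m m'. x \<in> Q} \<union>
     {frag_of (sx c x, m) - frag_of (x, sm c m) | c x m. x \<in> Q} \<union>
     {frag_of (z, m) | z m. z \<in> Z} \<union>
     {frag_of (x, j) | x j. x \<in> Q \<and> j \<in> J})"

text \<open>
  Flatness of the module \<open>M/J\<close> over \<open>'r / p\<close>: tensoring with it keeps every inclusion
  \<open>Q/Z \<subseteq> N/Z\<close> of modules injective, where \<open>N\<close> is free of countable rank.  The \<open>N/Z\<close> are all
  the countably generated modules over \<open>'r / p\<close>, and finitely generated ones are enough.
\<close>

definition flat_quotient :: "'r::comm_ring_1 set \<Rightarrow> ('r \<Rightarrow> 'm \<Rightarrow> 'm) \<Rightarrow> 'm::ab_group_add set \<Rightarrow> bool"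
  where "flat_quotient p sm J \<longleftrightarrow>
    (\<forall>Z Q :: (nat \<Rightarrow>\<^sub>0 'r) set.
      module.subspace smul Z \<and> module.subspace smul Q \<and> Z \<subseteq> Q \<and> (\<forall>c\<in>p. \<forall>x. smul c x \<in> Z) \<longrightarrow>
      (\<forall>\<xi>. Poly_Mapping.keys \<xi> \<subseteq> Q \<times> UNIV \<and> \<xi> \<in> tensor_relations smul sm UNIV Z J \<longrightarrow>
        \<xi> \<in> tensor_relations smul sm Q Z J))"


section \<open>Flat families and the Hilbert scheme\<close>

text \<open>
  An affine base scheme of finite type is \<open>Spec (C[t_0, t_1, ...] / p)\<close> for an ideal \<open>p\<close>
  containing all but finitely many of the \<open>t_i\<close>.  A closed subscheme of \<open>P^N\<close> times the base is
  given by a homogeneous ideal of \<open>C[t][x]\<close> containing \<open>p\<close>; its part over the chart \<open>x_i \<noteq> 0\<close> of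
  \<open>P^N\<close> is obtained by setting \<open>x_i = 1\<close>.
\<close>

type_synonym base_ring = "(nat, complex) polynomial"

definition affine_base :: "base_ring set \<Rightarrow> bool"
  where "affine_base p \<longleftrightarrow> is_ideal p \<and> finite {i. Var i \<notin> p}"

definition base_points :: "base_ring set \<Rightarrow> (nat \<Rightarrow> complex) set"
  where "base_points p = {t. \<forall>f\<in>p. peval t f = 0}"

definition base_zariski :: "base_ring set \<Rightarrow> (nat \<Rightarrow> complex) topology"
  where "base_zariski p = topology_generated_by {{t \<in> base_points p. peval t f \<noteq> 0} | f. True}"

definition flat_family :: "base_ring set \<Rightarrow> ('n::finite, base_ring) polynomial set \<Rightarrow> bool"
  where "flat_family p X \<longleftrightarrow> affine_base p \<and> homogeneous_ideal X \<and> Const ` p \<subseteq> X \<and>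
    (\<forall>i. flat_quotient p smul (ideal_gen (X \<union> {Var i - 1})))"

definition fibre :: "('n::finite, base_ring) polynomial set \<Rightarrow> (nat \<Rightarrow> complex) \<Rightarrow> 'n cpoly set"
  where "fibre X t = Proj_sub (Poly_Mapping.map (peval t) ` X)"

text \<open>
  The space of closed points of the Hilbert scheme of \<open>P^N\<close> (all Hilbert polynomials at once).
  The Hilbert scheme represents the functor of flat families and carries a universal family, so its
  Zariski topology is the finest one for which the classifying maps of all flat families over affine
  schemes of finite type are continuous.
\<close>

definition hilbert_open :: "('n::finite) cpoly set set \<Rightarrow> bool"
  where "hilbert_open U \<longleftrightarrow> U \<subseteq> closed_subschemes \<and>
    (\<forall>p X. flat_family p X \<longrightarrow> openin (base_zariski p) {t \<in> base_points p. fibre X t \<in> U})"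

definition hilbert_space :: "('n::finite) cpoly set topology"
  where "hilbert_space = topology hilbert_open"

lemma istopology_hilbert_open: "istopology (hilbert_open :: ('n::finite) cpoly set set \<Rightarrow> bool)"
proof -
  have "hilbert_open (S \<inter> T)" if "hilbert_open S" "hilbert_open T" for S T :: "'n cpoly set set"
  proof -
    have "{t \<in> base_points p. fibre X t \<in> S \<inter> T} =
        {t \<in> base_points p. fibre X t \<in> S} \<inter> {t \<in> base_points p. fibre X t \<in> T}"
      for p and X :: "('n, base_ring) polynomial set"
      by auto
    then show ?thesis
      using that unfolding hilbert_open_def by (auto intro!: openin_Int)
  qed
  moreover have "hilbert_open (\<Union>\<K>)" if "\<forall>K\<in>\<K>. hilbert_open K" for \<K> :: "'n cpoly set set set"
  proof -
    have "{t \<in> base_points p. fibre X t \<in> \<Union>\<K>} = (\<Union>K\<in>\<K>. {t \<in> base_points p. fibre X t \<in> K})"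
      for p and X :: "('n, base_ring) polynomial set"
      by auto
    then show ?thesis
      using that unfolding hilbert_open_def by (auto intro!: openin_Union)
  qed
  ultimately show ?thesis
    unfolding istopology_def by blast
qed

lemma openin_hilbert_space: "openin hilbert_space U \<longleftrightarrow> hilbert_open U"
  unfolding hilbert_space_def by (simp add: topology_inverse' istopology_hilbert_open)

text \<open>
  A condition holds for the general member of a component \<open>H\<close> if it holds on a dense open subset
  of \<open>H\<close>, which may be shrunk to avoid the other components and thus to be open in the Hilbert
  scheme.  \<open>U\<close> is such a subset; it is automatically dense in \<open>H\<close>, and \<open>H\<close> is the only component
  containing \<open>V\<close>.
\<close>

definition general_member ::
  "('n::finite) cpoly set set \<Rightarrow> 'n cpoly set set \<Rightarrow> 'n cpoly set \<Rightarrow> bool"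
  where "general_member H U V \<longleftrightarrow>
    irreducible_component hilbert_space H \<and> openin hilbert_space U \<and> U \<subseteq> H \<and> V \<in> U"

text \<open>
  \<open>V\<close> degenerates to \<open>W\<close>: a flat family over an integral affine base has special fibre \<open>W\<close>, and
  over a nonempty open subset \<open>B\<close> of the base its fibres, one of which is \<open>V\<close>, are general
  members of the component of \<open>V\<close>, that is, lie in \<open>U\<close>.
\<close>

definition degenerates :: "('n::finite) cpoly set set \<Rightarrow> 'n cpoly set \<Rightarrow> 'n cpoly set \<Rightarrow> bool"
  where "degenerates U V W \<longleftrightarrow> (\<exists>p X B s t. prime_ideal p \<and> flat_family p X \<and>
    openin (base_zariski p) B \<and> t \<in> B \<and> fibre X t = V \<and> (\<forall>b\<in>B. fibre X b \<in> U) \<and>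
    s \<in> base_points p \<and> fibre X s = W)"


section \<open>Simplicial complexes and Stanley--Reisner ideals\<close>

definition abstract_complex :: "'v set set \<Rightarrow> bool"
  where "abstract_complex K \<longleftrightarrow> finite K \<and> {} \<in> K \<and>
    (\<forall>s\<in>K. finite s \<and> (\<forall>r. r \<subseteq> s \<longrightarrow> r \<in> K))"

definition full_simplex :: "nat \<Rightarrow> nat set set"
  where "full_simplex m = Pow {0..m}"

definition join :: "'v set set \<Rightarrow> 'w set set \<Rightarrow> ('v + 'w) set set"
  where "join K L = {s <+> r | s r. s \<in> K \<and> r \<in> L}"

definition complex_iso :: "'v set set \<Rightarrow> 'w set set \<Rightarrow> bool"
  where "complex_iso K L \<longleftrightarrow> (\<exists>g. bij_betw g (\<Union>K) (\<Union>L) \<and> L = (\<lambda>s. g ` s) ` K)"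

text \<open>
  If not every element of \<open>'v\<close> is a vertex of \<open>K\<close>, the superfluous variables lie in the ideal, so
  that the quotient is the Stanley--Reisner ring in all cases.
\<close>

definition SR_ideal :: "('v::finite) set set \<Rightarrow> 'v cpoly set"
  where "SR_ideal K = ideal_gen {\<Prod>v\<in>s. Var v | s. s \<notin> K}"

definition geometric_realization :: "('v::finite) set set \<Rightarrow> (real ^ 'v) set"
  where "geometric_realization K =
    {x. (\<forall>v. 0 \<le> x $ v) \<and> (\<Sum>v\<in>UNIV. x $ v) = 1 \<and> {v. x $ v \<noteq> 0} \<in> K}"

definition PL_homeomorphic :: "'a::euclidean_space set \<Rightarrow> 'b::euclidean_space set \<Rightarrow> bool"
  where "PL_homeomorphic S T \<longleftrightarrow> (\<exists>f g. homeomorphism S T f g \<and>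
    (\<exists>P. finite P \<and> \<Union>P = S \<and>
      (\<forall>Q\<in>P. polytope Q \<and> (\<exists>A b. linear A \<and> (\<forall>x\<in>Q. f x = A x + b)))))"

text \<open>
  The simplex is taken in the space containing the realization of \<open>K\<close>, which is large enough since
  a combinatorial \<open>n\<close>-sphere has at least \<open>n + 2\<close> vertices.
\<close>

definition combinatorial_sphere :: "nat \<Rightarrow> ('v::finite) set set \<Rightarrow> bool"
  where "combinatorial_sphere n K \<longleftrightarrow> abstract_complex K \<and>
    (\<exists>S :: (real ^ 'v) set. (int n + 1) simplex S \<and>
      PL_homeomorphic (geometric_realization K) (rel_frontier S))"


section \<open>The second cotangent cohomology\<close>

text \<open>
  \<open>T^2(A/C; A)\<close> for \<open>A = P/I\<close> with \<open>P\<close> a polynomial ring over \<open>C\<close>, following Lichtenbaum and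
  Schlessinger: for a free module \<open>F\<close> mapping onto \<open>I\<close> with kernel \<open>R\<close>, and \<open>R0\<close> the submodule of
  Koszul relations, it is the cokernel of \<open>Hom(F, A) \<rightarrow> Hom(R/R0, A)\<close>.  Here \<open>F\<close> is the free module
  on the set \<open>I\<close>, and maps to \<open>A\<close> are given by maps to \<open>P\<close>, with all conditions imposed modulo \<open>I\<close>.
  The zero element of \<open>T2 I\<close> is the class \<open>T2_coboundaries I\<close>.
\<close>

definition relation_module :: "'v cpoly set \<Rightarrow> ('v cpoly \<Rightarrow>\<^sub>0 'v cpoly) set"
  where "relation_module I = {r. Poly_Mapping.keys r \<subseteq> I \<and>
    (\<Sum>f\<in>Poly_Mapping.keys r. Poly_Mapping.lookup r f * f) = 0}"

definition koszul_relations :: "'v cpoly set \<Rightarrow> ('v cpoly \<Rightarrow>\<^sub>0 'v cpoly) set"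
  where "koszul_relations I = module.span smul
    {Poly_Mapping.single g f - Poly_Mapping.single f g | f g. f \<in> I \<and> g \<in> I}"

definition T2_cocycles :: "'v cpoly set \<Rightarrow> (('v cpoly \<Rightarrow>\<^sub>0 'v cpoly) \<Rightarrow> 'v cpoly) set"
  where "T2_cocycles I = {\<phi>.
    (\<forall>r\<in>relation_module I. \<forall>s\<in>relation_module I. \<phi> (r + s) - (\<phi> r + \<phi> s) \<in> I) \<and>
    (\<forall>c. \<forall>r\<in>relation_module I. \<phi> (smul c r) - c * \<phi> r \<in> I) \<and>
    (\<forall>r\<in>koszul_relations I. \<phi> r \<in> I)}"

definition T2_coboundaries :: "'v cpoly set \<Rightarrow> (('v cpoly \<Rightarrow>\<^sub>0 'v cpoly) \<Rightarrow> 'v cpoly) set"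
  where "T2_coboundaries I = {\<phi>. \<exists>c. \<forall>r\<in>relation_module I.
    \<phi> r - (\<Sum>f\<in>Poly_Mapping.keys r. Poly_Mapping.lookup r f * c f) \<in> I}"

definition T2 :: "'v cpoly set \<Rightarrow> (('v cpoly \<Rightarrow>\<^sub>0 'v cpoly) \<Rightarrow> 'v cpoly) set set"
  where "T2 I = T2_cocycles I // {(\<phi>, \<psi>). \<phi> \<in> T2_cocycles I \<and> \<psi> \<in> T2_cocycles I \<and>
    (\<lambda>r. \<phi> r - \<psi> r) \<in> T2_coboundaries I}"


section \<open>Lattice polytopes\<close>

text \<open>The lattice is \<open>M = Z^d\<close> inside \<open>R^d\<close>.\<close>

definition lattice :: "(real ^ 'd::finite) set"
  where "lattice = {u. \<forall>i. u $ i \<in> \<int>}"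

definition lattice_polytope :: "(real ^ 'd::finite) set \<Rightarrow> bool"
  where "lattice_polytope Q \<longleftrightarrow> (\<exists>S. finite S \<and> S \<noteq> {} \<and> S \<subseteq> lattice \<and> Q = convex hull S)"

text \<open>
  The ideal of \<open>P(Q) = Proj C[S_Q]\<close> in its embedding by the degree one generators \<open>(u, 1)\<close>, with
  the coordinates labelled by the lattice points via \<open>\<tau>\<close>: the kernel of \<open>x_i \<mapsto> \<chi>^(\<tau> i, 1)\<close>.
\<close>

definition toric_ideal :: "('n::finite \<Rightarrow> real ^ 'd::finite) \<Rightarrow> 'n cpoly set"
  where "toric_ideal \<tau> = {f. subst_hom (\<lambda>c. Poly_Mapping.single 0 c)
    (\<lambda>i. Poly_Mapping.single (\<tau> i, 1 :: int) (1 :: complex)) f = 0}"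

text \<open>
  The normalized volume of the lattice simplex with vertex set \<open>s\<close>, relative to the lattice in its
  affine span, is the index of the subgroup generated by the differences of vertices in the group of
  all lattice vectors parallel to the simplex.
\<close>

definition difference_lattice :: "(real ^ 'd::finite) set \<Rightarrow> (real ^ 'd) set"
  where "difference_lattice s = module.span (\<lambda>(c::int) v. of_int c *\<^sub>R v) {u - v | u v. u \<in> s \<and> v \<in> s}"

definition normalized_volume :: "(real ^ 'd::finite) set \<Rightarrow> nat"
  where "normalized_volume s =
    card ((\<lambda>w. {w + l | l. l \<in> difference_lattice s}) ` (lattice \<inter> span {u - v | u v. u \<in> s \<and> v \<in> s}))"

definition vertex_complex :: "'a::euclidean_space set set \<Rightarrow> 'a set set"
  where "vertex_complex T = (\<lambda>S. {v. v extreme_point_of S}) ` T"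

definition triangulates :: "(real ^ 'd::finite) set set \<Rightarrow> (real ^ 'd) set \<Rightarrow> bool"
  where "triangulates T Q \<longleftrightarrow> simplicial_complex T \<and> \<Union>T = Q \<and> \<Union>(vertex_complex T) \<subseteq> lattice"

definition unimodular :: "(real ^ 'd::finite) set set \<Rightarrow> bool"
  where "unimodular T \<longleftrightarrow> (\<forall>s\<in>vertex_complex T.
    (\<forall>r\<in>vertex_complex T. s \<subseteq> r \<longrightarrow> r = s) \<longrightarrow> normalized_volume s = 1)"

text \<open>
  \<open>T\<close> is induced by the height function \<open>h\<close> on the lattice points of \<open>Q\<close>: its faces are the
  projections of the lower faces of the convex hull of the lifted points \<open>(u, h u)\<close>, a lower face
  being cut out by an affine function lying below \<open>h\<close>.
\<close>

definition regular_triangulation :: "(real ^ 'd::finite) set set \<Rightarrow> (real ^ 'd) set \<Rightarrow> bool"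
  where "regular_triangulation T Q \<longleftrightarrow> triangulates T Q \<and> (\<exists>h :: real ^ 'd \<Rightarrow> real.
    vertex_complex T = {{u \<in> Q \<inter> lattice. c \<bullet> u + b = h u} | c b.
      \<forall>u \<in> Q \<inter> lattice. c \<bullet> u + b \<le> h u})"

end

theory Submission
  imports Defs "HOL-Computational_Algebra.Primes" "HOL-Computational_Algebra.Fraction_Field"
begin

text \<open>
  Both \<open>V\<close> and \<open>P(\<nabla>)\<close> specialize to \<open>P(K * \<Delta>_m)\<close>: the second because a regular unimodular
  triangulation yields a squarefree initial ideal. As \<open>T\<^sup>2 = 0\<close>, the two deformations glue and lift to all
  infinitesimal orders, so the locus of tuples of \<open>N\<close> forms of a large degree \<open>r\<close> which locally generate
  an ideal of the right size has a single branch at the monomial point; algebraically, no product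
  \<open>f g\<close> with \<open>f\<close> nonzero on the first family and \<open>g\<close> nonzero on the second lies in the ideal of
  the locus. A prime ideal avoiding all these products carries a flat family with both \<open>V\<close> and
  \<open>P(\<nabla>)\<close> as fibres, and its fibres in \<open>U\<close> lie over an open set because \<open>U\<close> is Hilbert-open.
\<close>

text \<open>T2 governs deformations of the affine cone in all degrees, whereas a flat family of
  projective schemes fixes an ideal only in large degrees. The bridge is a vertex of \<Delta>_m: its
  coordinate \<open>x0\<close> occurs in no minimal nonface, so lifted generators found in large
  degrees can be divided by powers of it. Tuples of forms of one large degree then serve as
  coordinates near the cone, since an ideal and its truncation define the same subscheme. For the
  single branch, suppose f g vanished on the locus. The given family modulo p + m^k1 and the toric
  one modulo t^k both reduce to the cone, so they glue over the fibre product of their bases, and T2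
  = 0 lifts the result to the product base (A/c1)[t]/t^k. There g starts with a unit times a power
  of t, modulo m, which forces f into c1 = p + m^k1; Krull's intersection theorem supplies a k1 for
  which this is false. The labelling of the lattice points is arbitrary, so the toric family must
  also move the coordinates: it substitutes along a straight line of matrices, from the identity at
  t = 0 to a permutation at t = 1.\<close>

interpretation ideal: module "(*) :: 'a::comm_ring_1 => 'a => 'a"
 by unfold_locales (simp_all add: algebra_simps)

declare ideal.scale_scale [simp del]

lemmas alg = algebra_simps
lemmas izero = ideal.subspace_0 and iadd = ideal.subspace_add and iscale = ideal.subspace_scale
 and isetsum = ideal.subspace_sum and gen_base = ideal.span_base and gen_scale = ideal.span_scale
 and gen_sum = ideal.span_sum and gen_minimal = ideal.span_minimal and gen_ideal = ideal.subspace_span and gen_induct = ideal.span_induct_alt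
 and idealI = ideal.subspaceI and ineg = ideal.subspace_neg

type_synonym 'x mon = "'x \<Rightarrow>\<^sub>0 nat"
type_synonym ('x, 'a) pol = "('x, 'a) polynomial"

type_synonym ('k, 'a) pm = "'k \<Rightarrow>\<^sub>0 'a"

abbreviation idl :: "'a::comm_ring_1 set => bool" where "idl == is_ideal"
abbreviation igen :: "'a::comm_ring_1 set => 'a set" where "igen == ideal_gen"
abbreviation "hom == homogeneous"
abbreviation "hideal == homogeneous_ideal"

lemma iminus: "idl I ==> a:I ==> b:I ==> a - b:I"
 by (rule ideal.subspace_diff)

lemma iright: "idl I ==> a:I ==> a * c:I"
 by (metis iscale mult.commute)

lemmas ideal_intros = izero iadd iscale iright
 iminus ineg

lemma primeD:
 assumes "prime_ideal p"
 shows "idl p" "1 ~: p" "a * b:p ==> a:p | b:p"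
 using assms by (auto simp: prime_ideal_def)

lemma prime_mult_iff: "prime_ideal p ==> (a * b:p) = (a:p | b:p)"
 by (meson iscale iright prime_ideal_def)

lemma prime_ideal_power: "prime_ideal p ==> a ^ k:p ==> a:p"
 by (induction k) (auto simp: prime_mult_iff primeD)

lemma prime_ideal_prod: "prime_ideal p ==> (!!a. a:A ==> f a ~: p) ==> prod f A ~: p"
 by (induction A rule: infinite_finite_induct) (auto simp: prime_mult_iff primeD)

lemma ideal_vimage:
 assumes "idl I" and "!!a b. h (a + b) = h a + h b" and "!!a b. h (a * b) = h a * h b"
 shows "idl {a. h a:I}"
proof -
 have "h 0 = 0" using assms(2)[of 0 0] by simp
 thus ?thesis using assms by (auto simp: ideal.subspace_def)
qed

abbreviation "lk == Poly_Mapping.lookup"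
abbreviation "ks == Poly_Mapping.keys"
abbreviation "sg == Poly_Mapping.single"

lemmas pm_eqI = poly_mapping_eqI and keysI = in_keys_iff
 and lk_add = lookup_add and lk_minus = lookup_minus and lk_sum = lookup_sum

lemma lk_sg: "lk (sg i a) j = (if i = j then a else 0)"
 by (simp add: lookup_single when_def)

lemma homogeneousD: "hideal X ==> idl X"
 by (simp add: homogeneous_ideal_def)

section \<open>Monomials, degrees and coefficients of products\<close>

definition mon :: "'x mon => ('x, 'a::comm_ring_1) pol"
 where "mon mu = sg mu 1"

definition mdeg :: "'x mon => nat"
 where "mdeg mu = (SUM i:ks mu. lk mu i)"

lemma mdeg_0 [simp]: "mdeg 0 = 0"
 by (simp add: mdeg_def)

lemma mdeg_superset: "finite A ==> ks mu <= A ==> mdeg mu = (SUM i:A. lk mu i)"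
 unfolding mdeg_def by (rule sum.mono_neutral_left) (auto simp: keysI)

lemma keys_add_nat: "ks (mu + nu :: 'x mon) = ks mu Un ks nu"
 by (auto simp: keysI lk_add)

lemma mdeg_add [simp]: "mdeg (mu + nu) = mdeg mu + mdeg nu"
proof -
 let ?A = "ks mu Un ks nu"
 have "mdeg mu = (SUM i:?A. lk mu i)" "mdeg nu = (SUM i:?A. lk nu i)"
  "mdeg (mu + nu) = (SUM i:?A. lk (mu + nu) i)"
  by (rule mdeg_superset; simp add: keys_add_nat)+
 thus ?thesis by (simp add: lk_add sum.distrib)
qed

lemma mdeg_single [simp]: "mdeg (sg i k) = k"
 by (simp add: mdeg_def)

lemma mdeg_eq_0_iff [simp]: "(mdeg mu = 0) = (mu = 0)"
 unfolding mdeg_def by (auto simp: keysI intro!: pm_eqI)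

lemma hom_iff: "(hom d f) = (ALL mu. lk f mu ~= 0 --> mdeg mu = d)"
 by (auto simp: homogeneous_def mdeg_def keysI)

lemma sum_sg: "(SUM mu:ks f. sg mu (lk f mu)) = f"
 by (rule pm_eqI)
  (auto simp: lk_sum lk_sg keysI)

lemma sum_sg_superset:
 assumes "finite A" "ks f <= A"
 shows "(SUM mu:A. sg mu (lk f mu)) = f"
 using assms sum_sg[of f]
 by (metis (mono_tags, lifting) DiffE keysI single_zero sum.mono_neutral_left)

lemma poly_induct [case_names single add]:
 assumes "!!mu a. P (sg mu a)" and "!!f g. P f ==> P g ==> P (f + g)"
 shows "P (f :: 'k \<Rightarrow>\<^sub>0 'a::comm_monoid_add)"
proof -
 have "P (SUM mu:A. sg mu (lk f mu))" if "finite A" for A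
  using that by (induction A rule: finite_induct) (use assms(1)[of _ 0] in "auto intro: assms")
 thus ?thesis using sum_sg_superset[of "ks f" f] by (metis finite_keys order_refl)
qed

lemma additive_eqI:
 fixes F G :: "('k \<Rightarrow>\<^sub>0 'a::comm_monoid_add) => 'b::comm_monoid_add"
 assumes "!!f g. F (f + g) = F f + F g" "!!f g. G (f + g) = G f + G g" "!!mu a. F (sg mu a) = G (sg mu a)"
 shows "F f = G f"
 by (induction f rule: poly_induct) (simp_all add: assms)

lemma lk_single_mult: "lk (sg mu a * f) (mu + nu) = a * lk f nu" for mu :: "'x mon" and a :: "'a::comm_ring_1"
 by (induction f rule: poly_induct) (simp_all add: mult_single lk_sg lk_add ring_distribs)

lemma lk_single_mult_0: "(\<nexists>ka. nu = mu + ka) ==> lk (sg mu a * f) nu = 0"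
 for mu :: "'x mon" and a :: "'a::comm_ring_1"
 by (induction f rule: poly_induct) (auto simp: mult_single lk_sg lk_add ring_distribs)

lemma lk_mult_nonzeroD:
 fixes f g :: "('x, 'a::comm_ring_1) pol"
 assumes "lk (f * g) nu ~= 0"
 obtains mu ka where "nu = mu + ka" "lk f mu ~= 0" "lk g ka ~= 0"
 using keys_mult[of f g] assms by (force simp: keysI)

lemma mon_0 [simp]: "mon 0 = 1"
 by (simp add: mon_def)

lemma mon_add: "mon (mu + nu) = mon mu * mon nu"
 by (simp add: mon_def mult_single)

lemma Const_0 [simp]: "Const 0 = 0" and Const_1 [simp]: "Const 1 = 1"
 and Const_add: "Const (a + b) = Const a + Const b"
 and Const_mult: "Const (a * b) = Const a * Const b"
 and Const_minus: "Const (a - b) = Const a - Const b"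
 by (simp_all add: Const_def single_add mult_single single_diff single_uminus)

lemma sg_eq: "sg mu a = Const a * mon mu"
 by (simp add: Const_def mon_def mult_single)

lemma lk_Const: "lk (Const a * f) nu = a * lk f nu" for f :: "('x, 'a::comm_ring_1) pol"
 using lk_single_mult[of 0 a f nu] by (simp add: Const_def)

lemma lk_mon: "lk (mon mu) nu = (if mu = nu then 1 else 0)"
 by (simp add: mon_def lk_sg)

lemma lk_mon_mult: "lk (mon mu * f) (mu + nu) = lk f nu"
 by (simp add: mon_def lk_single_mult)

lemma lk_mon_mult_0: "(\<nexists>ka. nu = mu + ka) ==> lk (mon mu * f) nu = 0"
 by (simp add: mon_def lk_single_mult_0)

lemma Var_mon: "Var i = mon (sg i 1)"
 by (simp add: Var_def mon_def)

lemma Var_power: "Var i ^ k = mon (sg i k)"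
 by (induction k) (simp_all add: Var_mon flip: mon_add single_add)

lemma smul_Const: "smul c f = Const c * f"
 by (simp add: smul_def Const_def mult_map_scale_conv_mult)

lemma lk_smul: "lk (smul c g) i = c * lk g i"
 unfolding smul_def by transfer (auto simp: when_def)

lemma module_smul: "module (smul :: 'r::comm_ring_1 => ('i, 'r) pm => _)"
 apply (rule module.intro)
 apply (rule pm_eqI)
 apply (simp only: lk_smul lk_add ring_distribs)
 apply (rule pm_eqI)
 apply (simp only: lk_smul lk_add ring_distribs)
 apply (rule pm_eqI)
 apply (simp only: lk_smul mult.assoc)
 apply (rule pm_eqI)
 apply (simp only: lk_smul mult_1_left)
 done
interpretation sm: module smul
 by (rule module_smul)

lemmas sm_0 = sm.subspace_0 and sm_add = sm.subspace_add and sm_scale = sm.subspace_scale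

subsection \<open>Coefficient changes and substitutions\<close>

text \<open>The basic lemma asks only for \<open>h 0 = 0\<close>, because besides ring maps also
  additive functionals of the coefficient ring are applied coefficientwise in the obstruction
  argument.\<close>

definition cmap :: "('a::zero => 'b::zero) => ('k, 'a) pm => ('k, 'b) pm"
 where "cmap h = Poly_Mapping.map h"

lemma lk_cmap: "h 0 = 0 ==> lk (cmap h f) mu = h (lk f mu)"
 unfolding cmap_def by transfer (auto simp: when_def)

locale rhom =
 fixes h :: "'a::comm_ring_1 => 'b::comm_ring_1"
 assumes add: "h (a + b) = h a + h b" and mult: "h (a * b) = h a * h b" and one: "h 1 = 1"
begin

lemma zero: "h 0 = 0" using add[of 0 0] by simp

lemma uminus: "h (- a) = - h a" using add[of a "- a"] by (simp add: zero add_eq_0_iff)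

lemma diff: "h (a - b) = h a - h b" using add[of a "- b"] by (simp add: uminus)

lemma sum: "h (sum f A) = (SUM a:A. h (f a))"
 by (induction A rule: infinite_finite_induct) (simp_all add: zero add)

lemma prod: "h (prod f A) = (PROD a:A. h (f a))"
 by (induction A rule: infinite_finite_induct) (simp_all add: one mult)

lemma power: "h (a ^ k) = h a ^ k"
 by (induction k) (simp_all add: one mult)

lemmas hom_simps = zero one add mult uminus diff sum prod power

lemma lk_cm: "lk (cmap h f) mu = h (lk f mu)"
 by (rule lk_cmap) (rule zero)

lemma cmap_single: "cmap h (sg mu a) = sg mu (h a)"
 by (rule pm_eqI) (simp add: lk_cm lk_sg zero)

lemma cmap_Const: "cmap h (Const a) = Const (h a)"
 by (simp add: Const_def cmap_single)

lemma cmap_mon: "cmap h (mon mu) = mon mu"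
 by (simp add: mon_def cmap_single one)

lemma cmap_Var: "cmap h (Var i) = Var i"
 by (simp add: Var_mon cmap_mon)

lemma cmap_add: "cmap h (f + g) = cmap h f + cmap h g"
 by (rule pm_eqI) (simp add: lk_cm lk_add add)

lemma cmap_mult: "cmap h (f * g) = cmap h f * cmap h g" for f :: "('x, 'a) pol"
proof (induction f rule: poly_induct)
 case (single mu a)
 show ?case
  by (induction g rule: poly_induct)
   (simp_all add: mult_single cmap_single cmap_add mult ring_distribs)
qed (simp add: cmap_add ring_distribs)

lemma rhom_cmap: "rhom (cmap h :: ('x, 'a) pol => _)"
 by unfold_locales (simp_all add: cmap_add cmap_mult cmap_mon flip: mon_0)

lemma ideal_kernel: "idl I ==> idl {a. h a:I}"
 by (rule ideal_vimage) (simp_all add: add mult)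

lemma prime_kernel: "prime_ideal I ==> prime_ideal {a. h a:I}"
 by (auto simp: prime_ideal_def ideal_kernel mult one)

end

lemma rhom_comp: "rhom f ==> rhom g ==> rhom (%x. g (f x))"
 by (simp add: rhom_def)

lemma rhom_id: "rhom (%x. x)"
 by (simp add: rhom_def)

lemma rhom_Const: "rhom Const"
 by (simp add: rhom_def Const_add Const_mult)

definition meval :: "('x => 'b::comm_ring_1) => 'x mon => 'b"
 where "meval h mu = (PROD i:ks mu. h i ^ lk mu i)"

lemma meval_superset: "finite A ==> ks mu <= A ==> meval h mu = (PROD i:A. h i ^ lk mu i)"
 unfolding meval_def by (rule prod.mono_neutral_left) (auto simp: keysI)

lemma meval_add: "meval h (mu + nu) = meval h mu * meval h nu"
proof -
 let ?A = "ks mu Un ks nu"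
 have "meval h mu = (PROD i:?A. h i ^ lk mu i)" "meval h nu = (PROD i:?A. h i ^ lk nu i)"
  "meval h (mu + nu) = (PROD i:?A. h i ^ lk (mu + nu) i)"
  by (rule meval_superset; simp add: keys_add_nat)+
 thus ?thesis by (simp add: lk_add power_add prod.distrib)
qed

lemma meval_0 [simp]: "meval h 0 = 1"
 by (simp add: meval_def)

lemma meval_single [simp]: "meval h (sg i k) = h i ^ k"
 by (cases "k = 0") (simp_all add: meval_def)

lemma subst_hom_superset:
 assumes "e 0 = 0" "finite A" "ks f <= A"
 shows "subst_hom e h f = (SUM mu:A. e (lk f mu) * meval h mu)"
 unfolding subst_hom_def meval_def[symmetric] using assms
 by (intro sum.mono_neutral_left) (auto simp: keysI)

context rhom
begin

lemma subst_single: "subst_hom h k (sg mu a) = h a * meval k mu"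
 by (subst subst_hom_superset[where A = "{mu}"]) (auto simp: zero)

lemma subst_add: "subst_hom h k (f + g) = subst_hom h k f + subst_hom h k g"
proof -
 let ?A = "ks f Un ks g"
 have "subst_hom h k x = (SUM mu:?A. h (lk x mu) * meval k mu)" if "x:{f, g, f + g}" for x
  by (rule subst_hom_superset) (use that keys_add[of f g] in "auto simp: zero")
 thus ?thesis by (simp add: lk_add add sum.distrib ring_distribs)
qed

lemma subst_mult: "subst_hom h k (f * g) = subst_hom h k f * subst_hom h k g"
proof (induction f rule: poly_induct)
 case (single mu a)
 show ?case
  by (induction g rule: poly_induct)
   (simp_all add: mult_single subst_single subst_add mult meval_add ring_distribs)
qed (simp add: subst_add ring_distribs)

lemma rhom_subst: "rhom (subst_hom h k)"
 by unfold_locales (simp_all add: subst_add subst_mult subst_single one flip: single_one)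

lemma subst_Const: "subst_hom h k (Const a) = h a"
 by (simp add: Const_def subst_single)

lemma subst_mon: "subst_hom h k (mon mu) = meval k mu"
 by (simp add: mon_def subst_single one)

lemma subst_Var: "subst_hom h k (Var i) = k i"
 by (simp add: Var_mon subst_mon)

end

lemma rhom_peval: "rhom (peval t)"
 by (rule rhom.rhom_subst[OF rhom_id])

lemma peval_Const [simp]: "peval t (Const a) = a" and peval_Var [simp]: "peval t (Var i) = t i"
 by (rule rhom.subst_Const[OF rhom_id], rule rhom.subst_Var[OF rhom_id])

text \<open>Uniqueness in the universal property of polynomial rings; comparisons of substitutions
  and specializations below are reduced by it to constants and variables.\<close>

lemma rhom_eqI:
 fixes F G :: "('x, 'a::comm_ring_1) pol => 'b::comm_ring_1"
 assumes "rhom F" "rhom G" "!!a. F (Const a) = G (Const a)" "!!i. F (Var i) = G (Var i)"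
 shows "F f = G f"
proof -
 interpret F: rhom F by fact
 interpret G: rhom G by fact
 have m: "F (mon mu) = G (mon mu)" for mu
 proof (induction "mdeg mu" arbitrary: mu)
  case 0 thus ?case by (simp add: F.one G.one)
 next
  case (Suc n)
  hence "mu ~= 0" by auto
  then obtain i where i: "lk mu i ~= 0" by (metis lookup_zero pm_eqI)
  define nu where "nu = mu - sg i 1"
  have mu: "mu = nu + sg i 1" unfolding nu_def
   by (rule pm_eqI) (use i in "auto simp: lk_add lk_minus lk_sg")
  hence "F (mon nu) = G (mon nu)" using Suc by (intro Suc(1)) (metis Suc_eq_plus1 add_right_cancel mdeg_add mdeg_single)
  thus ?case using assms(4)[of i] by (simp add: mu mon_add F.mult G.mult Var_mon)
 qed
 show ?thesis
  by (rule additive_eqI) (simp_all add: F.add G.add sg_eq F.mult G.mult m assms(3))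
qed

subsection \<open>Homogeneous components\<close>

definition hcomp :: "nat => ('x, 'a::comm_ring_1) pol => ('x, 'a) pol"
 where "hcomp d f = (SUM mu:{mu:ks f. mdeg mu = d}. sg mu (lk f mu))"

lemma lk_hcomp: "lk (hcomp d f) mu = (if mdeg mu = d then lk f mu else 0)"
 by (auto simp: hcomp_def lk_sum lk_sg keysI)

lemma hcomp_add: "hcomp d (f + g) = hcomp d f + hcomp d g"
 and hcomp_0 [simp]: "hcomp d 0 = 0"
 and hcomp_minus: "hcomp d (f - g) = hcomp d f - hcomp d g"
 and hcomp_Const_mult: "hcomp d (Const a * f) = Const a * hcomp d f"
 by (rule pm_eqI; simp add: lk_hcomp lk_add lk_minus lk_Const)+

lemma hcomp_sum: "hcomp d (sum f A) = (SUM a:A. hcomp d (f a))"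
 by (induction A rule: infinite_finite_induct) (simp_all add: hcomp_add)

lemma hom_hcomp [simp]: "hom d (hcomp d f)"
 by (simp add: hom_iff lk_hcomp)

lemma hcomp_hom: "hom e f ==> hcomp d f = (if d = e then f else 0)"
 by (rule pm_eqI) (auto simp: hom_iff lk_hcomp)

lemma hom_0 [simp]: "hom d 0" and hom_mon: "hom (mdeg mu) (mon mu)"
 and hom_add: "hom d f ==> hom d g ==> hom d (f + g)"
 and hom_minus: "hom d f ==> hom d g ==> hom d (f - g)"
 and hom_Const_mult: "hom d f ==> hom d (Const a * f)"
 unfolding hom_iff lk_mon lk_add lk_minus lk_Const lk_sg lookup_zero
 by (metis add_0 diff_self mult_zero_right)+

lemma hom_sum: "(!!a. a:A ==> hom d (f a)) ==> hom d (sum f A)"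
 by (induction A rule: infinite_finite_induct) (simp_all add: hom_add)

lemma hom_mult: "hom d f ==> hom e g ==> hom (d + e) (f * g)"
 unfolding hom_iff by (metis lk_mult_nonzeroD mdeg_add)

lemma hom_cmap: "h 0 = 0 ==> hom d f ==> hom d (cmap h f)"
 unfolding hom_iff by (metis lk_cmap)

lemma hcomp_cmap: "h 0 = 0 ==> hcomp d (cmap h f) = cmap h (hcomp d f)"
 by (rule pm_eqI) (simp add: lk_hcomp lk_cmap)

lemma hom_mon_mult: "hom d f ==> hom (mdeg mu + d) (mon mu * f)"
 by (rule hom_mult[OF hom_mon])

lemma hcomp_mon_mult: "hcomp (mdeg mu + d) (mon mu * f) = mon mu * hcomp d f"
proof (rule pm_eqI)
 fix nu show "lk (hcomp (mdeg mu + d) (mon mu * f)) nu = lk (mon mu * hcomp d f) nu"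
 proof (cases "EX ka. nu = mu + ka")
  case True
  thus ?thesis by (auto simp: lk_hcomp lk_mon_mult)
 qed (simp add: lk_hcomp lk_mon_mult_0)
qed

lemma hcomp_mult_hom:
 assumes "hom e g" "e <= d" shows "hcomp d (f * g) = hcomp (d - e) f * g"
proof -
 have *: "hcomp d (f * g) = hcomp (d - e) f * g" if "g = sg mu a" "mdeg mu = e" for g mu a
 proof -
  have g: "x * g = Const a * (mon mu * x)" for x
   unfolding that(1) sg_eq by (metis mult.assoc mult.commute)
  have "hcomp d (f * g) = Const a * hcomp (mdeg mu + (d - e)) (mon mu * f)"
   unfolding g[of f] hcomp_Const_mult using that assms(2) by simp
  thus ?thesis unfolding hcomp_mon_mult g[of "hcomp (d - e) f"] .
 qed
 have "hcomp d (f * g) = (SUM mu:ks g. hcomp d (f * sg mu (lk g mu)))"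
  by (subst (1) sum_sg[of g, symmetric]) (simp add: sum_distrib_left hcomp_sum)
 also have "... = (SUM mu:ks g. hcomp (d - e) f * sg mu (lk g mu))"
  by (intro sum.cong *) (use assms in "auto simp: hom_iff keysI")
 finally show ?thesis by (simp add: sum_sg flip: sum_distrib_left)
qed

lemma hcomp_mult_0:
 assumes "hom e g" "d < e" shows "hcomp d (f * g) = 0"
proof (rule pm_eqI)
 fix mu show "lk (hcomp d (f * g)) mu = lk 0 mu"
 proof (rule ccontr)
  assume "~ ?thesis"
  hence mu: "mdeg mu = d" "lk (f * g) mu ~= 0" by (auto simp: lk_hcomp split: if_splits)
  then obtain ka nu where "mu = ka + nu" "lk g nu ~= 0" by (metis lk_mult_nonzeroD)
  thus False using assms mu(1) by (auto simp: hom_iff)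
 qed
qed

lemma sum_hcomp: "(!!mu. lk f mu ~= 0 ==> mdeg mu <= n) ==> (SUM d<=n. hcomp d f) = f"
 by (rule pm_eqI) (auto simp: lk_sum lk_hcomp)

definition pdeg :: "('x, 'a::comm_ring_1) pol => nat"
 where "pdeg f = Max (insert 0 (mdeg ` ks f))"

lemma mdeg_le_pdeg: "lk f mu ~= 0 ==> mdeg mu <= pdeg f"
 by (simp add: pdeg_def keysI)

lemma sum_hcomp_pdeg: "pdeg f <= n ==> (SUM d<=n. hcomp d f) = f"
 by (rule sum_hcomp) (use mdeg_le_pdeg le_trans in blast)

lemma hom_ideal_hcomp:
 assumes "hideal X" "f:X" shows "hcomp d f:X"
proof -
 have X: "idl X" "X = igen {f:X. EX d. hom d f}"
  using assms(1) by (auto simp: homogeneous_ideal_def)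
 have "f:igen {f:X. EX d. hom d f}" using X assms by auto
 thus ?thesis
 proof (induction rule: gen_induct)
  case base thus ?case using X by (simp add: izero)
 next
  case (step c x y)
  then obtain e where e: "hom e x" "x:X" by blast
  hence "hcomp d (c * x):X"
   using hcomp_mult_hom[of e x d c] hcomp_mult_0[of e x d c] X
   by (cases "e <= d") (auto intro: iscale izero)
  thus ?case using step X by (auto simp: hcomp_add intro: iadd)
 qed
qed

lemma hom_idealI:
 assumes "idl X" "!!f d. f:X ==> hcomp d f:X" shows "hideal X"
proof -
 let ?H = "{f:X. EX d. hom d f}"
 have "f:igen ?H" if "f:X" for f
 proof -
  have "(SUM d<=pdeg f. hcomp d f):igen ?H"
   by (intro gen_sum gen_base) (use that assms hom_hcomp in blast)
  thus ?thesis by (simp add: sum_hcomp_pdeg)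
 qed
 thus ?thesis using assms(1) gen_minimal[of ?H X] by (auto simp: homogeneous_ideal_def)
qed

lemma hom_ideal_gen:
 assumes "!!f. f:S ==> EX d. hom d f" shows "hideal (igen S)"
proof (rule hom_idealI)
 fix f d assume "f:igen S"
 thus "hcomp d f:igen S"
 proof (induction rule: gen_induct)
  case base thus ?case by (simp add: ideal.span_zero)
 next
  case (step c x y)
  then obtain e where "hom e x" using assms by blast
  hence "hcomp d (c * x):igen S"
   using hcomp_mult_hom[of e x d c] hcomp_mult_0[of e x d c] step(1)
   by (cases "e <= d") (auto intro: gen_scale ideal.span_zero gen_base)
  thus ?case using step by (auto simp: hcomp_add intro: ideal.span_add)
 qed
qed simp

subsection \<open>Coefficient ideals\<close>

text \<open>For an ideal \<open>c\<close> this is the extension of \<open>c\<close> to the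
  polynomial ring. Congruence modulo \<open>cI c\<close> replaces base change to R/c, so that no
  quotient type is formed.\<close>

definition cI :: "'a::comm_ring_1 set => ('x, 'a) pol set"
 where "cI c = {f. ALL mu. lk f mu:c}"

lemma cI_iff: "(f:cI c) = (ALL mu. lk f mu:c)"
 by (simp add: cI_def)

lemma cI_Const_mult: "idl c ==> a:c ==> Const a * f:cI c"
 by (simp add: cI_iff lk_Const iright)

lemma cI_mult_products:
 fixes f g :: "('x, 'a::comm_ring_1) pol"
 assumes c: "idl e" and ab: "!!a b. a:c ==> b:d ==> a * b:e" and f: "f:cI c" and g: "g:cI d"
 shows "f * g:cI e"
proof -
 have "lk (sg mu (lk f mu) * g) nu:e" for mu nu
 proof (cases "EX ka. nu = mu + ka")
  case True
  thus ?thesis using f g ab by (auto simp: lk_single_mult cI_iff)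
 qed (simp add: lk_single_mult_0 izero[OF c])
 hence "lk ((SUM mu:ks f. sg mu (lk f mu)) * g) nu:e" for nu
  using c by (simp add: sum_distrib_right lk_sum isetsum)
 thus ?thesis by (simp add: sum_sg cI_iff)
qed

lemma icI: "idl c ==> idl (cI c)"
proof (rule idealI)
 fix f g :: "('x, 'a) pol" assume "idl c" "g:cI c"
 thus "f * g:cI c" by (intro cI_mult_products[of c UNIV c]) (auto simp: cI_iff iscale)
qed (auto simp: cI_iff lk_add ideal_intros)

lemma cI_mono: "c <= d ==> cI c <= cI d"
 unfolding cI_def by blast

lemma hcomp_cI: "idl c ==> f:cI c ==> hcomp d f:cI c"
 by (auto simp: cI_iff lk_hcomp izero)

definition pro :: "'a::comm_ring_1 set => ('x, 'a) pol set => ('x, 'a) pol set"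
 where "pro c X = igen {Const a * f | a f. a:c & f:X}"

lemma pro_ideal: "idl (pro c X)"
 by (simp add: pro_def)

lemma pro_base: "a:c ==> f:X ==> Const a * f:pro c X"
 unfolding pro_def by (rule gen_base) blast

lemma pro_minimal:
 assumes "idl Y" "!!a f. a:c ==> f:X ==> Const a * f:Y" shows "pro c X <= Y"
 unfolding pro_def by (rule gen_minimal) (use assms in auto)

lemma pro_mono: "X <= Y ==> pro c X <= pro c Y"
 by (rule pro_minimal[OF pro_ideal]) (auto intro: pro_base)

definition isum :: "'a::comm_ring_1 set => 'a set => 'a set"
 where "isum I J = {a + b | a b. a:I & b:J}"

lemma isum_ideal:
 assumes I: "idl I" and J: "idl J" shows "idl (isum I J)"
proof (rule idealI)
 show "0:isum I J" using assms unfolding isum_def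
  by (metis (mono_tags, lifting) add_0 izero mem_Collect_eq)
next
 fix x y assume "x:isum I J" "y:isum I J"
 then obtain a b a' b' where *: "a:I" "a':I" "b:J" "b':J" "x = a + b" "y = a' + b'"
  unfolding isum_def by blast
 hence "x + y = (a + a') + (b + b')" by simp
 moreover have "a + a':I" "b + b':J" using * I J iadd by blast+
 ultimately show "x + y:isum I J" unfolding isum_def by blast
next
 fix c x assume "x:isum I J"
 then obtain a b where *: "a:I" "b:J" "x = a + b" unfolding isum_def by blast
 hence "c * x = c * a + c * b" by (simp add: ring_distribs)
 moreover have "c * a:I" "c * b:J" using * I J iscale by blast+
 ultimately show "c * x:isum I J" unfolding isum_def by blast
qed

lemma isumI: "a:I ==> b:J ==> a + b:isum I J"
 by (auto simp: isum_def)

lemma isum_iff: "(x:isum I J) = (EX a:I. x - a:J)"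
proof (intro iffI)
 assume "x:isum I J"
 then obtain a b where "a:I" "b:J" "x = a + b" unfolding isum_def by blast
 thus "EX a:I. x - a:J" by (intro bexI[of _ a]) simp_all
next
 assume "EX a:I. x - a:J"
 then obtain a where "a:I" "x - a:J" by blast
 hence "a + (x - a):isum I J" by (rule isumI)
 thus "x:isum I J" by simp
qed

lemma isum_left: assumes "idl J" shows "I <= isum I J"
 using isumI[OF _ izero[OF assms]] by fastforce

lemma isum_right: assumes "idl I" shows "J <= isum I J"
 using isumI[OF izero[OF assms]] by fastforce

lemma isum_minimal: "idl K ==> I <= K ==> J <= K ==> isum I J <= K"
 unfolding isum_def using iadd by blast

section \<open>Linear algebra modulo prime ideals\<close>

definition lc :: "(nat => 'r::comm_ring_1) => ('i => 'r) list => 'i => 'r"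
 where "lc r fs i = (SUM j<length fs. r j * (fs ! j) i)"

text \<open>For prime \<open>p\<close> this is linear independence of the reductions over the
  fraction field of R/p; clearing denominators makes it a statement about coefficients in R.\<close>

definition indep :: "'r::comm_ring_1 set => ('i => 'r) list => bool"
 where "(indep p fs) = ((ALL r. (ALL i. lc r fs i:p) --> (ALL j<length fs. r j:p)))"

lemma lc_Nil [simp]: "lc r [] i = 0"
 by (simp add: lc_def)

lemma lc_Cons [simp]: "lc r (f # fs) i = r 0 * f i + lc (%j. r (Suc j)) fs i"
 by (simp add: lc_def sum.lessThan_Suc_shift del: sum.lessThan_Suc)

lemma lc_zero [simp]: "lc (%_. 0) fs i = 0"
 by (simp add: lc_def)

lemma lc_snoc: "lc r (fs @ [g]) i = lc r fs i + r (length fs) * g i"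
 by (simp add: lc_def nth_append)

lemma lc_cong: "(!!j. j < length fs ==> r j = s j) ==> lc r fs i = lc s fs i"
 by (simp add: lc_def)

lemma lc_mult: "lc (%j. a * r j) fs i = a * lc r fs i"
 by (simp add: lc_def sum_distrib_left mult.assoc)

lemma lc_in: "idl p ==> (!!j. j < length fs ==> r j:p) ==> lc r fs i:p"
 unfolding lc_def by (intro isetsum) (auto intro: iright)

text \<open>A division-free step of Gaussian elimination: the pivot row \<open>f\<close> clears
  coordinate \<open>i\<close> of \<open>g\<close> at the cost of multiplying \<open>g\<close> by the
  pivot.\<close>

definition elim :: "'i => ('i => 'r::comm_ring_1) => ('i => 'r) => 'i => 'r"
 where "elim i f g k = f i * g k - g i * f k"

lemma lc_map_elim: "lc r (map (elim i f) fs) k = f i * lc r fs k - lc r fs i * f k"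
 by (simp add: lc_def elim_def sum_subtractf sum_distrib_left sum_distrib_right alg)

lemma indepD: "indep p fs ==> (!!i. lc r fs i:p) ==> j < length fs ==> r j:p"
 by (auto simp: indep_def)

lemma indep_pivot:
 assumes "prime_ideal p" "indep p (f # fs)" obtains i where "f i ~: p"
proof -
 have "EX i. f i ~: p"
 proof (rule ccontr)
  assume "\<nexists>i. f i ~: p"
  hence "lc (%j. if j = 0 then 1 else 0) (f # fs) i:p" for i
   by simp
  from indepD[OF assms(2) this, of 0] show False
   using assms(1) by (simp add: primeD)
 qed
 thus ?thesis using that by blast
qed

lemma indep_elim:
 assumes p: "prime_ideal p" and i: "f i ~: p"
 shows "(indep p (f # fs)) = (indep p (map (elim i f) fs))"
proof
 note I = primeD(1)[OF p]
 assume ind: "indep p (f # fs)"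
 show "indep p (map (elim i f) fs)"
  unfolding indep_def
 proof (intro allI impI)
  fix r j assume r: "ALL k. lc r (map (elim i f) fs) k:p" and j: "j < length (map (elim i f) fs)"
  define r' where "r' = case_nat (- lc r fs i) (%j. f i * r j)"
  have "lc r' (f # fs) k = lc r (map (elim i f) fs) k" for k
   by (simp add: r'_def lc_mult lc_map_elim)
  hence "r' (Suc j):p" using r j indepD[OF ind, of r' "Suc j"] by simp
  thus "r j:p" using i by (simp add: r'_def prime_mult_iff[OF p])
 qed
next
 note I = primeD(1)[OF p]
 assume ind: "indep p (map (elim i f) fs)"
 show "indep p (f # fs)"
  unfolding indep_def
 proof (intro allI impI)
  fix r j assume r: "ALL k. lc r (f # fs) k:p" and j: "j < length (f # fs)"
  define s where "s = (%j. r (Suc j))"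
  have "lc s (map (elim i f) fs) k:p" for k
  proof -
   have "lc s (map (elim i f) fs) k = f i * lc r (f # fs) k - f k * lc r (f # fs) i"
    by (simp add: lc_map_elim s_def alg)
   also have "...:p"
    by (rule iminus[OF I]; rule iscale[OF I]) (use r in blast)+
   finally show ?thesis .
  qed
  hence s: "s j:p" if "j < length fs" for j
   using indepD[OF ind, of s j] that by simp
  have "r 0 * f i = lc r (f # fs) i - lc s fs i" by (simp add: s_def)
  also have "...:p" using r lc_in[OF I s] by (intro iminus[OF I]) auto
  finally have "r 0:p" using i by (simp add: prime_mult_iff[OF p])
  thus "r j:p" using s[of "j - 1"] j by (cases j) (auto simp: s_def)
 qed
qed

text \<open>Rank is lower semicontinuous: an elimination whose pivots avoid the larger prime runs
  with the same pivots modulo the smaller one.\<close>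

lemma indep_mono:
 assumes "prime_ideal p" "prime_ideal q" "q <= p" "indep p fs"
 shows "indep q fs"
 using assms(4)
proof (induction "length fs" arbitrary: fs)
 case 0 thus ?case by (simp add: indep_def)
next
 case (Suc n)
 then obtain f gs where fs: "fs = f # gs" by (cases fs) auto
 obtain i where i: "f i ~: p" using indep_pivot[OF assms(1)] Suc(3) fs by metis
 have "indep p (map (elim i f) gs)" using Suc(3) indep_elim[of p f i gs, OF assms(1) i] unfolding fs by simp
 hence "indep q (map (elim i f) gs)" using Suc(2) fs by (intro Suc(1)) simp_all
 moreover have "f i ~: q" using i assms(3) by blast
 ultimately show ?case using indep_elim[OF assms(2), of f i gs] unfolding fs by simp
qed

text \<open>Each pivot uses up one coordinate of \<open>A\<close>, as the eliminated vectors vanish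
  modulo \<open>p\<close> at the pivot as well.\<close>

lemma indep_length_le:
 assumes "prime_ideal p" "finite A" "!!f k. f:set fs ==> k ~: A ==> f k:p" "indep p fs"
 shows "length fs <= card A"
 using assms(2-)
proof (induction "length fs" arbitrary: fs A)
 case 0 thus ?case by simp
next
 case (Suc n)
 note I = primeD(1)[OF assms(1)]
 obtain f gs where fs: "fs = f # gs" using Suc(2) by (cases fs) auto
 obtain i where i: "f i ~: p" using indep_pivot[OF assms(1)] Suc fs by metis
 hence iA: "i:A" using Suc(4)[of f i] fs by auto
 have "indep p (map (elim i f) gs)" using Suc(5) indep_elim[of p f i gs, OF assms(1) i] unfolding fs by simp
 moreover have "g k:p" if g: "g:set (map (elim i f) gs)" and k: "k ~: A - {i}" for g k
 proof -
  obtain g' where g': "g':set gs" "g = elim i f g'" using g by auto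
  show ?thesis
  proof (cases "k = i")
   case True thus ?thesis by (simp add: g' elim_def I izero mult.commute)
  next
   case False
   hence "k ~: A" using k by auto
   hence "g' k:p" "f k:p" using Suc(4)[of g' k] Suc(4)[of f k] fs g' by auto
   thus ?thesis unfolding g'(2) elim_def
    by (intro iminus[OF I] iscale[OF I])
  qed
 qed
 ultimately have "length (map (elim i f) gs) <= card (A - {i})"
  using Suc(2,3) fs by (intro Suc(1)) auto
 moreover have "card A > 0" using iA Suc(3) by (auto simp: card_gt_0_iff)
 ultimately show ?case using iA Suc(3) fs by (simp add: card_Diff_singleton)
qed

lemma indep_scale_last:
 assumes p: "prime_ideal p" and "a ~: p" "indep p (xs @ [g])" shows "indep p (xs @ [%k. a * g k])"
 unfolding indep_def
proof (intro allI impI)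
 fix r j assume r: "ALL i. lc r (xs @ [%k. a * g k]) i:p" and j: "j < length (xs @ [%k. a * g k])"
 define s where "s = r(length xs := r (length xs) * a)"
 have "lc s xs i = lc r xs i" for i by (rule lc_cong) (simp add: s_def)
 hence "lc s (xs @ [g]) i:p" for i using r by (simp add: lc_snoc s_def mult.assoc)
 hence "s j:p" using j indepD[OF assms(3), of s j] by simp
 thus "r j:p" using assms(2) by (auto simp: s_def prime_mult_iff[OF p] split: if_splits)
qed

text \<open>Cramer's rule without division: the multiplier \<open>u\<close> is a product of pivots,
  hence lies outside \<open>P\<close>, and every coefficient is built linearly from entries of
  \<open>F\<close>, hence lies in \<open>c\<close>. Keeping track of \<open>c\<close> is what later
  turns rank statements into flatness.\<close>

lemma indep_reduce:
 assumes P: "prime_ideal P" and q: "prime_ideal q" "q <= P" and c: "idl c"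
  and "indep P fs" "!!i. F i:c"
 shows "EX u g. u ~: P & (ALL j. g j:c) &
  ((ALL k. u * F k - lc g fs k:q) | indep q (fs @ [%k. u * F k - lc g fs k]))"
 using assms(5-)
proof (induction "length fs" arbitrary: fs F)
 case 0
 have "indep q [F]" if "F k ~: q" for k
  unfolding indep_def using that by (auto simp: prime_mult_iff[OF q(1)])
 thus ?case using 0 c primeD(2)[OF P]
  by (intro exI[of _ 1] exI[of _ "%_. 0"]) (auto simp: izero)
next
 case (Suc n)
 obtain f gs where fs: "fs = f # gs" using Suc(2) by (cases fs) auto
 obtain i where i: "f i ~: P" using indep_pivot[OF P] Suc fs by metis
 have ind: "indep P (map (elim i f) gs)" using Suc(3) indep_elim[of P f i gs, OF P i] unfolding fs by simp
 have "elim i f F k:c" for k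
  unfolding elim_def using Suc(4) by (intro iminus[OF c] iscale[OF c] iright[OF c])
 moreover have "n = length (map (elim i f) gs)" using Suc(2) fs by simp
 ultimately obtain u g where u: "u ~: P" and g: "ALL j. g j:c"
  and G: "(ALL k. u * elim i f F k - lc g (map (elim i f) gs) k:q) |
   indep q (map (elim i f) gs @ [%k. u * elim i f F k - lc g (map (elim i f) gs) k])"
  using Suc(1)[OF _ ind] by blast
 \<comment> \<open>The coefficient of the pivot row is forced by the demand that the remainder
   vanish at the pivot coordinate.\<close>
 define h where "h = case_nat (u * F i - lc g gs i) (%j. f i * g j)"
 have eq: "u * elim i f F k - lc g (map (elim i f) gs) k = u * f i * F k - lc h fs k" for k
  by (simp add: fs h_def lc_mult lc_map_elim elim_def alg)
 have "u * f i ~: P" using u i by (simp add: prime_mult_iff[OF P])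
 moreover have "h j:c" for j
  using g Suc(4) lc_in[OF c, of gs g i] unfolding h_def
  by (cases j) (auto intro!: iminus[OF c] iscale[OF c])
 moreover have "(ALL k. u * f i * F k - lc h fs k:q) | indep q (fs @ [%k. u * f i * F k - lc h fs k])"
 proof (cases "ALL k. u * f i * F k - lc h fs k:q")
  case False
  define G where "G = (%k. u * f i * F k - lc h fs k)"
  have "indep q (map (elim i f) gs @ [G])" using G False by (simp add: eq G_def)
  hence "indep q (map (elim i f) gs @ [%k. f i * G k])"
   by (rule indep_scale_last[OF q(1), rotated]) (use i q in auto)
  moreover have "G i = 0" by (simp add: G_def flip: eq) (simp add: elim_def lc_map_elim alg)
  hence "elim i f G = (%k. f i * G k)" by (simp add: elim_def fun_eq_iff)
  ultimately have "indep q (map (elim i f) (gs @ [G]))" by simp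
  moreover have "f i ~: q" using i q(2) by blast
  ultimately have "indep q (f # gs @ [G])" using indep_elim[OF q(1), of f i "gs @ [G]"] by simp
  thus ?thesis by (simp add: fs G_def)
 qed simp
 ultimately show ?case by blast
qed

text \<open>The coefficient vectors of the \<open>fs\<close> with respect to the \<open>F j\<close>
  inherit independence, and they are supported on \<open>J\<close>.\<close>

lemma indep_span_bound:
 assumes q: "prime_ideal q" and J: "finite J" and ind: "indep q fs"
  and "!!l. l < length fs ==> EX u r. u ~: q & (ALL k. u * (fs ! l) k - (SUM j:J. r j * F j k):q)"
 shows "length fs <= card J"
proof -
 note I = primeD(1)[OF q]
 obtain u r where u: "!!l. l < length fs ==> u l ~: q"
  and r: "!!l k. l < length fs ==> u l * (fs ! l) k - (SUM j:J. r l j * F j k):q"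
  using assms(4) by metis
 define vs where "vs = map (%l j. if j:J then r l j else 0) [0..<length fs]"
 have lcv: "lc e vs j = (SUM l<length fs. e l * (if j:J then r l j else 0))" for e j
  by (auto simp: lc_def vs_def intro!: sum.cong)
 have "indep q vs"
  unfolding indep_def
 proof (intro allI impI)
  fix e l assume e: "ALL j. lc e vs j:q" and l: "l < length vs"
  have "lc (%l. e l * u l) fs k:q" for k
  proof -
   have "(SUM l<length fs. e l * (SUM j:J. r l j * F j k)) = (SUM j:J. lc e vs j * F j k)"
    by (simp add: lcv sum_distrib_left sum_distrib_right mult.assoc) (rule sum.swap)
   hence "lc (%l. e l * u l) fs k
    = (SUM l<length fs. e l * (u l * (fs ! l) k - (SUM j:J. r l j * F j k))) + (SUM j:J. lc e vs j * F j k)"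
    by (simp add: lc_def right_diff_distrib sum_subtractf mult.assoc)
   also have "...:q"
    using r e by (intro iadd[OF I] isetsum[OF I])
    (auto intro: iscale[OF I] iright[OF I])
   finally show ?thesis .
  qed
  hence "e l * u l:q" using indepD[OF ind, of "%l. e l * u l" l] l by (simp add: vs_def)
  thus "e l:q" using u[of l] l by (simp add: vs_def prime_mult_iff[OF q])
 qed
 hence "length vs <= card J"
  by (rule indep_length_le[OF q J, rotated]) (auto simp: vs_def I izero)
 thus ?thesis by (simp add: vs_def)
qed

text \<open>Triangularity: a relation is tested at the largest leading position whose coefficient is
  nonzero modulo \<open>p\<close>; no other vector with a surviving coefficient contributes
  there.\<close>

lemma indep_leads:
 fixes N :: "'k => nat"
 assumes p: "prime_ideal p"
  and lead: "!!j. j < length fs ==> (fs ! j) (mu j) ~: p"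
  and less: "!!j nu. j < length fs ==> (fs ! j) nu ~: p ==> nu = mu j | N nu < N (mu j)"
  and inj: "!!j j'. j < length fs ==> j' < length fs ==> mu j = mu j' ==> j = j'"
 shows "indep p fs"
 unfolding indep_def
proof (intro allI impI, rule ccontr)
 note I = primeD(1)[OF p]
 fix r j0 assume r: "ALL i. lc r fs i:p" and j0: "j0 < length fs" "r j0 ~: p"
 define B where "B = {j. j < length fs & r j ~: p}"
 have B: "finite B" "B ~= {}" using j0 by (auto simp: B_def)
 have "Max ((%j. N (mu j)) ` B):(%j. N (mu j)) ` B" using B by (intro Max_in) auto
 then obtain j where "j:B" "N (mu j) = Max ((%j. N (mu j)) ` B)" by fastforce
 hence "j:B" "!!j'. j':B ==> N (mu j') <= N (mu j)" using B by auto
 hence j: "j < length fs" "r j ~: p" and max: "!!j'. j' < length fs ==> r j' ~: p ==> N (mu j') <= N (mu j)"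
  by (auto simp: B_def)
 have "r j' * (fs ! j') (mu j):p" if "j' < length fs" "j' ~= j" for j'
 proof (cases "r j':p")
  case False
  hence "(fs ! j') (mu j):p" using less[OF that(1), of "mu j"] inj[OF that(1) j(1)] max[OF that(1)] that(2) by fastforce
  thus ?thesis by (rule iscale[OF I])
 qed (rule iright[OF I])
 hence "(SUM j':{..<length fs} - {j}. r j' * (fs ! j') (mu j)):p"
  by (intro isetsum[OF I]) auto
 moreover have "r j * (fs ! j) (mu j) = lc r fs (mu j) - (SUM j':{..<length fs} - {j}. r j' * (fs ! j') (mu j))"
  unfolding lc_def using j by (subst sum.remove[of _ j]) auto
 moreover have "lc r fs (mu j):p" using r by blast
 ultimately have "r j * (fs ! j) (mu j):p" using iminus[OF I] by simp
 thus False using lead[OF j(1)] j(2) by (simp add: prime_mult_iff[OF p])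
qed

text \<open>Nakayama's lemma at a prime; \<open>W\<close> is a submodule and \<open>g\<close> generates another one modulo \<open>W\<close>.\<close>

lemma nakayama:
 fixes g :: "nat => 'b::ab_group_add"
 assumes "module sc" and W: "module.subspace sc W" and P: "prime_ideal P"
  and "!!i. i < n ==> v i ~: P" "!!i k. i < n ==> k < n ==> a i k:P"
  and "!!i. i < n ==> sc (v i) (g i) - (SUM k<n. sc (a i k) (g k)):W"
 shows "EX u. u ~: P & (ALL i<n. sc u (g i):W)"
 using assms(4-)
proof (induction n arbitrary: v a)
 case 0 thus ?case using primeD(2)[OF P] by blast
next
 case (Suc n)
 interpret M: module sc by fact
 note I = primeD(1)[OF P]
 \<comment> \<open>The last relation has the coefficient \<open>w\<close> at \<open>g n\<close>,
   still outside \<open>P\<close>; multiplying the other relations by \<open>w\<close> eliminates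
   \<open>g n\<close>.\<close>
 define w where "w = v n - a n n"
 have w: "w ~: P" unfolding w_def using Suc(2)[of n] Suc(3)[of n n] I
  by (metis diff_add_cancel iadd lessI)
 have gn: "sc w (g n) - (SUM k<n. sc (a n k) (g k)):W"
  using Suc(4)[of n] by (simp add: w_def M.scale_left_diff_distrib alg)
 have "EX u. u ~: P & (ALL i<n. sc u (g i):W)"
 proof (rule Suc(1)[of "%i. w * v i" "%i k. w * a i k + a i n * a n k"])
  fix i assume i: "i < n"
  show "w * v i ~: P" using w Suc(2)[of i] i by (simp add: prime_mult_iff[OF P])
  have "sc w (sc (v i) (g i) - (SUM k<Suc n. sc (a i k) (g k))) + sc (a i n) (sc w (g n) - (SUM k<n. sc (a n k) (g k))):W"
   using gn Suc(4)[of i] i by (intro M.subspace_add[OF W] M.subspace_scale[OF W]) auto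
  thus "sc (w * v i) (g i) - (SUM k<n. sc (w * a i k + a i n * a n k) (g k)):W"
   by (simp add: M.scale_right_diff_distrib M.scale_sum_right M.scale_left_distrib sum.distrib M.scale_right_distrib
    mult.commute alg)
 next
  fix i k assume "i < n" "k < n"
  thus "w * a i k + a i n * a n k:P"
   using Suc(3) by (intro iadd[OF I] iscale[OF I]) auto
 qed
 then obtain u where u: "u ~: P" "ALL i<n. sc u (g i):W" by blast
 have "sc (u * w) (g i):W" if "i < Suc n" for i
 proof (cases "i = n")
  case True
  have "sc (a n k) (sc u (g k)):W" if "k < n" for k
   using u(2) that M.subspace_scale[OF W] by blast
  hence "sc u (sc w (g n) - (SUM k<n. sc (a n k) (g k))) + (SUM k<n. sc (a n k) (sc u (g k))):W"
   using M.subspace_scale[OF W gn, of u] by (intro M.subspace_add[OF W] M.subspace_sum[OF W]) auto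
  thus ?thesis by (simp add: True M.scale_right_diff_distrib M.scale_sum_right mult.commute)
 next
  case False
  hence "sc u (g i):W" using u(2) that by auto
  hence "sc w (sc u (g i)):W" by (rule M.subspace_scale[OF W])
  thus ?thesis by (simp add: mult.commute)
 qed
 moreover have "u * w ~: P" using u w by (simp add: prime_mult_iff[OF P])
 ultimately show ?case by blast
qed

section \<open>Prime ideals and Noetherian rings\<close>

lemma ideal_Union_chain:
 assumes "C ~= {}" "subset.chain UNIV C" "!!I. I:C ==> idl I" shows "idl (\<Union>C)"
proof (rule idealI)
 show "0:\<Union>C" using assms(1,3) izero by blast
next
 fix x y assume "x:\<Union>C" "y:\<Union>C"
 then obtain A B where A: "A:C" "x:A" and B: "B:C" "y:B" by blast
 have "A <= B | B <= A" using assms(2) A B by (auto simp: subset.chain_def)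
 thus "x + y:\<Union>C" using A B assms(3) iadd by blast
next
 fix c x assume "x:\<Union>C"
 thus "c * x:\<Union>C" using assms(3) iscale by blast
qed

lemma ideal_zorn:
 assumes "A0:\<A>" "!!I. I:\<A> ==> idl I"
  and "!!C. C ~= {} ==> C <= \<A> ==> subset.chain UNIV C ==> idl (\<Union>C) ==> \<Union>C:\<A>"
 obtains M where "M:\<A>" "!!X. X:\<A> ==> M <= X ==> X = M"
proof -
 have "EX M:\<A>. ALL X:\<A>. M <= X --> X = M"
 proof (rule subset_Zorn_nonempty)
  fix C assume C: "C ~= {}" "subset.chain \<A> C"
  have "C <= \<A>" "subset.chain UNIV C" using C(2) by (auto simp: subset.chain_def)
  thus "\<Union>C:\<A>" using assms(2) C(1) by (intro assms(3) ideal_Union_chain) auto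
 qed (use assms(1) in auto)
 thus ?thesis using that by blast
qed

text \<open>An ideal maximal among those disjoint from a multiplicative set is prime. The base of
  the final family comes from this, applied to the set of all products of functions nonzero on the
  respective branches.\<close>

lemma prime_avoiding:
 assumes a: "idl a" and S: "1:S" "!!x y. x:S ==> y:S ==> x * y:S" "a Int S = {}"
 obtains P where "prime_ideal P" "a <= P" "P Int S = {}"
proof -
 obtain M where M: "M:{I. idl I & a <= I & I Int S = {}}"
  and max: "!!X. X:{I. idl I & a <= I & I Int S = {}} ==> M <= X ==> X = M"
  by (rule ideal_zorn[of a "{I. idl I & a <= I & I Int S = {}}"]) (use a S in blast)+
 have I: "idl M" using M by blast
 have meet: "EX s:S. EX c. s - c * x:M" if x: "x ~: M" for x
 proof -
  let ?X = "isum (igen {x}) M"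
  have X: "idl ?X" "M <= ?X" using isum_ideal[of "igen {x}" M] I isum_right[of "igen {x}" M]
   by simp_all
  have "x:?X" using isum_left[OF I, of "igen {x}"] gen_base[of x "{x}"] by auto
  hence "?X ~= M" using x by auto
  hence "?X Int S ~= {}" using max[of ?X] X M by blast
  then obtain s where s: "s:S" "s:?X" by blast
  then obtain y where y: "y:igen {x}" "s - y:M" unfolding isum_iff by blast
  then obtain c where "y = c * x" unfolding ideal.span_singleton by blast
  thus ?thesis using s y by blast
 qed
 have "prime_ideal M"
  unfolding prime_ideal_def
 proof (intro conjI allI impI)
  show "1 ~: M" using S(1) M by blast
  fix x y assume xy: "x * y:M"
  show "x:M | y:M"
  proof (rule ccontr)
   assume "~ ?thesis"
   then obtain s c s' c' where s: "s:S" "s - c * x:M" "s':S" "s' - c' * y:M"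
    using meet[of x] meet[of y] by blast
   have "s * s' = (s - c * x) * s' + (c * x) * (s' - c' * y) + (c * c') * (x * y)"
    by (simp add: alg)
   also have "...:M"
    by (rule iadd[OF I iadd[OF I iright[OF I s(2)]
    iscale[OF I s(4)]] iscale[OF I xy]])
   finally show False using S(2)[OF s(1) s(3)] M by blast
  qed
 qed (rule I)
 thus ?thesis using that M by blast
qed

lemma prime_avoiding_powers:
 assumes "idl a" "!!k. d ^ k ~: a"
 obtains P where "prime_ideal P" "a <= P" "d ~: P"
proof -
 obtain P where P: "prime_ideal P" "a <= P" "P Int range ((^) d) = {}"
 proof (rule prime_avoiding[OF assms(1), of "range ((^) d)"])
  show "1:range ((^) d)" by (metis power_0 rangeI)
  show "x * y:range ((^) d)" if "x:range ((^) d)" "y:range ((^) d)" for x y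
   using that by (auto simp flip: power_add)
  show "a Int range ((^) d) = {}" using assms(2) by blast
 qed
 have "d ^ 1 ~: P" using P(3) by blast
 thus ?thesis using that P by simp
qed

lemma ideal_gen_Un_image:
 assumes p: "idl p" and x: "x:igen (p Un g ` B)"
 obtains F a where "finite F" "F <= B" "x - (SUM i:F. a i * g i):p"
proof -
 \<comment> \<open>The coefficients are required to vanish off \<open>F\<close>, so that enlarging
   \<open>F\<close> by a new index keeps the old sum.\<close>
 have "EX F a. finite F & F <= B & (ALL i. i ~: F --> a i = 0) & x - (SUM i:F. a i * g i):p"
  using x
 proof (induction rule: gen_induct)
  case base
  thus ?case by (intro exI[of _ "{}"] exI[of _ "%_. 0"]) (simp add: izero[OF p])
 next
  case (step c x y)
  then obtain F a where F: "finite F" "F <= B" "!!i. i ~: F ==> a i = 0" "y - (SUM i:F. a i * g i):p"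
   by blast
  show ?case
  proof (cases "x:p")
   case True
   have "c * x + (y - (SUM i:F. a i * g i)):p"
    using True F by (intro iadd[OF p] iscale[OF p])
   thus ?thesis using F by (intro exI[of _ F] exI[of _ a]) (simp add: add_diff_eq)
  next
   case False
   then obtain i where i: "i:B" "x = g i" using step by blast
   let ?a = "a(i := a i + c)"
   have "(SUM j:insert i F. ?a j * g j) = c * g i + (SUM j:insert i F. a j * g j)"
    using F(1) by (simp add: sum.insert_remove alg)
   also have "(SUM j:insert i F. a j * g j) = (SUM j:F. a j * g j)"
    using F(1,3) by (cases "i:F") (simp_all add: insert_absorb)
   finally have "c * x + y - (SUM j:insert i F. ?a j * g j) = y - (SUM i:F. a i * g i)" using i by simp
   hence "c * x + y - (SUM j:insert i F. ?a j * g j):p" using F(4) by (simp only:)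
   moreover have "ALL j. j ~: insert i F --> ?a j = 0" using F(3) by simp
   ultimately show ?thesis using F(1,2) i(1) by (intro exI[of _ "insert i F"] exI[of _ ?a] conjI) simp_all
  qed
 qed
 thus ?thesis using that by blast
qed

lemma ideal_gen_Un_finite:
 assumes p: "idl p" and B: "finite B" and x: "x:igen (p Un g ` B)"
 obtains a where "x - (SUM i:B. a i * g i):p"
proof -
 obtain F a where F: "finite F" "F <= B" "x - (SUM i:F. a i * g i):p"
  using ideal_gen_Un_image[OF p x] by blast
 have "(SUM i:B. (if i:F then a i else 0) * g i) = (SUM i:F. a i * g i)"
  by (rule sum.mono_neutral_cong_right) (use B F in auto)
 thus ?thesis using that F(3) by metis
qed

text \<open>R/p is Noetherian, in terms of ideals of R. The relative form suits the ring of base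
  coordinates, which has infinitely many variables, all but finitely many of them in
  \<open>p\<close>.\<close>

definition noeth :: "'r::comm_ring_1 set => bool"
 where "(noeth p) = (idl p &
  (ALL I. idl I & p <= I --> (EX F. finite F & F <= I & I = igen (p Un F))))"

lemma noethE:
 assumes "noeth p" "idl I" "p <= I"
 obtains F where "finite F" "F <= I" "I = igen (p Un F)"
 using assms unfolding noeth_def by blast

lemma noeth_mono: "noeth p ==> idl q ==> p <= q ==> noeth q"
proof -
 assume p: "noeth p" and q: "idl q" "p <= q"
 have "EX F. finite F & F <= I & I = igen (q Un F)" if I: "idl I" "q <= I" for I
 proof -
  obtain F where F: "finite F" "F <= I" "I = igen (p Un F)"
   by (rule noethE[OF p I(1)]) (use q I in auto)
  have "I <= igen (q Un F)" by (subst F(3), rule ideal.span_mono) (use q in auto)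
  moreover have "igen (q Un F) <= I" by (rule gen_minimal) (use F I in auto)
  ultimately show ?thesis using F by blast
 qed
 thus ?thesis using q by (auto simp: noeth_def)
qed

lemma noeth_chain:
 fixes C :: "nat => 'r::comm_ring_1 set"
 assumes p: "noeth p" and C: "!!n. idl (C n)" "!!n. p <= C n" "!!n. C n <= C (Suc n)"
 shows "EX n. ALL k. C k <= C n"
proof -
 have mono: "C i <= C j" if "i <= j" for i j using lift_Suc_mono_le[of C, OF C(3) that] .
 let ?U = "\<Union>n. C n"
 have "idl ?U"
 proof (rule ideal_Union_chain)
  show "subset.chain UNIV (range C)" unfolding subset_chain_def using mono nat_le_linear by blast
 qed (use C in auto)
 moreover have "p <= ?U" using C(2)[of 0] by blast
 ultimately obtain F where F: "finite F" "F <= ?U" "?U = igen (p Un F)"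
  using noethE[OF p] by metis
 have "EX n. ALL x:F. x:C n"
  using F(1,2)
 proof (induction F rule: finite_induct)
  case (insert x F)
  then obtain n k where "ALL x:F. x:C n" "x:C k" by blast
  hence "ALL y:insert x F. y:C (max n k)" using mono[of n "max n k"] mono[of k "max n k"] by auto
  thus ?case by blast
 qed auto
 then obtain n where n: "F <= C n" by blast
 hence "igen (p Un F) <= C n" by (intro gen_minimal C) (use C in auto)
 thus ?thesis using F(3) by blast
qed

lemma noeth_induct [consumes 3, case_names step]:
 assumes p: "noeth p" and I: "idl I" "p <= I"
  and step: "!!I. idl I ==> p <= I ==> (!!J. idl J ==> I \<subset> J ==> P J) ==> P I"
 shows "P I"
proof (rule ccontr)
 assume "~ P I"
 define bad where "(bad J) = (idl J & p <= J & ~ P J)" for J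
 have "EX J'. bad J --> bad J' & J \<subset> J'" for J using step[of J] unfolding bad_def by blast
 hence "ALL J. EX J'. bad J --> bad J' & J \<subset> J'" by blast
 from choice[OF this] obtain s where s: "ALL J. bad J --> bad (s J) & J \<subset> s J" ..
 define C where "C n = (s ^^ n) I" for n :: nat
 have bad: "bad (C n)" for n
 proof (induction n)
  case 0 thus ?case using I \<open>~ P I\<close> by (simp add: C_def bad_def)
 next
  case (Suc n) thus ?case using s by (simp add: C_def)
 qed
 have lt: "C n \<subset> C (Suc n)" for n using s bad[of n] by (simp add: C_def)
 have "EX n. ALL k. C k <= C n"
 proof (rule noeth_chain[OF p])
  show "idl (C n)" "p <= C n" for n using bad[of n] by (simp_all add: bad_def)
  show "C n <= C (Suc n)" for n by (rule psubset_imp_subset[OF lt])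
 qed
 then obtain n where "ALL k. C k <= C n" ..
 hence "C (Suc n) <= C n" ..
 thus False using lt[of n] by simp
qed

lemma ideal_colon: "idl B ==> idl {y. y * x:B}"
 by (auto simp: ideal.subspace_def ring_distribs mult.assoc)

section \<open>Powers of ideals and Krull's intersection theorem\<close>

primrec ipow :: "'r::comm_ring_1 set => nat => 'r set"
 where "ipow m 0 = UNIV" | "ipow m (Suc k) = igen {a * b | a b. a:m & b:ipow m k}"

lemma ipow_ideal [simp]: "idl (ipow m k)"
 by (cases k) simp_all

lemma ipow_mult: "a:m ==> b:ipow m k ==> a * b:ipow m (Suc k)"
 by (auto intro: gen_base)

lemma ipow_Suc_subset: "ipow m (Suc k) <= ipow m k"
 unfolding ipow.simps by (rule gen_minimal) (auto intro: iscale)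

lemma ipow_antimono: "j <= k ==> ipow m k <= ipow m j"
 by (rule lift_Suc_antimono_le[of "ipow m"]) (use ipow_Suc_subset in auto)

text \<open>Pigeonhole on exponents: a product of more than \<open>sum n F\<close> generators
  contains some x at least \<open>n x\<close> times. The induction passes to the colon ideal B : x,
  which lowers \<open>n x\<close> by one.\<close>

lemma ipow_subset:
 assumes "finite F" "idl B" "p <= B" "!!x. x:F ==> x ^ n x:B" "sum n F < K"
 shows "ipow (igen (p Un F)) K <= B"
 using assms(2-)
proof (induction K arbitrary: n B)
 case (Suc K)
 show ?case
  unfolding ipow.simps
 proof (rule gen_minimal[OF _ Suc(2)], clarify)
  fix a b assume a: "a:igen (p Un F)" and b: "b:ipow (igen (p Un F)) K"
  have "p Un F <= {a. a * b:B}"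
  proof
   fix x assume "x:p Un F"
   then consider "x:p" | "x:F" "n x = 0" | "x:F" "n x > 0" by auto
   thus "x:{a. a * b:B}"
   proof cases
    case 1 thus ?thesis using Suc(2,3) iright by blast
   next
    case 2
    hence "1:B" using Suc(4)[of x] by simp
    thus ?thesis using iscale[OF Suc(2), of 1 "x * b"] by simp
   next
    case 3
    have "ipow (igen (p Un F)) K <= {y. y * x:B}"
    proof (rule Suc(1)[of _ "n(x := n x - 1)"])
    show "idl {y. y * x:B}" using Suc(2) by (rule ideal_colon)
    show "p <= {y. y * x:B}" using Suc(2,3) iright by blast
    show "y ^ (n(x := n x - 1)) y:{y. y * x:B}" if "y:F" for y
    proof (cases "y = x")
    case True
    obtain k where "n x = Suc k" using 3 by (cases "n x") auto
    thus ?thesis using Suc(4)[of x] 3 True by (simp add: mult.commute)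
    next
    case False
    thus ?thesis using Suc(4)[of y] that iright[OF Suc(2)] by simp
    qed
    have "sum (n(x := n x - 1)) F = sum n F - 1"
    using 3 assms(1) by (simp add: sum.remove[of F x])
    moreover have "sum n F > 0" using 3 assms(1) by (metis sum.remove add_gr_0)
    ultimately show "sum (n(x := n x - 1)) F < K" using Suc(5) by simp
    qed
    thus ?thesis using b by (auto simp: mult.commute)
   qed
  qed
  hence "igen (p Un F) <= {a. a * b:B}"
   by (rule gen_minimal) (rule ideal_colon[OF Suc(2)])
  thus "a * b:B" using a by blast
 qed
qed simp

text \<open>Herstein's proof of Krull's intersection theorem.\<close>

lemma krull_intersection:
 assumes p: "noeth p" and m: "idl m" "p <= m" and h: "!!k. h:isum p (ipow m k)"
 obtains a where "a:m" "(1 - a) * h:p"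
proof -
 have Ip: "idl p" using p by (simp add: noeth_def)
 define hm where "hm = isum {h * a | a. a:m} p"
 define hp where "hp = isum (igen {h}) p"
 have "idl {h * a | a. a:m}"
 proof (rule idealI)
  show "0:{h * a | a. a:m}" using izero[OF m(1)] by force
  show "x + y:{h * a | a. a:m}" if "x:{h * a | a. a:m}" "y:{h * a | a. a:m}" for x y
   using that iadd[OF m(1)] by (auto simp flip: distrib_left)
  show "c * x:{h * a | a. a:m}" if x: "x:{h * a | a. a:m}" for c x
  proof -
   obtain a where "a:m" "x = h * a" using x by blast
   hence "c * a:m" "c * x = h * (c * a)" using iscale[OF m(1)] by (auto simp: mult.left_commute)
   thus ?thesis by blast
  qed
 qed
 hence Ihm: "idl hm" unfolding hm_def using Ip by (rule isum_ideal)
 have Ihp: "idl hp" unfolding hp_def by (rule isum_ideal) (simp_all add: Ip)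
 have phm: "p <= hm" unfolding hm_def by (rule isum_right) fact
 \<comment> \<open>Here \<open>hm\<close> is h m + p and \<open>hp\<close> is (h) + p. A maximal
   such \<open>B\<close> contains a power of every element of \<open>m\<close>, hence p + m^k for
   some k, hence \<open>h\<close>; then \<open>h\<close> lies in \<open>hm\<close>.\<close>
 let ?A = "{B. idl B & hm <= B & B Int hp <= hm}"
 obtain B where B: "B:?A" and max: "!!X. X:?A ==> B <= X ==> X = B"
  by (rule ideal_zorn[of hm ?A]) (use Ihm in blast)+
 have IB: "idl B" "hm <= B" "B Int hp <= hm" using B by auto
 have pow: "EX n. x ^ n:B" if x: "x:m" for x
 proof -
  \<comment> \<open>Once the colon ideals of the powers of x are stationary, B + (x^n) still meets
    \<open>hp\<close> inside \<open>hm\<close>; maximality then puts x^n into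
    \<open>B\<close>.\<close>
  have "EX n. ALL k. {y. y * x ^ k:B} <= {y. y * x ^ n:B}"
  proof (rule noeth_chain[OF p])
   show "idl {y. y * x ^ n:B}" for n using IB(1) by (rule ideal_colon)
   show "p <= {y. y * x ^ n:B}" for n using phm IB iright by blast
   show "{y. y * x ^ n:B} <= {y. y * x ^ Suc n:B}" for n
   proof clarify
    fix y assume "y * x ^ n:B"
    hence "x * (y * x ^ n):B" by (rule iscale[OF IB(1)])
    thus "y * x ^ Suc n:B" by (simp add: mult.left_commute)
   qed
  qed
  then obtain n where n: "!!k. {y. y * x ^ k:B} <= {y. y * x ^ n:B}" by blast
  let ?X = "isum (igen {x ^ n}) B"
  have "idl ?X" by (rule isum_ideal) (simp_all add: IB)
  moreover have BX: "B <= ?X" by (rule isum_right) simp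
  moreover have "?X Int hp <= hm"
  proof
   fix y assume y: "y:?X Int hp"
   then obtain z where z: "z:igen {x ^ n}" "y - z:B" by (auto simp: isum_iff)
   then obtain a where a: "z = a * x ^ n" unfolding ideal.span_singleton by blast
   obtain w where w: "w:igen {h}" "y - w:p" using y by (auto simp: hp_def isum_iff)
   then obtain e where e: "w = e * h" unfolding ideal.span_singleton by blast
   have "x * y = h * (e * x) + x * (y - w)" by (simp add: e alg)
   also have "...:hm" unfolding hm_def
    using iscale[OF m(1) x, of e] iscale[OF Ip w(2), of x]
    by (intro isumI) auto
   finally have "x * y:B" using IB by blast
   hence "x * y - x * (y - z):B" using iscale[OF IB(1) z(2), of x] by (intro iminus[OF IB(1)])
   hence "a * x ^ Suc n:B" by (simp add: a alg)
   hence "z:B" using n[of "Suc n"] a by blast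
   hence "y:B" using z(2) IB(1) by (metis diff_add_cancel iadd)
   thus "y:hm" using y IB by blast
  qed
  ultimately have "?X = B" using IB(2) by (intro max) auto
  moreover have "x ^ n:?X" using isum_left[OF IB(1), of "igen {x ^ n}"] gen_base[of "x ^ n" "{x ^ n}"] by blast
  ultimately show ?thesis by blast
 qed
 obtain F where F: "finite F" "F <= m" "m = igen (p Un F)" using noethE[OF p m] by blast
 obtain n where n: "!!x. x:m ==> x ^ n x:B" using pow by metis
 have "ipow m (Suc (sum n F)) <= B"
  unfolding F(3) by (rule ipow_subset[OF F(1) IB(1)]) (use phm IB n F in auto)
 hence "isum p (ipow m (Suc (sum n F))) <= B" using phm IB by (intro isum_minimal) auto
 hence "h:B" using h by blast
 moreover have "h:hp" unfolding hp_def using isum_left[OF Ip, of "igen {h}"] gen_base[of h "{h}"] by blast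
 ultimately have "h:hm" using IB by blast
 then obtain a where "a:m" "h - h * a:p" unfolding hm_def isum_iff by blast
 thus ?thesis using that[of a] by (simp add: alg)
qed

section \<open>Dickson's lemma and Hilbert's basis theorem\<close>

text \<open>Recursive choice against the set of all earlier terms; both Dickson's lemma and the
  basis theorem draw their contradiction from such a sequence.\<close>

lemma choose_sequence:
 assumes "!!F. finite F ==> F <= S ==> EX x:S. Q F x"
 shows "EX f :: nat => 'a. ALL k. f k:S & Q (f ` {..<k}) (f k)"
proof -
 define pick where "pick F = (SOME x. x:S & Q F x)" for F
 have pick: "pick F:S & Q F (pick F)" if "finite F" "F <= S" for F
  unfolding pick_def by (rule someI_ex) (use assms[OF that] in blast)
 define G where "G = rec_nat {} (%_ F. insert (pick F) F)"
 have G: "G 0 = {}" "!!k. G (Suc k) = insert (pick (G k)) (G k)" by (simp_all add: G_def)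
 have GS: "finite (G k) & G k <= S" for k by (induction k) (auto simp: G pick)
 have im: "(%k. pick (G k)) ` {..<k} = G k" for k by (induction k) (simp_all add: G lessThan_Suc)
 have "pick (G k):S & Q (G k) (pick (G k))" for k using pick[of "G k"] GS[of k] by blast
 thus ?thesis by (intro exI[of _ "%k. pick (G k)"]) (simp add: im)
qed

lemma nat_incseq_subseq:
 fixes s :: "nat => nat" obtains f :: "nat => nat" where "strict_mono f" "!!i j. i <= j ==> s (f i) <= s (f j)"
proof -
 obtain f :: "nat => nat" where f: "strict_mono f" "monoseq (%n. s (f n))" using seq_monosub[of s] by blast
 show ?thesis
 proof (cases "incseq (%n. s (f n))")
  case True thus ?thesis using that[of f] f(1) by (simp add: incseq_def)
 next
  case False
  hence dec: "decseq (%n. s (f n))" using f by (auto simp: monoseq_iff)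
  \<comment> \<open>A decreasing sequence of naturals is constant from the point where it attains
    its minimum.\<close>
  define v where "v = (LEAST v. EX n. s (f n) = v)"
  obtain n where n: "s (f n) = v" using LeastI_ex[of "%v. EX n. s (f n) = v"] unfolding v_def by blast
  have "s (f k) = v" if "n <= k" for k
   using decseqD[OF dec that] Least_le[of "%v. EX n. s (f n) = v" "s (f k)"] n unfolding v_def by fastforce
  thus ?thesis using that[of "%k. f (n + k)"] f(1) by (auto simp: strict_mono_def)
 qed
qed

lemma dickson_seq:
 fixes mu :: "nat => 'x mon"
 assumes "finite A"
 shows "EX f :: nat => nat. strict_mono f & (ALL x:A. ALL i j. i <= j --> lk (mu (f i)) x <= lk (mu (f j)) x)"
 using assms
proof (induction A rule: finite_induct)
 case empty show ?case by (auto intro!: exI[of _ "%x. x"] simp: strict_mono_def)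
next
 case (insert a A)
 then obtain f :: "nat => nat" where f: "strict_mono f" "!!x i j. x:A ==> i <= j ==> lk (mu (f i)) x <= lk (mu (f j)) x" by blast
 obtain g :: "nat => nat" where g: "strict_mono g" "!!i j. i <= j ==> lk (mu (f (g i))) a <= lk (mu (f (g j))) a"
  using nat_incseq_subseq[of "%k. lk (mu (f k)) a"] by blast
 have "strict_mono (%k. f (g k))" using f g by (simp add: strict_mono_def)
 moreover have "g i <= g j" if "i <= j" for i j using g(1) that by (simp add: strict_mono_less_eq)
 ultimately show ?case using f g by (intro exI[of _ "%k. f (g k)"]) auto
qed

lemma monomial_leI:
 fixes mu nu :: "'x mon"
 assumes "!!x. lk mu x <= lk nu x" shows "EX ka. nu = mu + ka"
 by (rule exI[of _ "nu - mu"], rule pm_eqI) (simp add: lk_add lk_minus assms)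

lemma lk_outside: "ks mu <= A ==> x ~: A ==> lk mu x = 0"
 by (meson keysI subsetD)

lemma dickson_pair:
 fixes mu :: "nat => 'x mon"
 assumes "finite A" "!!k. ks (mu k) <= A"
 obtains f :: "nat => nat" where "strict_mono f" "!!i j. i <= j ==> EX ka. mu (f j) = mu (f i) + ka"
proof -
 obtain f :: "nat => nat" where f: "strict_mono f" "!!x i j. x:A ==> i <= j ==> lk (mu (f i)) x <= lk (mu (f j)) x"
  using dickson_seq[OF assms(1), of mu] by blast
 have le: "lk (mu (f i)) x <= lk (mu (f j)) x" if "i <= j" for i j x
 proof (cases "x:A")
  case False
  hence "lk (mu (f i)) x = 0" by (rule lk_outside[OF assms(2)])
  thus ?thesis by simp
 qed (use f(2) that in blast)
 show ?thesis
 proof (rule that[OF f(1)])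
  fix i j :: nat assume "i <= j"
  thus "EX ka. mu (f j) = mu (f i) + ka" by (intro monomial_leI le)
 qed
qed

text \<open>Otherwise there would be a sequence in which no term is a multiple of an earlier one,
  against the existence of a subsequence increasing for divisibility.\<close>

lemma dickson:
 fixes L :: "'x mon set"
 assumes A: "finite A" "!!mu. mu:L ==> ks mu <= A"
 obtains B where "finite B" "B <= L" "!!mu. mu:L ==> EX nu:B. EX ka. mu = nu + ka"
proof (rule ccontr)
 assume no: "~ thesis"
 define Q where "(Q F mu) = (~ (EX nu:F. EX ka. mu = nu + ka))" for F and mu :: "'x mon"
 have "EX mu:L. Q F mu" if "finite F" "F <= L" for F
  unfolding Q_def using no \<open>!!B. [|finite B; B <= L; !!mu. mu:L ==> EX nu:B. EX ka. mu = nu + ka|] ==> thesis\<close>[of F] that by blast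
 hence "EX mu :: nat => _. ALL k. mu k:L & Q (mu ` {..<k}) (mu k)"
  by (rule choose_sequence)
 then obtain mu :: "nat => 'x mon" where mu: "!!k. mu k:L" "!!k. Q (mu ` {..<k}) (mu k)" by blast
 obtain f :: "nat => nat" where f: "strict_mono f" "!!i j. i <= j ==> EX ka. mu (f j) = mu (f i) + ka"
  by (rule dickson_pair[OF A(1), of mu]) (use A(2) mu(1) in auto)
 have "f 0 < f 1" using f(1) by (simp add: strict_mono_def)
 thus False using mu(2)[of "f 1"] f(2)[of 0 1] unfolding Q_def by auto
qed

text \<open>Sending the variables to distinct primes orders the monomials.\<close>

lemma monomial_order:
 assumes A: "finite (A :: 'x set)"
 shows "EX N :: 'x mon => nat. (ALL mu nu. N (mu + nu) = N mu * N nu) & (ALL mu. N mu > 0) &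
  (ALL mu nu. ks mu <= A --> ks nu <= A --> N mu = N nu --> mu = nu)"
proof -
 obtain T where T: "T <= {p::nat. prime p}" "finite T" "card T = card A"
  using infinite_arbitrarily_large[OF primes_infinite] by metis
 then obtain e where e: "bij_betw e A T" using finite_same_card_bij[OF A] by metis
 \<comment> \<open>Integers instead of naturals, since \<open>meval\<close> takes values in a
   commutative ring. Unique factorization then gives injectivity on monomials supported in
   \<open>A\<close>.\<close>
 define g where "g x = (if x:A then int (e x) else 1)" for x
 define N where "N mu = nat (meval g mu)" for mu
 have pr: "prime (e x)" if "x:A" for x using e T that by (auto simp: bij_betw_def)
 have pos: "meval g mu > 0" for mu
  unfolding meval_def by (intro prod_pos) (auto simp: g_def prime_gt_0_nat pr)
 have NA: "N mu = (PROD x:A. e x ^ lk mu x)" if "ks mu <= A" for mu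
 proof -
  have "meval g mu = int (PROD x:A. e x ^ lk mu x)"
   by (subst meval_superset[OF A that]) (auto simp: g_def)
  thus ?thesis unfolding N_def by (simp only: nat_int)
 qed
 show ?thesis
 proof (intro exI[of _ N] conjI allI impI)
  show "N (mu + nu) = N mu * N nu" for mu nu
   using pos[of mu] pos[of nu] by (simp add: N_def meval_add nat_mult_distrib)
  show "N mu > 0" for mu using pos[of mu] by (simp add: N_def)
  fix mu nu :: "'x mon" assume mu: "ks mu <= A" and nu: "ks nu <= A" and eq: "N mu = N nu"
  have mult: "multiplicity (e x) (N ka) = lk ka x" if "ks ka <= A" "x:A" for ka x
  proof -
   have "N ka = (PROD p:T. p ^ lk ka (inv_into A e p))"
    unfolding NA[OF that(1)] prod.reindex_bij_betw[OF e, symmetric]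
    using e by (intro prod.cong) (auto simp: bij_betw_def)
   moreover have "multiplicity (e x) (PROD p:T. p ^ lk ka (inv_into A e p))
    = (if e x:T then lk ka (inv_into A e (e x)) else 0)"
    using T by (intro multiplicity_prod_prime_powers pr[OF that(2)]) auto
   ultimately show ?thesis using e that(2) by (auto simp: bij_betw_def)
  qed
  show "mu = nu"
  proof (rule pm_eqI)
   fix x show "lk mu x = lk nu x"
    using mult[OF mu, of x] mult[OF nu, of x] eq lk_outside[OF mu] lk_outside[OF nu]
    by (cases "x:A") simp_all
  qed
 qed
qed

lemma mon_outside:
 assumes "~ ks mu <= A"
 shows "(mon mu :: ('x, 'a::comm_ring_1) pol):igen (Var ` (- A))"
proof -
 obtain x where x: "x ~: A" "lk mu x ~= 0" using assms by (auto simp: keysI)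
 have "mu = (mu - sg x 1) + sg x 1"
  by (rule pm_eqI) (use x in "auto simp: lk_add lk_minus lk_sg")
 hence "(mon mu :: ('x, 'a) pol) = mon (mu - sg x 1) * Var x" by (metis Var_mon mon_add)
 moreover have "(mon (mu - sg x 1) * Var x :: ('x, 'a) pol):igen (Var ` (- A))"
  by (rule gen_scale, rule gen_base) (use x in auto)
 ultimately show ?thesis by (simp only:)
qed

text \<open>Leading terms are compared for all variables at once: divisibility of leading monomials
  comes from Dickson's lemma, the relation between leading coefficients from the chain condition in
  R/p. Variables outside the finite set \<open>A\<close> are part of the ideal.\<close>

theorem hilbert_basis:
 fixes p :: "'r::comm_ring_1 set"
 assumes p: "noeth p" and A: "finite (A :: 'x set)"
 shows "noeth (igen (Const ` p Un Var ` (- A)) :: ('x, 'r) pol set)"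
 unfolding noeth_def
proof (intro conjI allI impI, simp)
 define P where "P = (igen (Const ` p Un Var ` (- A)) :: ('x, 'r) pol set)"
 have Ip: "idl p" using p by (simp add: noeth_def)
 obtain N :: "'x mon => nat" where N: "!!mu nu. N (mu + nu) = N mu * N nu" "!!mu. N mu > 0"
  and inj: "!!mu nu. ks mu <= A ==> ks nu <= A ==> N mu = N nu ==> mu = nu"
  using monomial_order[OF A] by (elim exE conjE) metis
 fix I :: "('x, 'r) pol set" assume I: "ideal.subspace I & igen (Const ` p Un Var ` (- A)) <= I"
 hence II: "idl I" and PI: "P <= I" by (auto simp: P_def)
 define top where "top f = Max (insert 0 (N ` ks f))" for f :: "('x, 'r) pol"
 have top: "N mu <= top f" if "lk f mu ~= 0" for f mu using that by (auto simp: top_def keysI)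
 show "EX F. finite F & F <= I & I = igen (igen (Const ` p Un Var ` (- A)) Un F)"
  unfolding P_def[symmetric]
 proof (rule ccontr)
  assume no: "\<nexists>F. finite F & F <= I & I = igen (P Un F)"
  let ?S = "{f:I. ALL mu:ks f. ks mu <= A}"
  \<comment> \<open>The next element lies outside the ideal generated so far and has the smallest
    leading value among such elements.\<close>
  define Q where "(Q F f) = (f ~: igen (P Un F) & (ALL g:?S. g ~: igen (P Un F) --> top f <= top g))" for F f
  have "EX f:?S. Q F f" if F: "finite F" "F <= ?S" for F
  proof -
   have FI: "F <= I" using F by auto
   hence "igen (P Un F) <= I" using PI II by (intro gen_minimal) auto
   then obtain f where f: "f:I" "f ~: igen (P Un F)" using no F(1) FI by blast
   define f1 where "f1 = (SUM mu:{mu:ks f. ks mu <= A}. sg mu (lk f mu))"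
   define f2 where "f2 = (SUM mu:{mu:ks f. ~ ks mu <= A}. sg mu (lk f mu))"
   have f12: "f = f1 + f2"
    unfolding f1_def f2_def by (subst sum.union_disjoint[symmetric])
    (auto intro!: sum_sg[of f, symmetric, THEN trans] sum.cong)
   have f2P: "f2:P"
    unfolding f2_def
   proof (rule isetsum)
    show "idl P" by (simp add: P_def)
    fix mu assume "mu:{mu:ks f. ~ ks mu <= A}"
    hence "mon mu:P" using mon_outside[of mu A] ideal.span_mono[of "Var ` (-A)" "Const ` p Un Var ` (- A)"]
    unfolding P_def by blast
    thus "sg mu (lk f mu):P" unfolding sg_eq P_def by (rule gen_scale)
   qed
   have "f - f1 = f2" unfolding f12 by simp
   hence d: "f - f1:P" using f2P by (simp only:)
   hence f1I: "f1:I" using f(1) PI iminus[OF II f(1), of "f - f1"] by auto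
   have "f1 ~: igen (P Un F)"
    using f(2) d ideal.span_add[of f1 "P Un F" "f - f1"] gen_base[of "f - f1" "P Un F"] by auto
   moreover have "ks f1 <= {mu. ks mu <= A}"
   proof
    fix mu assume "mu:ks f1"
    hence "lk f1 mu ~= 0" by (simp add: keysI)
    thus "mu:{mu. ks mu <= A}"
    by (simp add: f1_def lk_sum lk_sg split: if_splits)
   qed
   ultimately have "f1:?S & f1 ~: igen (P Un F)" using f1I by auto
   then obtain g where "g:?S & g ~: igen (P Un F)"
    "!!g'. g':?S & g' ~: igen (P Un F) ==> top g <= top g'"
    using ex_has_least_nat[of "%g. g:?S & g ~: igen (P Un F)" f1 top] by blast
   thus ?thesis unfolding Q_def by blast
  qed
  hence "EX f :: nat => _. ALL k. f k:?S & Q (f ` {..<k}) (f k)" by (rule choose_sequence)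
  then obtain f :: "nat => ('x, 'r) pol" where fS: "!!k. f k:?S" and fQ: "!!k. Q (f ` {..<k}) (f k)" by blast
  have f0: "ks (f k) ~= {}" for k using fQ[of k] ideal.span_zero[of "P Un f ` {..<k}"] by (auto simp: Q_def)
  define mu where "mu k = (SOME mu. mu:ks (f k) & N mu = top (f k))" for k
  have mu: "mu k:ks (f k) & N (mu k) = top (f k)" for k
   unfolding mu_def
  proof (rule someI_ex)
   have "Max (insert 0 (N ` ks (f k))):insert 0 (N ` ks (f k))" by (intro Max_in) auto
   moreover obtain nu where "nu:ks (f k)" using f0[of k] by blast
   hence "Max (insert 0 (N ` ks (f k))) > 0" using N(2)[of nu] by (subst Max_gr_iff) auto
   ultimately show "EX mu. mu:ks (f k) & N mu = top (f k)" by (auto simp: top_def)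
  qed
  have muA: "ks (mu k) <= A" for k using mu[of k] fS[of k] by auto
  obtain ph :: "nat => nat" where ph: "strict_mono ph" "!!i j. i <= j ==> EX ka. mu (ph j) = mu (ph i) + ka"
   using dickson_pair[OF A, of mu] muA by metis
  define r where "r k = lk (f (ph k)) (mu (ph k))" for k
  have "EX n. ALL k. igen (p Un r ` {..<k}) <= igen (p Un r ` {..<n})"
  proof (rule noeth_chain[OF p])
   show "p <= igen (p Un r ` {..<k})" for k using gen_base by blast
   show "igen (p Un r ` {..<k}) <= igen (p Un r ` {..<Suc k})" for k
    by (rule ideal.span_mono) auto
  qed simp
  then obtain n where n: "!!k. igen (p Un r ` {..<k}) <= igen (p Un r ` {..<n})" by blast
  have "r n:igen (p Un r ` {..<Suc n})" by (rule gen_base) auto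
  hence "r n:igen (p Un r ` {..<n})" using n by blast
  then obtain a where a: "r n - (SUM i:{..<n}. a i * r i):p"
   using ideal_gen_Un_finite[OF Ip finite_lessThan] by blast
  define k where "k = ph n"
  obtain ka where ka: "!!i. i < n ==> mu k = mu (ph i) + ka i" using ph(2)[of _ n] unfolding k_def by (metis less_imp_le)
  have lt: "ph i < k" if "i < n" for i using ph(1) that by (simp add: k_def strict_mono_def)
  define \<pi> where "\<pi> = r n - (SUM i<n. a i * r i)"
  define s where "s = (SUM i<n. Const (a i) * (mon (ka i) * f (ph i)))"
  \<comment> \<open>The leading coefficient of \<open>f k\<close> is a combination of earlier ones
    up to \<pi> in \<open>p\<close>; subtracting both corrections cancels the leading term, so the
    difference is smaller than the chosen minimum.\<close>
  define g where "g = f k - Const \<pi> * mon (mu k) - s"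
  have sP: "Const \<pi> * mon (mu k):P" "s:igen (P Un f ` {..<k})" "s:I"
  proof -
   show "Const \<pi> * mon (mu k):P" unfolding P_def using a
    by (intro iright[OF gen_ideal] gen_base) (auto simp: \<pi>_def)
   show "s:igen (P Un f ` {..<k})" unfolding s_def using lt
    by (intro gen_sum gen_scale) (auto intro: gen_base)
   show "s:I" unfolding s_def using fS
    by (intro isetsum[OF II] iscale[OF II]) auto
  qed
  have fk: "f k ~: igen (P Un f ` {..<k})" and fmin: "!!g. g:?S ==> g ~: igen (P Un f ` {..<k}) ==> top (f k) <= top g"
   using fQ[of k] unfolding Q_def by blast+
  have gI: "g:I" unfolding g_def using fS[of k] sP PI by (intro iminus[OF II]) auto
  have gn: "g ~: igen (P Un f ` {..<k})"
  proof
   assume "g:igen (P Un f ` {..<k})"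
   hence "g + s + Const \<pi> * mon (mu k):igen (P Un f ` {..<k})"
    using sP by (intro ideal.span_add) (auto intro: gen_base)
   thus False using fk by (simp add: g_def)
  qed
  have lks: "lk (mon (ka i) * f (ph i)) nu ~= 0 ==> ks nu <= A & (nu = mu k | N nu < N (mu k))" if i: "i < n" for i nu
  proof -
   assume nz: "lk (mon (ka i) * f (ph i)) nu ~= 0"
   then obtain nu' where nu': "nu = ka i + nu'" by (metis lk_mon_mult_0)
   hence l: "lk (f (ph i)) nu' ~= 0" using nz by (simp add: lk_mon_mult)
   hence A': "ks nu' <= A" using fS[of "ph i"] by (auto simp: keysI)
   have "ks (ka i) <= A" using muA[of k] ka[OF i] by (simp add: keys_add_nat)
   hence "ks nu <= A" using A' nu' by (simp add: keys_add_nat)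
   moreover have "N nu' <= N (mu (ph i))" using top[OF l] mu[of "ph i"] by simp
   hence "nu' = mu (ph i) | N nu' < N (mu (ph i))" using inj[OF A' muA] by fastforce
   hence "nu = mu k | N nu < N (mu k)" using nu' ka[OF i] N by (auto simp: add.commute mult.commute)
   ultimately show ?thesis by blast
  qed
  have supp: "ks nu <= A & N nu < N (mu k)" if nz: "lk g nu ~= 0" for nu
  proof -
   have at: "lk (mon (ka i) * f (ph i)) (mu k) = r i" if "i < n" for i
    using lk_mon_mult[of "ka i" "f (ph i)" "mu (ph i)"] ka[OF that] by (simp add: r_def add.commute)
   have "lk g (mu k) = 0"
    by (simp add: g_def s_def lk_minus lk_sum lk_Const lk_mon at \<pi>_def) (simp add: r_def k_def)
   hence ne: "nu ~= mu k" using nz by auto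
   have "lk (f k) nu ~= 0 | (EX i<n. lk (mon (ka i) * f (ph i)) nu ~= 0)"
   proof (rule ccontr)
    assume "~ ?thesis"
    hence "lk g nu = 0" using ne by (simp add: g_def s_def lk_minus lk_sum lk_Const lk_mon)
    thus False using nz by simp
   qed
   thus ?thesis
   proof
    assume l: "lk (f k) nu ~= 0"
    hence "ks nu <= A" using fS[of k] by (auto simp: keysI)
    moreover have "N nu <= N (mu k)" using top[OF l] mu[of k] by simp
    ultimately show ?thesis using inj[of nu "mu k"] muA[of k] ne by fastforce
   qed (use lks ne in blast)
  qed
  have "g:?S" using gI supp by (auto simp: keysI)
  hence "top (f k) <= top g" using gn by (rule fmin)
  moreover have "top g < top (f k)"
   unfolding top_def[of g] using supp mu[of k] N(2)[of "mu k"] by (auto simp: Max_less_iff keysI)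
  ultimately show False by simp
 qed
qed

lemma noeth_field: "noeth ({0} :: 'a::field set)"
 unfolding noeth_def
proof (intro conjI allI impI)
 fix I :: "'a set" assume I: "ideal.subspace I & {0} <= I"
 show "EX F. finite F & F <= I & I = igen ({0} Un F)"
 proof (cases "I = {0}")
  case False
  then obtain a where a: "a:I" "a ~= 0" using I by blast
  have "x:igen ({0} Un {a})" for x
   using gen_scale[OF gen_base[of a "{0} Un {a}"], of "x / a"] a by simp
  moreover have "x:I" for x using iscale[of I a "x / a"] a I by simp
  ultimately show ?thesis using a by (intro exI[of _ "{a}"]) auto
 qed (auto intro!: exI[of _ "{}"])
qed simp

section \<open>Flatness in terms of ideals\<close>

lemma module_frag_cmul: "module frag_cmul"
 by (rule module.intro) (simp_all add: frag_cmul_distrib frag_cmul_distrib2)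

interpretation fm: module frag_cmul
 by (rule module_frag_cmul)

abbreviation TR :: "(nat \<Rightarrow>\<^sub>0 'r::comm_ring_1) set => (nat, 'r) pm set => ('k, 'r) pm set =>
  (((nat, 'r) pm \<times> ('k, 'r) pm) \<Rightarrow>\<^sub>0 int) set"
 where "TR == tensor_relations smul smul"

lemma TR_subspace [simp]: "fm.subspace (TR Q Z J)"
 unfolding tensor_relations_def by (rule fm.subspace_span)

lemmas TR_add = fm.subspace_add[OF TR_subspace] and TR_diff = fm.subspace_diff[OF TR_subspace]
 and TR_sum = fm.subspace_sum[OF TR_subspace] and TR_0 = fm.subspace_0[OF TR_subspace]

lemma TR_left: "x:Q ==> y:Q ==> frag_of (x + y, m) - frag_of (x, m) - frag_of (y, m):TR Q Z J"
 unfolding tensor_relations_def by (rule fm.span_base) blast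

lemma TR_right: "x:Q ==> frag_of (x, m + m') - frag_of (x, m) - frag_of (x, m'):TR Q Z J"
 unfolding tensor_relations_def by (rule fm.span_base) blast

lemma TR_scale: "x:Q ==> frag_of (smul c x, m) - frag_of (x, smul c m):TR Q Z J"
 unfolding tensor_relations_def by (rule fm.span_base) blast

lemma TR_Z: "z:Z ==> frag_of (z, m):TR Q Z J"
 unfolding tensor_relations_def by (rule fm.span_base) blast

lemma TR_J: "x:Q ==> j:J ==> frag_of (x, j):TR Q Z J"
 unfolding tensor_relations_def by (rule fm.span_base) blast

lemma TR_right_0: "x:Q ==> frag_of (x, 0):TR Q Z J"
 using TR_diff[OF TR_0 TR_right[of x Q 0 0 Z J]] by simp

lemma TR_left_0: "0:Q ==> frag_of (0, m):TR Q Z J"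
 using TR_diff[OF TR_0 TR_left[of 0 Q 0 m Z J]] by simp

lemma TR_right_sum:
 assumes "x:Q" "finite A" shows "frag_of (x, sum g A) - (SUM a:A. frag_of (x, g a)):TR Q Z J"
 using assms(2)
proof (induction A rule: finite_induct)
 case empty thus ?case using TR_right_0[OF assms(1)] by simp
next
 case (insert a A)
 thus ?case using TR_add[OF TR_right[OF assms(1), of "g a" "sum g A" Z J] insert(3)]
  by (simp add: alg)
qed

text \<open>The coordinate functions of \<open>R\<^sup>\<nat> \<otimes> M\<close>, which is a direct sum of copies of \<open>M\<close>.\<close>

definition coord :: "nat => (((nat \<Rightarrow>\<^sub>0 'r::comm_ring_1) \<times> ('k, 'r) pm) \<Rightarrow>\<^sub>0 int) => ('k, 'r) pm"
 where "coord k xi = (SUM y:ks xi. smul (of_int (lk xi y)) (smul (lk (fst y) k) (snd y)))"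

lemma coord_superset:
 "finite A ==> ks xi <= A ==> coord k xi = (SUM y:A. smul (of_int (lk xi y)) (smul (lk (fst y) k) (snd y)))"
 unfolding coord_def by (rule sum.mono_neutral_left) (auto simp: keysI)

lemma coord_diff: "coord k (xi - ze) = coord k xi - coord k ze"
proof -
 let ?A = "ks xi Un ks ze"
 have "coord k x = (SUM y:?A. smul (of_int (lk x y)) (smul (lk (fst y) k) (snd y)))" if "x:{xi, ze, xi - ze}" for x
  by (rule coord_superset) (use that keys_diff[of xi ze] in auto)
 thus ?thesis by (simp add: lk_minus sum_subtractf sm.scale_left_diff_distrib del: sm.scale_scale)
qed

lemma coord_0 [simp]: "coord k 0 = 0"
 by (simp add: coord_def)

lemma coord_add: "coord k (xi + ze) = coord k xi + coord k ze"
 using coord_diff[of k "xi + ze" ze] by simp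

lemma coord_sum: "coord k (sum g A) = (SUM a:A. coord k (g a))"
 by (induction A rule: infinite_finite_induct) (simp_all add: coord_add)

lemma coord_frag_of: "coord k (frag_of (x, m)) = smul (lk x k) m"
 by (simp add: coord_def)

lemma coord_cmul: "coord k (frag_cmul c xi) = smul (of_int c) (coord k xi)"
 by (subst coord_superset[of "ks xi"])
  (auto simp: coord_def sm.scale_sum_right mult.assoc keys_cmul intro: subsetD[OF keys_cmul])

lemma smul_single: "smul a (sg mu b) = sg mu (a * b)"
 by (rule pm_eqI) (simp add: lk_smul lk_sg)

text \<open>Flatness is tested on the inclusion of c/p in R/p, placed in coordinate 0 of the free
  module. The tensor \<open>xi\<close> equals \<open>e\<close> \<otimes> \<open>f\<close>, hence
  vanishes over the larger module; its vanishing over the smaller one is read off by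
  \<open>coord 0\<close>. As \<open>Y\<close> is any submodule containing cJ + pM, the content is J
  \<inter> cM \<subseteq> cJ + pM.\<close>

lemma flat_quotientD:
 fixes J :: "('k \<Rightarrow>\<^sub>0 'r::comm_ring_1) set"
 assumes flat: "flat_quotient p smul J" and p: "idl p" and c: "idl c" "p <= c"
  and Y: "sm.subspace Y" "!!a j. a:c ==> j:J ==> smul a j:Y" "!!a m. a:p ==> smul a m:Y"
  and f: "f:J" "!!mu. lk f mu:c"
 shows "f:Y"
proof -
 define Z where "Z = {v :: nat \<Rightarrow>\<^sub>0 'r. lk v 0:p}"
 define Q where "Q = {v :: nat \<Rightarrow>\<^sub>0 'r. lk v 0:c}"
 define e :: "nat \<Rightarrow>\<^sub>0 'r" where "e = sg 0 1"
 define xi where "xi = (SUM mu:ks f. frag_of (smul (lk f mu) e, sg mu (1::'r)))"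
 have ZQ: "sm.subspace Z" "sm.subspace Q" "Z <= Q" "ALL a:p. ALL x. smul a x:Z"
  using p c iright[OF p] by (auto simp: Z_def Q_def sm.subspace_def ideal.subspace_def lk_add lk_smul)
 have "xi - (SUM mu:ks f. frag_of (e, smul (lk f mu) (sg mu (1::'r)))):TR UNIV Z J"
  unfolding xi_def sum_subtractf[symmetric] by (intro TR_sum TR_scale) simp
 moreover have "frag_of (e, SUM mu:ks f. smul (lk f mu) (sg mu 1)) - (SUM mu:ks f. frag_of (e, smul (lk f mu) (sg mu (1::'r)))):TR UNIV Z J"
  by (intro TR_right_sum) auto
 moreover have "(SUM mu:ks f. smul (lk f mu) (sg mu 1)) = f" by (simp add: smul_single sum_sg)
 ultimately have "xi - frag_of (e, f):TR UNIV Z J" using TR_diff by fastforce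
 hence "xi:TR UNIV Z J" using TR_add[OF _ TR_J[of e UNIV f J Z]] f(1) by fastforce
 moreover have "ks xi <= Q \<times> UNIV"
 proof -
  have "ks xi <= (UN mu:ks f. {(smul (lk f mu) e, sg mu 1)})"
   unfolding xi_def by (rule order_trans[OF keys_sum]) (simp add: keys_frag_of)
  thus ?thesis using f(2) by (auto simp: Q_def lk_smul e_def)
 qed
 ultimately have xi: "xi:TR Q Z J" using flat ZQ unfolding flat_quotient_def by blast
 have "TR Q Z J <= {ze. coord 0 ze:Y}"
  unfolding tensor_relations_def
 proof (rule fm.span_minimal)
  show "fm.subspace {ze. coord 0 ze:Y}"
   using Y(1) by (simp add: fm.subspace_def coord_add coord_cmul sm_0 sm_add sm_scale)
  have 0: "0:Y" using Y(1) by (rule sm_0)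
  show "({frag_of (x + y, m) - frag_of (x, m) - frag_of (y, m) | x y m. x:Q & y:Q} Un
   {frag_of (x, m + m') - frag_of (x, m) - frag_of (x, m') | x m m'. x:Q} Un
   {frag_of (smul c x, m) - frag_of (x, smul c m) | c x m. x:Q} Un
   {frag_of (z, m) | z m. z:Z} Un
   {frag_of (x, j) | x j. x:Q & j:J}) <= {ze. coord 0 ze:Y}"
   using Y(2,3) 0
   by (auto simp: coord_diff coord_frag_of lk_add lk_smul sm.scale_left_distrib sm.scale_right_distrib
    Q_def Z_def mult.commute)
 qed
 hence "coord 0 xi:Y" using xi by blast
 moreover have "coord 0 xi = f"
  by (simp add: xi_def coord_sum coord_frag_of lk_smul e_def smul_single sum_sg)
 ultimately show ?thesis by simp
qed

text \<open>The ideal criterion for flatness: J \<inter> cM \<subseteq> cJ + pM for all ideals c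
  over p is enough. In coordinates an element of the kernel is a sequence in J plus a sequence in
  ZM, and the part in J is lifted to relations one coordinate at a time.\<close>

lemma flat_quotientI:
 fixes J :: "('k \<Rightarrow>\<^sub>0 'r::comm_ring_1) set"
 assumes p: "idl p" and J: "sm.subspace J" "!!a m. a:p ==> smul a m:J"
  and crit: "!!c f. idl c ==> p <= c ==> f:J ==> (!!mu. lk f mu:c) ==>
   f:sm.span ({smul a j | a j. a:c & j:J} Un {smul a m | a m. a:p})"
 shows "flat_quotient p smul J"
 unfolding flat_quotient_def
proof (intro allI impI, elim conjE)
 fix Z Q :: "(nat, 'r) pm set" and xi :: "((nat, 'r) pm \<times> ('k, 'r) pm) \<Rightarrow>\<^sub>0 int"
 assume Z: "sm.subspace Z" and Q: "sm.subspace Q" and ZQ: "Z <= Q" and pZ: "ALL c:p. ALL x. smul c x:Z"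
  and xiQ: "ks xi <= Q \<times> UNIV" and xi: "xi:TR UNIV Z J"
 have Q0: "0:Q" using Q by (rule sm_0)
 \<comment> \<open>\<open>V S ps\<close> says that the sequence \<open>ps\<close> lies in SM, tested
   separately at each index \<open>ka\<close> of the basis of M.\<close>
 define V where "(V S ps) = ((ALL ka. EX q:S. ALL k. lk q k = lk (ps k) ka))"
  for S :: "(nat, 'r) pm set" and ps :: "nat => 'k \<Rightarrow>\<^sub>0 'r"
 define G where "G = {ze:TR Q Z J. ks ze <= Q \<times> UNIV}"
 have G0: "0:G" by (simp add: G_def TR_0)
 have Gadd: "a + b:G" if "a:G" "b:G" for a b
  using that keys_add[of a b] by (auto simp: G_def TR_add)
 have Gsum: "sum g A:G" if "!!a. a:A ==> g a:G" for A :: "'k set" and g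
  using that by (induction A rule: infinite_finite_induct) (auto simp: G0 Gadd)
 have V_add: "V S (%k. a k + b k)" if S: "sm.subspace S" and ab: "V S a" "V S b" for S a b
  unfolding V_def
 proof
  fix ka
  obtain q q' where "q:S" "q':S" "ALL k. lk q k = lk (a k) ka" "ALL k. lk q' k = lk (b k) ka"
   using ab unfolding V_def by meson
  thus "EX q:S. ALL k. lk q k = lk (a k + b k) ka"
   using sm_add[OF S] by (intro bexI[of _ "q + q'"]) (auto simp: lk_add)
 qed
 have V_scale: "V S (%k. smul c (a k))" if S: "sm.subspace S" and a: "V S a" for S a c
  unfolding V_def
 proof
  fix ka
  obtain q where "q:S" "ALL k. lk q k = lk (a k) ka" using a unfolding V_def by meson
  thus "EX q:S. ALL k. lk q k = lk (smul c (a k)) ka"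
   using sm_scale[OF S] by (intro bexI[of _ "smul c q"]) (auto simp: lk_smul)
 qed
 have V_diff: "V S (%k. a k - b k)" if "sm.subspace S" "V S a" "V S b" for S a b
  using V_add[OF that(1,2) V_scale[OF that(1,3), of "-1"]] by simp
 have V_zero: "V S (%k. 0)" if "sm.subspace S" for S
  unfolding V_def using sm_0[OF that] by (intro allI bexI[of _ 0]) auto
 have V_frag: "V S (%k. coord k (frag_of (x, m)))" if "sm.subspace S" "x:S" for S x m
  unfolding V_def coord_frag_of
 proof
  fix ka show "EX q:S. ALL k. lk q k = lk (smul (lk x k) m) ka"
   by (intro bexI[of _ "smul (lk m ka) x"] sm_scale[OF that]) (simp add: lk_smul mult.commute)
 qed
 have V_coord: "V Q (%k. coord k ze)" if "ks ze <= Q \<times> UNIV" for ze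
  using that
 proof (induction ze rule: frag_induction)
  case zero thus ?case using V_zero[OF Q] by simp
 next
  case (one x) thus ?case using V_frag[OF Q, of "fst x" "snd x"] by auto
 next
  case (diff a b) thus ?case using V_diff[OF Q] by (simp add: coord_diff)
 qed
 text \<open>The map from \<open>(Q/Z) \<otimes> (M/J)\<close> to the free module is injective modulo the relations.\<close>
 have inj: "ze:TR Q Z J" if "ks ze <= Q \<times> UNIV" "!!k. coord k ze = 0" for ze
 proof -
  have "EX A w. finite A & (ALL ka. w ka:Q) & (ALL ka k. lk (w ka) k = lk (coord k ze) ka) &
   ze - (SUM ka:A. frag_of (w ka, sg ka 1)):TR Q Z J & (ALL ka. ka ~: A --> w ka = 0)"
   using that(1)
  proof (induction ze rule: frag_induction)
   case zero
   show ?case by (intro exI[of _ "{}"] exI[of _ "%_. 0"]) (simp add: Q0 TR_0)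
  next
   case (one x)
   define q where "q = fst x"
   define m where "m = snd x"
   have x: "x = (q, m)" "q:Q" using one by (auto simp: q_def m_def)
   have "frag_of (q, SUM ka:ks m. smul (lk m ka) (sg ka 1)) - (SUM ka:ks m. frag_of (q, smul (lk m ka) (sg ka 1))):TR Q Z J"
    by (intro TR_right_sum x) simp
   moreover have "(SUM ka:ks m. smul (lk m ka) (sg ka 1)) = m" by (simp add: smul_single sum_sg)
   moreover have "(SUM ka:ks m. frag_of (smul (lk m ka) q, sg ka 1)) - (SUM ka:ks m. frag_of (q, smul (lk m ka) (sg ka 1))):TR Q Z J"
    unfolding sum_subtractf[symmetric] by (intro TR_sum TR_scale x)
   ultimately have "frag_of (q, m) - (SUM ka:ks m. frag_of (smul (lk m ka) q, sg ka 1)):TR Q Z J"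
    using TR_diff by fastforce
   thus ?case using x
    by (intro exI[of _ "ks m"] exI[of _ "%ka. smul (lk m ka) q"])
    (auto simp: coord_frag_of lk_smul mult.commute keysI intro: sm_scale[OF Q])
  next
   case (diff a b)
   then obtain A w A' w' where
    A: "finite A" "ALL ka. w ka:Q" "ALL ka k. lk (w ka) k = lk (coord k a) ka"
    "a - (SUM ka:A. frag_of (w ka, sg ka 1)):TR Q Z J" "ALL ka. ka ~: A --> w ka = 0" and
    A': "finite A'" "ALL ka. w' ka:Q" "ALL ka k. lk (w' ka) k = lk (coord k b) ka"
    "b - (SUM ka:A'. frag_of (w' ka, sg ka 1)):TR Q Z J" "ALL ka. ka ~: A' --> w' ka = 0"
    by (elim exE conjE)
   let ?B = "A Un A'"
   have ext: "x - (SUM ka:?B. frag_of (v ka, sg ka (1::'r))):TR Q Z J"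
    if "C <= ?B" "x - (SUM ka:C. frag_of (v ka, sg ka 1)):TR Q Z J" "ALL ka. ka ~: C --> v ka = 0" for C x v
   proof -
    have rest: "(SUM ka:?B - C. frag_of (v ka, sg ka (1::'r))):TR Q Z J"
    by (rule TR_sum) (use that(3) TR_left_0[OF Q0] in auto)
    have "(SUM ka:?B. frag_of (v ka, sg ka (1::'r))) = (SUM ka:?B - C. frag_of (v ka, sg ka 1)) + (SUM ka:C. frag_of (v ka, sg ka 1))"
    by (rule sum.subset_diff) (use that(1) A(1) A'(1) in auto)
    hence "x - (SUM ka:?B. frag_of (v ka, sg ka (1::'r)))
    = (x - (SUM ka:C. frag_of (v ka, sg ka 1))) - (SUM ka:?B - C. frag_of (v ka, sg ka 1))" by simp
    thus ?thesis using TR_diff[OF that(2) rest] by (simp only:)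
   qed
   have "frag_of (w ka - w' ka, m) - (frag_of (w ka, m) - frag_of (w' ka, m)):TR Q Z J" for ka and m :: "'k \<Rightarrow>\<^sub>0 'r"
    using TR_diff[OF TR_0 TR_left[of "w ka - w' ka" Q "w' ka" m Z J]] A(2) A'(2) sm.subspace_diff[OF Q]
    by (simp add: alg)
   hence d: "(SUM ka:?B. frag_of (w ka - w' ka, sg ka (1::'r)) - (frag_of (w ka, sg ka 1) - frag_of (w' ka, sg ka 1))):TR Q Z J"
    by (intro TR_sum)
   have "(a - b) - (SUM ka:?B. frag_of (w ka - w' ka, sg ka (1::'r)))
    = ((a - (SUM ka:?B. frag_of (w ka, sg ka 1))) - (b - (SUM ka:?B. frag_of (w' ka, sg ka 1))))
    - (SUM ka:?B. frag_of (w ka - w' ka, sg ka (1::'r)) - (frag_of (w ka, sg ka 1) - frag_of (w' ka, sg ka 1)))"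
    unfolding sum_subtractf by simp
   also have "...:TR Q Z J"
    by (intro TR_diff d ext[OF _ A(4,5)] ext[OF _ A'(4,5)]) auto
   finally have "(a - b) - (SUM ka:?B. frag_of (w ka - w' ka, sg ka (1::'r))):TR Q Z J" .
   moreover have "ALL ka. w ka - w' ka:Q"  using A(2) A'(2) sm.subspace_diff[OF Q] by blast
   ultimately show ?case using A A'
    by (intro exI[of _ ?B] exI[of _ "%ka. w ka - w' ka"]) (simp add: coord_diff lk_minus)
  qed
  then obtain A w where w: "ALL ka k. lk (w ka) k = lk (coord k ze) ka"
   "ze - (SUM ka:A. frag_of (w ka, sg ka (1::'r))):TR Q Z J" by blast
  have "w ka = 0" for ka by (rule pm_eqI) (simp add: w(1) that(2))
  hence "(SUM ka:A. frag_of (w ka, sg ka (1::'r))):TR Q Z J" by (intro TR_sum) (simp add: TR_left_0[OF Q0])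
  from TR_add[OF w(2) this] show ?thesis by simp
 qed
 \<comment> \<open>Requiring \<open>j k\<close> to vanish for large k gives the induction on the
   last nonzero coordinate its start.\<close>
 define D where "(D ze) = ((EX j z. (ALL k. coord k ze = j k + z k) & (ALL k. j k:J) & V Z z & (EX K. ALL k>=K. j k = 0)))"
  for ze :: "((nat, 'r) pm \<times> ('k, 'r) pm) \<Rightarrow>\<^sub>0 int"
 have "TR UNIV Z J <= {ze. D ze}"
  unfolding tensor_relations_def
 proof (rule fm.span_minimal)
  show "fm.subspace {ze. D ze}"
  proof (rule fm.subspaceI)
   show "0:{ze. D ze}" unfolding D_def using sm_0[OF J(1)] V_zero[OF Z]
    by (auto intro!: exI[of _ "%_. 0"])
  next
   fix a b assume "a:{ze. D ze}" "b:{ze. D ze}"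
   then obtain j z K j' z' K' where
    "ALL k. coord k a = j k + z k" "ALL k. j k:J" "V Z z" "ALL k>=K. j k = 0"
    "ALL k. coord k b = j' k + z' k" "ALL k. j' k:J" "V Z z'" "ALL k>=K'. j' k = 0"
    unfolding D_def by blast
   hence "(ALL k. coord k (a + b) = (j k + j' k) + (z k + z' k)) & (ALL k. j k + j' k:J) &
    V Z (%k. z k + z' k) & (ALL k>=max K K'. j k + j' k = 0)"
    using V_add[OF Z] sm_add[OF J(1)] by (simp add: coord_add alg)
   thus "a + b:{ze. D ze}"
    unfolding D_def mem_Collect_eq
    by (intro exI[of _ "%k. j k + j' k"] exI[of _ "%k. z k + z' k"]) blast
  next
   fix c a assume "a:{ze. D ze}"
   then obtain j z K where
    "ALL k. coord k a = j k + z k" "ALL k. j k:J" "V Z z" "ALL k>=K. j k = 0"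
    unfolding D_def by blast
   hence "(ALL k. coord k (frag_cmul c a) = smul (of_int c) (j k) + smul (of_int c) (z k)) & (ALL k. smul (of_int c) (j k):J) &
    V Z (%k. smul (of_int c) (z k)) & (ALL k>=K. smul (of_int c) (j k) = 0)"
    using V_scale[OF Z] sm_scale[OF J(1)] by (simp add: coord_cmul sm.scale_right_distrib)
   thus "frag_cmul c a:{ze. D ze}"
    unfolding D_def mem_Collect_eq
    by (intro exI[of _ "%k. smul (of_int c) (j k)"] exI[of _ "%k. smul (of_int c) (z k)"]) blast
  qed
  have D0: "D ze" if "!!k. coord k ze = 0" for ze
   unfolding D_def using that V_zero[OF Z] sm_0[OF J(1)]
   by (intro exI[of _ "%_. 0"]) auto
  have DZ: "D (frag_of (z, m))" if "z:Z" for z m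
   unfolding D_def using V_frag[OF Z that, of m] sm_0[OF J(1)]
   by (intro exI[of _ "%_. 0"] exI[of _ "%k. coord k (frag_of (z, m))"]) auto
  have DJ: "D (frag_of (x, j))" if "j:J" for x j
  proof -
   have "finite (ks x)" by simp
   then obtain K where "ALL k:ks x. k < K" by (metis finite_nat_set_iff_bounded)
   hence K: "ALL k>=K. lk x k = 0" by (meson keysI not_less)
   show ?thesis
    unfolding D_def using V_zero[OF Z] sm_scale[OF J(1) that] K
    by - (rule exI[of _ "%k. smul (lk x k) j"], rule exI[of _ "%_. 0"], auto simp: coord_frag_of intro!: exI[of _ K])
  qed
  have D1: "D (frag_of (x + y, m) - frag_of (x, m) - frag_of (y, m))" for x y m
   by (rule D0) (simp add: coord_diff coord_frag_of lk_add sm.scale_left_distrib)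
  have D2: "D (frag_of (x, m + m') - frag_of (x, m) - frag_of (x, m'))" for x m m'
   by (rule D0) (simp add: coord_diff coord_frag_of sm.scale_right_distrib)
  have D3: "D (frag_of (smul c x, m) - frag_of (x, smul c m))" for c x m
   by (rule D0) (simp add: coord_diff coord_frag_of lk_smul mult.commute)
  show "{frag_of (x + y, m) - frag_of (x, m) - frag_of (y, m) | x y m. x:UNIV & y:UNIV} Un
   {frag_of (x, m + m') - frag_of (x, m) - frag_of (x, m') | x m m'. x:UNIV} Un
   {frag_of (smul c x, m) - frag_of (x, smul c m) | c x m. x:UNIV} Un
   {frag_of (z, m) | z m. z:Z} Un
   {frag_of (x, j) | x j. x:UNIV & j:J} <= {ze. D ze}"
   using DZ DJ D1 D2 D3 by blast
 qed
 hence "D xi" using xi by blast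
 then obtain j z K where jz: "!!k. coord k xi = j k + z k" and j: "!!k. j k:J" and z: "V Z z"
  and K: "!!k. k >= K ==> j k = 0" unfolding D_def by blast
 have VZQ: "V Q ps" if "V Z ps" for ps using that ZQ unfolding V_def by blast
 have jQ: "V Q j" using V_diff[OF Q V_coord[OF xiQ] VZQ[OF z]] by (simp add: jz)
 have lift: "EX ze:G. ALL k. coord k ze = j k"
  if "!!k. j k:J" "V Q j" "!!k. k >= K ==> j k = 0" for j :: "nat => 'k \<Rightarrow>\<^sub>0 'r" and K
  using that
 proof (induction K arbitrary: j)
  case 0
  thus ?case using G0 by (intro bexI[of _ 0]) auto
 next
  case (Suc K)
  \<comment> \<open>The entries at position K of the elements of Q that vanish beyond K; the
    hypothesis is applied to this ideal.\<close>
  define c where "c = {lk v K | v. v:Q & (ALL k>K. lk v k = 0)}"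
  have c: "idl c"
  proof (rule idealI)
   show "0:c" unfolding c_def using Q0 by (intro CollectI exI[of _ 0]) simp
  next
   fix a b assume "a:c" "b:c"
   then obtain v w where "a = lk v K" "v:Q" "ALL k>K. lk v k = 0" "b = lk w K" "w:Q" "ALL k>K. lk w k = 0"
    unfolding c_def by blast
   thus "a + b:c" unfolding c_def using sm_add[OF Q]
    by (intro CollectI exI[of _ "v + w"]) (simp add: lk_add)
  next
   fix r a assume "a:c"
   then obtain v where "a = lk v K" "v:Q" "ALL k>K. lk v k = 0" unfolding c_def by blast
   thus "r * a:c" unfolding c_def using sm_scale[OF Q]
    by (intro CollectI exI[of _ "smul r v"]) (simp add: lk_smul)
  qed
  have pc: "p <= c"
  proof
   fix a assume "a:p"
   hence "smul a (sg K 1):Q" using pZ ZQ by blast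
   thus "a:c" unfolding c_def
    by (intro CollectI exI[of _ "smul a (sg K 1)"]) (simp add: lk_smul lk_sg)
  qed
  have "lk (j K) mu:c" for mu
  proof -
   obtain q where "q:Q" "ALL k. lk q k = lk (j k) mu" using Suc(3) unfolding V_def by meson
   thus ?thesis unfolding c_def using Suc(4) by (intro CollectI exI[of _ q]) simp
  qed
  hence "j K:sm.span ({smul a j | a j. a:c & j:J} Un {smul a m | a m. a:p})"
   using crit[OF c pc Suc(2)] by blast
  hence "EX ze:G. coord K ze = j K & (ALL k>K. coord k ze = 0) & (ALL k. coord k ze:J)"
  proof (induction rule: sm.span_induct_alt)
   case base
   thus ?case using G0 sm_0[OF J(1)] by (intro bexI[of _ 0]) auto
  next
   case (step r x y)
   then obtain ze where ze: "ze:G" "coord K ze = y" "ALL k>K. coord k ze = 0" "ALL k. coord k ze:J" by blast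
   have "EX et:G. coord K et = smul r x & (ALL k>K. coord k et = 0) & (ALL k. coord k et:J)"
    using step(1)
   proof
    assume "x:{smul a j | a j. a:c & j:J}"
    then obtain v i where v: "x = smul (lk v K) i" "v:Q" "ALL k>K. lk v k = 0" "i:J" unfolding c_def by blast
    have ri: "smul r i:J" using v(4) by (rule sm_scale[OF J(1)])
    have "frag_of (v, smul r i):G" unfolding G_def using TR_J[OF v(2) ri] v(2) by (simp add: keys_frag_of)
    thus ?thesis using v sm_scale[OF J(1) v(4)]
    by (intro bexI[of _ "frag_of (v, smul r i)"]) (simp_all add: coord_frag_of mult.commute)
   next
    assume "x:{smul a m | a m. a:p}"
    then obtain a m where a: "x = smul a m" "a:p" by blast
    have "smul a (sg K 1):Z" using a(2) pZ by blast
    hence aZ: "sg K a:Z" by (simp add: smul_single)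
    have "frag_of (sg K a, smul r m):G" unfolding G_def using TR_Z[OF aZ] aZ ZQ by (auto simp: keys_frag_of)
    thus ?thesis using a sm_0[OF J(1)] J(2)[OF a(2)]
    by (intro bexI[of _ "frag_of (sg K a, smul r m)"])
    (simp_all add: coord_frag_of lk_sg sm.scale_left_commute[of a r] sm_scale[OF J(1)] del: sm.scale_scale)
   qed
   then obtain et where "et:G" "coord K et = smul r x" "ALL k>K. coord k et = 0" "ALL k. coord k et:J" by blast
   thus ?case using ze Gadd sm_add[OF J(1)] by (intro bexI[of _ "et + ze"]) (simp_all add: coord_add)
  qed
  then obtain ze where ze: "ze:G" "coord K ze = j K" "!!k. k > K ==> coord k ze = 0" "!!k. coord k ze:J" by blast
  define i where "i k = j k - coord k ze" for k
  have "i k = 0" if "k >= K" for k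
   using Suc(4)[of k] ze(2) ze(3)[of k] that by (cases "k = K") (auto simp: i_def)
  moreover have "i k:J" for k unfolding i_def using Suc(2) ze(4) by (rule sm.subspace_diff[OF J(1)])
  moreover have "V Q (%k. coord k ze)" using ze(1) by (intro V_coord) (simp add: G_def)
  hence "V Q i" unfolding i_def by (rule V_diff[OF Q Suc(3)])
  ultimately obtain et where "et:G" "ALL k. coord k et = i k" using Suc(1) by blast
  thus ?case using ze(1) Gadd by (intro bexI[of _ "et + ze"]) (auto simp: coord_add i_def)
 qed
 obtain ze1 where ze1: "ze1:G" "!!k. coord k ze1 = j k" using lift[OF j jQ K] by blast
 have "EX ze:G. ALL k. coord k ze = z k"
 proof -
  obtain L where L: "!!k. k >= L ==> coord k xi = 0"
  proof -
   have "finite (UN y:ks xi. ks (fst y))" by simp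
   then obtain L where L: "ALL k:(UN y:ks xi. ks (fst y)). k < L" by (metis finite_nat_set_iff_bounded)
   have "coord k xi = 0" if "k >= L" for k
    unfolding coord_def
   proof (rule sum.neutral, rule ballI)
    fix y assume "y:ks xi"
    hence "lk (fst y) k = 0" using L \<open>k >= L\<close> by (meson UN_I keysI not_less)
    thus "smul (of_int (lk xi y)) (smul (lk (fst y) k) (snd y)) = 0" by simp
   qed
   thus ?thesis using that by blast
  qed
  have zk: "z k = coord k xi - j k" for k by (simp add: jz)
  have z0: "z k = 0" if "k >= max K L" for k using K[of k] L[of k] that by (simp add: zk)
  define A where "A = (\<Union>k<max K L. ks (z k))"
  have "ALL ka. EX q. q:Z & (ALL k. lk q k = lk (z k) ka)" using z unfolding V_def by blast
  from choice[OF this] obtain w where w: "!!ka. w ka:Z" "!!ka k. lk (w ka) k = lk (z k) ka" by blast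
  define ze where "ze = (SUM ka:A. frag_of (w ka, sg ka (1::'r)))"
  have "ze:G" unfolding ze_def
  proof (rule Gsum)
   fix ka show "frag_of (w ka, sg ka (1::'r)):G" unfolding G_def using TR_Z[OF w(1)] w(1) ZQ by (auto simp: keys_frag_of)
  qed
  moreover have "coord k ze = z k" for k
  proof -
   have "ks (z k) <= A"
   proof (cases "k < max K L")
    case False
    hence "z k = 0" by (intro z0) (simp only: not_less)
    thus ?thesis by simp
   qed (auto simp: A_def)
   thus ?thesis unfolding ze_def coord_sum coord_frag_of w(2) smul_single mult_1_right
    by (intro sum_sg_superset) (auto simp: A_def)
  qed
  ultimately show ?thesis by blast
 qed
 then obtain ze2 where ze2: "ze2:G" "!!k. coord k ze2 = z k" by blast
 have "ks (xi - (ze1 + ze2)) <= Q \<times> UNIV"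
  using keys_diff[of xi "ze1 + ze2"] xiQ Gadd[OF ze1(1) ze2(1)] by (auto simp: G_def)
 hence "xi - (ze1 + ze2):TR Q Z J"
  by (rule inj) (simp add: coord_diff coord_add ze1 ze2 jz)
 moreover have "ze1 + ze2:TR Q Z J" using Gadd[OF ze1(1) ze2(1)] by (simp add: G_def)
 ultimately show "xi:TR Q Z J" using TR_add by fastforce
qed

section \<open>Flatness on charts and homogeneous components\<close>

text \<open>Homogenization to degree \<open>N\<close> by powers of x_i, inverse to setting x_i = 1;
  components of degree above \<open>N\<close> are dropped.\<close>

definition rehom :: "'x => nat => ('x, 'r::comm_ring_1) pol => ('x, 'r) pol"
 where "rehom i N f = (SUM D<=N. Var i ^ (N - D) * hcomp D f)"

lemma rehom_add: "rehom i N (f + g) = rehom i N f + rehom i N g"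
 by (simp add: rehom_def hcomp_add ring_distribs sum.distrib)

lemma rehom_minus: "rehom i N (f - g) = rehom i N f - rehom i N g"
 by (simp add: rehom_def hcomp_minus right_diff_distrib sum_subtractf)

lemma rehom_0 [simp]: "rehom i N 0 = 0"
 by (simp add: rehom_def)

lemma rehom_Const: "rehom i N (Const a * f) = Const a * rehom i N f"
 by (simp add: rehom_def hcomp_Const_mult sum_distrib_left mult.left_commute)

lemma rehom_hom: "hom d f ==> d <= N ==> rehom i N f = Var i ^ (N - d) * f"
 by (simp add: rehom_def hcomp_hom if_distrib[of "%x. _ * x"] cong: if_cong)

lemma hcomp_Var_mult_Suc: "hcomp (Suc D) (Var i * h) = Var i * hcomp D h"
 using hcomp_mon_mult[of "sg i 1" D h] by (simp add: Var_mon)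

lemma hcomp_Var_mult_0: "hcomp 0 (Var i * h) = 0"
proof -
 have "hom 1 (Var i)" using hom_mon[of "sg i 1"] by (simp add: Var_mon)
 thus ?thesis using hcomp_mult_0[of 1 "Var i" 0 h] by (simp add: mult.commute)
qed

lemma hcomp_eq_0: "pdeg f < d ==> hcomp d f = 0"
 by (rule pm_eqI) (use mdeg_le_pdeg[of f] in "fastforce simp: lk_hcomp")

text \<open>The homogenizations of x_i h and of h coincide as soon as \<open>N\<close> exceeds the
  degree of h, since both are filled up with x_i.\<close>

lemma rehom_Var_minus_1:
 assumes "pdeg h < N" shows "rehom i N (h * (Var i - 1)) = 0"
proof -
 obtain M where N: "N = Suc M" using assms by (cases N) auto
 have "rehom i N (Var i * h) = (SUM D<=M. Var i ^ (N - Suc D) * (Var i * hcomp D h))"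
  by (simp add: rehom_def N sum.atMost_Suc_shift hcomp_Var_mult_0 hcomp_Var_mult_Suc del: sum.atMost_Suc)
 also have "... = (SUM D<=M. Var i ^ (N - D) * hcomp D h)"
 proof (rule sum.cong)
  fix D assume "D:{..M}"
  hence "N - D = Suc (N - Suc D)" by (auto simp: N)
  thus "Var i ^ (N - Suc D) * (Var i * hcomp D h) = Var i ^ (N - D) * hcomp D h"
   by (simp add: mult.assoc mult.left_commute)
 qed simp
 also have "... = rehom i N h"
  using hcomp_eq_0[OF assms] by (simp add: rehom_def N)
 finally have e: "rehom i N (Var i * h) = rehom i N h" .
 have "h * (Var i - 1) = Var i * h - h" by (simp add: alg)
 thus ?thesis by (simp add: rehom_minus e)
qed

lemma rehom_ideal:
 assumes X: "hideal X" and j: "j:igen (X Un {Var i - 1})"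
 shows "EX N0. ALL N>=N0. rehom i N j:X"
 using j
proof (induction rule: gen_induct)
 note I = homogeneousD[OF X]
 case base
 thus ?case using izero[OF I] by simp
next
 note I = homogeneousD[OF X]
 case (step c x y)
 then obtain N0 where N0: "ALL N>=N0. rehom i N y:X" by blast
 have "EX N1. ALL N>=N1. rehom i N (c * x):X"
 proof (cases "x:X")
  case True
  hence "c * x:X" by (rule iscale[OF I])
  hence "rehom i N (c * x):X" for N unfolding rehom_def
   using hom_ideal_hcomp[OF X] by (intro isetsum[OF I] iscale[OF I])
  thus ?thesis by blast
 next
  case False
  hence x: "x = Var i - 1" using step by blast
  have "rehom i N (c * x) = 0" if "N >= Suc (pdeg c)" for N
   unfolding x by (rule rehom_Var_minus_1) (use that in simp)
  thus ?thesis using izero[OF I] by (intro exI[of _ "Suc (pdeg c)"]) simp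
 qed
 then obtain N1 where "ALL N>=N1. rehom i N (c * x):X" by blast
 thus ?case using N0 iadd[OF I] by (intro exI[of _ "max N0 N1"]) (simp add: rehom_add)
qed

lemma rehom_cI: "idl c ==> f:cI c ==> rehom i N f:cI c"
 unfolding rehom_def
 by (intro isetsum[OF icI] iscale[OF icI] hcomp_cI)

text \<open>Homogenizes the conclusion of \<open>flat_quotientD\<close>: \<open>Y\<close> collects
  the polynomials whose homogenizations in all large degrees lie in cX + p. A power of x_i is the
  price of leaving the chart.\<close>

lemma flat_chartD:
 fixes X :: "('x, 'r::comm_ring_1) pol set"
 assumes flat: "flat_quotient p smul (igen (X Un {Var i - 1}))" and X: "hideal X"
  and p: "idl p" and c: "idl c" "p <= c" and F: "F:X" "hom d F" "F:cI c"
 shows "EX k. Var i ^ k * F:isum (pro c X) (cI p)"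
proof -
 let ?W = "isum (pro c X) (cI p)"
 define Y where "Y = {f. EX N0. ALL N>=N0. rehom i N f:?W}"
 have W: "idl ?W" by (intro isum_ideal pro_ideal icI p)
 have "F:Y"
 proof (rule flat_quotientD[OF flat p c])
  show "sm.subspace Y"
  proof (rule sm.subspaceI)
   show "0:Y" using izero[OF W] by (simp add: Y_def)
  next
   fix f g assume "f:Y" "g:Y"
   then obtain N0 N1 where "ALL N>=N0. rehom i N f:?W" "ALL N>=N1. rehom i N g:?W" unfolding Y_def by blast
   hence "ALL N>=max N0 N1. rehom i N (f + g):?W" using iadd[OF W] by (simp add: rehom_add)
   thus "f + g:Y" unfolding Y_def by blast
  next
   fix a f assume "f:Y"
   thus "smul a f:Y" using iscale[OF W] by (auto simp: Y_def smul_Const rehom_Const)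
  qed
  show "smul a j:Y" if "a:c" "j:igen (X Un {Var i - 1})" for a j
  proof -
   obtain N0 where "ALL N>=N0. rehom i N j:X" using rehom_ideal[OF X \<open>j:_\<close>] by blast
   hence "ALL N>=N0. rehom i N (smul a j):?W"
    using pro_base[OF \<open>a:c\<close>] isum_left[OF icI[OF p], of "pro c X"] by (auto simp: smul_Const rehom_Const)
   thus ?thesis unfolding Y_def by blast
  qed
  show "smul a m:Y" if "a:p" for a m
  proof -
   have "Const a * rehom i N m:cI p" for N using that by (rule cI_Const_mult[OF p])
   thus ?thesis using isum_right[OF pro_ideal, of "cI p" c X]
    by (auto simp: Y_def smul_Const rehom_Const)
  qed
  show "F:igen (X Un {Var i - 1})" using F(1) by (auto intro: gen_base)
  show "lk F mu:c" for mu using F(3) by (simp add: cI_iff)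
 qed
 then obtain N0 where "ALL N>=N0. rehom i N F:?W" unfolding Y_def by blast
 hence "rehom i (max N0 d) F:?W" by simp
 thus ?thesis using F(2) by (subst (asm) rehom_hom) auto
qed

text \<open>Flatness in graded form: X \<inter> cR[x] lies in cX + pR[x] up to powers of each
  variable. Unlike flatness on charts, this can be checked degree by degree.\<close>

definition FL :: "'r::comm_ring_1 set => ('x, 'r) pol set => bool"
 where "(FL p X) = ((ALL c. idl c & p <= c --> (ALL F d i. F:X & hom d F & F:cI c -->
  (EX k. Var i ^ k * F:isum (pro c X) (cI p)))))"

lemma power_minus_1_dvd: "EX h. x ^ e - 1 = h * (x - 1 :: 'a::comm_ring_1)"
proof (induction e)
 case (Suc e)
 then obtain h where "x ^ e - 1 = h * (x - 1)" by blast
 have "x ^ Suc e - 1 = x * (x ^ e - 1) + (x - 1)" by (simp add: alg)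
 also have "... = (x * h + 1) * (x - 1)" unfolding \<open>x ^ e - 1 = h * (x - 1)\<close> by (simp add: alg)
 finally show ?case by blast
qed (auto intro: exI[of _ 0])

lemma flat_chartI:
 fixes X :: "('x, 'r::comm_ring_1) pol set"
 assumes fl: "FL p X" and X: "hideal X" and p: "idl p" and pX: "cI p <= X"
 shows "flat_quotient p smul (igen (X Un {Var i - 1}))"
proof (rule flat_quotientI[OF p])
 let ?J = "igen (X Un {Var i - 1 :: ('x, 'r) pol})"
 have XJ: "X <= ?J" using gen_base by blast
 show J: "sm.subspace ?J"
  by (rule sm.subspaceI) (auto simp: smul_Const ideal.span_zero intro: ideal.span_add gen_scale)
 show "smul a m:?J" if "a:p" for a m
  using cI_Const_mult[OF p that, of m] pX XJ by (auto simp: smul_Const)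
 fix c and f :: "('x, 'r) pol" assume c: "idl c" "p <= c" and f: "f:?J" "!!mu. lk f mu:c"
 define W where "W = sm.span ({smul a j | a j. a:c & j:?J} Un {smul a m | a m. a:p})"
 have W1: "smul a j:W" if "a:c" "j:?J" for a j unfolding W_def by (rule sm.span_base) (use that in blast)
 have W2: "smul a m:W" if "a:p" for a m unfolding W_def by (rule sm.span_base) (use that in blast)
 have Wadd: "a + b:W" if "a:W" "b:W" for a b using that unfolding W_def by (rule sm.span_add)
 have Wsum: "sum g A:W" if "!!a. a:A ==> g a:W" for A :: "'x mon set" and g using that unfolding W_def by (rule sm.span_sum)
 have cIp: "g:W" if "g:cI p" for g
 proof -
  have "(SUM mu:ks g. sg mu (lk g mu)):W"
   by (rule Wsum) (use that W2[of _ "mon _"] in "simp add: cI_iff smul_Const sg_eq")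
  thus ?thesis by (simp add: sum_sg)
 qed
 have proW: "g:W" if "g:pro c X" for g
  using that unfolding pro_def
 proof (induction rule: gen_induct)
  case base thus ?case by (simp add: W_def sm.span_zero)
 next
  case (step h x y)
  then obtain a xi where a: "x = Const a * xi" "a:c" "xi:X" by blast
  have "h * xi:?J" using a(3) XJ by (intro gen_scale) auto
  hence "smul a (h * xi):W" using a(2) by (intro W1)
  thus ?case using step Wadd by (simp add: a(1) smul_Const mult.left_commute)
 qed
 obtain N0 where N0: "ALL N>=N0. rehom i N f:X" using rehom_ideal[OF X f(1)] by blast
 define N where "N = max N0 (pdeg f)"
 have fc: "f:cI c" using f(2) by (simp add: cI_iff)
 have "hom N (rehom i N f)"
  unfolding rehom_def
 proof (rule hom_sum)
  fix D assume "D:{..N}"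
  thus "hom N (Var i ^ (N - D) * hcomp D f)"
   using hom_mon_mult[of D "hcomp D f" "sg i (N - D)"] by (simp add: Var_power)
 qed
 then obtain k where k: "Var i ^ k * rehom i N f:isum (pro c X) (cI p)"
  using fl c N0 rehom_cI[OF c(1) fc, of i N] unfolding FL_def N_def by (meson max.cobounded1)
 then obtain a b where ab: "a:pro c X" "b:cI p" "Var i ^ k * rehom i N f = a + b"
  unfolding isum_def by blast
 have kW: "Var i ^ k * rehom i N f:W"
  unfolding ab(3) by (rule Wadd[OF proW[OF ab(1)] cIp[OF ab(2)]])
 \<comment> \<open>On the chart x_i is 1: multiplication by 1 - x_i^e lands in the chart ideal while
   the coefficients stay in \<open>c\<close>. Hence \<open>f\<close> and its homogenization agree
   modulo \<open>W\<close>.\<close>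
 have unit: "(1 - Var i ^ e) * g:W" if "g:cI c" for g e
 proof -
  obtain h where h: "Var i ^ e - 1 = h * (Var i - 1 :: ('x, 'r) pol)" using power_minus_1_dvd by blast
  have "(1 - Var i ^ e) * mon mu:?J" for mu
  proof -
   have "(1 - Var i ^ e) * mon mu = - ((Var i ^ e - 1) * mon mu :: ('x, 'r) pol)" by (simp add: alg)
   also have "... = (- (mon mu * h)) * (Var i - 1)" unfolding h by (simp add: alg)
   finally show ?thesis by (simp only:) (intro gen_scale gen_base, simp)
  qed
  hence "(SUM mu:ks g. smul (lk g mu) ((1 - Var i ^ e) * mon mu)):W"
   using that by (intro Wsum W1) (auto simp: cI_iff)
  moreover have "(SUM mu:ks g. smul (lk g mu) ((1 - Var i ^ e) * mon mu)) = (1 - Var i ^ e) * (SUM mu:ks g. sg mu (lk g mu))"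
   by (simp add: sum_distrib_left smul_Const sg_eq mult.left_commute)
  ultimately show ?thesis by (simp add: sum_sg)
 qed
 have "(SUM D<=N. hcomp D f) = f" by (rule sum_hcomp_pdeg) (simp add: N_def)
 hence "f - Var i ^ k * rehom i N f = (SUM D<=N. hcomp D f - Var i ^ k * (Var i ^ (N - D) * hcomp D f))"
  by (simp add: rehom_def sum_distrib_left sum_subtractf)
 also have "... = (SUM D<=N. (1 - Var i ^ (k + (N - D))) * hcomp D f)"
  by (simp only: power_add left_diff_distrib mult.assoc mult_1_left)
 also have "...:W" using hcomp_cI[OF c(1) fc] unit unfolding W_def by (intro sm.span_sum) auto
 finally have "f:W" using Wadd[OF _ kW] by fastforce
 thus "f:sm.span ({smul a j | a j. a:c & j:?J} Un {smul a m | a m. a:p})" by (simp add: W_def)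
qed

section \<open>Openness of flatness\<close>

definition hpart :: "('x, 'r::comm_ring_1) pol set => nat => ('x, 'r) pol set"
 where "hpart X d = {f:X. hom d f}"

text \<open>The degree \<open>d\<close> part of \<open>X\<close> has an image of dimension at least
  \<open>n\<close> over the residue field of \<open>P\<close>. The image in the polynomial ring over
  that field is counted, so these ranks can only grow when \<open>P\<close> shrinks.\<close>

definition hrank_ge :: "'r::comm_ring_1 set => ('x, 'r) pol set => nat => nat => bool"
 where "(hrank_ge P X d n) = ((EX fs. set fs <= hpart X d & length fs = n & indep P (map lk fs)))"

definition hrank_le :: "'r::comm_ring_1 set => ('x, 'r) pol set => nat => nat => bool"
 where "(hrank_le P X d n) = ((ALL fs. set fs <= hpart X d & indep P (map lk fs) --> length fs <= n))"

lemma lk_lc: "lk (SUM j<length fs. Const (r j) * fs ! j) mu = lc r (map lk fs) mu"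
 by (simp add: lc_def lk_sum lk_Const)

lemma hpart_lc: "idl X ==> set fs <= hpart X d ==> (SUM j<length fs. Const (r j) * fs ! j):hpart X d"
 unfolding hpart_def mem_Collect_eq
proof
 assume X: "idl X" and fs: "set fs <= {f:X. hom d f}"
 have *: "fs ! j:X & hom d (fs ! j)" if "j < length fs" for j using fs that nth_mem by blast
 show "(SUM j<length fs. Const (r j) * fs ! j):X"
  using * by (intro isetsum[OF X] iscale[OF X]) auto
 show "hom d (SUM j<length fs. Const (r j) * fs ! j)"
  using * by (intro hom_sum hom_Const_mult) auto
qed

lemma finite_mdeg: "finite {mu :: 'n::finite \<Rightarrow>\<^sub>0 nat. mdeg mu = d}"
proof -
 have "lk ` {mu :: 'n mon. mdeg mu = d} <= (UNIV \<rightarrow>\<^sub>E {..d})"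
 proof clarify
  fix mu :: "'n mon"
  have "lk mu i <= mdeg mu" for i
   using member_le_sum[of i UNIV "lk mu"] by (simp add: mdeg_superset[of UNIV])
  thus "lk mu:UNIV \<rightarrow>\<^sub>E {..mdeg mu}" by auto
 qed
 hence "finite (lk ` {mu :: 'n mon. mdeg mu = d})" by (rule finite_subset) (simp add: finite_PiE)
 thus ?thesis by (rule finite_imageD) (simp add: inj_on_def)
qed

lemma hrank_ge_mono:
 assumes "prime_ideal P" "prime_ideal Q" "Q <= P" "hrank_ge P X d n" shows "hrank_ge Q X d n"
 using assms indep_mono unfolding hrank_ge_def by blast

lemma hrank_ge_le:
 assumes "hrank_ge P X d n" "m <= n" shows "hrank_ge P X d m"
proof -
 obtain fs where fs: "set fs <= hpart X d" "length fs = n" "indep P (map lk fs)" using assms(1) unfolding hrank_ge_def by blast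
 have "indep P (map lk (take m fs))"
  unfolding indep_def
 proof (intro allI impI)
  fix r j assume r: "ALL i. lc r (map lk (take m fs)) i:P" and j: "j < length (map lk (take m fs))"
  define r' where "r' = (%j. if j < m then r j else 0)"
  have "lc r' (map lk fs) i = lc r (map lk (take m fs)) i" for i
   unfolding lc_def by (rule sum.mono_neutral_cong_right) (auto simp: r'_def)
  hence "lc r' (map lk fs) i:P" for i using r by simp
  hence "r' j:P" using indepD[OF fs(3), of r' j] j by simp
  thus "r j:P" using j by (simp add: r'_def)
 qed
 thus ?thesis unfolding hrank_ge_def using fs assms(2) set_take_subset[of m fs]
  by (intro exI[of _ "take m fs"]) auto
qed

text \<open>Generic freeness through leading monomials: modulo \<open>I\<close> they are generated
  by finitely many, and where the corresponding leading coefficients do not vanish, multiples of the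
  chosen elements keep their leading monomials. One \<open>ep\<close> thus serves all
  degrees.\<close>

lemma open_rank_generic:
 fixes X :: "('n::finite, 'r::comm_ring_1) pol set"
 assumes I: "prime_ideal I" and X: "idl X"
 obtains ep where "ep ~: I"
  "!!P d n. prime_ideal P ==> I <= P ==> ep ~: P ==> hrank_ge I X d n ==> hrank_ge P X d n"
proof -
 note II = primeD(1)[OF I]
 obtain N :: "'n mon => nat" where N: "ALL mu nu. N (mu + nu) = N mu * N nu" "ALL mu. N mu > 0"
  and inj: "ALL mu nu. ks mu <= UNIV --> ks nu <= UNIV --> N mu = N nu --> mu = nu"
  using monomial_order[of "UNIV :: 'n set"] by auto
 define lead where "(lead P f mu) = (lk f mu ~: P & (ALL nu. lk f nu ~: P --> nu = mu | N nu < N mu))"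
  for P and f :: "('n, 'r) pol" and mu
 define L where "L = {mu. EX f. f:hpart X (mdeg mu) & lead I f mu}"
 obtain B where B: "finite B" "B <= L" "!!mu. mu:L ==> EX nu:B. EX ka. mu = nu + ka"
  using dickson[of "UNIV :: 'n set" L] by auto
 have "ALL mu. EX f. mu:L --> f:hpart X (mdeg mu) & lead I f mu" unfolding L_def by blast
 from choice[OF this] obtain f where f: "!!mu. mu:L ==> f mu:hpart X (mdeg mu)" "!!mu. mu:L ==> lead I (f mu) mu" by blast
 define ep where "ep = (PROD mu:B. lk (f mu) mu)"
 have ep: "ep ~: I" unfolding ep_def using B(2) f(2) by (intro prime_ideal_prod[OF I]) (auto simp: lead_def)
 show ?thesis
 proof (rule that[OF ep])
  fix P d n assume P: "prime_ideal P" "I <= P" "ep ~: P" and rk: "hrank_ge I X d n"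
  note PI = primeD(1)[OF P(1)]
  define Ld where "Ld = {mu:L. mdeg mu = d}"
  have finL: "finite Ld" unfolding Ld_def by (rule finite_subset[OF _ finite_mdeg[of d]]) auto
  obtain fs where fs: "set fs <= hpart X d" "length fs = n" "indep I (map lk fs)" using rk unfolding hrank_ge_def by blast
  \<comment> \<open>Coordinates outside \<open>Ld\<close> can be discarded: a combination that
    vanishes modulo \<open>I\<close> on \<open>Ld\<close> has no possible leading monomial
    left.\<close>
  define vs where "vs = map (%g mu. if mu:Ld then lk g mu else 0) fs"
  have lcv: "lc r vs mu = (if mu:Ld then lc r (map lk fs) mu else 0)" for r mu
   by (simp add: lc_def vs_def)
  have "indep I vs"
   unfolding indep_def
  proof (intro allI impI)
   fix r j assume r: "ALL i. lc r vs i:I" and j: "j < length vs"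
   define F where "F = (SUM j<length fs. Const (r j) * fs ! j)"
   have F: "F:hpart X d" unfolding F_def using X fs(1) by (rule hpart_lc)
   have lkF: "lk F mu = lc r (map lk fs) mu" for mu unfolding F_def by (rule lk_lc)
   have "lk F mu:I" for mu
   proof (rule ccontr)
    assume no: "lk F mu ~: I"
    define S where "S = {mu. lk F mu ~: I}"
    have "S <= ks F" using izero[OF II] by (auto simp: S_def keysI)
    hence S: "finite S" "S ~= {}" using no by (auto simp: S_def intro: finite_subset)
    have "Max (N ` S):N ` S" using S by (intro Max_in) auto
    then obtain nu where nu: "nu:S" "N nu = Max (N ` S)" by (metis imageE)
    have "N ka <= N nu" if "ka:S" for ka using that S(1) by (simp add: nu(2))
    hence "lead I F nu" using nu(1) inj unfolding lead_def S_def by (metis (mono_tags) le_neq_implies_less mem_Collect_eq subset_UNIV)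
    moreover have d: "mdeg nu = d" using F nu(1) izero[OF II]
    unfolding hpart_def hom_iff S_def by (metis (mono_tags, lifting) mem_Collect_eq)
    ultimately have "nu:Ld" using F unfolding Ld_def L_def by blast
    moreover have "lc r vs nu:I" using r by blast
    ultimately have "lk F nu:I" by (simp add: lcv lkF)
    thus False using nu(1) by (simp add: S_def)
   qed
   thus "r j:I" using indepD[OF fs(3), of r j] j lkF by (simp add: vs_def)
  qed
  hence "length vs <= card Ld"
   by (rule indep_length_le[OF I finL, rotated]) (auto simp: vs_def II izero)
  hence nL: "n <= card Ld" using fs(2) by (simp add: vs_def)
  have "ALL mu. EX g. mu:Ld --> g:hpart X d & lead P g mu"
  proof
   fix mu show "EX g. mu:Ld --> g:hpart X d & lead P g mu"
   proof (cases "mu:Ld")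
    case True
    then obtain nu ka where nu: "nu:B" "mu = nu + ka" using B(3) unfolding Ld_def by blast
    hence nuL: "nu:L" using B(2) by blast
    define g where "g = mon ka * f nu"
    have "g:hpart X d"
    using f(1)[OF nuL] True nu(2) hom_mon_mult[of "mdeg nu" "f nu" ka]
    by (auto simp: hpart_def g_def Ld_def add.commute intro: iscale[OF X])
    moreover have "lead P g mu"
    unfolding lead_def
    proof (intro conjI allI impI)
    have "lk (f nu) nu ~: P" using P(3) nu(1) unfolding ep_def prod.remove[OF B(1) nu(1)]
    by (metis iright[OF PI])
    thus "lk g mu ~: P" unfolding g_def nu(2) add.commute[of nu] lk_mon_mult .
    fix ta assume ta: "lk g ta ~: P"
    hence "lk g ta ~= 0" using izero[OF PI] by metis
    then obtain si where si: "ta = ka + si" unfolding g_def by (metis lk_mon_mult_0)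
    hence "lk (f nu) si ~: P" using ta unfolding g_def si lk_mon_mult by simp
    hence "si = nu | N si < N nu" using f(2)[OF nuL] P(2) unfolding lead_def by blast
    thus "ta = mu | N ta < N mu" using si nu(2) N by (auto simp: add.commute mult.commute)
    qed
    ultimately show ?thesis by blast
   qed blast
  qed
  from choice[OF this] obtain g where g: "!!mu. mu:Ld ==> g mu:hpart X d" "!!mu. mu:Ld ==> lead P (g mu) mu" by blast
  obtain ms where ms: "set ms = Ld" "distinct ms" using finite_distinct_list[OF finL] by blast
  have "indep P (map lk (map g ms))"
  proof (rule indep_leads[OF P(1), where mu = "%j. ms ! j" and N = N])
   fix j assume "j < length (map lk (map g ms))"
   hence j: "ms ! j:Ld" "j < length ms" using ms(1) by auto
   show "(map lk (map g ms) ! j) (ms ! j) ~: P" using g(2)[OF j(1)] j(2) by (simp add: lead_def)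
   show "(map lk (map g ms) ! j) nu ~: P ==> nu = ms ! j | N nu < N (ms ! j)" for nu
    using g(2)[OF j(1)] j(2) by (simp add: lead_def)
  qed (use ms(2) in "simp add: nth_eq_iff_index_eq")
  moreover have "length ms = card Ld" using ms distinct_card by fastforce
  ultimately have "hrank_ge P X d (card Ld)" unfolding hrank_ge_def using g(1) ms(1)
   by (intro exI[of _ "map g ms"]) auto
  thus "hrank_ge P X d n" using nL by (rule hrank_ge_le)
 qed
qed

text \<open>Noetherian induction over the closed sets V(I): for prime \<open>I\<close> a generic
  open part and its complement are treated separately, a non-prime \<open>I\<close> gives a union of
  two smaller closed sets, and a V(I) that does not contain \<open>b\<close> is excluded by the
  choice of \<open>de\<close>.\<close>

theorem open_rank:
 fixes X :: "('n::finite, 'r::comm_ring_1) pol set"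
 assumes q: "noeth q" and b: "prime_ideal b" "q <= b" and X: "idl X"
  and rk: "!!d. d >= r ==> hrank_ge b X d (n d)"
 shows "EX de. de ~: b & (ALL P. prime_ideal P & q <= P & de ~: P --> (ALL d>=r. hrank_ge P X d (n d)))"
proof -
 define C where "(C I) = ((EX de. de ~: b & (ALL P. prime_ideal P & I <= P & de ~: P --> (ALL d>=r. hrank_ge P X d (n d)))))" for I
 have "idl q" using q by (simp add: noeth_def)
 from q this order_refl have "C q"
 proof (induction rule: noeth_induct)
  case (step I)
  have bigger: "C (isum I (igen {a}))" if "a ~: I" for a
  proof (rule step(3))
   show "idl (isum I (igen {a}))" by (rule isum_ideal[OF step(1)]) simp
   have "I <= isum I (igen {a})" by (rule isum_left) simp
   moreover have "a:isum I (igen {a})"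
    using isum_right[OF step(1), of "igen {a}"] gen_base[of a "{a}"] by blast
   ultimately show "I \<subset> isum I (igen {a})" using that by blast
  qed
  have sub: "isum I (igen {a}) <= P" if "prime_ideal P" "I <= P" "a:P" for a P
   using that primeD(1)[OF that(1)] by (intro isum_minimal gen_minimal) auto
  consider "~ I <= b" | "I <= b" "prime_ideal I" | a e where "I <= b" "a * e:I" "a ~: I" "e ~: I"
   using step(1) primeD(2)[OF b(1)] unfolding prime_ideal_def by blast
  thus ?case
  proof cases
   case 1
   then obtain de where "de:I" "de ~: b" by blast
   thus ?thesis unfolding C_def by blast
  next
   case 2
   obtain ep where ep: "ep ~: I"
    "!!P d n. prime_ideal P ==> I <= P ==> ep ~: P ==> hrank_ge I X d n ==> hrank_ge P X d n"
    using open_rank_generic[OF 2(2) X] by blast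
   obtain de where de: "de ~: b"
    "!!P. prime_ideal P & isum I (igen {ep}) <= P & de ~: P --> (ALL d>=r. hrank_ge P X d (n d))"
    using bigger[OF ep(1)] unfolding C_def by blast
   have "hrank_ge P X d (n d)" if "prime_ideal P" "I <= P" "de ~: P" "d >= r" for P d
   proof (cases "ep:P")
    case True thus ?thesis using de(2)[of P] sub that by blast
   next
    case False
    have "hrank_ge I X d (n d)" using hrank_ge_mono[OF b(1) 2(2,1)] rk[OF that(4)] by blast
    thus ?thesis using ep(2) that False by blast
   qed
   thus ?thesis unfolding C_def using de(1) by blast
  next
   case 3
   from bigger[OF 3(3), unfolded C_def] obtain de where de: "de ~: b"
    "ALL P. prime_ideal P & isum I (igen {a}) <= P & de ~: P --> (ALL d>=r. hrank_ge P X d (n d))"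
    by (elim exE conjE)
   from bigger[OF 3(4), unfolded C_def] obtain de' where de': "de' ~: b"
    "ALL P. prime_ideal P & isum I (igen {e}) <= P & de' ~: P --> (ALL d>=r. hrank_ge P X d (n d))"
    by (elim exE conjE)
   have "hrank_ge P X d (n d)" if P: "prime_ideal P" "I <= P" "de * de' ~: P" "d >= r" for P d
   proof -
    have n: "de ~: P" "de' ~: P" using P(3) prime_mult_iff[OF P(1)] by auto
    have "a:P | e:P" using 3(2) P(2) prime_mult_iff[OF P(1)] by blast
    thus ?thesis
    proof
    assume "a:P"
    thus ?thesis using de(2) sub[OF P(1,2)] P(1,4) n(1) by blast
    next
    assume "e:P"
    thus ?thesis using de'(2) sub[OF P(1,2)] P(1,4) n(2) by blast
    qed
   qed
   moreover have "de * de' ~: b" using de(1) de'(1) prime_mult_iff[OF b(1)] by blast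
   ultimately show ?thesis unfolding C_def by blast
  qed
 qed
 thus ?thesis unfolding C_def .
qed

text \<open>The multipliers h with hF in cX + q form an ideal. Without a power of \<open>de\<close>
  in it, some prime \<open>P\<close> off \<open>de\<close> would contain it. But at \<open>P\<close>
  there are \<open>n\<close> independent elements against which F reduces with coefficients in
  \<open>c\<close>, and the remainder vanishes modulo \<open>q\<close> because \<open>n\<close> is
  the maximal rank there.\<close>

lemma flat_of_constant_rank:
 fixes X :: "('x, 'r::comm_ring_1) pol set"
 assumes q: "prime_ideal q" and X: "idl X" and le: "hrank_le q X d n"
  and ge: "!!P. prime_ideal P ==> q <= P ==> de ~: P ==> hrank_ge P X d n"
  and c: "idl c" "q <= c" and F: "F:hpart X d" "F:cI c"
 shows "EX k. Const (de ^ k) * F:isum (pro c X) (cI q)"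
proof (rule ccontr)
 let ?W = "isum (pro c X) (cI q)"
 note qI = primeD(1)[OF q]
 assume no: "\<nexists>k. Const (de ^ k) * F:?W"
 have W: "idl ?W" by (intro isum_ideal pro_ideal icI qI)
 define aa where "aa = {h. Const h * F:?W}"
 have "idl aa"
  unfolding aa_def
  by (rule idealI) (auto simp: izero[OF W] Const_add Const_mult ring_distribs mult.assoc
    intro: iadd[OF W] iscale[OF W])
 moreover have "de ^ k ~: aa" for k using no by (auto simp: aa_def)
 ultimately obtain P where P: "prime_ideal P" "aa <= P" "de ~: P" using prime_avoiding_powers by blast
 have "q <= aa"
 proof
  fix h assume "h:q"
  hence "Const h * F:cI q" by (rule cI_Const_mult[OF qI])
  thus "h:aa" using isum_right[OF pro_ideal, of "cI q" c X] by (auto simp: aa_def)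
 qed
 hence qP: "q <= P" using P(2) by blast
 obtain fs where fs: "set fs <= hpart X d" "length fs = n" "indep P (map lk fs)"
  using ge[OF P(1) qP P(3)] unfolding hrank_ge_def by blast
 have "lk F i:c" for i using F(2) by (simp add: cI_iff)
 from indep_reduce[OF P(1) q qP c(1) fs(3), of "lk F", OF this] obtain u g where u: "u ~: P" and g: "ALL j. g j:c"
  and G: "(ALL k. u * lk F k - lc g (map lk fs) k:q) | indep q (map lk fs @ [%k. u * lk F k - lc g (map lk fs) k])"
  by blast
 define S where "S = (SUM j<length fs. Const (g j) * fs ! j)"
 define H where "H = Const u * F - S"
 have S: "S:hpart X d" unfolding S_def using X fs(1) by (rule hpart_lc)
 have lkH: "lk H = (%k. u * lk F k - lc g (map lk fs) k)"
  by (simp add: fun_eq_iff H_def S_def lk_minus lk_Const lk_lc)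
 have "H:hpart X d" using F(1) S unfolding H_def hpart_def
  by (auto intro!: iminus[OF X] iscale[OF X] hom_minus hom_Const_mult)
 hence sub: "set (fs @ [H]) <= hpart X d" using fs(1) by simp
 have "~ indep q (map lk (fs @ [H]))"
 proof
  assume "indep q (map lk (fs @ [H]))"
  hence "length (fs @ [H]) <= n" using le sub unfolding hrank_le_def by blast
  thus False using fs(2) by simp
 qed
 hence "H:cI q" using G by (simp add: lkH cI_iff)
 moreover have "fs ! j:X" if "j < length fs" for j using fs(1) nth_mem[OF that] by (auto simp: hpart_def)
 hence "S:pro c X"
  unfolding S_def using g by (intro isetsum[OF pro_ideal] pro_base) auto
 ultimately have "S + H:?W" by (intro isumI)
 hence "u:aa" by (simp add: H_def aa_def)
 thus False using u P(2) by blast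
qed

section \<open>Flat families near a point of the base\<close>

lemma cI_eq_ideal_gen: "idl p ==> cI p = igen (Const ` p)"
proof
 assume p: "idl p"
 show "cI p <= igen (Const ` p)"
 proof
  fix f assume f: "f:cI p"
  have "(SUM mu:ks f. sg mu (lk f mu)):igen (Const ` p)"
  proof (rule gen_sum)
   fix mu
   have "Const (lk f mu):igen (Const ` p)" by (rule gen_base) (use f in "auto simp: cI_iff")
   thus "sg mu (lk f mu):igen (Const ` p)"
    unfolding sg_eq by (rule iright[OF gen_ideal])
  qed
  thus "f:igen (Const ` p)" by (simp add: sum_sg)
 qed
 show "igen (Const ` p) <= cI p"
  by (rule gen_minimal[OF _ icI[OF p]])
   (use cI_Const_mult[OF p, of _ 1] in auto)
qed

section \<open>Finite generation and torsion in large degrees\<close>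

lemma noeth_cI:
 assumes "noeth p" shows "noeth (cI p :: ('n::finite, 'r::comm_ring_1) pol set)"
proof -
 have "noeth (igen (Const ` p Un Var ` (- UNIV)) :: ('n, 'r) pol set)"
  by (rule hilbert_basis[OF assms]) simp
 moreover have "idl p" using assms by (simp add: noeth_def)
 ultimately show ?thesis by (simp add: cI_eq_ideal_gen)
qed

lemma hom_gens:
 fixes X :: "('n::finite, 'r::comm_ring_1) pol set"
 assumes p: "noeth p" and X: "hideal X" "cI p <= X"
 shows "EX F e. finite F & F <= X & (ALL f:F. hom (e f) f) & X = igen (cI p Un F)"
proof -
 note I = homogeneousD[OF X(1)]
 obtain F0 where F0: "finite F0" "F0 <= X" "X = igen (cI p Un F0)"
  using noethE[OF noeth_cI[OF p] I X(2)] by metis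
 define F where "F = (UN f:F0. (%d. hcomp d f) ` {..pdeg f})"
 have F: "finite F" "F <= X" using F0 hom_ideal_hcomp[OF X(1)] by (auto simp: F_def)
 have "F0 <= igen (cI p Un F)"
 proof
  fix f assume f: "f:F0"
  have "(SUM d<=pdeg f. hcomp d f):igen (cI p Un F)"
   by (intro gen_sum gen_base) (use f in "auto simp: F_def")
  thus "f:igen (cI p Un F)" by (simp add: sum_hcomp_pdeg)
 qed
 moreover have "cI p <= igen (cI p Un F)" using ideal.span_superset[of "cI p Un F"] by simp
 ultimately have "igen (cI p Un F0) <= igen (cI p Un F)" by (intro gen_minimal) simp_all
 hence "X <= igen (cI p Un F)" using F0(3) by simp
 moreover have "igen (cI p Un F) <= X" by (rule gen_minimal) (use F X I in simp_all)
 ultimately have "X = igen (cI p Un F)" by (rule subset_antisym)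
 moreover have "EX d. hom d f" if "f:F" for f using that hom_hcomp unfolding F_def by blast
 hence "hom (SOME d. hom d f) f" if "f:F" for f using that by (metis someI_ex)
 ultimately show ?thesis using F by (intro exI[of _ F] exI[of _ "%f. SOME d. hom d f"]) simp
qed

lemma big_monomial:
 fixes ka :: "'n::finite \<Rightarrow>\<^sub>0 nat"
 assumes "mdeg ka >= CARD('n) * K" obtains i nu where "ka = sg i K + nu"
proof -
 have "EX i. lk ka i >= K"
 proof (rule ccontr)
  assume "\<nexists>i. lk ka i >= K"
  hence "lk ka i < K" for i by (simp add: not_le)
  hence "(SUM i:UNIV. lk ka i) < (SUM i:(UNIV :: 'n set). K)" by (intro sum_strict_mono) auto
  thus False using assms by (simp add: mdeg_superset[of UNIV])
 qed
 then obtain i where "lk ka i >= K" by blast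
 hence "ka = sg i K + (ka - sg i K)"
  by (intro pm_eqI) (auto simp: lk_add lk_minus lk_sg)
 thus ?thesis by (rule that)
qed

lemma hom_mult_mem:
 assumes W: "idl W" and "!!ka. mdeg ka = d ==> mon ka * f:W" and h: "hom d h"
 shows "h * f:W"
proof -
 have "(SUM mu:ks h. sg mu (lk h mu)) * f:W"
  unfolding sum_distrib_right
 proof (rule isetsum[OF W])
  fix mu assume "mu:ks h"
  hence "mdeg mu = d" using h by (auto simp: hom_iff keysI)
  hence "mon mu * f:W" by (rule assms(2))
  hence "Const (lk h mu) * (mon mu * f):W" by (rule iscale[OF W])
  thus "sg mu (lk h mu) * f:W" by (simp add: sg_eq mult.assoc)
 qed
 thus ?thesis unfolding sum_sg .
qed

text \<open>By flatness the finitely many generators of X \<inter> mR[x] enter mX + p after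
  multiplication by powers of each variable. In large degree every monomial multiplier contains such
  a power, so nothing but mX (modulo p) dies modulo m there.\<close>

lemma torsion_bound:
 fixes X :: "('n::finite, 'r::comm_ring_1) pol set"
 assumes p: "noeth p" and flat: "!!i. flat_quotient p smul (igen (X Un {Var i - 1}))"
  and X: "hideal X" "cI p <= X" and m: "idl m" "p <= m"
 shows "EX d0. ALL d>=d0. ALL F. F:hpart X d & F:cI m --> F:isum (pro m X) (cI p)"
proof -
 let ?W = "isum (pro m X) (cI p)"
 have pI: "idl p" using p by (simp add: noeth_def)
 note I = homogeneousD[OF X(1)]
 have W: "idl ?W" by (intro isum_ideal pro_ideal icI pI)
 define Y where "Y = X Int cI m"
 have Y: "hideal Y" unfolding Y_def
  by (rule hom_idealI)
   (auto intro: ideal.subspace_inter[OF I icI[OF m(1)]] hom_ideal_hcomp[OF X(1)] hcomp_cI[OF m(1)])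
 have pY: "cI p <= Y" using X(2) cI_mono[OF m(2)] by (auto simp: Y_def)
 from hom_gens[OF p Y pY] obtain F e where
  F0: "finite F & F <= Y & (ALL f:F. hom (e f) f) & Y = igen (cI p Un F)"
  by (elim exE)
 have F: "finite F" "F <= Y" "!!f. f:F ==> hom (e f) f" "Y = igen (cI p Un F)"
  using F0 by blast+
 have "ALL f. ALL i. EX k. f:F --> Var i ^ k * f:?W"
 proof (intro allI)
  fix f i
  show "EX k. f:F --> Var i ^ k * f:?W"
  proof (cases "f:F")
   case True
   hence "f:X" "f:cI m" using F(2) by (auto simp: Y_def)
   thus ?thesis using flat_chartD[OF flat X(1) pI m _ F(3)[OF True]] by blast
  qed blast
 qed
 then obtain k where k: "!!f i. f:F ==> Var i ^ k f i * f:?W" by metis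
 define K where "K = Max (insert 0 ((%(f, i). k f i) ` (F \<times> UNIV)))"
 define E where "E = Max (insert 0 (e ` F))"
 have kK: "k f i <= K" if "f:F" for f i
  unfolding K_def using F(1) that by (intro Max_ge) auto
 have eE: "e f <= E" if "f:F" for f
  unfolding E_def using F(1) that by (intro Max_ge) auto
 have mon: "mon ka * f:?W" if f: "f:F" and ka: "mdeg ka >= CARD('n) * K" for f ka
 proof -
  obtain i nu where nu: "ka = sg i K + nu" by (rule big_monomial[OF ka])
  have "mon nu * Var i ^ (K - k f i) * (Var i ^ k f i * f):?W"
   by (rule iscale[OF W k[OF f]])
  moreover have P: "(Var i ^ K :: ('n, 'r) pol) = Var i ^ (K - k f i) * Var i ^ k f i"
   using kK[OF f, of i] by (simp flip: power_add)
  have "(mon ka :: ('n, 'r) pol) = mon nu * Var i ^ K"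
   unfolding nu mon_add Var_power by (rule mult.commute)
  hence "(mon ka :: ('n, 'r) pol) = mon nu * Var i ^ (K - k f i) * Var i ^ k f i"
   by (simp only: P mult.assoc)
  ultimately show ?thesis by (simp add: mult.assoc)
 qed
 have "ALL G. G:hpart X d & G:cI m --> G:?W" if d: "d >= E + CARD('n) * K" for d
 proof (intro allI impI)
  fix G assume G: "G:hpart X d & G:cI m"
  hence "G:igen (cI p Un (%f. f) ` F)" using F(4) by (auto simp: hpart_def Y_def)
  then obtain h where h: "G - (SUM f:F. h f * f):cI p"
   using ideal_gen_Un_finite[OF icI[OF pI] F(1), of G "%f. f"] by blast
  have "hcomp d (G - (SUM f:F. h f * f)) = G - (SUM f:F. hcomp (d - e f) (h f) * f)"
  proof -
   have "hcomp d G = G" using G hcomp_hom[of d G d] by (simp add: hpart_def)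
   moreover have "hcomp d (h f * f) = hcomp (d - e f) (h f) * f" if "f:F" for f
    using eE[OF that] d by (intro hcomp_mult_hom F(3) that) simp
   ultimately show ?thesis by (simp add: hcomp_minus hcomp_sum)
  qed
  hence "G - (SUM f:F. hcomp (d - e f) (h f) * f):cI p" using hcomp_cI[OF pI h, of d] by simp
  hence 1: "G - (SUM f:F. hcomp (d - e f) (h f) * f):?W"
   using isum_right[OF pro_ideal, of "cI p" m X] by blast
  have "hcomp (d - e f) (h f) * f:?W" if "f:F" for f
   by (rule hom_mult_mem[OF W _ hom_hcomp]) (use mon[OF that] eE[OF that] d in auto)
  hence "(SUM f:F. hcomp (d - e f) (h f) * f):?W" by (intro isetsum[OF W])
  from iadd[OF W 1 this] show "G:?W" by simp
 qed
 thus ?thesis by blast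
qed

lemma hpart_subspace: "idl X ==> sm.subspace (hpart X d)"
 by (rule sm.subspaceI)
  (auto simp: hpart_def smul_Const intro: izero iadd iscale
   hom_add hom_Const_mult)

lemma sm_subspace_ideal: "idl X ==> sm.subspace (X :: ('x, 'r::comm_ring_1) pol set)"
 by (rule sm.subspaceI) (auto simp: smul_Const izero intro: iadd iscale)

definition msum :: "'b::ab_group_add set => 'b set => 'b set"
 where "msum A B = {x. EX a:A. x - a:B}"

lemma msum_subspace:
 assumes "sm.subspace A" "sm.subspace B" shows "sm.subspace (msum A B)"
proof (rule sm.subspaceI)
 show "0:msum A B" unfolding msum_def using sm_0[OF assms(1)] sm_0[OF assms(2)] by force
next
 fix x y assume "x:msum A B" "y:msum A B"
 then obtain a b where ab: "a:A" "x - a:B" "b:A" "y - b:B" unfolding msum_def by blast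
 have "(x - a) + (y - b):B" using ab by (intro sm_add[OF assms(2)])
 hence "x + y - (a + b):B" by (simp add: alg)
 thus "x + y:msum A B" unfolding msum_def using sm_add[OF assms(1) ab(1,3)] by blast
next
 fix c x assume "x:msum A B"
 then obtain a where a: "a:A" "x - a:B" unfolding msum_def by blast
 have "smul c x - smul c a:B" using sm_scale[OF assms(2) a(2), of c] by (simp add: sm.scale_right_diff_distrib)
 thus "smul c x:msum A B" unfolding msum_def using sm_scale[OF assms(1) a(1)] by blast
qed

lemma hpart_gens:
 fixes X :: "('n::finite, 'r::comm_ring_1) pol set"
 assumes p: "noeth p" and X: "hideal X" "cI p <= X"
 obtains B where "finite B" "B <= hpart X d" "hpart X d <= msum (sm.span B) (cI p)"
proof -
 have pI: "idl p" using p by (simp add: noeth_def)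
 note I = homogeneousD[OF X(1)]
 from hom_gens[OF p X] obtain F e where
  F0: "finite F & F <= X & (ALL f:F. hom (e f) f) & X = igen (cI p Un F)"
  by (elim exE)
 have F: "finite F" "F <= X" "!!f. f:F ==> hom (e f) f" "X = igen (cI p Un F)"
  using F0 by blast+
 define B where "B = (UN f:F. (%ka. mon ka * f) ` {ka. e f <= d & mdeg ka = d - e f})"
 have finB: "finite B"
  unfolding B_def using F(1) by (intro finite_UN_I finite_imageI) (auto intro: finite_subset[OF _ finite_mdeg])
 have BX: "B <= hpart X d"
 proof
  fix x assume "x:B"
  then obtain f ka where f: "f:F" "e f <= d" "mdeg ka = d - e f" "x = mon ka * f" unfolding B_def by blast
  have "hom d x" using hom_mon_mult[OF F(3)[OF f(1)], of ka] f by simp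
  moreover have "x:X" unfolding f(4) using f(1) F(2) by (intro iscale[OF I]) auto
  ultimately show "x:hpart X d" by (simp add: hpart_def)
 qed
 let ?T = "msum (sm.span B) (cI p)"
 have T: "sm.subspace ?T" by (rule msum_subspace[OF sm.subspace_span sm_subspace_ideal[OF icI[OF pI]]])
 have BT: "B <= ?T" "cI p <= ?T"
  unfolding msum_def using sm.span_base[of _ B] sm.span_zero[of B] izero[OF icI[OF pI]] by force+
 have "G:?T" if G: "G:hpart X d" for G
 proof -
  have "G:igen (cI p Un (%f. f) ` F)" using G F(4) by (auto simp: hpart_def)
  then obtain h where h: "G - (SUM f:F. h f * f):cI p"
   using ideal_gen_Un_finite[OF icI[OF pI] F(1), of G "%f. f"] by blast
  have "hcomp d (h f * f):?T" if f: "f:F" for f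
  proof (cases "e f <= d")
   case True
   have "(SUM mu:ks (hcomp (d - e f) (h f)). smul (lk (hcomp (d - e f) (h f)) mu) (mon mu * f)):?T"
   proof (intro sm.subspace_sum[OF T] sm_scale[OF T])
    fix mu assume "mu:ks (hcomp (d - e f) (h f))"
    hence "mdeg mu = d - e f" by (auto simp: keysI lk_hcomp split: if_splits)
    hence "mon mu * f:B" unfolding B_def using f True by blast
    thus "mon mu * f:?T" using BT by blast
   qed
   moreover have "(SUM mu:ks g. smul (lk g mu) (mon mu * f)) = g * f" for g
   proof -
    have "(SUM mu:ks g. smul (lk g mu) (mon mu * f)) = (SUM mu:ks g. sg mu (lk g mu)) * f"
    by (simp add: sum_distrib_right smul_Const sg_eq mult.assoc)
    thus ?thesis by (simp add: sum_sg)
   qed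
   ultimately show ?thesis using hcomp_mult_hom[OF F(3)[OF f] True] by simp
  next
   case False
   thus ?thesis using hcomp_mult_0[OF F(3)[OF f]] sm_0[OF T] by simp
  qed
  hence "(SUM f:F. hcomp d (h f * f)):?T" by (intro sm.subspace_sum[OF T])
  moreover have "hcomp d (G - (SUM f:F. h f * f)):?T" using hcomp_cI[OF pI h] BT by blast
  ultimately have "hcomp d (G - (SUM f:F. h f * f)) + (SUM f:F. hcomp d (h f * f)):?T" by (intro sm_add[OF T])
  hence "hcomp d G:?T" by (simp add: hcomp_minus hcomp_sum)
  thus ?thesis using G hcomp_hom[of d G d] by (simp add: hpart_def)
 qed
 thus ?thesis using that[OF finB BX] by blast
qed

lemma pro_hcomp:
 assumes "hideal X" "F:pro c X"
 shows "hcomp d F:sm.span {smul a g | a g. a:c & g:hpart X d}"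
 using assms(2) unfolding pro_def
proof (induction rule: gen_induct)
 case base thus ?case by (simp add: sm.span_zero)
next
 note I = homogeneousD[OF assms(1)]
 case (step h x y)
 then obtain a xi where a: "x = Const a * xi" "a:c" "xi:X" by blast
 have "hcomp d (h * xi):hpart X d"
  using hom_ideal_hcomp[OF assms(1) iscale[OF I a(3)]] by (simp add: hpart_def)
 hence "smul a (hcomp d (h * xi)):sm.span {smul a g | a g. a:c & g:hpart X d}"
  using a(2) by (intro sm.span_base) blast
 moreover have "h * x = Const a * (h * xi)" by (simp add: a(1) alg)
 hence "hcomp d (h * x) = smul a (hcomp d (h * xi))"
  by (simp only: smul_Const hcomp_Const_mult)
 ultimately have "hcomp d (h * x):sm.span {smul a g | a g. a:c & g:hpart X d}"
  by (simp only:)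
 thus ?case unfolding hcomp_add by (rule sm.span_add[OF _ step(2)])
qed

text \<open>Semicontinuity in the other direction, from Nakayama: a maximal independent family
  modulo \<open>m\<close> generates X_d up to mX_d by the torsion hypothesis, hence generates it
  after inverting some \<open>u\<close> outside \<open>m\<close>. The generic rank is therefore at
  most the special one.\<close>

lemma hrank_le_specialize:
 fixes X :: "('n::finite, 'r::comm_ring_1) pol set"
 assumes p: "noeth p" "prime_ideal p" and X: "hideal X" "cI p <= X"
  and m: "prime_ideal m" "p <= m"
  and tor: "!!F. F:hpart X d ==> F:cI m ==> F:isum (pro m X) (cI p)"
  and rk: "hrank_le m X d n"
 shows "hrank_le p X d n"
proof -
 note pI = primeD(1)[OF p(2)] and mI = primeD(1)[OF m(1)]
 note I = homogeneousD[OF X(1)]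
 define Q where "(Q fs) = (set fs <= hpart X d & indep m (map lk fs))" for fs
 have Q0: "Q []" by (simp add: indep_def Q_def)
 have "ALL fs. Q fs --> length fs < Suc n" using rk by (simp add: hrank_le_def Q_def less_Suc_eq_le)
 from ex_has_greatest_nat[OF Q0 this] obtain fs where
  fsQ: "Q fs & (ALL gs. Q gs --> length gs <= length fs)" by (elim exE)
 hence fs: "set fs <= hpart X d & indep m (map lk fs)" by (simp add: Q_def)
 define W where "W = msum (sm.span (set fs)) (cI p)"
 have W: "sm.subspace W" unfolding W_def by (rule msum_subspace[OF sm.subspace_span sm_subspace_ideal[OF icI[OF pI]]])
 have pW: "cI p <= W" unfolding W_def msum_def using sm.span_zero[of "set fs"] by force
 obtain B where B: "finite B" "B <= hpart X d" "hpart X d <= msum (sm.span B) (cI p)"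
  by (rule hpart_gens[OF p(1) X])
 obtain bs where bs: "set bs = B" "distinct bs" using finite_distinct_list[OF B(1)] by blast
 define l where "l = length bs"
 have sumB: "(SUM v:B. smul (w v) v) = (SUM k<l. smul (w (bs ! k)) (bs ! k))" for w :: "('n, 'r) pol => 'r"
  using sum.reindex_bij_betw[OF bij_betw_nth[OF bs(2) refl refl], of "%v. smul (w v) v"] bs(1) by (simp add: l_def)
 have expand: "EX a. (ALL k. a k:c) & F - (SUM k<l. smul (a k) (bs ! k)):cI p"
  if c: "idl c" and F: "F:sm.span {smul a g | a g. a:c & g:hpart X d}" for c F
  using F
 proof (induction rule: sm.span_induct_alt)
  case base
  thus ?case using izero[OF c] izero[OF icI[OF pI]] by (intro exI[of _ "%_. 0"]) simp
 next
  case (step r x y)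
  then obtain a where a: "ALL k. a k:c" "y - (SUM k<l. smul (a k) (bs ! k)):cI p" by blast
  obtain b g where b: "x = smul b g" "b:c" "g:hpart X d" using step(1) by blast
  obtain v where v: "v:sm.span B" "g - v:cI p" using b(3) B(3) unfolding msum_def by blast
  obtain w where "v = (SUM v:B. smul (w v) v)" using v(1) sm.span_finite[OF B(1)] by blast
  hence v': "v = (SUM k<l. smul (w (bs ! k)) (bs ! k))" using sumB by simp
  let ?a = "%k. r * b * w (bs ! k) + a k"
  have "?a k:c" for k
   using a(1) by (intro iadd[OF c] iright[OF c iscale[OF c b(2)]]) blast
  moreover have "smul (r * b) (g - v) + (y - (SUM k<l. smul (a k) (bs ! k))):cI p"
   using a(2) v(2) sm_subspace_ideal[OF icI[OF pI]] by (metis sm_add sm_scale)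
  moreover have "smul (r * b) (g - v) + (y - (SUM k<l. smul (a k) (bs ! k))) = smul r x + y - (SUM k<l. smul (?a k) (bs ! k))"
   by (simp add: b(1) v' sm.scale_right_diff_distrib sm.scale_left_distrib sum.distrib sm.scale_sum_right mult.assoc)
  ultimately show ?case by (intro exI[of _ ?a]) simp
 qed
 \<comment> \<open>The maximal family cannot be enlarged by the remainder, so the remainder vanishes
   modulo \<open>m\<close>; this is what makes the torsion hypothesis applicable to it.\<close>
 have red: "EX u a. u ~: m & (ALL k. a k:m) & smul u G - (SUM k<l. smul (a k) (bs ! k)):W" if G: "G:hpart X d" for G
 proof -
  have U: "idl (UNIV :: 'r set)" by simp
  obtain u g where u: "u ~: m" and g: "(ALL k. u * lk G k - lc g (map lk fs) k:m) |
    indep m (map lk fs @ [%k. u * lk G k - lc g (map lk fs) k])"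
   using indep_reduce[OF m(1) m(1) order_refl U, of "map lk fs" "lk G"] fs by auto
  define S where "S = (SUM j<length fs. Const (g j) * fs ! j)"
  define H where "H = Const u * G - S"
  have S: "S:hpart X d" unfolding S_def using I fs by (intro hpart_lc) auto
  have lkH: "lk H = (%k. u * lk G k - lc g (map lk fs) k)"
   by (simp add: fun_eq_iff H_def S_def lk_minus lk_Const lk_lc)
  have H: "H:hpart X d" unfolding H_def using sm.subspace_diff[OF hpart_subspace[OF I] sm_scale[OF hpart_subspace[OF I] G] S]
   by (simp add: smul_Const)
  have "~ Q (fs @ [H])"
  proof
   assume "Q (fs @ [H])"
   hence "length (fs @ [H]) <= length fs" using fsQ by blast
   thus False by simp
  qed
  hence "~ indep m (map lk fs @ [lk H])" using fs H by (simp add: Q_def)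
  hence "H:cI m" using g by (auto simp: lkH cI_iff)
  hence "H:isum (pro m X) (cI p)" by (rule tor[OF H])
  then obtain a b where ab: "a:pro m X" "b:cI p" "H = a + b" unfolding isum_def by blast
  have "H = hcomp d H" using H hcomp_hom[of d H d] by (simp add: hpart_def)
  hence Hd: "H = hcomp d a + hcomp d b" by (simp add: ab(3) hcomp_add)
  obtain e where e: "ALL k. e k:m" "hcomp d a - (SUM k<l. smul (e k) (bs ! k)):cI p"
   using expand[OF mI pro_hcomp[OF X(1) ab(1)]] by blast
  have "S:sm.span (set fs)" unfolding S_def smul_Const[symmetric] by (intro sm.span_sum sm.span_scale sm.span_base) simp
  hence "S:W" unfolding W_def msum_def using izero[OF icI[OF pI]] by force
  moreover have "hcomp d b:W" "hcomp d a - (SUM k<l. smul (e k) (bs ! k)):W" using e(2) hcomp_cI[OF pI ab(2)] pW by auto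
  ultimately have SW: "S + (hcomp d b + (hcomp d a - (SUM k<l. smul (e k) (bs ! k)))):W" by (intro sm_add[OF W])
  have "smul u G = H + S" by (simp add: H_def smul_Const)
  hence "smul u G - (SUM k<l. smul (e k) (bs ! k)) = S + (hcomp d b + (hcomp d a - (SUM k<l. smul (e k) (bs ! k))))"
   using Hd by simp
  hence "smul u G - (SUM k<l. smul (e k) (bs ! k)):W" using SW by (simp only:)
  thus ?thesis using u e(1) by blast
 qed
 have "ALL i. EX u a. i < l --> u ~: m & (ALL k. a k:m) & smul u (bs ! i) - (SUM k<l. smul (a k) (bs ! k)):W"
 proof
  fix i show "EX u a. i < l --> u ~: m & (ALL k. a k:m) & smul u (bs ! i) - (SUM k<l. smul (a k) (bs ! k)):W"
  proof (cases "i < l")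
   case True
   hence "bs ! i:hpart X d" using B(2) bs(1) by (auto simp: l_def)
   thus ?thesis using red by blast
  qed blast
 qed
 from choice[OF this] obtain v where "ALL i. EX a. i < l --> v i ~: m & (ALL k. a k:m) & smul (v i) (bs ! i) - (SUM k<l. smul (a k) (bs ! k)):W" ..
 from choice[OF this] obtain a where va: "ALL i. i < l --> v i ~: m & (ALL k. a i k:m) & smul (v i) (bs ! i) - (SUM k<l. smul (a i k) (bs ! k)):W" ..
 have "EX u. u ~: m & (ALL i<l. smul u (bs ! i):W)"
  by (rule nakayama[OF module_smul W m(1), of l v a]) (use va in auto)
 then obtain u where u: "u ~: m" "ALL i<l. smul u (bs ! i):W" by blast
 have uW: "smul u G:W" if G: "G:hpart X d" for G
 proof -
  obtain v where v: "v:sm.span B" "G - v:cI p" using G B(3) unfolding msum_def by blast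
  obtain w where "v = (SUM v:B. smul (w v) v)" using v(1) sm.span_finite[OF B(1)] by blast
  hence "smul u v = (SUM k<l. smul (w (bs ! k)) (smul u (bs ! k)))"
   by (simp add: sumB sm.scale_sum_right mult.commute)
  also have "...:W" using u(2) by (intro sm.subspace_sum[OF W] sm_scale[OF W, of "smul u _"]) auto
  finally have uv: "smul u v:W" .
  have "G - v:W" using v(2) pW by blast
  hence "smul u v + smul u (G - v):W" by (intro sm_add[OF W uv] sm_scale[OF W])
  thus ?thesis by (simp add: sm.scale_right_diff_distrib)
 qed
 show ?thesis
  unfolding hrank_le_def
 proof (intro allI impI, elim conjE)
  fix hs assume hs: "set hs <= hpart X d" "indep p (map lk hs)"
  have "length (map lk hs) <= card {..<length fs}"
  proof (rule indep_span_bound[OF p(2) finite_lessThan hs(2)])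
   fix j assume "j < length (map lk hs)"
   hence j: "hs ! j:hpart X d" "j < length hs" using hs(1) by auto
   obtain s where s: "s:sm.span (set fs)" "smul u (hs ! j) - s:cI p" using uW[OF j(1)] unfolding W_def msum_def by blast
   have "EX r. s = (SUM k<length fs. smul (r k) (fs ! k))"
    using s(1)
   proof (induction rule: sm.span_induct_alt)
    case base thus ?case by (intro exI[of _ "%_. 0"]) simp
   next
    case (step c x y)
    then obtain r where r: "y = (SUM k<length fs. smul (r k) (fs ! k))" by blast
    obtain i where i: "i < length fs" "x = fs ! i" using step(1) by (metis in_set_conv_nth)
    have "(SUM k<length fs. smul (if k = i then c else 0) (fs ! k)) = smul c x"
    using i by (subst sum.mono_neutral_right[of _ "{i}"]) auto
    thus ?case using r by (intro exI[of _ "%k. (if k = i then c else 0) + r k"]) (simp add: sm.scale_left_distrib sum.distrib)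
   qed
   then obtain r where "s = (SUM k<length fs. smul (r k) (fs ! k))" by blast
   hence "u * (map lk hs ! j) k - (SUM i<length fs. r i * lk (fs ! i) k):p" for k
    using s(2) j(2) by (simp add: cI_iff lk_minus lk_smul lk_sum)
   moreover have "u ~: p" using u(1) m(2) by blast
   ultimately show "EX u r. u ~: p & (ALL k. u * (map lk hs ! j) k - (SUM i:{..<length fs}. r i * lk (fs ! i) k):p)" by blast
  qed
  also have "length fs <= n" using fs rk by (simp add: hrank_le_def)
  finally show "length hs <= n" by simp
 qed
qed

text \<open>The basis theorem over C for the finitely many variables outside \<open>p\<close>; the
  other variables lie in \<open>p\<close>.\<close>

lemma noeth_affine_base:
 assumes "affine_base p" shows "noeth p"
proof -
 have p: "idl p" "finite {i. Var i ~: p}" using assms by (auto simp: affine_base_def)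
 have "noeth (igen (Const ` {0} Un Var ` (- {i. Var i ~: p})) :: base_ring set)"
  by (rule hilbert_basis[OF noeth_field p(2)])
 thus ?thesis
 proof (rule noeth_mono[OF _ p(1)])
  show "igen (Const ` {0} Un Var ` (- {i. Var i ~: p})) <= p"
   by (rule gen_minimal[OF _ p(1)]) (auto simp: izero[OF p(1)])
 qed
qed

section \<open>Unipotent operators on polynomials\<close>

text \<open>The R-linear extension of a map on monomials. If it is the identity modulo an ideal n,
  it is invertible modulo powers of n (\<open>Zop_surj\<close>, \<open>Zop_inj\<close>); this takes
  the place of division algorithms over nilpotent thickenings.\<close>

definition Zop :: "('x mon => ('y, 'r::comm_ring_1) pol) => ('x, 'r) pol => ('y, 'r) pol"
 where "Zop ze f = (SUM mu:ks f. Const (lk f mu) * ze mu)"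

lemma Zop_superset: "finite A ==> ks f <= A ==> Zop ze f = (SUM mu:A. Const (lk f mu) * ze mu)"
 unfolding Zop_def by (rule sum.mono_neutral_left) (auto simp: keysI)

lemma Zop_add: "Zop ze (f + g) = Zop ze f + Zop ze g"
proof -
 let ?A = "ks f Un ks g"
 have "Zop ze x = (SUM mu:?A. Const (lk x mu) * ze mu)" if "x:{f, g, f + g}" for x
  by (rule Zop_superset) (use that keys_add[of f g] in auto)
 thus ?thesis by (simp add: lk_add Const_add ring_distribs sum.distrib)
qed

lemma Zop_0 [simp]: "Zop ze 0 = 0"
 by (simp add: Zop_def)

lemma Zop_minus: "Zop ze (f - g) = Zop ze f - Zop ze g"
 using Zop_add[of ze "f - g" g] by simp

lemma Zop_sum: "Zop ze (sum f A) = (SUM a:A. Zop ze (f a))"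
 by (induction A rule: infinite_finite_induct) (simp_all add: Zop_add)

lemma Zop_single: "Zop ze (sg mu a) = Const a * ze mu"
 by (subst Zop_superset[of "{mu}"]) auto

lemma Zop_mon: "Zop ze (mon mu) = ze mu"
 by (simp add: mon_def Zop_single)

lemma Zop_Const: "Zop ze (Const a * f) = Const a * Zop ze f"
proof -
 have "ks (Const a * f) <= ks f" by (auto simp: keysI lk_Const)
 hence "Zop ze (Const a * f) = (SUM mu:ks f. Const (lk (Const a * f) mu) * ze mu)" by (intro Zop_superset) auto
 thus ?thesis by (simp add: Zop_def lk_Const Const_mult sum_distrib_left mult.assoc)
qed

lemma Zop_id: "(!!mu. lk f mu ~= 0 ==> ze mu = mon mu) ==> Zop ze f = f"
proof -
 assume "!!mu. lk f mu ~= 0 ==> ze mu = mon mu"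
 hence "Zop ze f = (SUM mu:ks f. sg mu (lk f mu))"
  unfolding Zop_def by (intro sum.cong) (auto simp: sg_eq keysI)
 thus ?thesis by (simp add: sum_sg)
qed

lemma Zop_mem: "idl Y ==> (!!mu. lk f mu ~= 0 ==> ze mu:Y) ==> Zop ze f:Y"
 unfolding Zop_def by (rule isetsum, assumption, rule iscale) (auto simp: keysI)

lemma Zop_cI: "idl a ==> f:cI a ==> Zop ze f:cI a"
 unfolding Zop_def by (intro isetsum[OF icI] cI_Const_mult) (auto simp: cI_iff)

lemma Zop_hom:
 assumes "!!mu. hom (mdeg mu) (ze mu)" "hom d f" shows "hom d (Zop ze f)"
 unfolding Zop_def
proof (rule hom_sum)
 fix mu assume "mu:ks f"
 hence "mdeg mu = d" using assms(2) by (auto simp: hom_iff keysI)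
 thus "hom d (Const (lk f mu) * ze mu)" using assms(1)[of mu] by (simp add: hom_Const_mult)
qed

lemma Const_mult_cI: "idl e ==> (!!y. y:b ==> x * y:e) ==> f:cI b ==> Const x * f:cI e"
 by (simp add: cI_iff lk_Const)

lemma Zop_diff_cI:
 assumes e: "idl e" and be: "!!x y. x:a ==> y:b ==> x * y:e"
  and ze: "!!mu. ze mu - mon mu:cI b" and f: "f:cI a"
 shows "Zop ze f - f:cI e"
proof -
 have "(SUM mu:ks f. Const (lk f mu) * (ze mu - mon mu)):cI e"
  using f ze be by (intro isetsum[OF icI[OF e]] Const_mult_cI[OF e, of b]) (auto simp: cI_iff)
 moreover have "(SUM mu:ks f. Const (lk f mu) * (ze mu - mon mu)) = Zop ze f - f"
  using sum_sg[of f] by (simp add: Zop_def right_diff_distrib sum_subtractf sg_eq)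
 ultimately show ?thesis by simp
qed

text \<open>Neumann series: adding the error f - Z(H) to H applies 1 - Z to the error, which pushes
  its coefficients one power of \<open>n\<close> deeper.\<close>

lemma Zop_surj:
 assumes n: "idl n" and a: "idl a" and ze: "!!mu. ze mu - mon mu:cI n"
  and hom: "!!mu. hom (mdeg mu) (ze mu)" and f: "f:cI a"
 shows "EX H. H:cI a & f - Zop ze H:cI (ipow n j) & (ALL d. hom d f --> hom d H)"
proof -
 have "EX H. H:cI a & f - Zop ze H:cI a & f - Zop ze H:cI (ipow n j) & (ALL d. hom d f --> hom d H)"
 proof (induction j)
  case 0
  show ?case by (rule exI[of _ 0]) (use f izero[OF icI[OF a]] in "auto simp: cI_iff")
 next
  case (Suc j)
  then obtain H where H: "H:cI a" "f - Zop ze H:cI a" "f - Zop ze H:cI (ipow n j)"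
   "ALL d. hom d f --> hom d H" by blast
  define g where "g = f - Zop ze H"
  have eq: "f - Zop ze (H + g) = g - Zop ze g" by (simp add: Zop_add g_def)
  have "Zop ze g - g:cI (ipow n (Suc j))"
  proof (rule Zop_diff_cI[OF ipow_ideal, of "ipow n j" n])
   show "x * y:ipow n (Suc j)" if "x:ipow n j" "y:n" for x y
    using ipow_mult[OF that(2,1)] by (simp only: mult.commute)
   show "g:cI (ipow n j)" unfolding g_def by (rule H(3))
  qed (rule ze)
  hence "g - Zop ze g:cI (ipow n (Suc j))"
   using ineg[OF icI[OF ipow_ideal]] by fastforce
  moreover have "g - Zop ze g:cI a" using H(2) Zop_cI[OF a] by (intro iminus[OF icI[OF a]]) (auto simp: g_def)
  moreover have "H + g:cI a" using H(1,2) by (intro iadd[OF icI[OF a]]) (auto simp: g_def)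
  moreover have "hom d (H + g)" if "hom d f" for d
   using H(4) that unfolding g_def by (intro hom_add hom_minus Zop_hom hom) auto
  ultimately show ?case unfolding eq[symmetric] by blast
 qed
 thus ?thesis by blast
qed

lemma isum_ipow_mult:
 assumes "idl c" "x:isum c (ipow n j)" "y:n"
 shows "x * y:isum c (ipow n (Suc j))"
proof -
 obtain a b where ab: "a:c" "b:ipow n j" "x = a + b" using assms(2) unfolding isum_def by blast
 have "a * y + y * b:isum c (ipow n (Suc j))"
  by (intro isumI iright[OF assms(1) ab(1)] ipow_mult assms ab)
 thus ?thesis by (simp add: ab(3) alg)
qed

text \<open>If H lies in c + n^j, then Z(H) and H agree modulo c + n^(j+1), so Z(H) in c pushes H
  one power further.\<close>

lemma Zop_inj:
 assumes c: "idl c" "ipow n J <= c" and ze: "!!mu. ze mu - mon mu:cI n" and H: "Zop ze H:cI c"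
 shows "H:cI c"
proof -
 have "H:cI (isum c (ipow n j))" for j
 proof (induction j)
  case 0
  have "x:isum c UNIV" for x using isumI[of 0 c x UNIV] izero[OF c(1)] by simp
  thus ?case by (simp add: cI_iff)
 next
  case (Suc j)
  have e: "idl (isum c (ipow n (Suc j)))" by (intro isum_ideal c ipow_ideal)
  have 1: "Zop ze H - H:cI (isum c (ipow n (Suc j)))"
   by (rule Zop_diff_cI[OF e _ ze Suc]) (rule isum_ipow_mult[OF c(1)])
  have "Zop ze H:cI (isum c (ipow n (Suc j)))"
   using H cI_mono[OF isum_left[OF ipow_ideal, of c n "Suc j"]] by blast
  from iminus[OF icI[OF e] this 1] show ?case by simp
 qed
 hence "H:cI (isum c (ipow n J))" .
 moreover have "isum c (ipow n J) <= c" by (rule isum_minimal[OF c(1)]) (use c in auto)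
 ultimately show ?thesis using cI_mono by blast
qed

definition rs :: "('x mon => bool) => ('x, 'r::comm_ring_1) pol => ('x, 'r) pol"
 where "rs P f = (SUM mu:{mu:ks f. P mu}. sg mu (lk f mu))"

lemma lk_rs: "lk (rs P f) mu = (if P mu then lk f mu else 0)"
 by (auto simp: rs_def lk_sum lk_sg keysI)

lemma rs_split: "f = rs P f + rs (%mu. ~ P mu) f"
 by (rule pm_eqI) (simp add: lk_rs lk_add)

lemma rs_cI: "idl a ==> f:cI a ==> rs P f:cI a"
 by (auto simp: cI_iff lk_rs izero)

lemma rs_hom: "hom d f ==> hom d (rs P f)"
 by (auto simp: hom_iff lk_rs split: if_splits)

section \<open>Lifting a Stanley--Reisner cone along a flat family\<close>

text \<open>\<open>std\<close> marks the monomials that survive modulo a squarefree monomial ideal.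
  \<open>std_cone\<close> makes \<open>x0\<close> a cone vertex; \<open>std_supp\<close> expresses
  squarefreeness, as raising an exponent that is already positive keeps a monomial standard.\<close>

locale std_monomials =
 fixes std :: "'x mon => bool" and x0 :: 'x
 assumes nonstd_add: "~ std mu ==> ~ std (mu + ka)"
  and std_cone: "(std (mu + sg x0 1)) = std mu"
  and std_supp: "std mu ==> lk mu v ~= 0 ==> std (mu + sg v 1)"
begin

definition stdp :: "('x, 'r::comm_ring_1) pol => bool"
 where "(stdp f) = (ALL mu. lk f mu ~= 0 --> std mu)"

lemma stdp_rs [simp]: "stdp (rs std f)"
 by (simp add: stdp_def lk_rs)

lemma stdp_add: "stdp f ==> stdp g ==> stdp (f + g)" and stdp_minus: "stdp f ==> stdp g ==> stdp (f - g)"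
 unfolding stdp_def by (metis lk_add add_0) (metis lk_minus diff_self)

lemma stdp_Const: "stdp f ==> stdp (Const a * f)"
 unfolding stdp_def lk_Const by (metis mult_zero_right)

lemma stdp_0 [simp]: "stdp 0"
 by (simp add: stdp_def)

lemma stdp_sum: "(!!a. a:A ==> stdp (f a)) ==> stdp (sum f A)"
 by (induction A rule: infinite_finite_induct) (simp_all add: stdp_add)

lemma stdp_hcomp: "stdp f ==> stdp (hcomp d f)"
 by (simp add: stdp_def lk_hcomp)

lemma std_cone_power: "(std (mu + sg x0 k)) = std mu"
proof (induction k)
 case (Suc k)
 have "mu + sg x0 (Suc k) = (mu + sg x0 k) + sg x0 1" by (simp add: add.assoc flip: single_add)
 thus ?case using Suc std_cone by metis
qed simp

lemma stdp_cone: "stdp f ==> stdp (Var x0 ^ k * f)"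
 unfolding stdp_def Var_power
proof (intro allI impI)
 fix mu assume f: "ALL mu. lk f mu ~= 0 --> std mu" and mu: "lk (mon (sg x0 k) * f) mu ~= 0"
 obtain nu where nu: "mu = sg x0 k + nu" using mu lk_mon_mult_0 by blast
 hence "std nu" using f mu by (simp add: lk_mon_mult)
 thus "std mu" using std_cone_power[of nu k] nu by (simp add: add.commute)
qed

end

text \<open>A family over the thickening R/c of the point \<open>m\<close> whose fibre there is the
  given monomial ideal, at least in degrees from \<open>d0\<close> on: \<open>onto\<close> and
  \<open>into\<close> describe that fibre, \<open>tor\<close> is flatness in large degrees. The goal
  is control of the saturation in all degrees.\<close>

locale cone_family = std_monomials std x0 for std :: "('n::finite) mon => bool" and x0 :: 'n +
 fixes X :: "('n, 'r::comm_ring_1) pol set" and m c :: "'r set" and J d0 :: nat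
 assumes X: "hideal X" and cX: "cI c <= X" and m: "idl m" and c: "idl c" and cm: "c <= m"
  and nilp: "ipow m J <= c"
  and tor: "d >= d0 ==> F:hpart X d ==> F:cI m ==> F:isum (pro m X) (cI c)"
  and onto: "~ std mu ==> mdeg mu >= d0 ==> EX f:hpart X (mdeg mu). f - mon mu:cI m"
  and into: "f:X ==> std mu ==> lk f mu:m"
begin

lemma XI: "idl X"
 using X by (simp add: homogeneous_ideal_def)

lemma zero_cI: "(0 :: ('n, 'r) pol):cI m"
 by (rule izero[OF icI[OF m]])

text \<open>Only powers of \<open>x0\<close> are divided out: this is the variable by which standard
  monomials can be shifted freely.\<close>

definition sat :: "('n, 'r) pol set"
 where "sat = {f. EX e. Var x0 ^ e * f:X}"

lemma sat_ideal: "idl sat"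
proof (rule idealI)
 show "0:sat" by (simp add: sat_def izero[OF XI])
next
 fix f g assume "f:sat" "g:sat"
 then obtain a b where ab: "Var x0 ^ a * f:X" "Var x0 ^ b * g:X" unfolding sat_def by blast
 have "Var x0 ^ b * (Var x0 ^ a * f) + Var x0 ^ a * (Var x0 ^ b * g):X"
  using ab by (intro iadd[OF XI]) (rule iscale[OF XI], assumption)+
 hence "Var x0 ^ (a + b) * (f + g):X" by (simp add: power_add alg)
 thus "f + g:sat" unfolding sat_def by blast
next
 fix h f assume "f:sat"
 then obtain a where "Var x0 ^ a * f:X" unfolding sat_def by blast
 hence "h * (Var x0 ^ a * f):X" by (rule iscale[OF XI])
 hence "Var x0 ^ a * (h * f):X" by (simp add: mult.left_commute)
 thus "h * f:sat" unfolding sat_def by blast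
qed

lemma X_sat: "X <= sat"
 unfolding sat_def by (auto intro: exI[of _ 0])

lemma sat_hcomp: "f:sat ==> hcomp d f:sat"
proof -
 assume "f:sat"
 then obtain a where "Var x0 ^ a * f:X" unfolding sat_def by blast
 hence "hcomp (a + d) (Var x0 ^ a * f):X" by (rule hom_ideal_hcomp[OF X])
 hence "Var x0 ^ a * hcomp d f:X" using hcomp_mon_mult[of "sg x0 a" d f] by (simp add: Var_power)
 thus ?thesis unfolding sat_def by blast
qed

lemma sat_cancel: "Var x0 * f:sat ==> f:sat"
proof -
 assume "Var x0 * f:sat"
 then obtain e where "Var x0 ^ e * (Var x0 * f):X" unfolding sat_def by blast
 hence "Var x0 ^ Suc e * f:X" by (simp add: mult.assoc mult.left_commute)
 thus ?thesis unfolding sat_def by blast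
qed

text \<open>Induction over the powers of \<open>m\<close>. A standard \<open>g\<close> in X has
  coefficients in \<open>m\<close>, hence lies in mX + c by \<open>tor\<close>; every element of X
  splits into lifts of nonstandard monomials and a standard part already known to lie in c + m^j, so
  the factor from \<open>m\<close> gains one power for \<open>g\<close>.\<close>

lemma std_high:
 assumes d: "d >= d0" and g: "g:hpart X d" "stdp g" shows "g:cI c"
proof -
 have "ALL mu. EX f. ~ std mu & mdeg mu = d --> f:hpart X d & f - mon mu:cI m" using onto d by blast
 from choice[OF this] obtain z where z: "!!mu. ~ std mu ==> mdeg mu = d ==> z mu:hpart X d & z mu - mon mu:cI m"
  by blast
 define ze where "ze mu = (if ~ std mu & mdeg mu = d then z mu else mon mu)" for mu
 have ze: "ze mu - mon mu:cI m" for mu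
  using z[of mu] zero_cI by (cases "std mu | mdeg mu ~= d") (auto simp: ze_def)
 have zeh: "hom (mdeg mu) (ze mu)" for mu
  using z[of mu] by (auto simp: ze_def hpart_def hom_mon)
 have Zstd: "Zop ze s = s" if "stdp s" for s using that by (intro Zop_id) (simp add: stdp_def ze_def)
 let ?A = "%j. isum c (ipow m j)"
 have A: "idl (?A j)" for j by (intro isum_ideal c ipow_ideal)
 have "ALL g. g:hpart X d & stdp g --> g:cI (?A j)" for j
 proof (induction j)
  case 0
  have "x:isum c UNIV" for x using isumI[of 0 c x UNIV] izero[OF c] by simp
  thus ?case by (simp add: cI_iff)
 next
  case (Suc j)
  have split: "EX H s. (ALL mu. lk H mu ~= 0 --> ~ std mu) & stdp s & s:cI (?A j) & x - Zop ze H - s:cI c"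
   if x: "x:hpart X d" for x
  proof -
   have "x:cI UNIV" by (simp add: cI_iff)
   then obtain H where H: "x - Zop ze H:cI (ipow m J)" "hom d H"
    using Zop_surj[OF m _ ze zeh, of UNIV x J] x by (auto simp: hpart_def)
   define H1 where "H1 = rs (%mu. ~ std mu) H"
   define s where "s = rs std H"
   have HH: "Zop ze H = Zop ze H1 + s"
    using Zop_add[of ze "rs std H" "rs (%mu. ~ std mu) H"] rs_split[of H std] Zstd[of s] by (simp add: H1_def s_def)
   have cc: "x - Zop ze H:cI c" using H(1) cI_mono[OF nilp] by blast
   have "Zop ze H1:X"
    using z H(2) by (intro Zop_mem[OF XI]) (auto simp: H1_def lk_rs ze_def hom_iff hpart_def split: if_splits)
   moreover have "x:X" using x by (simp add: hpart_def)
   ultimately have "x - Zop ze H1 - (x - Zop ze H):X" by (intro iminus[OF XI] subsetD[OF cX cc])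
   hence "s:hpart X d" using rs_hom[OF H(2)] by (simp add: HH hpart_def s_def)
   hence "s:cI (?A j)" using Suc by (simp add: s_def)
   thus ?thesis using cc by (intro exI[of _ H1] exI[of _ s]) (auto simp: HH H1_def s_def lk_rs diff_diff_eq)
  qed
  show ?case
  proof (intro allI impI, elim conjE)
   fix g assume g: "g:hpart X d" "stdp g"
   have "g:cI m" using g into by (auto simp: cI_iff stdp_def hpart_def) (metis izero[OF m])
   hence "g:isum (pro m X) (cI c)" by (rule tor[OF d g(1)])
   then obtain a b where ab: "a:pro m X" "b:cI c" "g = a + b" unfolding isum_def by blast
   have "g = hcomp d g" using g hcomp_hom[of d g d] by (simp add: hpart_def)
   hence gd: "g = hcomp d a + hcomp d b" by (simp add: ab(3) hcomp_add)
   have "EX H s. (ALL mu. lk H mu ~= 0 --> ~ std mu) & stdp s & s:cI (?A (Suc j)) & hcomp d a - Zop ze H - s:cI c"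
    using pro_hcomp[OF X ab(1), of d]
   proof (induction rule: sm.span_induct_alt)
    case base
    show ?case by (intro exI[of _ 0]) (simp add: izero[OF icI[OF A]] izero[OF icI[OF c]] del: ipow.simps)
   next
    case (step r x y)
    then obtain H s where Hs: "ALL mu. lk H mu ~= 0 --> ~ std mu" "stdp s" "s:cI (?A (Suc j))" "y - Zop ze H - s:cI c" by blast
    obtain u xi where u: "x = smul u xi" "u:m" "xi:hpart X d" using step(1) by blast
    obtain H' s' where Hs': "ALL mu. lk H' mu ~= 0 --> ~ std mu" "stdp s'" "s':cI (?A j)" "xi - Zop ze H' - s':cI c"
    using split[OF u(3)] by blast
    have "Const u * s':cI (?A (Suc j))"
    using isum_ipow_mult[OF c _ u(2)] by (intro Const_mult_cI[OF A _ Hs'(3)]) (simp add: mult.commute del: ipow.simps)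
    from iadd[OF icI[OF A] iscale[OF icI[OF A] this, of "Const r"] Hs(3)]
    have "Const (r * u) * s' + s:cI (?A (Suc j))" unfolding Const_mult mult.assoc .
    moreover have "stdp (Const (r * u) * s' + s)" by (intro stdp_add stdp_Const Hs Hs')
    moreover have "ALL mu. lk (Const (r * u) * H' + H) mu ~= 0 --> ~ std mu"
    using Hs(1) Hs'(1) unfolding lk_add lk_Const by (metis add_0 mult_zero_right)
    moreover have "Const (r * u) * (xi - Zop ze H' - s') + (y - Zop ze H - s):cI c"
    by (intro iadd[OF icI[OF c]] iscale[OF icI[OF c]] Hs Hs')
    hence "smul r x + y - Zop ze (Const (r * u) * H' + H) - (Const (r * u) * s' + s):cI c"
    by (simp only: u(1) smul_Const Zop_add Zop_Const) (simp add: Const_mult alg)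
    ultimately show ?case by blast
   qed
   then obtain H s where Hs: "ALL mu. lk H mu ~= 0 --> ~ std mu" "stdp s" "s:cI (?A (Suc j))" "hcomp d a - Zop ze H - s:cI c" by blast
   have "(hcomp d a - Zop ze H - s) + hcomp d b:cI c"
    by (intro iadd[OF icI[OF c]] Hs hcomp_cI c ab)
   hence "(g - s) - Zop ze H:cI c" by (simp add: gd alg)
   moreover have "Zop ze (g - s) = g - s" by (intro Zstd stdp_minus g Hs)
   ultimately have "Zop ze ((g - s) - H):cI c" by (simp add: Zop_minus)
   hence "(g - s) - H:cI c" by (rule Zop_inj[OF c nilp ze])
   hence "rs std ((g - s) - H):cI c" by (rule rs_cI[OF c])
   moreover have "rs std ((g - s) - H) = g - s"
   proof (rule pm_eqI)
    fix mu show "lk (rs std ((g - s) - H)) mu = lk (g - s) mu"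
    using Hs(1) stdp_minus[OF g(2) Hs(2)] by (auto simp: lk_rs stdp_def lk_minus)
   qed
   ultimately have "g - s:cI c" by simp
   hence "g - s:cI (?A (Suc j))" using cI_mono[OF isum_left[OF ipow_ideal, of c m "Suc j"]] by blast
   from iadd[OF icI[OF A] this Hs(3)] show "g:cI (?A (Suc j))" by simp
  qed
 qed
 hence "g:cI (?A J)" using g by blast
 moreover have "?A J <= c" by (rule isum_minimal[OF c]) (use nilp in auto)
 ultimately show ?thesis using cI_mono by blast
qed

text \<open>Multiplication by a power of \<open>x0\<close> moves a form into large degrees without
  changing its standardness or its coefficients.\<close>

lemma std_sat:
 assumes g: "g:sat" "stdp g" shows "g:cI c"
proof -
 have "hcomp d g:cI c" for d
 proof -
  obtain e where "Var x0 ^ e * hcomp d g:X" using sat_hcomp[OF g(1)] unfolding sat_def by blast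
  hence "Var x0 ^ d0 * (Var x0 ^ e * hcomp d g):X" by (rule iscale[OF XI])
  hence 1: "Var x0 ^ (d0 + e) * hcomp d g:X" by (simp add: power_add mult.assoc)
  have "hom (d0 + e + d) (Var x0 ^ (d0 + e) * hcomp d g)"
   using hom_mon_mult[OF hom_hcomp, of "sg x0 (d0 + e)" d g] by (simp add: Var_power)
  hence "Var x0 ^ (d0 + e) * hcomp d g:cI c"
   using 1 by (intro std_high[of "d0 + e + d"] stdp_cone stdp_hcomp g) (auto simp: hpart_def)
  thus ?thesis unfolding cI_iff Var_power by (metis lk_mon_mult)
 qed
 hence "(SUM d<=pdeg g. hcomp d g):cI c" by (intro isetsum[OF icI[OF c]])
 thus ?thesis by (simp add: sum_hcomp_pdeg)
qed

text \<open>In degree \<open>d\<close> each nonstandard monomial leads an element of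
  \<open>sat\<close> in reduced form: all other terms are standard with coefficients in
  \<open>m\<close>.\<close>

definition good :: "nat => bool"
 where "(good d) = ((ALL mu. ~ std mu & mdeg mu = d --> (EX f:sat. hom d f & f - mon mu:cI m & stdp (f - mon mu))))"

lemma good_high: "d >= d0 ==> good d"
 unfolding good_def
proof (intro allI impI, elim conjE)
 fix mu assume d: "d >= d0" and mu: "~ std mu" "mdeg mu = d"
 have "ALL mu. EX f. ~ std mu & mdeg mu = d --> f:hpart X d & f - mon mu:cI m" using onto d by blast
 from choice[OF this] obtain z where z: "!!mu. ~ std mu ==> mdeg mu = d ==> z mu:hpart X d & z mu - mon mu:cI m"
  by blast
 define ze where "ze mu = (if ~ std mu & mdeg mu = d then z mu else mon mu)" for mu
 have ze: "ze mu - mon mu:cI m" for mu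
  using z[of mu] zero_cI by (cases "std mu | mdeg mu ~= d") (auto simp: ze_def)
 have zeh: "hom (mdeg mu) (ze mu)" for mu
  using z[of mu] by (auto simp: ze_def hpart_def hom_mon)
 have hm: "hom d (mon mu :: ('n, 'r) pol)" using hom_mon[of mu] mu by simp
 have "(mon mu :: ('n, 'r) pol):cI UNIV" by (simp add: cI_iff)
 then obtain H where H: "mon mu - Zop ze H:cI (ipow m J)" "hom d H"
  using Zop_surj[OF m _ ze zeh, of UNIV "mon mu" J] hm by auto
 have cc: "mon mu - Zop ze H:cI c" using H(1) cI_mono[OF nilp] by blast
 define H1 where "H1 = rs (%mu. ~ std mu) H"
 define s where "s = rs std H"
 have "Zop ze s = s" by (intro Zop_id) (auto simp: s_def ze_def lk_rs split: if_splits)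
 hence HH: "Zop ze H = Zop ze H1 + s"
  using Zop_add[of ze "rs std H" "rs (%mu. ~ std mu) H"] rs_split[of H std] by (simp add: H1_def s_def)
 have "Zop ze H1:X"
  using z H(2) by (intro Zop_mem[OF XI]) (auto simp: H1_def lk_rs ze_def hom_iff hpart_def split: if_splits)
 hence "Zop ze H1 + (mon mu - Zop ze H):X" using cc cX by (intro iadd[OF XI]) auto
 hence "mon mu - s:sat" using X_sat by (auto simp: HH)
 moreover have "s:cI m"
 proof -
  have "Zop ze H - H:cI m" by (rule Zop_diff_cI[OF m _ ze, of UNIV]) (auto simp: cI_iff intro: iscale[OF m])
  hence "(mon mu - Zop ze H) + (Zop ze H - H):cI m" using cc cI_mono[OF cm] by (intro iadd[OF icI[OF m]]) auto
  hence "rs std (mon mu - H):cI m" by (intro rs_cI[OF m]) simp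
  moreover have "rs std (mon mu - H) = - s"
   by (rule pm_eqI) (use mu(1) in "auto simp: s_def lk_rs lk_minus lk_mon")
  ultimately show ?thesis using ineg[OF icI[OF m], of "- s"] by simp
 qed
 moreover have "hom d (mon mu - s)" unfolding s_def by (intro hom_minus hm rs_hom H)
 moreover have "stdp (- s)" using stdp_minus[of 0 s] by (simp add: s_def)
 ultimately show "EX f:sat. hom d f & f - mon mu:cI m & stdp (f - mon mu)"
  by (intro bexI[of _ "mon mu - s"]) (simp_all add: ineg[OF icI[OF m]])
qed

text \<open>Descending induction on the degree. For a nonstandard mu the element with leading term
  x0 mu has to be divided by \<open>x0\<close>; the obstacle is the part \<open>r\<close> of its
  tail that is free of \<open>x0\<close>. Comparison with the element for x_v mu, where x_v occurs
  in a given monomial of \<open>r\<close>, shows that \<open>r\<close> lies in c + m^j for every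
  j.\<close>

lemma good_all: "good d"
proof (induction "d0 - d" arbitrary: d rule: less_induct)
 case less
 show ?case
 proof (cases "d >= d0")
  case True thus ?thesis by (rule good_high)
 next
  case False
  have up: "good e" if "e > d" for e using less[of e] False that good_high by (cases "e >= d0") auto
  have "ALL mu. EX f. ~ std mu & mdeg mu > d --> f:sat & hom (mdeg mu) f & f - mon mu:cI m & stdp (f - mon mu)"
   using up unfolding good_def by blast
  hence "EX z. ALL mu. ~ std mu & mdeg mu > d -->
    z mu:sat & hom (mdeg mu) (z mu) & z mu - mon mu:cI m & stdp (z mu - mon mu)"
   by (rule choice)
  then obtain z where z0: "ALL mu. ~ std mu & mdeg mu > d -->
    z mu:sat & hom (mdeg mu) (z mu) & z mu - mon mu:cI m & stdp (z mu - mon mu)" ..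
  have z: "z mu:sat & hom (mdeg mu) (z mu) & z mu - mon mu:cI m & stdp (z mu - mon mu)"
   if "~ std mu" "mdeg mu > d" for mu using z0 that by simp
  \<comment> \<open>Normal form modulo \<open>sat\<close> for forms of degree above
    \<open>d\<close>: a nonstandard monomial is replaced by minus the tail of its reduced
    element.\<close>
  define et where "et mu = (if ~ std mu & mdeg mu > d then mon mu - z mu else if std mu then mon mu else 0)" for mu
  have etstd: "stdp (Zop et F)" for F
  proof -
   have "stdp (et mu)" for mu
   proof (cases "~ std mu & mdeg mu > d")
    case True
    hence "stdp (z mu - mon mu)" using z by blast
    from stdp_minus[OF stdp_0 this] have "stdp (0 - (z mu - mon mu))" .
    thus ?thesis using True by (simp add: et_def)
   next
    case False
    thus ?thesis by (auto simp: et_def stdp_def lk_mon)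
   qed
   thus ?thesis unfolding Zop_def by (intro stdp_sum stdp_Const)
  qed
  have etsat: "F - Zop et F:sat" if "hom e F" "e > d" for F e
  proof -
   have "(SUM mu:ks F. Const (lk F mu) * (mon mu - et mu)):sat"
   proof (intro isetsum[OF sat_ideal] iscale[OF sat_ideal])
    fix mu assume "mu:ks F"
    hence "mdeg mu > d" using that by (auto simp: hom_iff keysI)
    thus "mon mu - et mu:sat" using z[of mu] izero[OF sat_ideal] by (auto simp: et_def)
   qed
   moreover have "(SUM mu:ks F. Const (lk F mu) * (mon mu - et mu)) = F - Zop et F"
    using sum_sg[of F] by (simp add: Zop_def right_diff_distrib sum_subtractf sg_eq)
   ultimately show ?thesis by simp
  qed
  show ?thesis
   unfolding good_def
  proof (intro allI impI, elim conjE)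
   fix mu assume mu: "~ std mu" "mdeg mu = d"
   have muv: "~ std (mu + sg v 1)" "mdeg (mu + sg v 1) = Suc d" for v using nonstd_add[OF mu(1)] mu(2) by auto
   define h where "h v = mon (mu + sg v 1) - z (mu + sg v 1)" for v
   have hz: "z (mu + sg v 1):sat" "hom (Suc d) (z (mu + sg v 1))" "stdp (h v)" "h v:cI m"
    "hom (Suc d) (h v)" for v
   proof -
    have zz: "z (mu + sg v 1):sat & hom (mdeg (mu + sg v 1)) (z (mu + sg v 1)) &
    z (mu + sg v 1) - mon (mu + sg v 1):cI m & stdp (z (mu + sg v 1) - mon (mu + sg v 1))"
    by (rule z[OF muv(1)]) (simp only: muv(2))
    thus "z (mu + sg v 1):sat" "hom (Suc d) (z (mu + sg v 1))" using muv(2)[of v] by simp_all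
    have neg: "h v = 0 - (z (mu + sg v 1) - mon (mu + sg v 1))" by (simp add: h_def)
    show "stdp (h v)" unfolding neg using stdp_minus[OF stdp_0, of "z (mu + sg v 1) - mon (mu + sg v 1)"] zz by blast
    show "h v:cI m" unfolding neg
    using zz zero_cI iminus[OF icI[OF m], of 0 "z (mu + sg v 1) - mon (mu + sg v 1)"] by blast
    show "hom (Suc d) (h v)" unfolding h_def
    using zz hom_mon[of "mu + sg v 1"] muv(2)[of v] by (intro hom_minus) auto
   qed
   \<comment> \<open>The tail is split as \<open>h x0\<close> = x0 g + r; once \<open>r\<close> is
     known to lie in \<open>c\<close>, the element mon mu - g is the one sought.\<close>
   define r where "r = rs (%nu. lk nu x0 = 0) (h x0)"
   define g where "g = (SUM nu:{nu:ks (h x0). lk nu x0 ~= 0}. sg (nu - sg x0 1) (lk (h x0) nu))"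
   have gsplit: "h x0 = Var x0 * g + r"
   proof -
    have "Var x0 * g = (SUM nu:{nu:ks (h x0). lk nu x0 ~= 0}. sg nu (lk (h x0) nu))"
    unfolding g_def sum_distrib_left
    proof (rule sum.cong)
    fix nu assume "nu:{nu:ks (h x0). lk nu x0 ~= 0}"
    hence "sg x0 1 + (nu - sg x0 1) = nu"
    by (intro pm_eqI) (auto simp: lk_add lk_minus lk_sg)
    thus "Var x0 * sg (nu - sg x0 1) (lk (h x0) nu) = sg nu (lk (h x0) nu)"
    by (simp add: Var_def mult_single)
    qed simp
    hence "Var x0 * g = rs (%nu. ~ lk nu x0 = 0) (h x0)" by (simp add: rs_def)
    thus ?thesis using rs_split[of "h x0" "%nu. lk nu x0 = 0"] by (simp add: r_def add.commute)
   qed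
   have lg: "lk g nu = lk (h x0) (sg x0 1 + nu)" for nu
   proof -
    have "lk (h x0) (sg x0 1 + nu) = lk g nu + lk r (sg x0 1 + nu)"
    using gsplit lk_mon_mult[of "sg x0 1" g nu] by (simp add: lk_add Var_mon)
    thus ?thesis by (simp add: r_def lk_rs lk_add)
   qed
   have gs: "stdp g" "g:cI m" "hom d g"
   proof -
    show "stdp g" using hz(3)[of x0] std_cone by (auto simp: stdp_def lg add.commute)
    show "g:cI m" using hz(4)[of x0] by (simp add: cI_iff lg)
    show "hom d g" using hz(5)[of x0] unfolding hom_iff lg
    by (metis add_Suc_right add.commute mdeg_add mdeg_single nat.inject One_nat_def add_0 add_Suc)
   qed
   let ?A = "%j. isum c (ipow m j)"
   have A: "idl (?A j)" for j by (intro isum_ideal c ipow_ideal)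
   have "r:cI (?A j)" for j
   proof (induction j)
    case 0
    have "x:isum c UNIV" for x using isumI[of 0 c x UNIV] izero[OF c] by simp
    thus ?case by (simp add: cI_iff)
   next
    case (Suc j)
    have "lk r nu:?A (Suc j)" for nu
    proof (cases "lk r nu = 0")
    case True thus ?thesis using izero[OF A[of "Suc j"]] by (simp only:)
    next
    case False
    hence nu: "lk nu x0 = 0" "lk (h x0) nu ~= 0" by (auto simp: r_def lk_rs split: if_splits)
    hence "mdeg nu = Suc d" "std nu" using hz(3,5)[of x0] by (auto simp: hom_iff stdp_def)
    hence "nu ~= 0" by auto
    then obtain v where v: "lk nu v ~= 0" by (metis lookup_zero pm_eqI)
    hence vx: "v ~= x0" using nu by auto
    define P where "P = h v - Var v * g"
    define N1 where "N1 = Zop et P"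
    have hVg: "hom (Suc d) (Var v * g)"
    using hom_mon_mult[OF gs(3), of "sg v 1"] by (simp add: Var_mon)
    have P: "hom (Suc d) P" unfolding P_def by (intro hom_minus hz hVg)
    have N1: "stdp N1" "P - N1:sat" unfolding N1_def using etstd etsat[OF P] by auto
    define s1 where "s1 = rs std (Var v * r)"
    define s2 where "s2 = rs (%mu. ~ std mu) (Var v * r)"
    have rh: "hom (Suc d) r" unfolding r_def by (intro rs_hom hz)
    have vr: "hom (Suc (Suc d)) (Var v * r)"
    using hom_mon_mult[OF rh, of "sg v 1"] by (simp add: Var_mon)
    have s12: "Var v * r = s1 + s2" unfolding s1_def s2_def by (rule rs_split)
    have s2h: "hom (Suc (Suc d)) s2" unfolding s2_def by (intro rs_hom vr)
    define N2 where "N2 = Zop et s2"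
    have N2: "stdp N2" "s2 - N2:sat" unfolding N2_def using etstd etsat[OF s2h] by auto
    have "Var v * r:cI (?A j)" using Suc by (intro iscale[OF icI[OF A]])
    hence s2A: "s2:cI (?A j)" unfolding s2_def by (rule rs_cI[OF A])
    have N2A: "N2:cI (?A (Suc j))"
    unfolding N2_def Zop_def
    proof (rule isetsum[OF icI[OF A]])
    fix mu assume mu2: "mu:ks s2"
    hence "~ std mu" by (auto simp: s2_def keysI lk_rs split: if_splits)
    moreover have "mdeg mu > d" using mu2 s2h by (auto simp: hom_iff keysI)
    ultimately have "mon mu - z mu:cI m" "et mu = mon mu - z mu"
    using z[of mu] ineg[OF icI[OF m], of "z mu - mon mu"] by (auto simp: et_def)
    thus "Const (lk s2 mu) * et mu:cI (?A (Suc j))"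
    using s2A isum_ipow_mult[OF c] by (intro Const_mult_cI[OF A, of m]) (auto simp: cI_iff simp del: ipow.simps)
    qed
    \<comment> \<open>Both products have the leading term x0 x_v mu, so the tails satisfy x0 h_v -
      x_v h_x0 in \<open>sat\<close>. Its normal form is standard, hence zero modulo
      \<open>c\<close> by \<open>std_sat\<close>.\<close>
    have "Var v * z (mu + sg x0 1) - Var x0 * z (mu + sg v 1):sat"
    by (intro iminus[OF sat_ideal] iscale[OF sat_ideal] hz)
    moreover have "Var v * z (mu + sg x0 1) - Var x0 * z (mu + sg v 1) = Var x0 * h v - Var v * h x0"
    proof -
    have zh: "z (mu + sg w 1) = mon mu * Var w - h w" for w by (simp add: h_def mon_add Var_mon)
    show ?thesis unfolding zh by (simp add: alg)
    qed
    ultimately have "Var x0 * h v - Var v * h x0:sat" by simp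
    hence 1: "Var x0 * P - Var v * r:sat" by (simp add: gsplit P_def alg)
    have "(Var x0 * (P - N1) - (Var x0 * P - Var v * r)) - (s2 - N2):sat"
    by (intro iminus[OF sat_ideal] iscale[OF sat_ideal] N1 N2 1)
    moreover have "(Var x0 * (P - N1) - (Var x0 * P - Var v * r)) - (s2 - N2) = s1 + N2 - Var x0 * N1"
    unfolding s12 by (simp add: alg)
    ultimately have "s1 + N2 - Var x0 * N1:sat" by simp
    moreover have "stdp (s1 + N2 - Var x0 * N1)"
    using stdp_cone[OF N1(1), of 1] by (intro stdp_minus stdp_add N2) (auto simp: s1_def)
    ultimately have "s1 + N2 - Var x0 * N1:cI c" by (rule std_sat)
    hence cc: "lk (s1 + N2 - Var x0 * N1) (sg v 1 + nu):c" by (simp add: cI_iff)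
    \<comment> \<open>At x_v nu the product x0 N1 has no coefficient, as nu does not contain
      \<open>x0\<close>. By squarefreeness x_v nu is standard, so there \<open>s1\<close> shows the
      coefficient of \<open>r\<close> at nu, and only \<open>N2\<close>, already one power deeper,
      interferes.\<close>
    have "lk (Var x0 * N1) (sg v 1 + nu) = 0"
    proof -
    have "\<nexists>ka. sg v 1 + nu = sg x0 1 + ka"
    proof
    assume "EX ka. sg v 1 + nu = sg x0 1 + ka"
    then obtain ka where "sg v 1 + nu = sg x0 1 + ka" by blast
    hence "lk (sg v 1 + nu) x0 = lk (sg x0 1 + ka) x0" by simp
    thus False using nu(1) vx by (simp add: lk_add lk_sg)
    qed
    thus ?thesis unfolding Var_mon by (rule lk_mon_mult_0)
    qed
    moreover have "lk s1 (sg v 1 + nu) = lk r nu"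
    using std_supp[OF \<open>std nu\<close> v] lk_mon_mult[of "sg v 1" r nu] by (simp add: s1_def lk_rs Var_mon add.commute)
    ultimately have "lk r nu + lk N2 (sg v 1 + nu):c" using cc by (simp add: lk_add lk_minus)
    hence "lk r nu + lk N2 (sg v 1 + nu):?A (Suc j)" using isum_left[OF ipow_ideal, of c m "Suc j"] by blast
    moreover have "lk N2 (sg v 1 + nu):?A (Suc j)" using N2A unfolding cI_iff by blast
    ultimately have "lk r nu + lk N2 (sg v 1 + nu) - lk N2 (sg v 1 + nu):?A (Suc j)" by (intro iminus[OF A])
    thus ?thesis by (simp del: ipow.simps)
    qed
    thus ?case unfolding cI_iff by blast
   qed
   hence "r:cI (?A J)" .
   moreover have "?A J <= c" by (rule isum_minimal[OF c]) (use nilp in auto)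
   ultimately have "r:cI c" using cI_mono by blast
   hence "r:sat" using cX X_sat by blast
   hence "z (mu + sg x0 1) + r:sat" using hz(1)[of x0] by (intro iadd[OF sat_ideal])
   moreover have "z (mu + sg x0 1) + r = Var x0 * (mon mu - g)"
   proof -
    have "z (mu + sg x0 1) = mon mu * Var x0 - h x0" by (simp add: h_def mon_add Var_mon)
    thus ?thesis unfolding gsplit by (simp add: alg)
   qed
   ultimately have "Var x0 * (mon mu - g):sat" by simp
   hence "mon mu - g:sat" by (rule sat_cancel)
   moreover have "hom d (mon mu - g)" using hom_mon[of mu] mu(2) gs(3) by (intro hom_minus) auto
   moreover have "stdp (- g)" using stdp_minus[of 0 g] gs by simp
   ultimately show "EX f:sat. hom d f & f - mon mu:cI m & stdp (f - mon mu)"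
    using gs by (intro bexI[of _ "mon mu - g"]) (simp_all add: ineg[OF icI[OF m]])
  qed
 qed
qed

end

text \<open>Modulo \<open>c'\<close> the finite set \<open>D\<close> spans a finite-dimensional
  complex space. \<open>E\<close> is a basis of it chosen inside \<open>D\<close>, and the
  \<open>ph e\<close> are its coordinates, extended to all of R and zero on \<open>c'\<close>. They
  break an obstruction over R into finitely many over C.\<close>

lemma separating_functionals:
 fixes io :: "complex => 'r::comm_ring_1"
 assumes io: "rhom io" and c': "idl c'" and D: "finite D"
 shows "EX E ph. finite E & E <= D & (ALL e:E. (ALL x y. ph e (x + y) = ph e x + ph e y) &
   (ALL z x. ph e (io z * x) = z * (ph e x :: complex)) & (ALL x:c'. ph e x = 0)) &
  (ALL d:D. d - (SUM e:E. io (ph e d) * e):c')"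
proof -
 interpret io: rhom io by (rule io)
 interpret V: vector_space "%z x. io z * x"
  by unfold_locales (simp_all add: io.hom_simps alg)
 \<comment> \<open>Nested bases of c', of the span of c' and D, and of R; the coordinate functions
   of the last restrict to those of the others.\<close>
 obtain B1 where B1: "B1 <= c'" "V.independent B1" "c' <= V.span B1"
  using V.maximal_independent_subset[of c'] by blast
 obtain B2 where B2: "B1 <= B2" "B2 <= c' Un D" "V.independent B2" "c' Un D <= V.span B2"
  by (rule V.maximal_independent_subset_extend[of B1 "c' Un D"]) (use B1 in auto)
 obtain B3 where B3: "B2 <= B3" "V.independent B3" "UNIV <= V.span B3"
  by (rule V.maximal_independent_subset_extend[of B2 UNIV]) (use B2 in auto)
 define R where "R = V.representation B3"
 define E where "E = B2 - B1"
 have sp: "x:V.span B3" for x using B3(3) by blast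
 have ED: "E <= D"
 proof
  fix e assume e: "e:E"
  have "e ~: c'"
  proof
   assume "e:c'"
   hence "e:V.span (B2 - {e})" using B1(3) V.span_mono[of B1 "B2 - {e}"] B2(1) e by (auto simp: E_def)
   thus False using B2(3) e unfolding V.dependent_def E_def by blast
  qed
  thus "e:D" using e B2(2) by (auto simp: E_def)
 qed
 have add: "R (x + y) e = R x e + R y e" for x y e
  using V.representation_add[OF B3(2) sp sp] by (simp add: R_def)
 have scale: "R (io z * x) e = z * R x e" for z x e
  using V.representation_scale[OF B3(2) sp] by (simp add: R_def)
 have van: "R x e = 0" if "x:c'" "e:E" for x e
 proof -
  have "R x = V.representation B1 x" unfolding R_def
   by (rule V.representation_extend[OF B3(2)]) (use that B1 B2 B3 in auto)
  thus ?thesis using V.representation_ne_zero[of B1 x e] that by (auto simp: E_def)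
 qed
 have rep: "d - (SUM e:E. io (R d e) * e):c'" if "d:D" for d
 proof -
  let ?N = "{b. R d b ~= 0}"
  have eq: "R d = V.representation B2 d" unfolding R_def
   by (rule V.representation_extend[OF B3(2)]) (use that B2 B3 in auto)
  have N: "?N <= B2" using V.representation_ne_zero[of B2 d] by (auto simp: eq)
  have fin: "finite ?N" unfolding R_def by (rule V.finite_representation)
  have finE: "finite E" using ED D finite_subset by blast
  have "d = (SUM b:?N. io (R d b) * b)"
   using V.sum_nonzero_representation_eq[OF B3(2) sp, of d] by (simp add: R_def)
  also have "... = (SUM b:?N Un E. io (R d b) * b)"
   by (rule sum.mono_neutral_left) (use fin finE in "auto simp: io.zero")
  also have "... = (SUM b:E. io (R d b) * b) + (SUM b:(?N Un E) - E. io (R d b) * b)"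
   by (subst sum.subset_diff[of E]) (use fin finE in "auto simp: add.commute")
  finally have "d - (SUM e:E. io (R d e) * e) = (SUM b:(?N Un E) - E. io (R d b) * b)" by (simp add: alg)
  also have "...:c'"
   using N B1(1) by (intro isetsum[OF c'] iscale[OF c']) (auto simp: E_def)
  finally show ?thesis .
 qed
 show ?thesis
  by (rule exI[of _ E], rule exI[of _ "%e x. R x e"])
   (use ED D finite_subset add scale van rep in "auto intro: finite_subset")
qed

section \<open>Lifts of monomial generators and of the relations between them\<close>

locale monomial_gens = std_monomials std x0 for std :: "'x mon => bool" and x0 :: 'x +
 fixes Gs :: "'x mon set"
 assumes finite_Gs: "finite Gs" and gens: "(~ std mu) = (EX g:Gs. EX ka. mu = ka + g)"
begin

definition comb :: "('x mon => ('x, 'r::comm_ring_1) pol) => ('x mon => ('x, 'r) pol) => ('x, 'r) pol"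
 where "comb h th = (SUM g:Gs. h g * th g)"

definition base :: "'x mon => 'x mon"
 where "base mu = (SOME g. g:Gs & (EX ka. mu = ka + g))"

text \<open>Nonstandard monomials are lifted through a chosen generator dividing them;
  \<open>Zop (lifted th)\<close> then carries the monomial ideal into the one generated by
  \<open>th\<close> and fixes standard polynomials.\<close>

definition lifted :: "('x mon => ('x, 'r::comm_ring_1) pol) => 'x mon => ('x, 'r) pol"
 where "lifted th mu = (if std mu then mon mu else mon (mu - base mu) * th (base mu))"

definition nonstdp :: "('x, 'r::comm_ring_1) pol => bool"
 where "(nonstdp f) = (ALL mu. lk f mu ~= 0 --> ~ std mu)"

lemma base: "~ std mu ==> base mu:Gs & (mu - base mu) + base mu = mu"
proof -
 assume "~ std mu"
 hence "EX g. g:Gs & (EX ka. mu = ka + g)" using gens by blast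
 hence "base mu:Gs & (EX ka. mu = ka + base mu)" unfolding base_def by (rule someI_ex)
 thus ?thesis by (metis add_diff_cancel_right')
qed

lemma nonstd_gen: "g:Gs ==> ~ std (ka + g)"
 using gens by blast

lemma comb_mon_nonstd: "nonstdp (comb h mon)"
 unfolding nonstdp_def
proof (intro allI impI)
 fix mu assume "lk (comb h mon) mu ~= 0"
 then obtain g where g: "g:Gs" "lk (h g * mon g) mu ~= 0"
  unfolding comb_def lk_sum by (meson sum.not_neutral_contains_not_neutral)
 hence "lk (mon g * h g) mu ~= 0" by (simp add: mult.commute)
 then obtain ka where "mu = g + ka" using lk_mon_mult_0 by blast
 thus "~ std mu" using nonstd_gen[OF g(1), of ka] by (simp add: add.commute)
qed

lemma comb_add: "comb (%g. h g + k g) th = comb h th + comb k th"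
 and comb_minus: "comb (%g. h g - k g) th = comb h th - comb k th"
 and comb_mult: "comb (%g. q * h g) th = q * comb h th"
 by (simp_all add: comb_def ring_distribs sum.distrib sum_subtractf sum_distrib_left mult.assoc)

lemma comb_cI: "idl a ==> (!!g. g:Gs ==> h g:cI a) ==> comb h th:cI a"
 unfolding comb_def by (intro isetsum[OF icI] iright[OF icI])

lemma nonstdp_add: "nonstdp f ==> nonstdp g ==> nonstdp (f + g)"
 unfolding nonstdp_def lk_add by (metis add_0)

lemma nonstdp_0 [simp]: "nonstdp 0"
 by (simp add: nonstdp_def)

lemma Zop_lifted_std: "stdp f ==> Zop (lifted th) f = f"
 by (rule Zop_id) (simp add: stdp_def lifted_def)

text \<open>\<open>th\<close> lifts the monomial generators modulo \<open>n\<close>, and the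
  pairwise relations lift modulo \<open>c\<close>: the relation criterion for flatness of the lifted
  ideal over R/c. Pairs are enough because they generate all syzygies of monomials.\<close>

definition first_rels :: "'r::comm_ring_1 set => 'r set => ('x mon => ('x, 'r) pol) => bool"
 where "(first_rels n c th) = ((ALL g:Gs. th g - mon g:cI n & hom (mdeg g) (th g)) &
  (ALL g:Gs. ALL g':Gs. EX h. (ALL e. h e:cI n) & mon (g' - g) * th g - mon (g - g') * th g' - comb h th:cI c))"

text \<open>A common multiple of two generators is a multiple of their least common multiple, so the
  lifted pair relation is merely multiplied by \<open>ka0\<close>.\<close>

lemma first_rels_pair:
 assumes c: "idl c" and n: "idl n" and L: "first_rels n c th" and g: "g:Gs" "g':Gs" "ka + g = ka' + g'"
 shows "EX k. (ALL e. k e:cI n) & mon ka * th g - mon ka' * th g' - comb k th:cI c"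
proof -
 obtain h where h: "!!e. h e:cI n" "mon (g' - g) * th g - mon (g - g') * th g' - comb h th:cI c"
  using L g unfolding first_rels_def by blast
 define ka0 where "ka0 = ka - (g' - g)"
 have *: "lk ka i + lk g i = lk ka' i + lk g' i" for i using g(3) by (metis lk_add)
 have 1: "x = x - (b - a) + (b - a)" "y = x - (b - a) + (a - b)" if "x + a = y + b" for x y a b :: nat
  using that by arith+
 have ka: "ka = ka0 + (g' - g)" "ka' = ka0 + (g - g')"
  unfolding ka0_def by (rule pm_eqI; simp only: lk_add lk_minus; rule 1[OF *])+
 have "mon ka0 * (mon (g' - g) * th g - mon (g - g') * th g' - comb h th):cI c"
  by (rule iscale[OF icI[OF c] h(2)])
 hence "mon ka * th g - mon ka' * th g' - comb (%e. mon ka0 * h e) th:cI c"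
  by (simp add: ka mon_add comb_mult alg)
 moreover have "mon ka0 * h e:cI n" for e by (rule iscale[OF icI[OF n] h(1)])
 ultimately show ?thesis by (intro exI[of _ "%e. mon ka0 * h e"]) simp
qed

text \<open>Each term of a combination is moved to the chosen generator of its monomial by a lifted
  pair relation; what remains is another combination with one more factor from \<open>n\<close>. The
  quantifiers over \<open>a\<close> and \<open>d\<close> sit inside, so that one \<open>h'\<close>
  obeys all coefficient bounds at once.\<close>

lemma comb_step:
 assumes c: "idl c" and n: "idl n" and L: "first_rels n c th"
 shows "EX h'. (ALL a d e. (ALL g:Gs. h g:cI a) & idl d & (ALL x:a. ALL y:n. x * y:d) --> h' e:cI d) &
  (ALL a d. (ALL g:Gs. h g:cI a) & idl d & (ALL x:a. ALL y:c. x * y:d) -->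
   comb h th - Zop (lifted th) (comb h mon) - comb h' th:cI d)"
proof -
 have "EX k. g:Gs --> (ALL e. k e:cI n) & mon ka * th g - lifted th (ka + g) - comb k th:cI c" for g ka
 proof (cases "g:Gs")
  case True
  have ns: "~ std (ka + g)" by (rule nonstd_gen[OF True])
  show ?thesis using first_rels_pair[OF c n L True, of "base (ka + g)" ka "ka + g - base (ka + g)"] base[OF ns] ns
   by (simp add: lifted_def)
 qed simp
 hence "ALL g ka. EX k. g:Gs --> (ALL e. k e:cI n) & mon ka * th g - lifted th (ka + g) - comb k th:cI c" by blast
 hence "EX k. ALL g ka. g:Gs --> (ALL e. k g ka e:cI n) & mon ka * th g - lifted th (ka + g) - comb (k g ka) th:cI c"
  by (simp only: choice_iff)
 then obtain k where k0: "ALL g ka. g:Gs --> (ALL e. k g ka e:cI n) & mon ka * th g - lifted th (ka + g) - comb (k g ka) th:cI c" ..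
 have k: "k g ka e:cI n" "mon ka * th g - lifted th (ka + g) - comb (k g ka) th:cI c" if "g:Gs" for g ka e
  using k0 that by simp_all
 define h' where "h' e = (SUM g:Gs. SUM ka:ks (h g). Const (lk (h g) ka) * k g ka e)" for e
 have hs: "h g = (SUM ka:ks (h g). Const (lk (h g) ka) * mon ka)" for g
  using sum_sg[of "h g"] by (simp add: sg_eq)
 have 1: "comb h th = (SUM g:Gs. SUM ka:ks (h g). Const (lk (h g) ka) * (mon ka * th g))"
  unfolding comb_def by (subst hs) (simp add: sum_distrib_right mult.assoc)
 have "comb h mon = (SUM g:Gs. SUM ka:ks (h g). Const (lk (h g) ka) * mon (ka + g))"
  unfolding comb_def by (subst hs) (simp add: sum_distrib_right mult.assoc mon_add)
 hence 2: "Zop (lifted th) (comb h mon) = (SUM g:Gs. SUM ka:ks (h g). Const (lk (h g) ka) * lifted th (ka + g))"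
  by (simp add: Zop_sum Zop_Const Zop_mon)
 have 3: "comb h' th = (SUM g:Gs. SUM ka:ks (h g). Const (lk (h g) ka) * comb (k g ka) th)"
 proof -
  have "comb h' th = (SUM e:Gs. SUM g:Gs. SUM ka:ks (h g). Const (lk (h g) ka) * k g ka e * th e)"
   by (simp add: comb_def h'_def sum_distrib_right)
  also have "... = (SUM g:Gs. SUM e:Gs. SUM ka:ks (h g). Const (lk (h g) ka) * k g ka e * th e)" by (rule sum.swap)
  also have "... = (SUM g:Gs. SUM ka:ks (h g). SUM e:Gs. Const (lk (h g) ka) * k g ka e * th e)"
   by (intro sum.cong refl sum.swap)
  finally show ?thesis by (simp add: comb_def sum_distrib_left mult.assoc)
 qed
 have 4: "comb h th - Zop (lifted th) (comb h mon) - comb h' th =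
   (SUM g:Gs. SUM ka:ks (h g). Const (lk (h g) ka) * (mon ka * th g - lifted th (ka + g) - comb (k g ka) th))"
  unfolding 1 2 3 by (simp add: right_diff_distrib sum_subtractf)
 have coef: "Const (lk (h g) ka) * y:cI d"
  if "ALL g:Gs. h g:cI a" "idl d" "ALL x:a. ALL z:b. x * z:d" "g:Gs" "y:cI b" for a b d g ka and y
  by (rule Const_mult_cI[OF that(2) _ that(5)]) (use that in "auto simp: cI_iff")
 show ?thesis
 proof (intro exI[of _ h'] conjI allI impI; elim conjE)
  fix a d e assume "ALL g:Gs. h g:cI a" "idl d" "ALL x:a. ALL y:n. x * y:d"
  thus "h' e:cI d" unfolding h'_def
   by (intro isetsum[OF icI] coef[of a _ n] k)
 next
  fix a d assume "ALL g:Gs. h g:cI a" "idl d" "ALL x:a. ALL y:c. x * y:d"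
  thus "comb h th - Zop (lifted th) (comb h mon) - comb h' th:cI d" unfolding 4
   by (intro isetsum[OF icI] coef[of a _ c] k)
 qed
qed

text \<open>\<open>comb_step\<close> is iterated until the remaining coefficients lie in n^J, hence
  in \<open>c'\<close>.\<close>

lemma comb_reduce:
 assumes c: "idl c" and n: "idl n" and L: "first_rels n c th"
  and a: "idl a" and c': "idl c'" and ac: "!!x y. x:a ==> y:c ==> x * y:c'"
  and nil: "ipow n J <= c'" and h: "!!g. g:Gs ==> h g:cI a"
 shows "EX H. H:cI a & nonstdp H & comb h th - Zop (lifted th) H:cI c'"
proof -
 have "EX H h'. H:cI a & nonstdp H & (ALL g:Gs. h' g:cI a) & (ALL g:Gs. h' g:cI (ipow n j)) &
   comb h th - Zop (lifted th) H - comb h' th:cI c'" for j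
 proof (induction j)
  case 0
  show ?case
   by (intro exI[of _ 0] exI[of _ h]) (use h in "simp add: izero[OF a] izero[OF c'] cI_iff")
 next
  case (Suc j)
  then obtain H h1 where H: "H:cI a" "nonstdp H" "!!g. g:Gs ==> h1 g:cI a" "!!g. g:Gs ==> h1 g:cI (ipow n j)"
   "comb h th - Zop (lifted th) H - comb h1 th:cI c'" by blast
  obtain h2 where h2: "!!a d e. (ALL g:Gs. h1 g:cI a) & idl d & (ALL x:a. ALL y:n. x * y:d) --> h2 e:cI d"
   "!!a d. (ALL g:Gs. h1 g:cI a) & idl d & (ALL x:a. ALL y:c. x * y:d) -->
   comb h1 th - Zop (lifted th) (comb h1 mon) - comb h2 th:cI d"
   using comb_step[OF c n L, of h1] by blast
  have "h2 g:cI a" for g using h2(1)[of a a g] H(3) a iright[OF a] by blast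
  moreover have "h2 g:cI (ipow n (Suc j))" for g
  proof -
   have "ALL x:ipow n j. ALL y:n. x * y:ipow n (Suc j)" using ipow_mult[of _ n _ j] by (metis mult.commute)
   thus ?thesis using h2(1)[of "ipow n j" "ipow n (Suc j)" g] H(4) ipow_ideal by blast
  qed
  moreover have "H + comb h1 mon:cI a" using H by (intro iadd[OF icI[OF a]] comb_cI a)
  moreover have "nonstdp (H + comb h1 mon)" by (intro nonstdp_add H comb_mon_nonstd)
  moreover have "(comb h th - Zop (lifted th) H - comb h1 th) + (comb h1 th - Zop (lifted th) (comb h1 mon) - comb h2 th):cI c'"
   using h2(2)[of a c'] H(3,5) ac c' by (intro iadd[OF icI[OF c']]) auto
  hence "comb h th - Zop (lifted th) (H + comb h1 mon) - comb h2 th:cI c'"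
   by (simp add: Zop_add alg)
  ultimately show ?case by blast
 qed
 then obtain H h' where H: "H:cI a" "nonstdp H" "ALL g:Gs. h' g:cI (ipow n J)"
   "comb h th - Zop (lifted th) H - comb h' th:cI c'" by blast
 have "comb h' th:cI c'" using H(3) cI_mono[OF nil] by (intro comb_cI c') auto
 from iadd[OF icI[OF c'] H(4) this] show ?thesis using H(1,2) by (intro exI[of _ H]) simp
qed

lemma lifted_minus_mon:
 assumes n: "idl n" and L: "!!g. g:Gs ==> th g - mon g:cI n"
 shows "lifted th mu - mon mu:cI n"
proof (cases "std mu")
 case True thus ?thesis by (simp add: lifted_def izero[OF icI[OF n]])
next
 case False
 have "mon (mu - base mu) * (th (base mu) - mon (base mu)):cI n"
  using L base[OF False] by (intro iscale[OF icI[OF n]]) blast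
 thus ?thesis using False base[OF False] by (simp add: lifted_def right_diff_distrib flip: mon_add)
qed

text \<open>A combination of the lifted generators is the image of a nonstandard polynomial under
  the unipotent operator, which fixes standard ones; injectivity modulo \<open>c\<close> separates
  the two.\<close>

lemma std_in_comb:
 assumes c: "idl c" and n: "idl n" and L: "first_rels n c th" and nil: "ipow n J <= c"
  and s: "stdp s" "s - comb h th:cI c"
 shows "s:cI c"
proof -
 have "EX H. H:cI UNIV & nonstdp H & comb h th - Zop (lifted th) H:cI c"
  by (rule comb_reduce[OF c n L _ c _ nil]) (auto simp: cI_iff intro: iscale[OF c])
 then obtain H where H: "nonstdp H" "comb h th - Zop (lifted th) H:cI c" by blast
 from iadd[OF icI[OF c] s(2) H(2)] have "s - Zop (lifted th) H:cI c" by simp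
 hence "Zop (lifted th) (s - H):cI c" by (simp add: Zop_minus Zop_lifted_std[OF s(1)])
 hence "s - H:cI c"
  by (rule Zop_inj[OF c nil lifted_minus_mon[OF n], rotated]) (use L in "simp add: first_rels_def")
 hence "rs std (s - H):cI c" by (rule rs_cI[OF c])
 moreover have "rs std (s - H) = s"
  by (rule pm_eqI) (use s(1) H(1) in "auto simp: lk_rs lk_minus stdp_def nonstdp_def")
 ultimately show ?thesis by simp
qed

text \<open>This goes one order beyond what the relations guarantee. The combination comes from a
  nonstandard H, which lies in \<open>c\<close> by injectivity; since n c is in c', the operator is
  the identity on H modulo c'. The obstruction thereby becomes independent of choices.\<close>

lemma comb_std_coeff:
 assumes c: "idl c" and n: "idl n" and L: "first_rels n c th" and c': "idl c'" "c' <= c"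
  and nc: "!!x y. x:n ==> y:c ==> x * y:c'" and nil: "ipow n J <= c'"
  and h: "!!g. g:Gs ==> h g:cI n" and hc: "comb h th:cI c" and mu: "std mu"
 shows "lk (comb h th) mu:c'"
proof -
 obtain H where H: "H:cI n" "nonstdp H" "comb h th - Zop (lifted th) H:cI c'"
  using comb_reduce[OF c n L n c'(1) nc nil, of h] h by blast
 have ze: "lifted th mu - mon mu:cI n" for mu
  using L lifted_minus_mon[OF n] by (auto simp: first_rels_def)
 have "Zop (lifted th) H:cI c" using iminus[OF icI[OF c] hc subsetD[OF cI_mono[OF c'(2)] H(3)]] by simp
 hence "H:cI c" by (rule Zop_inj[OF c subset_trans[OF nil c'(2)] ze])
 hence "Zop (lifted th) H - H:cI c'"
  by (intro Zop_diff_cI[OF c'(1) _ ze, of c]) (use nc in "metis mult.commute")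
 from iadd[OF icI[OF c'(1)] this H(3)] have "comb h th - H:cI c'" by simp
 hence "lk (comb h th) mu - lk H mu:c'" by (simp add: cI_iff lk_minus)
 moreover have "lk H mu = 0" using H(2) mu by (auto simp: nonstdp_def)
 ultimately show ?thesis by simp
qed

end

text \<open>A complex algebra with a rational point: \<open>io\<close> is the structure map,
  \<open>ev\<close> the evaluation at the point, \<open>ker\<close> its maximal ideal.\<close>

locale alg_retract = io: rhom io + ev: rhom ev for io :: "complex => 'r::comm_ring_1" and ev :: "'r => complex" +
 assumes ev_io: "ev (io z) = z"
begin

definition "ker = {x. ev x = 0}"

lemma is_ideal_ker: "idl ker"
 unfolding ker_def by (rule idealI) (simp_all add: ev.hom_simps)

end

context monomial_gens
begin

section \<open>Syzygies of monomials and the obstruction to lifting\<close>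

definition rels :: "('x mon => ('x, complex) pol) set"
 where "rels = {r. comb r mon = 0}"

definition pair_rel :: "'x mon => 'x mon => 'x mon => ('x, complex) pol"
 where "pair_rel g g' e = (if e = g then mon (g' - g) else 0) - (if e = g' then mon (g - g') else 0)"

definition koszul_rel :: "'x mon => 'x mon => 'x mon => ('x, complex) pol"
 where "koszul_rel g g' e = (if e = g' then mon g else 0) - (if e = g then mon g' else 0)"

text \<open>\<open>T\<^sup>2 = 0\<close>, with only the conclusion needed for lifting.\<close>

definition T2_vanishes :: bool
 where "(T2_vanishes) = ((ALL ph. (ALL r:rels. ALL s:rels. nonstdp (ph (%e. r e + s e) - ph r - ph s)) -->
  (ALL q. ALL r:rels. nonstdp (ph (%e. q * r e) - q * ph r)) -->
  (ALL g:Gs. ALL g':Gs. nonstdp (ph (koszul_rel g g'))) -->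
  (EX c. ALL g:Gs. ALL g':Gs. nonstdp (ph (pair_rel g g') - comb (pair_rel g g') c))))"

lemma comb_pair_rel: "g:Gs ==> g':Gs ==> comb (%e. cmap h (pair_rel g g' e)) c = mon (g' - g) * c g - mon (g - g') * c g'"
 if "rhom h" for h :: "complex => 'r::comm_ring_1"
proof -
 interpret rhom h by (rule that)
 assume g: "g:Gs" "g':Gs"
 have "comb (%e. cmap h (pair_rel g g' e)) c = (SUM e:Gs. (if e = g then mon (g' - g) * c e else 0) - (if e = g' then mon (g - g') * c e else 0))"
  unfolding comb_def pair_rel_def
  by (rule sum.cong) (auto simp: cmap_mon rhom.hom_simps[OF rhom_cmap] left_diff_distrib)
 thus ?thesis using g finite_Gs by (simp add: sum_subtractf)
qed

lemma comb_koszul_rel: "g:Gs ==> g':Gs ==> comb (%e. cmap h (koszul_rel g g' e)) c = mon g * c g' - mon g' * c g"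
 if "rhom h" for h :: "complex => 'r::comm_ring_1"
proof -
 interpret rhom h by (rule that)
 assume g: "g:Gs" "g':Gs"
 have "comb (%e. cmap h (koszul_rel g g' e)) c = (SUM e:Gs. (if e = g' then mon g * c e else 0) - (if e = g then mon g' * c e else 0))"
  unfolding comb_def koszul_rel_def
  by (rule sum.cong) (auto simp: cmap_mon rhom.hom_simps[OF rhom_cmap] left_diff_distrib)
 thus ?thesis using g finite_Gs by (simp add: sum_subtractf)
qed

lemma cmap_id: "cmap (%x. x) f = f"
 by (rule pm_eqI) (simp add: lk_cmap)

lemma comb_pair: "g:Gs ==> g':Gs ==> comb (pair_rel g g') c = mon (g' - g) * c g - mon (g - g') * c g'"
 using comb_pair_rel[OF rhom_id] by (simp add: cmap_id)

lemma comb_koszul: "g:Gs ==> g':Gs ==> comb (koszul_rel g g') c = mon g * c g' - mon g' * c g"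
 using comb_koszul_rel[OF rhom_id] by (simp add: cmap_id)

lemma pair_lcm: "(g' - g) + g = (g - g') + g'" for g g' :: "'x mon"
proof (rule pm_eqI)
 have "b - a + a = a - b + b" for a b :: nat by arith
 thus "lk ((g' - g) + g) k = lk ((g - g') + g') k" for k by (simp only: lk_add lk_minus)
qed

lemma pair_rels: "g:Gs ==> g':Gs ==> pair_rel g g':rels"
 and koszul_rels: "g:Gs ==> g':Gs ==> koszul_rel g g':rels"
proof -
 assume g: "g:Gs" "g':Gs"
 have "mon (g' - g) * mon g = (mon (g - g') * mon g' :: ('x, complex) pol)"
  unfolding mon_add[symmetric] by (rule arg_cong[OF pair_lcm])
 thus "pair_rel g g':rels" "koszul_rel g g':rels" using g by (simp_all add: rels_def comb_pair comb_koszul)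
qed

lemma rels_add: "r:rels ==> s:rels ==> (%e. r e + s e):rels"
 and rels_mult: "r:rels ==> (%e. q * r e):rels"
 by (simp_all add: rels_def comb_add comb_mult)

lemma nonstdp_hcomp: "nonstdp f ==> nonstdp (hcomp d f)"
 by (simp add: nonstdp_def lk_hcomp)

lemma nonstdp_mult: "nonstdp f ==> nonstdp (q * f)"
 unfolding nonstdp_def
proof (intro allI impI)
 fix mu assume f: "ALL mu. lk f mu ~= 0 --> ~ std mu" and nz: "lk (q * f) mu ~= 0"
 obtain ka nu where mu: "mu = ka + nu" "lk f nu ~= 0" by (rule lk_mult_nonzeroD[OF nz])
 have "~ std nu" using f mu(2) by simp
 from nonstd_add[OF this, of ka] show "~ std mu" unfolding mu(1) add.commute[of ka] .
qed

text \<open>Terms are grouped by their chosen generator. The coefficients of \<open>k\<close> are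
  then coefficients of \<open>G\<close>, whence the bound for all ideals \<open>a\<close> at
  once.\<close>

lemma nonstd_comb:
 fixes G :: "('x, 'r::comm_ring_1) pol"
 assumes G: "nonstdp G"
 shows "EX k. (ALL a e. idl a & G:cI a --> k e:cI a) & comb k th = Zop (lifted th) G"
proof -
 define k where "k e = (SUM mu:{mu:ks G. base mu = e}. Const (lk G mu) * (mon (mu - e) :: ('x, 'r) pol))" for e
 have ns: "~ std mu" if "mu:ks G" for mu using G that by (auto simp: nonstdp_def keysI)
 have "comb k th = (SUM g:Gs. SUM mu:{mu:ks G. base mu = g}. Const (lk G mu) * lifted th mu)"
  unfolding comb_def k_def sum_distrib_right by (intro sum.cong refl) (use ns in "auto simp: lifted_def mult.assoc")
 also have "... = (SUM mu:ks G. Const (lk G mu) * lifted th mu)"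
  by (rule sum.group) (use finite_Gs base ns in auto)
 finally have "comb k th = Zop (lifted th) G" by (simp add: Zop_def)
 moreover have "k e:cI a" if "idl a" "G:cI a" for a e
  unfolding k_def using that by (intro isetsum[OF icI] cI_Const_mult) (auto simp: cI_iff)
 ultimately show ?thesis by blast
qed

end

locale lifting = monomial_gens std x0 Gs + alg_retract io ev
 for std :: "'x mon => bool" and x0 :: 'x and Gs and io :: "complex => 'r::comm_ring_1" and ev
begin

lemma cmap_io_nonstdp: "nonstdp f ==> nonstdp (cmap io f)"
 unfolding nonstdp_def io.lk_cm by (metis io.zero)

lemma relation_lift:
 assumes c: "idl c" and L: "first_rels ker c th" and r: "r:rels"
 shows "EX h. (ALL g. h g:cI ker) & comb (%g. cmap io (r g) + h g) th:cI c"
proof -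
 obtain h' where h': "ALL a d e. (ALL g:Gs. cmap io (r g):cI a) & idl d & (ALL x:a. ALL y:ker. x * y:d) --> h' e:cI d"
  "ALL a d. (ALL g:Gs. cmap io (r g):cI a) & idl d & (ALL x:a. ALL y:c. x * y:d) -->
   comb (%g. cmap io (r g)) th - Zop (lifted th) (comb (%g. cmap io (r g)) mon) - comb h' th:cI d"
  using comb_step[OF c is_ideal_ker L, of "%g. cmap io (r g)"] by blast
 have "comb (%g. cmap io (r g)) mon = cmap io (comb r mon)"
  by (simp add: comb_def rhom.hom_simps[OF io.rhom_cmap] io.cmap_mon)
 hence z: "comb (%g. cmap io (r g)) mon = 0" using r by (simp add: rels_def rhom.zero[OF io.rhom_cmap])
 have u: "ALL g:Gs. cmap io (r g):cI UNIV" by (simp add: cI_iff)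
 have "h' e:cI ker" for e
  using h'(1)[rule_format, of UNIV ker e] u is_ideal_ker iscale[OF is_ideal_ker] by blast
 moreover have "comb (%g. cmap io (r g)) th - comb h' th:cI c"
  using h'(2)[rule_format, of UNIV c] u c iscale[OF c] z by simp
 ultimately show ?thesis
  by (intro exI[of _ "%g. - h' g"]) (simp add: ineg[OF icI[OF is_ideal_ker]] comb_minus[symmetric])
qed

text \<open>The obstruction argument for the small extension from R/c to R/c'. \<open>F r\<close> is
  the value of a lifted relation, well defined modulo \<open>c'\<close> and nonstandard terms. Its
  complex components \<open>ps e\<close> satisfy the cocycle conditions, so vanishing of T2 makes
  them equal on pair relations to \<open>comb\<close> with some \<open>a e\<close>; subtracting the
  e-multiples of these from \<open>th\<close> removes the obstruction.\<close>

lemma lift_step: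
 assumes c: "idl c" and c': "idl c'" "c' <= c" "c <= ker" and nc: "!!x y. x:ker ==> y:c ==> x * y:c'"
  and nil: "ipow ker J <= c'" and T2: T2_vanishes and L: "first_rels ker c th"
 shows "EX th'. first_rels ker c' th' & (ALL g:Gs. th' g - th g:cI c)"
proof -
 note n = is_ideal_ker
 have "ALL r. EX h. r:rels --> (ALL g. h g:cI ker) & comb (%g. cmap io (r g) + h g) th:cI c"
  using relation_lift[OF c L] by blast
 hence "EX ob. ALL r. r:rels --> (ALL g. ob r g:cI ker) & comb (%g. cmap io (r g) + ob r g) th:cI c"
  by (simp only: choice_iff)
 then obtain ob where ob0: "ALL r. r:rels --> (ALL g. ob r g:cI ker) & comb (%g. cmap io (r g) + ob r g) th:cI c" ..
 define F where "F r = comb (%g. cmap io (r g) + ob r g) th" for r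
 have ob: "ob r g:cI ker" "F r:cI c" if "r:rels" for r g using ob0 that by (simp_all add: F_def)
 have sub: "x:cI ker ==> y:cI ker ==> x - y:cI ker" for x y :: "('x, 'r) pol"
  by (rule iminus[OF icI[OF n]])
 have std_coeff: "lk (comb h th) mu:c'" if "!!g. g:Gs ==> h g:cI ker" "comb h th:cI c" "std mu" for h mu
  by (rule comb_std_coeff[OF c n L c'(1,2) nc nil that])
 \<comment> \<open>Only the values on pair relations have to be corrected, so the coefficients to be
   separated form a finite set.\<close>
 define prs where "prs = (%(g, g'). F (pair_rel g g')) ` (Gs \<times> Gs)"
 define D where "D = (UN f:prs. lk f ` ks f)"
 have "finite D" unfolding D_def prs_def using finite_Gs by simp
 have Dc: "D <= c" using ob(2) pair_rels by (auto simp: D_def prs_def cI_iff)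
 obtain E where "EX ph. finite E & E <= D & (ALL e:E. (ALL x y. ph e (x + y) = ph e x + ph e y) &
   (ALL z x. ph e (io z * x) = z * ph e x) & (ALL x:c'. ph e x = 0)) &
  (ALL d:D. d - (SUM e:E. io (ph e d) * e):c')"
  using separating_functionals[OF io.rhom_axioms c'(1) \<open>finite D\<close>] ..
 then obtain ph where all: "finite E & E <= D & (ALL e:E. (ALL x y. ph e (x + y) = ph e x + ph e y) &
   (ALL z x. ph e (io z * x) = z * ph e x) & (ALL x:c'. ph e x = 0)) &
  (ALL d:D. d - (SUM e:E. io (ph e d) * e):c')" ..
 have E: "finite E" "E <= D" and ph_add: "!!e x y. e:E ==> ph e (x + y) = ph e x + ph e y"
  and ph_scale: "!!e z x. e:E ==> ph e (io z * x) = z * ph e x" and ph_0: "!!e x. e:E ==> x:c' ==> ph e x = 0"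
  and ph_rep: "!!d. d:D ==> d - (SUM e:E. io (ph e d) * e):c'"
  using all by simp_all
 have phz: "ph e 0 = 0" if "e:E" for e using ph_0[OF that izero[OF c'(1)]] .
 have ph_diff: "ph e (x - y) = ph e x - ph e y" if "e:E" for e x y
  using ph_add[OF that, of "x - y" y] by simp
 have lP: "lk (cmap (ph e) f) mu = ph e (lk f mu)" if "e:E" for e f mu by (rule lk_cmap[of "ph e", OF phz[OF that]])
 define ps where "ps e r = cmap (ph e) (F r)" for e r
 have cm_diff: "cmap (ph e) (f - g) = cmap (ph e) f - cmap (ph e) g" if "e:E" for e f g
  by (rule pm_eqI) (simp add: lP[OF that] lk_minus ph_diff[OF that])
 have cm_add: "cmap (ph e) (f + g) = cmap (ph e) f + cmap (ph e) g" if "e:E" for e f g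
  by (rule pm_eqI) (simp add: lP[OF that] lk_add ph_add[OF that])
 have cm_mult: "cmap (ph e) (cmap io q * f) = q * cmap (ph e) f" if e: "e:E" for e and q :: "('x, complex) pol" and f
 proof (induction q rule: poly_induct)
  case (single mu z)
  show ?case
  proof (rule pm_eqI)
   fix nu show "lk (cmap (ph e) (cmap io (sg mu z) * f)) nu = lk (sg mu z * cmap (ph e) f) nu"
   proof (cases "EX ka. nu = mu + ka")
    case True
    then obtain ka where ka: "nu = mu + ka" ..
    show ?thesis unfolding lP[OF e] io.cmap_single ka lk_single_mult by (rule ph_scale[OF e])
   next
    case False
    thus ?thesis by (simp add: lP[OF e] io.cmap_single lk_single_mult_0 phz[OF e])
   qed
  qed
 next
  case (add f g)
  thus ?case by (simp add: io.cmap_add ring_distribs cm_add[OF e])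
 qed
 have van: "nonstdp (cmap (ph e) (comb h th))"
  if "e:E" "!!g. g:Gs ==> h g:cI ker" "comb h th:cI c" for e h
  unfolding nonstdp_def lP[OF that(1)] using std_coeff[OF that(2,3)] ph_0[OF that(1)] by blast
 have Th: "th g - mon g:cI ker" "hom (mdeg g) (th g)" if "g:Gs" for g
  using L that by (auto simp: first_rels_def)
 have Fcomb: "F r = comb (%g. cmap io (r g)) th + comb (ob r) th" for r by (simp add: F_def comb_add)
 have zero_ker: "(0 :: ('x, 'r) pol):cI ker" by (rule izero[OF icI[OF n]])
 have cIc_diff: "x - y:cI c" if "x:cI c" "y:cI c" for x y :: "('x, 'r) pol"
  by (rule iminus[OF icI[OF c] that])
 have hyp1: "nonstdp (ps e (%g. r g + s g) - ps e r - ps e s)" if e: "e:E" and rs: "r:rels" "s:rels" for e r s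
 proof -
  let ?h = "%g. ob (%g. r g + s g) g - ob r g - ob s g"
  have eq: "F (%g. r g + s g) - F r - F s = comb ?h th"
   by (simp add: Fcomb comb_add comb_minus io.cmap_add)
  have "comb ?h th:cI c" unfolding eq[symmetric] by (intro cIc_diff ob rels_add rs)
  hence "nonstdp (cmap (ph e) (comb ?h th))" by (intro van[OF e] sub ob rels_add rs)
  thus ?thesis unfolding ps_def by (simp add: cm_diff[OF e, symmetric] eq)
 qed
 have hyp2: "nonstdp (ps e (%g. q * r g) - q * ps e r)" if e: "e:E" and r: "r:rels" for e r q
 proof -
  let ?h = "%g. ob (%g. q * r g) g - cmap io q * ob r g"
  have eq: "F (%g. q * r g) - cmap io q * F r = comb ?h th"
   by (simp add: Fcomb comb_mult comb_minus io.cmap_mult ring_distribs)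
  have "comb ?h th:cI c" unfolding eq[symmetric]
   by (intro cIc_diff ob rels_mult r iscale[OF icI[OF c] ob(2)])
  hence "nonstdp (cmap (ph e) (comb ?h th))"
   by (intro van[OF e] sub ob(1) rels_mult r iscale[OF icI[OF n] ob(1)])
  thus ?thesis unfolding ps_def by (simp add: cm_mult[OF e, symmetric] cm_diff[OF e, symmetric] eq)
 qed
 have hyp3: "nonstdp (ps e (koszul_rel g g'))" if e: "e:E" and g: "g:Gs" "g':Gs" for e g g'
 proof -
  \<comment> \<open>With \<open>th\<close> in place of the monomials the Koszul relation is exact;
    its value is therefore a combination of the \<open>th\<close> whose coefficients are the
    differences \<open>h\<close>, lying in \<open>ker\<close>.\<close>
  define h where "h x = (if x = g then th g' - mon g' else 0) - (if x = g' then th g - mon g else 0)" for x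
  have "comb h th = (SUM x:Gs. (if x = g then (th g' - mon g') * th x else 0) - (if x = g' then (th g - mon g) * th x else 0))"
   unfolding comb_def h_def by (rule sum.cong) (auto simp: left_diff_distrib)
  hence "comb h th = mon g * th g' - mon g' * th g"
   using g finite_Gs by (simp add: sum_subtractf alg)
  hence eq: "F (koszul_rel g g') = comb (%x. h x + ob (koszul_rel g g') x) th"
   by (simp add: Fcomb comb_koszul_rel[OF io.rhom_axioms g] comb_add)
  have hk: "h x:cI ker" for x unfolding h_def using Th(1) g zero_ker by (intro sub) auto
  show ?thesis unfolding ps_def eq
  proof (rule van[OF e])
   show "h x + ob (koszul_rel g g') x:cI ker" for x
    by (intro iadd[OF icI[OF n]] hk ob koszul_rels g)
   show "comb (%x. h x + ob (koszul_rel g g') x) th:cI c"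
    unfolding eq[symmetric] by (intro ob koszul_rels g)
  qed
 qed
 have ex: "EX c. ALL g:Gs. ALL g':Gs. nonstdp (ps e (pair_rel g g') - comb (pair_rel g g') c)" if e: "e:E" for e
  using T2[unfolded T2_vanishes_def, rule_format, of "ps e"] hyp1[OF e] hyp2[OF e] hyp3[OF e] by blast
 hence "ALL e. EX c. e:E --> (ALL g:Gs. ALL g':Gs. nonstdp (ps e (pair_rel g g') - comb (pair_rel g g') c))" by blast
 hence "EX b. ALL e. e:E --> (ALL g:Gs. ALL g':Gs. nonstdp (ps e (pair_rel g g') - comb (pair_rel g g') (b e)))"
  by (rule choice)
 then obtain b where b: "ALL e. e:E --> (ALL g:Gs. ALL g':Gs. nonstdp (ps e (pair_rel g g') - comb (pair_rel g g') (b e)))" ..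
 \<comment> \<open>Only the part of the correction in the degree of \<open>g\<close> is kept, so
   that the new generators stay homogeneous.\<close>
 define a where "a e g = hcomp (mdeg g) (b e g)" for e g
 have key: "nonstdp (ps e (pair_rel g g') - comb (pair_rel g g') (a e))" if e: "e:E" and g: "g:Gs" "g':Gs" for e g g'
 proof -
  define d where "d = mdeg ((g' - g) + g)"
  have d: "d = mdeg (g' - g) + mdeg g" "d = mdeg (g - g') + mdeg g'"
   unfolding d_def mdeg_add using arg_cong[OF pair_lcm[of g' g], of mdeg] by simp_all
  have hc: "hcomp d (comb (pair_rel g g') (b e)) = comb (pair_rel g g') (a e)"
   using hcomp_mon_mult[of "g' - g" "mdeg g" "b e g"] hcomp_mon_mult[of "g - g'" "mdeg g'" "b e g'"]
   unfolding comb_pair[OF g] hcomp_minus a_def d(1)[symmetric] d(2)[symmetric] by simp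
  define h where "h x = (if mdeg x <= d then hcomp (d - mdeg x) (ob (pair_rel g g') x) else 0)" for x
  have "hcomp d (comb (ob (pair_rel g g')) th) = comb h th"
   unfolding comb_def hcomp_sum
  proof (rule sum.cong)
   fix x assume x: "x:Gs"
   show "hcomp d (ob (pair_rel g g') x * th x) = h x * th x"
   proof (cases "mdeg x <= d")
    case True
    thus ?thesis using hcomp_mult_hom[OF Th(2)[OF x] True, of "ob (pair_rel g g') x"]
    by (simp add: h_def mult.commute)
   next
    case False
    thus ?thesis using hcomp_mult_0[OF Th(2)[OF x], of d "ob (pair_rel g g') x"]
    by (simp add: h_def mult.commute)
   qed
  qed simp
  moreover have "hcomp d (comb (%x. cmap io (pair_rel g g' x)) th) = comb (%x. cmap io (pair_rel g g' x)) th"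
  proof -
   have "hom d (comb (%x. cmap io (pair_rel g g' x)) th)"
    unfolding comb_pair_rel[OF io.rhom_axioms g]
    using hom_mon_mult[OF Th(2)[OF g(1)], of "g' - g"] hom_mon_mult[OF Th(2)[OF g(2)], of "g - g'"]
    unfolding d(1)[symmetric] d(2)[symmetric] by (rule hom_minus)
   thus ?thesis by (simp add: hcomp_hom)
  qed
  ultimately have eq: "F (pair_rel g g') - hcomp d (F (pair_rel g g')) = comb (%x. ob (pair_rel g g') x - h x) th"
   by (simp add: Fcomb hcomp_add comb_minus)
  note P = pair_rels[OF g]
  have "comb (%x. ob (pair_rel g g') x - h x) th:cI c"
   unfolding eq[symmetric] by (intro cIc_diff ob P hcomp_cI c)
  moreover have "h x:cI ker" for x unfolding h_def
   by (cases "mdeg x <= d") (simp_all only: if_True if_False hcomp_cI[OF n ob(1)[OF P]] zero_ker)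
  ultimately have "nonstdp (cmap (ph e) (F (pair_rel g g') - hcomp d (F (pair_rel g g'))))"
   unfolding eq by (intro van[OF e] sub ob P)
  hence 1: "nonstdp (ps e (pair_rel g g') - hcomp d (ps e (pair_rel g g')))"
   unfolding ps_def hcomp_cmap[of "ph e", OF phz[OF e]] cm_diff[OF e] .
  have "nonstdp (hcomp d (ps e (pair_rel g g') - comb (pair_rel g g') (b e)))" using b e g by (intro nonstdp_hcomp) blast
  from nonstdp_add[OF 1 this] show ?thesis unfolding hcomp_minus hc by simp
 qed
 define S where "S g = (SUM e:E. Const e * cmap io (a e g))" for g
 define th' where "th' g = th g - S g" for g
 have Ec: "e:c" if "e:E" for e using that E(2) Dc by blast
 have S: "S g:cI c" for g unfolding S_def
  by (intro isetsum[OF icI[OF c]] cI_Const_mult[OF c] Ec)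
 have Sh: "hom (mdeg g) (S g)" for g unfolding S_def a_def
  by (intro hom_sum hom_Const_mult hom_cmap hom_hcomp io.zero)
 have T1: "th' g - mon g:cI ker" "hom (mdeg g) (th' g)" if "g:Gs" for g
 proof -
  have "(th g - mon g) - S g:cI ker" by (rule sub[OF Th(1)[OF that] subsetD[OF cI_mono[OF c'(3)] S]])
  thus "th' g - mon g:cI ker" by (simp add: th'_def alg)
  show "hom (mdeg g) (th' g)" unfolding th'_def by (intro hom_minus Th(2)[OF that] Sh)
 qed
 have cc: "x * y:c'" if "x:c" "y:ker" for x y using nc[OF that(2,1)] by (simp add: mult.commute)
 have "EX h. (ALL e. h e:cI ker) & mon (g' - g) * th' g - mon (g - g') * th' g' - comb h th':cI c'"
  if g: "g:Gs" "g':Gs" for g g'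
 proof -
  note P = pair_rels[OF g]
  define rh where "rh = pair_rel g g'"
  define i where "i e = ps e rh - comb rh (a e)" for e
  define G where "G = (SUM e:E. Const e * cmap io (i e))"
  have "nonstdp G" unfolding G_def
  proof -
   have "nonstdp (SUM e:B. Const e * cmap io (i e))" if "B <= E" for B
    using finite_subset[OF that E(1)] that
   proof (induction B rule: finite_induct)
    case (insert e B)
    hence "nonstdp (Const e * cmap io (i e))" unfolding i_def rh_def
    by (intro nonstdp_mult cmap_io_nonstdp key g) auto
    thus ?case using insert by (simp add: nonstdp_add)
   qed simp
   thus "nonstdp (SUM e:E. Const e * cmap io (i e))" by simp
  qed
  have Gc: "G:cI c" unfolding G_def
   by (intro isetsum[OF icI[OF c]] cI_Const_mult[OF c] Ec)
  obtain k where k: "ALL a e. idl a & G:cI a --> k e:cI a" "comb k th' = Zop (lifted th') G"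
   using nonstd_comb[OF \<open>nonstdp G\<close>, of th'] by blast
  have kn: "k e:cI ker" for e using k(1) c Gc cI_mono[OF c'(3)] by blast
  have "Zop (lifted th') G - G:cI c'"
   by (rule Zop_diff_cI[OF c'(1) cc _ Gc]) (assumption, assumption, rule lifted_minus_mon[OF n T1(1)])
  hence 1: "comb k th' - G:cI c'" by (simp add: k(2))
  have 2: "F rh - (SUM e:E. Const e * cmap io (ps e rh)):cI c'"
   unfolding cI_iff
  proof
   fix mu
   have "lk (F rh - (SUM e:E. Const e * cmap io (ps e rh))) mu = lk (F rh) mu - (SUM e:E. io (ph e (lk (F rh) mu)) * e)"
    by (simp add: lk_minus lk_sum lk_Const io.lk_cm ps_def lP mult.commute)
   also have "...:c'"
   proof (cases "lk (F rh) mu = 0")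
    case True
    thus ?thesis by (simp add: phz io.zero izero[OF c'(1)])
   next
    case False
    hence "lk (F rh) mu:lk (F rh) ` ks (F rh)" by (simp add: keysI)
    moreover have "F rh:prs" unfolding prs_def rh_def using g by auto
    ultimately have "lk (F rh) mu:D" unfolding D_def by blast
    thus ?thesis by (rule ph_rep)
   qed
   finally show "lk (F rh - (SUM e:E. Const e * cmap io (ps e rh))) mu:c'" .
  qed
  have 3: "comb (ob rh) S:cI c'" unfolding comb_def
   by (intro isetsum[OF icI[OF c'(1)]] cI_mult_products[of c' ker c])
    (use ob(1)[OF P] S nc c'(1) in "auto simp: rh_def")
  have 4: "comb (%x. cmap io (rh x)) S = (SUM e:E. Const e * cmap io (comb rh (a e)))"
  proof -
   have "comb (%x. cmap io (rh x)) S = (SUM x:Gs. SUM e:E. Const e * (cmap io (rh x) * cmap io (a e x)))"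
    unfolding comb_def S_def sum_distrib_left by (simp only: mult.left_commute)
   also have "... = (SUM e:E. SUM x:Gs. Const e * (cmap io (rh x) * cmap io (a e x)))" by (rule sum.swap)
   finally show ?thesis by (simp add: comb_def rhom.sum[OF io.rhom_cmap] io.cmap_mult sum_distrib_left)
  qed
  have 5: "(SUM e:E. Const e * cmap io (ps e rh)) = G + (SUM e:E. Const e * cmap io (comb rh (a e)))"
   unfolding G_def i_def by (simp add: rhom.diff[OF io.rhom_cmap] right_diff_distrib sum_subtractf)
  have 6: "comb h th' = comb h th - comb h S" for h
   by (simp add: comb_def th'_def right_diff_distrib sum_subtractf)
  \<comment> \<open>Modulo \<open>c'\<close> the value \<open>F rh\<close> is the nonstandard part G
    plus the coboundary. G is absorbed by the combination \<open>k\<close> of the new generators,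
    the coboundary by the change from \<open>th\<close> to th', and the products of
    \<open>ob\<close> with the correction vanish.\<close>
  have "(F rh - (SUM e:E. Const e * cmap io (ps e rh))) - (comb k th' - G) - comb (ob rh) S:cI c'"
   by (intro iminus[OF icI[OF c'(1)]] 1 2 3)
  also have "(F rh - (SUM e:E. Const e * cmap io (ps e rh))) - (comb k th' - G) - comb (ob rh) S =
    comb (%x. cmap io (rh x)) th' - comb (%x. k x - ob rh x) th'"
   unfolding 5 4[symmetric] comb_minus 6[of "ob rh"] 6[of "%x. cmap io (rh x)"] Fcomb by (simp add: alg)
  also have "comb (%x. cmap io (rh x)) th' = mon (g' - g) * th' g - mon (g - g') * th' g'"
   unfolding rh_def by (rule comb_pair_rel[OF io.rhom_axioms g])
  finally have fin: "mon (g' - g) * th' g - mon (g - g') * th' g' - comb (%x. k x - ob rh x) th':cI c'" .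
  have "k x - ob rh x:cI ker" for x unfolding rh_def by (intro sub kn ob P)
  thus ?thesis using fin by (intro exI[of _ "%x. k x - ob rh x"]) simp
 qed
 hence "first_rels ker c' th'" using T1 unfolding first_rels_def by blast
 moreover have "th' g - th g:cI c" for g
  using ineg[OF icI[OF c] S[of g]] by (simp add: th'_def)
 ultimately show ?thesis by blast
qed

lemma first_rels_mono: "c <= c' ==> first_rels ker c th ==> first_rels ker c' th"
 unfolding first_rels_def using cI_mono[of c c'] by blast

text \<open>The steps run through c + (c0 \<inter> ker^j). Each is small, since \<open>ker\<close>
  times one of these ideals lies in the next, and at j = J nothing beyond \<open>c\<close> is
  left.\<close>

lemma lift_chain:
 assumes c0: "idl c0" "c0 <= ker" and c: "idl c" "c <= c0" and nil: "ipow ker J <= c"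
  and T2: T2_vanishes and L: "first_rels ker c0 th"
 shows "EX th'. first_rels ker c th' & (ALL g:Gs. th' g - th g:cI c0)"
proof -
 let ?c = "%j. isum c (c0 Int ipow ker j)"
 have i: "idl (c0 Int ipow ker j)" for j by (rule ideal.subspace_inter[OF c0(1) ipow_ideal])
 have I: "idl (?c j)" for j by (rule isum_ideal[OF c(1) i])
 have sub0: "?c j <= c0" for j by (rule isum_minimal[OF c0(1) c(2)]) auto
 have "EX th'. first_rels ker (?c j) th' & (ALL g:Gs. th' g - th g:cI c0)" for j
 proof (induction j)
  case 0
  have "c0 <= ?c 0" using isum_right[OF c(1), of "c0 Int ipow ker 0"] by simp
  hence "first_rels ker (?c 0) th" using L by (rule first_rels_mono)
  moreover have "th g - th g:cI c0" for g using izero[OF c0(1)] by (simp add: cI_iff)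
  ultimately show ?case by blast
 next
  case (Suc j)
  then obtain th1 where 1: "first_rels ker (?c j) th1" "ALL g:Gs. th1 g - th g:cI c0" by blast
  have "EX th'. first_rels ker (?c (Suc j)) th' & (ALL g:Gs. th' g - th1 g:cI (?c j))"
  proof (rule lift_step[OF I I _ _ _ _ T2 1(1)])
   show "?c (Suc j) <= ?c j"
   proof (rule isum_minimal[OF I isum_left[OF i]])
    have "c0 Int ipow ker (Suc j) <= c0 Int ipow ker j" using ipow_Suc_subset by blast
    thus "c0 Int ipow ker (Suc j) <= ?c j" using isum_right[OF c(1)] by blast
   qed
   show "?c j <= ker" using sub0 c0(2) by blast
   show "x * y:?c (Suc j)" if x: "x:ker" and y: "y:?c j" for x y
   proof -
    obtain u v where uv: "u:c" "v:c0 Int ipow ker j" "y = u + v" using y unfolding isum_def by blast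
    have "x * v:c0 Int ipow ker (Suc j)"
    using ipow_mult[OF x, of v j] iscale[OF c0(1), of v x] uv(2) by blast
    thus ?thesis unfolding uv(3) distrib_left by (intro isumI iscale[OF c(1)] uv(1))
   qed
   show "ipow ker J <= ?c (Suc j)" using nil isum_left[OF i] by blast
  qed
  then obtain th2 where 2: "first_rels ker (?c (Suc j)) th2" "ALL g:Gs. th2 g - th1 g:cI (?c j)" by blast
  have "th2 g - th g:cI c0" if "g:Gs" for g
  proof -
   have "th2 g - th1 g:cI c0" using 2(2) that cI_mono[OF sub0] by blast
   from iadd[OF icI[OF c0(1)] this] 1(2) that show ?thesis by fastforce
  qed
  thus ?case using 2(1) by blast
 qed
 from this[of J] obtain th' where th': "first_rels ker (?c J) th'" "ALL g:Gs. th' g - th g:cI c0" by blast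
 have "?c J <= c" by (rule isum_minimal[OF c(1)]) (use nil in auto)
 thus ?thesis using first_rels_mono[OF _ th'(1)] th'(2) by blast
qed

end

section \<open>Stanley--Reisner ideals of joins with simplices\<close>

definition fpm :: "('a::finite => 'b::zero) => 'a \<Rightarrow>\<^sub>0 'b"
 where "fpm = Abs_poly_mapping"

lemma lk_fpm [simp]: "lk (fpm f) = f"
 by (simp add: fpm_def)

lemma keys_nat_sum: "finite A ==> ks (SUM a:A. f a :: 'x mon) = (UN a:A. ks (f a))"
 by (induction A rule: finite_induct) (simp_all add: keys_add_nat)

lemma mon_sum: "mon (sum f A) = (PROD a:A. mon (f a))"
 by (induction A rule: infinite_finite_induct) (simp_all add: mon_add)

definition ind :: "'x set => 'x mon"
 where "ind s = (SUM v:s. sg v 1)"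

lemma lk_ind: "finite s ==> lk (ind s) v = (if v:s then 1 else 0)"
 by (auto simp: ind_def lk_sum lk_sg)

lemma keys_ind: "finite s ==> ks (ind s) = s"
 by (simp add: ind_def keys_nat_sum)

lemma mon_ind: "mon (ind s) = (PROD v:s. Var v)"
 by (simp add: ind_def mon_sum Var_mon)

lemma SR_ideal_iff:
 fixes K :: "('v::finite) set set"
 assumes K: "!!s r. s:K ==> r <= s ==> r:K"
 shows "(f:SR_ideal K) = (ALL mu. lk f mu ~= 0 --> ks mu ~: K)"
proof
 let ?I = "{f :: 'v cpoly. ALL mu. lk f mu ~= 0 --> ks mu ~: K}"
 have I: "idl ?I"
 proof (rule idealI)
  fix f g :: "'v cpoly" assume "f:?I" "g:?I"
  thus "f + g:?I" unfolding mem_Collect_eq lk_add by (metis add_0)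
 next
  fix c f :: "'v cpoly" assume f: "f:?I"
  show "c * f:?I" unfolding mem_Collect_eq
  proof (intro allI impI)
   fix mu assume nz: "lk (c * f) mu ~= 0"
   obtain ka nu where mu: "mu = ka + nu" "lk f nu ~= 0" by (rule lk_mult_nonzeroD[OF nz])
   hence "ks nu ~: K" using f by simp
   thus "ks mu ~: K" using K[of "ks mu" "ks nu"] mu(1) by (auto simp: keys_add_nat)
  qed
 qed simp
 have "SR_ideal K <= ?I" unfolding SR_ideal_def
 proof (rule gen_minimal[OF _ I], safe)
  fix s assume s: "s ~: K"
  fix mu assume "lk (PROD v:s. Var v :: 'v cpoly) mu ~= 0" "ks mu:K"
  hence "mu = ind s" unfolding mon_ind[symmetric] by (simp add: lk_mon split: if_splits)
  thus False using s \<open>ks mu:K\<close> by (simp add: keys_ind)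
 qed
 thus "f:SR_ideal K ==> ALL mu. lk f mu ~= 0 --> ks mu ~: K" by blast
next
 assume f: "ALL mu. lk f mu ~= 0 --> ks mu ~: K"
 have "sg mu (lk f mu):SR_ideal K" if "mu:ks f" for mu
 proof -
  have "ks mu ~: K" using f that by (auto simp: keysI)
  hence "mon (ind (ks mu)):SR_ideal K" unfolding SR_ideal_def mon_ind by (intro gen_base) blast
  hence "Const (lk f mu) * mon (mu - ind (ks mu)) * mon (ind (ks mu)):SR_ideal K"
   unfolding SR_ideal_def by (rule gen_scale)
  moreover have "(mu - ind (ks mu)) + ind (ks mu) = mu"
   by (rule pm_eqI) (auto simp: lk_add lk_minus lk_ind keysI)
  ultimately show ?thesis by (simp add: sg_eq mult.assoc flip: mon_add)
 qed
 hence "(SUM mu:ks f. sg mu (lk f mu)):SR_ideal K" unfolding SR_ideal_def by (rule gen_sum)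
 thus "f:SR_ideal K" by (simp add: sum_sg)
qed

lemma T2_trivialD:
 assumes "T2 I = {T2_coboundaries I}" "ph:T2_cocycles I" "idl I"
 shows "EX c. ALL r:relation_module I. ph r - (SUM f:ks r. lk r f * c f):I"
proof -
 let ?E = "{(ph, ps). ph:T2_cocycles I & ps:T2_cocycles I & (%r. ph r - ps r):T2_coboundaries I}"
 have "?E `` {ph}:T2 I" unfolding T2_def using assms(2) by (rule quotientI)
 hence "?E `` {ph} = T2_coboundaries I" using assms(1) by auto
 moreover have "(%r. ph r - ph r):T2_coboundaries I"
  unfolding T2_coboundaries_def using izero[OF assms(3)] by (auto intro!: exI[of _ "%_. 0"])
 ultimately have "ph:T2_coboundaries I" using assms(2) by blast
 thus ?thesis unfolding T2_coboundaries_def by blast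
qed

definition rcomb :: "('a::comm_ring_1 => 'b::comm_ring_1) => ('k => 'b) => ('k, 'a) pm => 'b"
 where "rcomb h c R = (SUM f:ks R. h (lk R f) * c f)"

context rhom
begin

lemma rcomb_superset: "finite A ==> ks R <= A ==> rcomb h c R = (SUM f:A. h (lk R f) * c f)"
 unfolding rcomb_def by (rule sum.mono_neutral_left) (auto simp: keysI zero)

lemma rcomb_add: "rcomb h c (R + S) = rcomb h c R + rcomb h c S"
proof -
 let ?A = "ks R Un ks S"
 have "rcomb h c x = (SUM f:?A. h (lk x f) * c f)" if "x:{R, S, R + S}" for x
  by (rule rcomb_superset) (use that keys_add[of R S] in auto)
 thus ?thesis by (simp add: lk_add add ring_distribs sum.distrib)
qed

lemma rcomb_minus: "rcomb h c (R - S) = rcomb h c R - rcomb h c S"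
 using rcomb_add[of c "R - S" S] by simp

lemma rcomb_smul: "rcomb h c (smul a R) = h a * rcomb h c R"
proof -
 have "ks (smul a R) <= ks R" by (auto simp: keysI lk_smul)
 hence "rcomb h c (smul a R) = (SUM f:ks R. h (lk (smul a R) f) * c f)" by (intro rcomb_superset) auto
 thus ?thesis by (simp add: rcomb_def lk_smul mult sum_distrib_left mult.assoc)
qed

lemma rcomb_single: "rcomb h c (sg f a) = h a * c f"
 by (subst rcomb_superset[of "{f}"]) auto

lemma rcomb_0 [simp]: "rcomb h c 0 = 0"
 by (simp add: rcomb_def)

end

section \<open>The join in labelled coordinates\<close>

locale join_complex =
 fixes K :: "('v::finite) set set" and m :: nat and si :: "'v + nat => 'n::finite"
 assumes K: "abstract_complex K" and si: "bij_betw si (\<Union>(join K (full_simplex m))) UNIV"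
begin

lemma K_sub: "s:K ==> r <= s ==> r:K" and K_empty: "{}:K"
 using K by (auto simp: abstract_complex_def)

lemma verts: "\<Union>(join K (full_simplex m)) = \<Union>K <+> {0..m}"
proof -
 have "Inl v:\<Union>(join K (full_simplex m))" if v: "v:s" "s:K" for v s
  using v by (auto simp: join_def full_simplex_def intro!: bexI[of _ "s <+> {}"])
 moreover have "Inr j:\<Union>(join K (full_simplex m))" if "j <= m" for j
 proof -
  have "{} <+> {j}:join K (full_simplex m)"
   unfolding join_def full_simplex_def using that K_empty by (intro CollectI exI[of _ "{}"] exI[of _ "{j}"]) auto
  thus ?thesis by blast
 qed
 ultimately show ?thesis by (auto simp: join_def full_simplex_def Plus_def)
qed

abbreviation "xv v == si (Inl v)"

lemma si_inj: "a:\<Union>K <+> {0..m} ==> b:\<Union>K <+> {0..m} ==> si a = si b ==> a = b"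
 using si unfolding verts bij_betw_def inj_on_def by blast

lemma si_surj: "EX a:\<Union>K <+> {0..m}. i = si a"
 using si unfolding verts bij_betw_def by blast

definition L :: "'n set set"
 where "L = (%s. si ` s) ` join K (full_simplex m)"

text \<open>\<open>X\<close> and \<open>Y\<close> separate the exponents of the vertices of K from
  the exponents of the simplex coordinates; \<open>ext\<close> embeds the former back.\<close>

definition X :: "'n mon => 'v mon"
 where "X mu = fpm (%v. if v:\<Union>K then lk mu (xv v) else 0)"

definition Y :: "'n mon => 'n mon"
 where "Y mu = fpm (%i. if i:xv ` \<Union>K then 0 else lk mu i)"

definition ext :: "'v mon => 'n mon"
 where "ext nu = (SUM v:ks nu. sg (xv v) (lk nu v))"

definition std :: "'n mon => bool"
 where "(std mu) = (ks (X mu):K)"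

text \<open>All nonfaces among the vertices are taken, minimal or not: then every nonstandard
  monomial in the vertices of K has a distinguished generator, the one with the same
  support.\<close>

definition Gs :: "'n mon set"
 where "Gs = {ext (ind s) | s. s <= \<Union>K & s ~: K}"

lemma xv_inj: "v:\<Union>K ==> w:\<Union>K ==> xv v = xv w ==> v = w"
 using si_inj[of "Inl v" "Inl w"] by auto

lemma lk_ext: "ks nu <= \<Union>K ==> v:\<Union>K ==> lk (ext nu) (xv v) = lk nu v"
proof -
 assume a: "ks nu <= \<Union>K" "v:\<Union>K"
 have "lk (ext nu) (xv v) = (SUM w:ks nu. if w = v then lk nu w else 0)"
  unfolding ext_def lk_sum by (rule sum.cong) (use a xv_inj in "auto simp: lk_sg")
 thus ?thesis by (simp add: keysI)
qed

lemma lk_ext_0: "ks nu <= \<Union>K ==> i ~: xv ` \<Union>K ==> lk (ext nu) i = 0"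
 unfolding ext_def lk_sum by (rule sum.neutral) (auto simp: lk_sg)

lemma X_add: "X (mu + nu) = X mu + X nu" and Y_add: "Y (mu + nu) = Y mu + Y nu"
 by (rule pm_eqI, simp add: X_def Y_def lk_add)+

lemma X_keys: "ks (X mu) <= \<Union>K"
 by (auto simp: X_def keysI split: if_splits)

lemma X_ext: "ks nu <= \<Union>K ==> X (ext nu) = nu"
 by (rule pm_eqI) (auto simp: X_def lk_ext keysI)

lemma Y_ext: "ks nu <= \<Union>K ==> Y (ext nu) = 0"
 by (rule pm_eqI) (auto simp: Y_def lk_ext_0)

lemma split: "Y mu + ext (X mu) = mu"
proof (rule pm_eqI)
 fix i show "lk (Y mu + ext (X mu)) i = lk mu i"
 proof (cases "i:xv ` \<Union>K")
  case True
  then obtain v where v: "i = xv v" "v:\<Union>K" by blast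
  have "lk (X mu) v = lk mu i" using v by (simp add: X_def)
  thus ?thesis using lk_ext[OF X_keys v(2), of mu] True by (simp add: lk_add Y_def v(1))
 next
  case False
  thus ?thesis using X_keys[of mu] by (simp add: lk_add Y_def lk_ext_0)
 qed
qed

lemma std_iff: "(std mu) = (ks mu:L)"
proof
 assume s: "std mu"
 let ?r = "{j:{0..m}. si (Inr j):ks mu}"
 have "ks mu = si ` (ks (X mu) <+> ?r)"
 proof
  show "ks mu <= si ` (ks (X mu) <+> ?r)"
  proof
   fix i assume i: "i:ks mu"
   obtain a where a: "a:\<Union>K <+> {0..m}" "i = si a" using si_surj by blast
   show "i:si ` (ks (X mu) <+> ?r)"
    using a i by (cases a) (auto simp: X_def keysI intro!: imageI)
  qed
 qed (auto simp: X_def keysI split: if_splits)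
 moreover have "ks (X mu) <+> ?r:join K (full_simplex m)"
  using s unfolding std_def join_def full_simplex_def by blast
 ultimately show "ks mu:L" unfolding L_def by blast
next
 assume "ks mu:L"
 then obtain s r where sr: "s:K" "r <= {0..m}" "ks mu = si ` (s <+> r)"
  unfolding L_def join_def full_simplex_def by blast
 have "ks (X mu) <= s"
 proof
  fix v assume v: "v:ks (X mu)"
  hence vK: "v:\<Union>K" and "xv v:ks mu" by (auto simp: X_def keysI split: if_splits)
  then obtain a where a: "a:s <+> r" "xv v = si a" using sr(3) by blast
  have "a:\<Union>K <+> {0..m}" using a(1) sr by blast
  hence "Inl v = a" using si_inj[of "Inl v" a] vK a(2) by blast
  thus "v:s" using a(1) by blast
 qed
 thus "std mu" unfolding std_def by (rule K_sub[OF sr(1)])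
qed

lemma L_sub: "s:L ==> r <= s ==> r:L"
proof -
 assume s: "s:L" and r: "r <= s"
 have "ks (ind s):L" using s by (simp add: keys_ind)
 hence "std (ind s)" by (simp add: std_iff)
 moreover have "ind s = ind r + ind (s - r)"
  by (rule pm_eqI) (use r in "auto simp: lk_ind lk_add")
 ultimately have "std (ind r)" unfolding std_def using K_sub X_add by (simp add: keys_add_nat)
 thus "r:L" by (simp add: std_iff keys_ind)
qed

sublocale monomial_gens std "si (Inr 0)" Gs
proof
 show "~ std (mu + ka)" if "~ std mu" for mu ka
  using that K_sub[of "ks (X (mu + ka))" "ks (X mu)"] by (auto simp: std_def X_add keys_add_nat)
 have "si (Inr 0) ~= xv v" if "v:\<Union>K" for v
  using si_inj[OF InrI InlI[OF that], of 0] by auto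
 hence "X (sg (si (Inr 0)) 1) = 0"
  unfolding X_def by (intro pm_eqI) (simp only: lk_fpm lk_sg lookup_zero, simp)
 thus "(std (mu + sg (si (Inr 0)) 1)) = std mu" for mu by (simp add: std_def X_add)
 show "std (mu + sg v 1)" if "std mu" "lk mu v ~= 0" for mu v
 proof -
  have "ks (mu + sg v 1) = ks mu" using that(2) by (auto simp: keys_add_nat keysI)
  thus ?thesis using that(1) by (simp add: std_iff)
 qed
 have "Gs <= (%s. ext (ind s)) ` UNIV" unfolding Gs_def by blast
 thus "finite Gs" by (rule finite_subset) simp
 show "(~ std mu) = (EX g:Gs. EX ka. mu = ka + g)" for mu
 proof
  assume ns: "~ std mu"
  let ?s = "ks (X mu)"
  have s: "ks (ind ?s) <= \<Union>K" using X_keys by (simp add: keys_ind)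
  have le: "lk (ext (ind ?s)) i <= lk mu i" for i
  proof (cases "i:xv ` \<Union>K")
   case True
   then obtain v where v: "i = xv v" "v:\<Union>K" by blast
   have "lk (ext (ind ?s)) i = (if v:?s then 1 else 0)" unfolding v(1) lk_ext[OF s v(2)] by (simp add: lk_ind)
   thus ?thesis by (auto simp: keysI X_def v split: if_splits)
  next
   case False
   show ?thesis unfolding lk_ext_0[OF s False] by simp
  qed
  have "mu = (mu - ext (ind ?s)) + ext (ind ?s)"
   by (rule pm_eqI) (simp add: lk_add lk_minus le)
  moreover have "ext (ind ?s):Gs" unfolding Gs_def using ns X_keys by (auto simp: std_def)
  ultimately show "EX g:Gs. EX ka. mu = ka + g" by blast
 next
  assume "EX g:Gs. EX ka. mu = ka + g"
  then obtain s ka where s: "s <= \<Union>K" "s ~: K" "mu = ka + ext (ind s)" unfolding Gs_def by blast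
  have "X mu = X ka + ind s" using s(1) by (simp add: s(3) X_add X_ext keys_ind)
  hence "s <= ks (X mu)" by (auto simp: keys_add_nat keys_ind)
  thus "~ std mu" using K_sub s(2) unfolding std_def by blast
 qed
qed

lemma SR_L: "(f:SR_ideal L) = nonstdp f"
 using SR_ideal_iff[of L f] L_sub unfolding nonstdp_def std_iff by blast

definition rh :: "'v cpoly => 'n cpoly"
 where "rh = subst_hom Const (%v. if v:\<Union>K then Var (xv v) else 0)"

sublocale rh: rhom rh
 unfolding rh_def by (rule rhom.rhom_subst[OF rhom_Const])

lemma rh_mon: "rh (mon nu) = (if ks nu <= \<Union>K then mon (ext nu) else 0)"
proof (cases "ks nu <= \<Union>K")
 case True
 have "(if v:\<Union>K then Var (xv v) else 0 :: 'n cpoly) ^ lk nu v = mon (sg (xv v) (lk nu v))" if "v:ks nu" for v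
 proof -
  have "v:\<Union>K" using True that by blast
  thus ?thesis by (simp only: if_True Var_power)
 qed
 thus ?thesis using True unfolding rh_def rhom.subst_mon[OF rhom_Const] meval_def ext_def mon_sum by simp
next
 case False
 then obtain v where v: "v:ks nu" "v ~: \<Union>K" by blast
 have "(PROD i:ks nu. (if i:\<Union>K then Var (xv i) else 0 :: 'n cpoly) ^ lk nu i) = 0"
  by (rule prod_zero) (use v in "auto simp: keysI zero_power intro!: bexI[of _ v]")
 thus ?thesis unfolding rh_def rhom.subst_mon[OF rhom_Const] meval_def using False by simp
qed

lemma rh_Const: "rh (Const a) = Const a"
 by (simp add: rh_def rhom.subst_Const[OF rhom_Const])

lemma rh_single: "rh (sg mu a) = Const a * rh (mon mu)"
 unfolding sg_eq rh.mult rh_Const ..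

lemma nonstdp_sum: "(!!a. a:A ==> nonstdp (f a)) ==> nonstdp (sum f A)"
 by (induction A rule: infinite_finite_induct) (simp_all add: nonstdp_add)

lemma SR_K: "(f:SR_ideal K) = (ALL mu. lk f mu ~= 0 --> ks mu ~: K)"
 by (rule SR_ideal_iff) (rule K_sub)

lemma SR_K_ideal: "idl (SR_ideal K)"
 unfolding SR_ideal_def by (rule gen_ideal)

lemma rh_SR: "f:SR_ideal K ==> nonstdp (rh f)"
proof -
 assume f: "f:SR_ideal K"
 have "rh f = (SUM mu:ks f. Const (lk f mu) * rh (mon mu))"
  by (subst (1) sum_sg[symmetric]) (simp add: rh.sum rh_single)
 moreover have "nonstdp (Const (lk f mu) * rh (mon mu))" if "mu:ks f" for mu
 proof (intro nonstdp_mult)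
  have "ks mu ~: K" using f that unfolding SR_K by (simp add: keysI)
  thus "nonstdp (rh (mon mu))" by (auto simp: rh_mon nonstdp_def lk_mon std_def X_ext)
 qed
 ultimately show ?thesis by (simp add: nonstdp_sum)
qed

text \<open>The polynomial ring of the join is free over that of the vertices of K, with the
  monomials in the simplex coordinates as a basis; \<open>ka be\<close> is the coefficient at the
  basis element \<open>be\<close>.\<close>

definition ka :: "'n mon => 'n cpoly => 'v cpoly"
 where "ka be = Zop (%mu. if Y mu = be then mon (X mu) else 0)"

lemma ka_nonstdp: "nonstdp F ==> ka be F:SR_ideal K"
 unfolding ka_def
 by (rule Zop_mem[OF SR_K_ideal]) (auto simp: nonstdp_def std_def SR_K lk_mon)

lemma ka_mult_mon: "ks nu <= \<Union>K ==> ka be (mon (ext nu) * F) = mon nu * ka be F"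
proof (induction F rule: poly_induct)
 case (single mu a)
 have "mon (ext nu) * sg mu a = sg (ext nu + mu) a" by (simp add: mon_def mult_single)
 thus ?case using single by (simp add: ka_def Zop_single X_add Y_add X_ext Y_ext mon_add mult.left_commute)
next
 case (add f g)
 thus ?case by (simp add: ka_def ring_distribs Zop_add)
qed

text \<open>Linearity holds only modulo the Stanley--Reisner ideal, because \<open>rh\<close> kills
  the variables that are not vertices.\<close>

lemma ka_mult: "ka be (rh c * F) - c * ka be F:SR_ideal K"
proof (induction c rule: poly_induct)
 case (single mu a)
 show ?case
 proof (cases "ks mu <= \<Union>K")
  case True
  hence "ka be (rh (sg mu a) * F) = sg mu a * ka be F"
   using ka_mult_mon[OF True, of be F] unfolding rh_single
   by (simp add: True rh_mon mult.assoc ka_def Zop_Const sg_eq)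
  thus ?thesis using izero[OF SR_K_ideal] by simp
 next
  case False
  hence "sg mu a:SR_ideal K" unfolding SR_K by (auto simp: lk_sg)
  hence "0 - sg mu a * ka be F:SR_ideal K"
   by (intro iminus[OF SR_K_ideal] iright[OF SR_K_ideal] izero[OF SR_K_ideal])
  thus ?thesis using False by (simp add: rh_single rh_mon ka_def)
 qed
next
 case (add f g)
 have "ka be (rh (f + g) * F) - (f + g) * ka be F = (ka be (rh f * F) - f * ka be F) + (ka be (rh g * F) - g * ka be F)"
  by (simp add: ka_def ring_distribs Zop_add rh.add)
 thus ?case using iadd[OF SR_K_ideal add] by simp
qed

lemma ka_recover:
 assumes B: "finite B" "Y ` ks F <= B" shows "F = (SUM be:B. mon be * rh (ka be F))"
proof -
 have "rh (ka be F) = (SUM mu:ks F. Const (lk F mu) * (if Y mu = be then mon (ext (X mu)) else 0))" for be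
  unfolding ka_def Zop_def rh.sum rh.mult
  by (rule sum.cong) (simp_all add: rh_mon rh.zero rh_Const X_keys)
 hence "(SUM be:B. mon be * rh (ka be F)) = (SUM be:B. SUM mu:ks F. if be = Y mu then sg mu (lk F mu) else 0)"
  by (auto simp: sum_distrib_left sg_eq split mult.left_commute[of "mon _"] simp flip: mon_add intro!: sum.cong)
 also have "... = (SUM mu:ks F. SUM be:B. if be = Y mu then sg mu (lk F mu) else 0)" by (rule sum.swap)
 also have "... = (SUM mu:ks F. sg mu (lk F mu))" by (rule sum.cong) (use B in auto)
 finally show ?thesis by (simp add: sum_sg)
qed

text \<open>Monomials in the generators of the Stanley--Reisner ideal provide an explicit splitting of the
  free module on the whole ideal.\<close>

definition quo :: "'v cpoly => 'v set => 'v cpoly"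
 where "quo f s = Zop (%mu. if ks mu = s then mon (mu - ind s) else 0) f"

text \<open>Turns a relation between arbitrary elements of the Stanley--Reisner ideal of K into one
  between the monomial generators of the join, along the splitting by \<open>quo\<close>.\<close>

definition push :: "('v cpoly \<Rightarrow>\<^sub>0 'v cpoly) => 'n mon => 'n cpoly"
 where "push R g = (if g:Gs then rcomb rh (%f. rh (quo f (ks (X g)))) R else 0)"

lemma X_gen: "s <= \<Union>K ==> X (ext (ind s)) = ind s"
 by (simp add: X_ext keys_ind)

lemma Gs_eq: "g:Gs ==> g = ext (ind (ks (X g))) & ks (X g) <= \<Union>K & ks (X g) ~: K"
proof -
 assume "g:Gs"
 then obtain s where s: "g = ext (ind s)" "s <= \<Union>K" "s ~: K" unfolding Gs_def by blast
 have "ks (X g) = s" unfolding s(1) X_gen[OF s(2)] by (simp add: keys_ind)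
 thus ?thesis using s by simp
qed

lemma quo_sum:
 assumes f: "f:SR_ideal K"
 shows "(SUM g:Gs. rh (quo f (ks (X g))) * mon g) = rh f"
proof -
 have inner: "(SUM g:Gs. if ks mu = ks (X g) then rh (mon (mu - ind (ks (X g)))) * mon g else 0) = rh (mon mu)"
  if mu: "ks mu ~: K" for mu
 proof (cases "ks mu <= \<Union>K")
  case True
  let ?g = "ext (ind (ks mu))"
  have g: "?g:Gs" unfolding Gs_def using True mu by blast
  have eq: "(ks mu = ks (X g)) = (g = ?g)" if "g:Gs" for g
   using Gs_eq[OF that] X_gen[OF True] by (metis keys_ind finite_keys)
  have "mu = (mu - ind (ks mu)) + ind (ks mu)"
   by (rule pm_eqI) (auto simp: lk_add lk_minus lk_ind keysI)
  hence "rh (mon mu) = rh (mon (mu - ind (ks mu))) * rh (mon (ind (ks mu)))" by (metis mon_add rh.mult)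
  also have "rh (mon (ind (ks mu))) = mon ?g" using True by (simp add: rh_mon keys_ind)
  finally have "(SUM g:Gs. if ks mu = ks (X g) then rh (mon (mu - ind (ks (X g)))) * mon g else 0) =
    (SUM g:Gs. if g = ?g then rh (mon mu) else 0)"
   by (intro sum.cong refl) (use eq X_gen[OF True] in "auto simp: keys_ind")
  thus ?thesis using g finite_Gs by simp
 next
  case False
  hence "ks mu ~= ks (X g)" for g using X_keys by blast
  thus ?thesis using False by (simp add: rh_mon)
 qed
 have "(SUM g:Gs. rh (quo f (ks (X g))) * mon g) =
   (SUM g:Gs. SUM mu:ks f. Const (lk f mu) * (if ks mu = ks (X g) then rh (mon (mu - ind (ks (X g)))) * mon g else 0))"
  unfolding quo_def Zop_def rh.sum rh.mult sum_distrib_right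
  by (intro sum.cong refl) (simp add: rh.zero rh_Const)
 also have "... = (SUM mu:ks f. SUM g:Gs. Const (lk f mu) * (if ks mu = ks (X g) then rh (mon (mu - ind (ks (X g)))) * mon g else 0))"
  by (rule sum.swap)
 also have "... = (SUM mu:ks f. Const (lk f mu) * rh (mon mu))"
  unfolding sum_distrib_left[symmetric] by (intro sum.cong refl) (use f inner in "auto simp: SR_K keysI")
 also have "... = rh f" by (subst (3) sum_sg[symmetric]) (simp add: rh.sum rh_single)
 finally show ?thesis .
qed

lemma comb_push: "ks R <= SR_ideal K ==> comb (push R) mon = rh (rcomb (%x. x) (%f. f) R)"
proof -
 assume R: "ks R <= SR_ideal K"
 have "comb (push R) mon = (SUM g:Gs. SUM f:ks R. rh (lk R f) * (rh (quo f (ks (X g))) * mon g))"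
  by (simp add: comb_def push_def rcomb_def sum_distrib_right mult.assoc)
 also have "... = (SUM f:ks R. SUM g:Gs. rh (lk R f) * (rh (quo f (ks (X g))) * mon g))" by (rule sum.swap)
 also have "... = (SUM f:ks R. rh (lk R f) * rh f)"
  unfolding sum_distrib_left[symmetric] by (intro sum.cong refl) (use R quo_sum in auto)
 finally show ?thesis by (simp add: rcomb_def rh.sum rh.mult)
qed

lemma push_add: "push (R + S) = (%g. push R g + push S g)" and push_minus: "push (R - S) = (%g. push R g - push S g)"
 and push_smul: "push (smul c R) = (%g. rh c * push R g)" and push_0: "push 0 = (%g. 0)"
 by (auto simp: push_def rh.rcomb_add rh.rcomb_minus rh.rcomb_smul)

lemma push_single: "push (sg f a) = (%g. if g:Gs then rh a * rh (quo f (ks (X g))) else 0)"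
 by (auto simp: push_def rh.rcomb_single)

lemma relation_module_iff: "(R:relation_module I) = (ks R <= I & rcomb (%x. x) (%f. f) R = 0)"
 by (simp add: relation_module_def rcomb_def)

lemma push_rels: "R:relation_module (SR_ideal K) ==> push R:rels"
 unfolding relation_module_iff by (simp add: rels_def comb_push rh.zero)

text \<open>Joining with a simplex adjoins free variables, so T2 is only tensored with a polynomial
  ring. Concretely a cocycle is pulled back along \<open>push\<close>, expanded in the simplex
  coordinates, trivialized coefficient by coefficient and reassembled.\<close>

lemma T2_vanishes_join:
 assumes T2: "T2 (SR_ideal K) = {T2_coboundaries (SR_ideal K)}"
 shows T2_vanishes
 unfolding T2_vanishes_def
proof (intro allI impI)
 fix Ph :: "('n mon => 'n cpoly) => 'n cpoly"
 assume "ALL r:rels. ALL s:rels. nonstdp (Ph (%e. r e + s e) - Ph r - Ph s)"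
  and "ALL q. ALL r:rels. nonstdp (Ph (%e. q * r e) - q * Ph r)"
  and "ALL g:Gs. ALL g':Gs. nonstdp (Ph (koszul_rel g g'))"
 hence add: "!!r s. r:rels ==> s:rels ==> nonstdp (Ph (%e. r e + s e) - Ph r - Ph s)"
  and mult: "!!q r. r:rels ==> nonstdp (Ph (%e. q * r e) - q * Ph r)"
  and koszul: "!!g g'. g:Gs ==> g':Gs ==> nonstdp (Ph (koszul_rel g g'))" by blast+
 let ?I = "SR_ideal K"
 note I = SR_K_ideal
 have zero: "(%e. 0):rels & nonstdp (Ph (%e. 0))"
 proof -
  have z: "(%e. 0):rels" by (simp add: rels_def comb_def)
  thus ?thesis using mult[OF z, of 0] by simp
 qed
 have add': "(%e. r e + s e):rels & nonstdp (Ph (%e. r e + s e))"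
  if "r:rels & nonstdp (Ph r)" "s:rels & nonstdp (Ph s)" for r s
  using that rels_add nonstdp_add[OF nonstdp_add[OF add[of r s], of "Ph r"], of "Ph s"] by (auto simp: alg)
 have mult': "(%e. q * r e):rels & nonstdp (Ph (%e. q * r e))" if "r:rels & nonstdp (Ph r)" for q r
  using that rels_mult nonstdp_add[OF mult[of r q] nonstdp_mult[of "Ph r" q]] by simp
 have sum': "(%e. SUM a:A. q a * r a e):rels & nonstdp (Ph (%e. SUM a:A. q a * r a e))"
  if "finite A" "!!a. a:A ==> r a:rels & nonstdp (Ph (r a))" for A :: "('n mon \<times> 'n mon) set" and q r
  using that
 proof (induction A rule: finite_induct)
  case (insert a A)
  thus ?case using add'[OF mult'[of "r a" "q a"]] by simp
 qed (use zero in simp)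
 have kos: "push R:rels & nonstdp (Ph (push R))" if "R:koszul_relations ?I" for R
  using that unfolding koszul_relations_def
 proof (induction R rule: sm.span_induct_alt)
  case base
  show ?case using zero by (simp add: push_0)
 next
  case (step c x y)
  then obtain f g where fg: "x = sg g f - sg f g" "f:?I" "g:?I" by blast
  \<comment> \<open>The push of a Koszul relation of f and g is a combination of the Koszul
    relations of generators, with the products of components of f and g as coefficients.\<close>
  define q where "q = (%(s, t). rh (quo f (ks (X s))) * rh (quo g (ks (X t))))"
  have "push x = (%e. SUM a:Gs \<times> Gs. q a * koszul_rel (fst a) (snd a) e)"
  proof
   fix e show "push x e = (SUM a:Gs \<times> Gs. q a * koszul_rel (fst a) (snd a) e)"
   proof (cases "e:Gs")
    case False
    hence "(SUM a:Gs \<times> Gs. q a * koszul_rel (fst a) (snd a) e) = 0"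
    by (intro sum.neutral) (auto simp: koszul_rel_def)
    thus ?thesis using False by (simp add: fg(1) push_minus push_single)
   next
    case True
    let ?a = "%s. rh (quo f (ks (X s)))" and ?b = "%s. rh (quo g (ks (X s)))"
    have "(SUM a:Gs \<times> Gs. q a * koszul_rel (fst a) (snd a) e) =
    (SUM s:Gs. SUM t:Gs. (if e = t then ?a s * mon s * ?b e else 0) - (if e = s then ?a e * (?b t * mon t) else 0))"
    unfolding sum.cartesian_product by (rule sum.cong) (auto simp: q_def koszul_rel_def alg)
    also have "... = (SUM s:Gs. ?a s * mon s * ?b e) - (SUM s:Gs. if e = s then ?a e * (SUM t:Gs. ?b t * mon t) else 0)"
    unfolding sum_subtractf[symmetric]
    by (intro sum.cong refl) (use True finite_Gs in "auto simp: sum_subtractf sum_distrib_left")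
    also have "... = rh f * ?b e - ?a e * rh g"
    using True finite_Gs quo_sum[OF fg(2)] quo_sum[OF fg(3)] by (simp flip: sum_distrib_right)
    finally show ?thesis using True by (simp add: fg(1) push_minus push_single mult.commute)
   qed
  qed
  moreover have "koszul_rel (fst a) (snd a):rels & nonstdp (Ph (koszul_rel (fst a) (snd a)))" if "a:Gs \<times> Gs" for a
   using that koszul koszul_rels by auto
  ultimately have "push x:rels & nonstdp (Ph (push x))"
   using sum'[of "Gs \<times> Gs" "%a. koszul_rel (fst a) (snd a)" q] finite_Gs by simp
  from add'[OF mult'[OF this, of "rh c"] step(2)] show ?case by (simp add: push_add push_smul)
 qed
 have "EX c. ALL r:relation_module ?I. ka be (Ph (push r)) - rcomb (%x. x) c r:?I" for be
  unfolding rcomb_def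
 proof (rule T2_trivialD[OF T2 _ I])
  show "(%r. ka be (Ph (push r))):T2_cocycles ?I"
   unfolding T2_cocycles_def
  proof (intro CollectI conjI ballI allI)
   fix r s assume "r:relation_module ?I" "s:relation_module ?I"
   hence "ka be (Ph (push (r + s)) - Ph (push r) - Ph (push s)):?I"
    unfolding push_add by (intro ka_nonstdp add push_rels)
   thus "ka be (Ph (push (r + s))) - (ka be (Ph (push r)) + ka be (Ph (push s))):?I"
    by (simp add: ka_def Zop_minus Zop_add diff_diff_eq)
  next
   fix c r assume "r:relation_module ?I"
   hence "ka be (Ph (push (smul c r)) - rh c * Ph (push r)):?I"
    unfolding push_smul by (intro ka_nonstdp mult push_rels)
   from iadd[OF I this ka_mult[of be c "Ph (push r)"]]
   show "ka be (Ph (push (smul c r))) - c * ka be (Ph (push r)):?I"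
    by (simp add: ka_def Zop_minus)
  next
   fix r assume "r:koszul_relations ?I"
   thus "ka be (Ph (push r)):?I" using kos by (intro ka_nonstdp) blast
  qed
 qed
 hence "EX c. ALL be. ALL r:relation_module ?I. ka be (Ph (push r)) - rcomb (%x. x) (c be) r:?I"
  by (intro choice) blast
 then obtain c where c: "ALL be. ALL r:relation_module ?I. ka be (Ph (push r)) - rcomb (%x. x) (c be) r:?I" ..
 \<comment> \<open>There is a trivialization for every simplex monomial, but the finitely many pair
   relations involve only finitely many of them, so a finite sum can be formed.\<close>
 define B where "B = (UN (g, g'):Gs \<times> Gs. Y ` ks (Ph (pair_rel g g')))"
 have "finite B" unfolding B_def using finite_Gs by auto
 define C where "C g = (SUM be:B. mon be * rh (c be (mon (ind (ks (X g))))))" for g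
 have "nonstdp (Ph (pair_rel g g') - comb (pair_rel g g') C)" if g: "g:Gs" "g':Gs" for g g'
 proof -
  let ?s = "ks (X g)" and ?s' = "ks (X g')"
  have s: "g = ext (ind ?s)" "?s <= \<Union>K" "?s ~: K" "g' = ext (ind ?s')" "?s' <= \<Union>K" "?s' ~: K"
   using Gs_eq[OF g(1)] Gs_eq[OF g(2)] by blast+
  have inI: "mon (ind s):?I" if "s ~: K" for s using that by (simp add: SR_K lk_mon keys_ind)
  define a where "a = ind ?s' - ind ?s"
  define b where "b = ind ?s - ind ?s'"
  have sub: "ks (mu - nu) <= ks mu" for mu nu :: "'v mon" by (auto simp: keysI lk_minus)
  have ext_diff: "ext (mu - nu) = ext mu - ext nu" if "ks mu <= \<Union>K" "ks nu <= \<Union>K" for mu nu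
  proof (rule pm_eqI)
   have d: "ks (mu - nu) <= \<Union>K" using that sub by blast
   fix i show "lk (ext (mu - nu)) i = lk (ext mu - ext nu) i"
   proof (cases "i:xv ` \<Union>K")
    case True
    then obtain v where "i = xv v" "v:\<Union>K" by blast
    thus ?thesis by (simp only: lk_minus lk_ext[OF d] lk_ext[OF that(1)] lk_ext[OF that(2)])
   next
    case False
    thus ?thesis by (simp add: lk_minus lk_ext_0[OF d False] lk_ext_0[OF that(1) False])
   qed
  qed
  have i: "ks (ind ?s) <= \<Union>K" "ks (ind ?s') <= \<Union>K" using s by (simp_all add: keys_ind)
  have ab: "rh (mon a) = mon (g' - g)" "rh (mon b) = mon (g - g')"
  proof -
   have k: "ks a <= \<Union>K" "ks b <= \<Union>K" unfolding a_def b_def using i sub by blast+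
   have "ext a = g' - g" "ext b = g - g'"
    unfolding a_def b_def ext_diff[OF i(2,1)] ext_diff[OF i] using s(1,4) by simp_all
   thus "rh (mon a) = mon (g' - g)" "rh (mon b) = mon (g - g')" using k by (simp_all only: rh_mon if_True)
  qed
  \<comment> \<open>A relation in the large free module over the whole ideal whose push is the given
    pair relation.\<close>
  define R where "R = sg (mon (ind ?s)) (mon a) - (sg (mon (ind ?s')) (mon b) :: 'v cpoly \<Rightarrow>\<^sub>0 'v cpoly)"
  have rR: "rcomb (%x. x) f R = mon a * f (mon (ind ?s)) - mon b * f (mon (ind ?s'))" for f :: "'v cpoly => 'v cpoly"
   by (simp only: R_def rhom.rcomb_minus[OF rhom_id] rhom.rcomb_single[OF rhom_id])
  have "R:relation_module ?I" unfolding relation_module_iff rR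
  proof
   show "ks R <= ?I" using inI s unfolding R_def by (auto simp: keysI lk_minus lk_sg split: if_splits)
   have "a + ind ?s = b + ind ?s'" unfolding a_def b_def
    by (rule pm_eqI) (simp add: lk_add lk_minus)
   thus "mon a * mon (ind ?s) - mon b * mon (ind ?s') = (0 :: 'v cpoly)" by (simp flip: mon_add)
  qed
  moreover have "push R = pair_rel g g'"
  proof
   fix t
   have q: "quo (mon (ind u)) w = (if u = w then 1 else 0)" for u w
    by (simp add: quo_def Zop_mon keys_ind)
   have eq: "(ks (X h) = ks (X t)) = (t = h)" if "t:Gs" "h:Gs" for h using Gs_eq[OF that(1)] Gs_eq[OF that(2)] by metis
   show "push R t = pair_rel g g' t"
   proof (cases "t:Gs")
    case True
    show ?thesis using True
    by (simp add: R_def push_minus push_single q eq[OF True g(1)] eq[OF True g(2)] ab rh.zero rh.one pair_rel_def)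
   next
    case False
    hence "t ~= g" "t ~= g'" using g by blast+
    thus ?thesis using False by (simp add: R_def push_minus push_single pair_rel_def)
   qed
  qed
  ultimately have *: "ka be (Ph (pair_rel g g')) - (mon a * c be (mon (ind ?s)) - mon b * c be (mon (ind ?s'))):?I" for be
   using c unfolding rR[symmetric] by metis
  have rec: "Ph (pair_rel g g') = (SUM be:B. mon be * rh (ka be (Ph (pair_rel g g'))))"
   by (rule ka_recover[OF \<open>finite B\<close>]) (use g in "auto simp: B_def")
  have "comb (pair_rel g g') C = (SUM be:B. mon be * rh (mon a * c be (mon (ind ?s)) - mon b * c be (mon (ind ?s'))))"
   unfolding comb_pair[OF g] C_def sum_distrib_left
   by (simp add: rh.diff rh.mult ab sum_subtractf[symmetric] alg)
  hence "Ph (pair_rel g g') - comb (pair_rel g g') C =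
   (SUM be:B. mon be * rh (ka be (Ph (pair_rel g g')) - (mon a * c be (mon (ind ?s)) - mon b * c be (mon (ind ?s')))))"
   by (subst rec) (simp add: rh.diff right_diff_distrib sum_subtractf)
  also have "nonstdp ..." by (intro nonstdp_sum nonstdp_mult rh_SR *)
  finally show ?thesis .
 qed
 thus "EX c. ALL g:Gs. ALL g':Gs. nonstdp (Ph (pair_rel g g') - comb (pair_rel g g') c)" by blast
qed

end

section \<open>Unimodular regular triangulations\<close>

lemma vertex_simplex:
 assumes "EX n. n simplex S"
 shows "finite {v. v extreme_point_of S} & ~ affine_dependent {v. v extreme_point_of S} & S = convex hull {v. v extreme_point_of S}"
proof -
 obtain C where C: "finite C" "~ affine_dependent C" "S = convex hull C" using assms unfolding simplex by blast
 have "{v. v extreme_point_of S} = C" unfolding C(3) by (simp add: extreme_point_of_convex_hull_affine_independent C(2))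
 thus ?thesis using C by simp
qed

lemma affine_independent_coeffs:
 assumes "finite C" "~ affine_dependent C" "sum a C = sum b C" "(SUM v:C. a v *\<^sub>R v) = (SUM v:C. b v *\<^sub>R v)" "v:C"
 shows "a v = b v"
proof (rule ccontr)
 assume "a v ~= b v"
 moreover have "(SUM v:C. a v - b v) = 0" "(SUM v:C. (a v - b v) *\<^sub>R v) = 0"
  using assms(3,4) by (simp_all add: sum_subtractf scaleR_left_diff_distrib)
 ultimately have "EX U. sum U C = 0 & (EX v:C. U v ~= 0) & (SUM v:C. U v *\<^sub>R v) = 0"
  using assms(5) by (intro exI[of _ "%v. a v - b v"]) auto
 thus False using assms(2) affine_dependent_explicit_finite[OF assms(1)] by blast
qed

lemma difference_lattice_coeffs:
 assumes "finite C" "x:difference_lattice C"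
 shows "EX z. (SUM v:C. z v :: int) = 0 & x = (SUM v:C. of_int (z v) *\<^sub>R v)"
proof -
 interpret I: module "%(c::int) v. of_int c *\<^sub>R (v :: real ^ 'a)"
  by unfold_locales (simp_all add: alg)
 show ?thesis using assms(2) unfolding difference_lattice_def
 proof (induction x rule: I.span_induct_alt)
  case base
  show ?case by (intro exI[of _ "%_. 0"]) simp
 next
  case (step c x y)
  then obtain z where z: "(SUM v:C. z v :: int) = 0" "y = (SUM v:C. of_int (z v) *\<^sub>R v)" by blast
  obtain u w where uw: "x = u - w" "u:C" "w:C" using step(1) by blast
  have e: "(SUM v:C. (if v = u then c else 0) - (if v = w then c else 0)) = 0"
   using uw assms(1) by (simp add: sum_subtractf)
  have "(SUM v:C. of_int ((if v = u then c else 0) - (if v = w then c else 0)) *\<^sub>R v) =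
    (SUM v:C. (if v = u then of_int c *\<^sub>R v else 0) - (if v = w then of_int c *\<^sub>R v else 0))"
   by (rule sum.cong) (auto simp: alg)
  also have "... = of_int c *\<^sub>R x" using uw(2,3) assms(1) by (simp add: uw(1) sum_subtractf scaleR_right_diff_distrib)
  finally have "of_int c *\<^sub>R x + y = (SUM v:C. of_int ((if v = u then c else 0) - (if v = w then c else 0) + z v) *\<^sub>R v)"
   by (simp add: z(2) scaleR_left_distrib sum.distrib)
  thus ?case using e z(1)
   by (intro exI[of _ "%v. (if v = u then c else 0) - (if v = w then c else 0) + z v"]) (simp add: sum.distrib)
 qed
qed

lemma normalized_volume_1D:
 assumes "normalized_volume s = 1" "x:lattice" "x:span {u - v | u v. u:s & v:s}"
 shows "x:difference_lattice s"
proof -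
 interpret I: module "%(c::int) v. of_int c *\<^sub>R (v :: real ^ 'a)"
  by unfold_locales (simp_all add: alg)
 let ?f = "%w. {w + l | l. l:difference_lattice s}"
 let ?A = "lattice Int span {u - v | u v. u:s & v:s}"
 obtain c where c: "?f ` ?A = {c}" using assms(1) unfolding normalized_volume_def by (auto simp: card_1_singleton_iff)
 have "?f 0:?f ` ?A" by (rule imageI) (simp add: lattice_def span_zero)
 moreover have "?f x:?f ` ?A" by (rule imageI) (use assms(2,3) in simp)
 ultimately have "?f x = ?f 0" unfolding c by simp
 moreover have "x:?f x" using I.span_zero by (auto simp: difference_lattice_def)
 ultimately have "x:?f 0" by simp
 thus ?thesis by simp
qed

lemma lattice_sum: "(!!i. i:A ==> f i:lattice) ==> (SUM i:A. of_nat (k i) *\<^sub>R f i):lattice"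
 by (auto simp: lattice_def intro!: Ints_sum Ints_mult)

lemma lattice_diff: "x:lattice ==> y:lattice ==> x - y:lattice"
 by (auto simp: lattice_def)

section \<open>Lattice points in unimodular simplices\<close>

locale toric_triangulation =
 fixes Q :: "(real ^ 'd::finite) set" and T h
 assumes poly: "lattice_polytope Q" and tri: "triangulates T Q"
  and heights: "vertex_complex T = {{u:Q Int lattice. c \<bullet> u + b = h u} | c b. ALL u:Q Int lattice. c \<bullet> u + b <= h u}"
  and unimod: "unimodular T"
begin

abbreviation "VC == vertex_complex T"

lemma convex_Q: "convex Q"
 using poly unfolding lattice_polytope_def by auto

lemma VC_props:
 assumes "C:VC" shows "finite C" "~ affine_dependent C" "C <= Q Int lattice" "convex hull C <= Q"
proof -
 obtain S where S: "S:T" "C = {v. v extreme_point_of S}" using assms unfolding vertex_complex_def by blast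
 have "EX n. n simplex S" using tri S(1) unfolding triangulates_def simplicial_complex_def by blast
 from vertex_simplex[OF this] have v: "finite C" "~ affine_dependent C" "S = convex hull C" unfolding S(2) by blast+
 show "finite C" "~ affine_dependent C" by (fact v)+
 show "convex hull C <= Q" using v(3) S(1) tri unfolding triangulates_def by blast
 show "C <= Q Int lattice" using assms heights by auto
qed

lemma finite_VC: "finite VC"
 unfolding vertex_complex_def using tri by (intro finite_imageI) (simp add: triangulates_def simplicial_complex_def)

lemma cover:
 assumes "p:Q"
 shows "EX C:VC. p:convex hull C & normalized_volume C = 1"
proof -
 obtain S where S: "S:T" "p:S" using assms tri unfolding triangulates_def by blast
 have "EX n. n simplex S" using tri S(1) unfolding triangulates_def simplicial_complex_def by blast
 hence p: "p:convex hull {v. v extreme_point_of S}" using vertex_simplex S(2) by blast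
 have "{v. v extreme_point_of S}:VC" using S(1) unfolding vertex_complex_def by blast
 then obtain C where C: "C:VC" "{v. v extreme_point_of S} <= C" "!!r. r:VC ==> C <= r ==> C = r"
  using finite_has_maximal2[OF finite_VC] by metis
 have "normalized_volume C = 1" using unimod C unfolding unimodular_def by blast
 thus ?thesis using C(1,2) p hull_mono[OF C(2)] by blast
qed

text \<open>P/d lies in a simplex of normalized volume one. Its barycentric coordinates times d
  agree, by affine independence, with the integers from the expansion of P - d v0 in the difference
  lattice, and are therefore natural numbers.\<close>

lemma unimodular_decomposition:
 assumes P: "P:lattice" and d: "d > 0" and PQ: "(1 / real d) *\<^sub>R P:Q"
 shows "EX C:VC. EX k. (SUM v:C. k v) = d & P = (SUM v:C. of_nat (k v) *\<^sub>R v)"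
proof -
 obtain C where C: "C:VC" "(1 / real d) *\<^sub>R P:convex hull C" "normalized_volume C = 1" using cover[OF PQ] by blast
 note fin = VC_props(1)[OF C(1)] and ind = VC_props(2)[OF C(1)] and lat = VC_props(3)[OF C(1)]
 obtain a where a: "ALL x:C. 0 <= a x" "sum a C = 1" "(SUM x:C. a x *\<^sub>R x) = (1 / real d) *\<^sub>R P"
  using C(2) unfolding convex_hull_finite[OF fin] by blast
 have "C ~= {}" using a(2) by auto
 then obtain v0 where v0: "v0:C" by blast
 have "real d *\<^sub>R ((1 / real d) *\<^sub>R P) = P" using d by simp
 hence P2: "P = (SUM x:C. (real d * a x) *\<^sub>R x)" unfolding a(3)[symmetric] by (simp add: scaleR_right.sum)
 have "P - real d *\<^sub>R v0 = (SUM x:C. (real d * a x) *\<^sub>R (x - v0))"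
  using a(2) by (simp add: P2 scaleR_right_diff_distrib sum_subtractf flip: scaleR_left.sum sum_distrib_left)
 also have "...:span {u - v | u v. u:C & v:C}"
  using v0 by (intro span_sum span_scale span_base) blast
 finally have "P - real d *\<^sub>R v0:span {u - v | u v. u:C & v:C}" .
 moreover have "P - real d *\<^sub>R v0:lattice"
  using lattice_sum[of "{v0}" "%x. x" "%_. d"] lat v0 by (intro lattice_diff P) auto
 ultimately have "P - real d *\<^sub>R v0:difference_lattice C" by (intro normalized_volume_1D[OF C(3)])
 then obtain z where z: "(SUM v:C. z v :: int) = 0" "P - real d *\<^sub>R v0 = (SUM v:C. of_int (z v) *\<^sub>R v)"
  using difference_lattice_coeffs[OF fin] by blast
 define y where "y v = z v + (if v = v0 then int d else 0)" for v
 have y: "(SUM v:C. real_of_int (y v)) = real d"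
 proof -
  have "(SUM v:C. y v) = int d" using z(1) v0 fin by (simp add: y_def sum.distrib)
  thus ?thesis by (metis of_int_of_nat_eq of_int_sum)
 qed
 have "(SUM v:C. of_int (y v) *\<^sub>R v) = (SUM v:C. of_int (z v) *\<^sub>R v) + (SUM v:C. if v = v0 then real d *\<^sub>R v else 0)"
  unfolding sum.distrib[symmetric] by (rule sum.cong) (auto simp: y_def alg)
 also have "... = P" using z(2) v0 fin by (simp add: alg)
 finally have yP: "(SUM v:C. real_of_int (y v) *\<^sub>R v) = P" .
 have eq: "real_of_int (y v) = real d * a v" if "v:C" for v
  by (rule affine_independent_coeffs[OF fin ind _ _ that])
   (use y yP P2 a(2) in "simp_all flip: sum_distrib_left")
 have pos: "y v >= 0" if "v:C" for v
 proof -
  have "real d * a v >= 0" using a(1) that by simp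
  thus ?thesis using eq[OF that] by linarith
 qed
 have 1: "(SUM v:C. nat (y v)) = d"
 proof -
  have "real (SUM v:C. nat (y v)) = (SUM v:C. real_of_int (y v))" using pos by (simp add: of_nat_nat)
  thus ?thesis using y by linarith
 qed
 have 2: "P = (SUM v:C. of_nat (nat (y v)) *\<^sub>R v)" using pos by (simp add: yP[symmetric])
 show ?thesis using C(1) 1 2 by (intro bexI[of _ C] exI[of _ "%v. nat (y v)"]) simp_all
qed

lemma lattice_points: "\<Union>VC = Q Int lattice"
proof
 show "\<Union>VC <= Q Int lattice" using VC_props(3) by blast
 show "Q Int lattice <= \<Union>VC"
 proof
  fix p assume "p:Q Int lattice"
  then obtain C k where C: "C:VC" "(SUM v:C. k v :: nat) = 1" "p = (SUM v:C. of_nat (k v) *\<^sub>R v)"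
   using unimodular_decomposition[of p 1] by auto
  have fin: "finite C" by (rule VC_props(1)[OF C(1)])
  obtain v where v: "v:C" "k v = 1" "ALL u:C. u ~= v --> k u = 0" using C(2) unfolding sum_eq_1_iff[OF fin] by auto
  have "p = (SUM u:C. if u = v then v else 0)" unfolding C(3) by (rule sum.cong) (use v in auto)
  thus "p:\<Union>VC" using v(1) fin C(1) by auto
 qed
qed

end

text \<open>Together with \<open>mdeg\<close> this is the exponent of the image of a monomial under
  the toric parametrization.\<close>

definition timg :: "('n::finite => real ^ 'd::finite) => 'n mon => real ^ 'd"
 where "timg ta mu = (SUM i:UNIV. of_nat (lk mu i) *\<^sub>R ta i)"

lemma timg_add: "timg ta (mu + nu) = timg ta mu + timg ta nu"
 by (simp add: timg_def lk_add scaleR_left_distrib sum.distrib)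

lemma mdeg_UNIV: "mdeg mu = (SUM i:UNIV. lk mu i)" for mu :: "'n::finite \<Rightarrow>\<^sub>0 nat"
 by (rule mdeg_superset) auto

text \<open>Real heights are scaled until every gap reaches the degree, shifted to be nonnegative
  and rounded down. Equality of degrees cancels the shift, and rounding loses strictly less than the
  degree.\<close>

lemma integer_weights:
 fixes H :: "'n::finite => real"
 assumes G: "finite G" and lt: "!!g. g:G ==> (SUM i:UNIV. real (lk (nu g) i) * H i) < (SUM i:UNIV. real (lk g i) * H i)"
  and deg: "!!g. g:G ==> mdeg (nu g) = mdeg g"
 shows "EX w :: 'n => nat. ALL g:G. (SUM i:UNIV. lk (nu g) i * w i) < (SUM i:UNIV. lk g i * w i)"
proof -
 let ?H = "%mu. (SUM i:UNIV. real (lk mu i) * H i)"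
 have "EX M. ALL g:G. real (mdeg g) / (?H g - ?H (nu g)) <= M"
  using bdd_above_finite[of "(%g. real (mdeg g) / (?H g - ?H (nu g))) ` G"] G unfolding bdd_above_def by blast
 then obtain M where M: "!!g. g:G ==> real (mdeg g) / (?H g - ?H (nu g)) <= M" by blast
 obtain s where s: "!!i. \<bar>M * H i\<bar> <= s"
  using bdd_above_finite[of "(%i. \<bar>M * H i\<bar>) ` UNIV"] unfolding bdd_above_def by auto
 define w where "w i = nat \<lfloor>M * H i + s\<rfloor>" for i
 have w: "real (w i) <= M * H i + s" "real (w i) > M * H i + s - 1" for i
  using s[of i] unfolding w_def by linarith+
 have "(SUM i:UNIV. lk (nu g) i * w i) < (SUM i:UNIV. lk g i * w i)" if g: "g:G" for g
 proof -
  have pos: "mdeg g > 0"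
  proof (rule ccontr)
   assume "~ mdeg g > 0"
   hence "g = 0" "nu g = 0" using deg[OF g] by auto
   thus False using lt[OF g] by simp
  qed
  have "real (SUM i:UNIV. lk (nu g) i * w i) <= (SUM i:UNIV. real (lk (nu g) i) * (M * H i + s))"
   unfolding of_nat_sum of_nat_mult by (intro sum_mono mult_left_mono w) simp
  also have "... = M * ?H (nu g) + s * real (mdeg (nu g))"
   unfolding mdeg_UNIV by (simp add: alg sum.distrib sum_distrib_left)
  finally have 1: "real (SUM i:UNIV. lk (nu g) i * w i) <= M * ?H (nu g) + s * real (mdeg g)" unfolding deg[OF g] .
  have "(SUM i:UNIV. real (lk g i) * (M * H i + s - 1)) < real (SUM i:UNIV. lk g i * w i)"
   unfolding of_nat_sum of_nat_mult
  proof (rule sum_strict_mono_ex1)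
   show "ALL i:UNIV. real (lk g i) * (M * H i + s - 1) <= real (lk g i) * real (w i)"
    using less_imp_le[OF w(2)] by (intro ballI mult_left_mono) auto
   obtain i where "lk g i ~= 0" using pos by (metis mdeg_0 less_irrefl lookup_zero pm_eqI)
   thus "EX i:UNIV. real (lk g i) * (M * H i + s - 1) < real (lk g i) * real (w i)"
    using w(2)[of i] by (intro bexI[of _ i]) auto
  qed simp
  moreover have "(SUM i:UNIV. real (lk g i) * (M * H i + s - 1)) = M * ?H g + s * real (mdeg g) - real (mdeg g)"
   unfolding mdeg_UNIV by (simp add: alg sum.distrib sum_distrib_left sum_subtractf)
  moreover have "real (mdeg g) <= M * (?H g - ?H (nu g))"
   using M[OF g] lt[OF g] by (simp add: pos_divide_le_eq)
  hence "real (mdeg g) <= M * ?H g - M * ?H (nu g)" by (simp add: right_diff_distrib)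
  ultimately have "real (SUM i:UNIV. lk (nu g) i * w i) < real (SUM i:UNIV. lk g i * w i)" using 1 by linarith
  thus ?thesis by linarith
 qed
 thus ?thesis by blast
qed

locale toric_join = join_complex K m si + toric_triangulation Q T h
 for K :: "('v::finite) set set" and m and si :: "'v + nat => 'n::finite" and Q :: "(real ^ 'd::finite) set" and T h +
 assumes iso: "complex_iso (vertex_complex T) (join K (full_simplex m))"
begin

lemma labelling: "EX ta. bij_betw ta UNIV (Q Int lattice) & (ALL S. S:L \<longleftrightarrow> ta ` S:VC)"
proof -
 obtain g where g: "bij_betw g (\<Union>VC) (\<Union>(join K (full_simplex m)))" "join K (full_simplex m) = (%s. g ` s) ` VC"
  using iso unfolding complex_iso_def by blast
 define e where "e = si \<circ> g"
 have e: "bij_betw e (Q Int lattice) UNIV"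
  using bij_betw_trans[OF g(1) si] by (simp add: e_def lattice_points)
 define ta where "ta = inv_into (Q Int lattice) e"
 have ta: "bij_betw ta UNIV (Q Int lattice)" unfolding ta_def by (rule bij_betw_inv_into[OF e])
 have 1: "ta (e p) = p" if "p:Q Int lattice" for p unfolding ta_def
  by (rule inv_into_f_f[OF bij_betw_imp_inj_on[OF e] that])
 have 2: "e (ta i) = i" for i unfolding ta_def by (rule f_inv_into_f) (use e in "simp add: bij_betw_def")
 have Le: "L = (%C. e ` C) ` VC" unfolding L_def g(2) e_def by (simp add: image_image image_comp)
 have "(S:L) = (ta ` S:VC)" for S
 proof
  assume "S:L"
  then obtain C where C: "C:VC" "S = e ` C" unfolding Le by blast
  have "ta ` S = C" unfolding C(2) image_image using 1 VC_props(3)[OF C(1)] by (simp add: subset_iff)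
  thus "ta ` S:VC" using C(1) by simp
 next
  assume "ta ` S:VC"
  moreover have "S = e ` ta ` S" unfolding image_image 2 by simp
  ultimately show "S:L" unfolding Le by blast
 qed
 thus ?thesis using ta by blast
qed

text \<open>The last two clauses say that the nonface ideal is the initial ideal of the toric ideal
  for the weight \<open>w\<close>: standard monomials have distinct images, and each generator has a
  lighter standard companion with the same image.\<close>

lemma toric_data:
 "EX ta (w :: 'n => nat). bij_betw ta UNIV (Q Int lattice) &
  (ALL mu nu. std mu --> std nu --> mdeg mu = mdeg nu --> timg ta mu = timg ta nu --> mu = nu) &
  (ALL g:Gs. EX nu. std nu & mdeg nu = mdeg g & timg ta nu = timg ta g &
   (SUM i:UNIV. lk nu i * w i) < (SUM i:UNIV. lk g i * w i))"
proof -
 obtain ta where ta: "bij_betw ta UNIV (Q Int lattice)" and LV: "!!S. S:L \<longleftrightarrow> ta ` S:VC"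
  using labelling by blast
 have taQ: "ta i:Q Int lattice" for i using ta unfolding bij_betw_def by blast
 have tainj: "ta i = ta j ==> i = j" for i j using ta unfolding bij_betw_def inj_on_def by blast
 let ?H = "%mu. SUM i:UNIV. real (lk mu i) * h (ta i)"
 \<comment> \<open>The affine function that cuts out the face of a standard nu lies below all
   heights. Among monomials of the same degree and image, nu therefore has minimal height, and
   equality forces the support into that face.\<close>
 have height: "?H nu <= ?H mu & (?H nu = ?H mu --> ks mu <= ks nu)"
  if nu: "std nu" and eq: "mdeg mu = mdeg nu" "timg ta mu = timg ta nu" for mu nu
 proof -
  have "ta ` ks nu:VC" using nu unfolding std_iff LV .
  then obtain c b where cb: "ta ` ks nu = {u:Q Int lattice. c \<bullet> u + b = h u}" "ALL u:Q Int lattice. c \<bullet> u + b <= h u"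
   unfolding heights by blast
  define l where "l i = h (ta i) - (c \<bullet> ta i + b)" for i
  have l0: "l i >= 0" for i using cb(2) taQ[of i] by (simp add: l_def)
  have l1: "(l i = 0) = (i:ks nu)" for i
  proof -
   have "(l i = 0) = (ta i:ta ` ks nu)" unfolding cb(1) using taQ[of i] by (auto simp: l_def)
   thus ?thesis using tainj by blast
  qed
  have HL: "?H ka = (SUM i:UNIV. real (lk ka i) * l i) + (c \<bullet> timg ta ka + b * real (mdeg ka))" for ka
  proof -
   have "c \<bullet> timg ta ka = (SUM i:UNIV. real (lk ka i) * (c \<bullet> ta i))" by (simp add: timg_def inner_sum_right)
   moreover have "b * real (mdeg ka) = (SUM i:UNIV. real (lk ka i) * b)" unfolding mdeg_UNIV by (simp add: sum_distrib_left mult.commute)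
   ultimately have "(SUM i:UNIV. real (lk ka i) * l i) + (c \<bullet> timg ta ka + b * real (mdeg ka)) =
    (SUM i:UNIV. real (lk ka i) * l i + (real (lk ka i) * (c \<bullet> ta i) + real (lk ka i) * b))"
    by (simp add: sum.distrib)
   also have "... = ?H ka" by (rule sum.cong) (simp_all add: l_def alg)
   finally show ?thesis by simp
  qed
  have "(SUM i:UNIV. real (lk nu i) * l i) = 0" by (rule sum.neutral) (use l1 in "auto simp: keysI")
  hence d: "?H mu - ?H nu = (SUM i:UNIV. real (lk mu i) * l i)" using HL[of mu] HL[of nu] eq by simp
  have nn: "(SUM i:UNIV. real (lk mu i) * l i) >= 0" using l0 by (intro sum_nonneg) simp
  have "ks mu <= ks nu" if "?H nu = ?H mu"
  proof
   fix i assume i: "i:ks mu"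
   have "(SUM i:UNIV. real (lk mu i) * l i) = 0" using d that by simp
   hence "real (lk mu i) * l i = 0" using l0 sum_nonneg_eq_0_iff[of UNIV "%i. real (lk mu i) * l i"] by simp
   thus "i:ks nu" using i l1 by (simp add: keysI)
  qed
  thus ?thesis using d nn by auto
 qed
 have sep: "mu = nu" if std: "std mu" "std nu" and eq: "mdeg mu = mdeg nu" "timg ta mu = timg ta nu" for mu nu
 proof -
  have "ks mu <= ks nu" using height[OF std(2) eq] height[OF std(1) eq[symmetric]] by linarith
  have C: "ta ` ks nu:VC" using std(2) unfolding std_iff LV .
  note fin = VC_props(1)[OF C] and ind = VC_props(2)[OF C]
  have inj: "inj_on ta (ks nu)" using tainj by (auto simp: inj_on_def)
  define r where "r ka v = real (lk ka (inv_into (ks nu) ta v))" for ka :: "'n mon" and v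
  have r: "r ka (ta i) = real (lk ka i)" if "i:ks nu" for ka i by (simp add: r_def inv_into_f_f[OF inj that])
  have 1: "sum (r ka) (ta ` ks nu) = real (mdeg ka)" "(SUM v:ta ` ks nu. r ka v *\<^sub>R v) = timg ta ka" if "ks ka <= ks nu" for ka
  proof -
   show "sum (r ka) (ta ` ks nu) = real (mdeg ka)"
    unfolding mdeg_superset[OF finite_keys that] by (simp add: sum.reindex[OF inj] r)
   have "(SUM v:ta ` ks nu. r ka v *\<^sub>R v) = (SUM i:ks nu. real (lk ka i) *\<^sub>R ta i)" by (simp add: sum.reindex[OF inj] r)
   also have "... = timg ta ka" unfolding timg_def
    by (rule sum.mono_neutral_left) (use that in "auto simp: keysI")
   finally show "(SUM v:ta ` ks nu. r ka v *\<^sub>R v) = timg ta ka" .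
  qed
  have "r mu v = r nu v" if "v:ta ` ks nu" for v
   by (rule affine_independent_coeffs[OF fin ind _ _ that]) (simp_all only: 1 \<open>ks mu <= ks nu\<close> order_refl eq)
  hence "lk mu i = lk nu i" if "i:ks nu" for i using r[OF that] that by (metis imageI of_nat_eq_iff)
  thus ?thesis using \<open>ks mu <= ks nu\<close> by (intro pm_eqI) (metis keysI subsetD)
 qed
 have "EX nu. std nu & mdeg nu = mdeg g & timg ta nu = timg ta g & ?H nu < ?H g" if ns: "~ std g" for g
 proof -
  have "X 0 = 0" by (rule pm_eqI) (simp add: X_def)
  hence "std 0" by (simp add: std_def K_empty)
  hence d: "mdeg g > 0" using ns by (metis mdeg_eq_0_iff neq0_conv)
  have P: "timg ta g:lattice" unfolding timg_def using taQ by (intro lattice_sum) simp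
  have "(SUM i:UNIV. (real (lk g i) / real (mdeg g)) *\<^sub>R ta i):Q"
  proof (rule convex_sum[OF _ convex_Q])
   show "(SUM i:UNIV. real (lk g i) / real (mdeg g)) = 1"
   proof -
    have "(SUM i:UNIV. real (lk g i) / real (mdeg g)) = real (mdeg g) / real (mdeg g)"
    unfolding sum_divide_distrib[symmetric] of_nat_sum[symmetric] mdeg_UNIV[symmetric] ..
    also have "... = 1" using d by (intro divide_self) linarith
    finally show ?thesis .
   qed
  qed (use taQ in auto)
  hence "(1 / real (mdeg g)) *\<^sub>R timg ta g:Q" by (simp add: timg_def scaleR_right.sum)
  then obtain C k where C: "C:VC" "(SUM v:C. k v) = mdeg g" "timg ta g = (SUM v:C. of_nat (k v) *\<^sub>R v)"
   using unimodular_decomposition[OF P d] by blast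
  define nu where "nu = fpm (%i. if ta i:C then k (ta i) else 0)"
  have CQ: "C <= Q Int lattice" by (rule VC_props(3)[OF C(1)])
  have finQ: "finite (Q Int lattice)" using bij_betw_finite[OF ta] by simp
  have 1: "mdeg nu = mdeg g"
  proof -
   have "mdeg nu = (SUM v:Q Int lattice. if v:C then k v else 0)"
    unfolding mdeg_UNIV nu_def lk_fpm by (rule sum.reindex_bij_betw[OF ta])
   also have "... = (SUM v:C. k v)" using CQ finQ by (simp add: Int_absorb1 flip: sum.inter_restrict)
   finally show ?thesis using C(2) by simp
  qed
  have 2: "timg ta nu = timg ta g"
  proof -
   have "timg ta nu = (SUM v:Q Int lattice. of_nat (if v:C then k v else 0) *\<^sub>R v)"
    unfolding timg_def nu_def lk_fpm by (rule sum.reindex_bij_betw[OF ta])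
   also have "... = (SUM v:Q Int lattice. if v:C then of_nat (k v) *\<^sub>R v else 0)" by (rule sum.cong) auto
   also have "... = (SUM v:C. of_nat (k v) *\<^sub>R v)" using CQ finQ by (simp add: Int_absorb1 flip: sum.inter_restrict)
   finally show ?thesis using C(3) by simp
  qed
  have "{i. ta i:C}:L"
  proof -
   have "ta ` {i. ta i:C} = C"
   proof
    show "C <= ta ` {i. ta i:C}"
    proof
    fix v assume v: "v:C"
    hence "v:range ta" using CQ ta unfolding bij_betw_def by blast
    thus "v:ta ` {i. ta i:C}" using v by blast
    qed
   qed blast
   thus ?thesis using C(1) LV by simp
  qed
  hence 3: "std nu" unfolding std_iff by (rule L_sub) (auto simp: nu_def keysI split: if_splits)
  have "?H nu ~= ?H g"
  proof
   assume "?H nu = ?H g"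
   hence "ks g <= ks nu" using height[OF 3 1[symmetric] 2[symmetric]] by blast
   thus False using ns 3 L_sub unfolding std_iff by blast
  qed
  thus ?thesis using 1 2 3 height[OF 3 1[symmetric] 2[symmetric]] by (intro exI[of _ nu]) auto
 qed
 hence "ALL g. EX nu. ~ std g --> std nu & mdeg nu = mdeg g & timg ta nu = timg ta g & ?H nu < ?H g" by blast
 hence "EX nu. ALL g. ~ std g --> std (nu g) & mdeg (nu g) = mdeg g & timg ta (nu g) = timg ta g & ?H (nu g) < ?H g"
  by (rule choice)
 then obtain nu where nu: "ALL g. ~ std g --> std (nu g) & mdeg (nu g) = mdeg g & timg ta (nu g) = timg ta g & ?H (nu g) < ?H g" ..
 have nsG: "~ std g" if "g:Gs" for g using nonstd_gen[OF that, of 0] by simp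
 have "EX w :: 'n => nat. ALL g:Gs. (SUM i:UNIV. lk (nu g) i * w i) < (SUM i:UNIV. lk g i * w i)"
  by (rule integer_weights[OF finite_Gs, where H = "%i. h (ta i)"]) (use nu nsG in auto)
 then obtain w :: "'n => nat" where w: "ALL g:Gs. (SUM i:UNIV. lk (nu g) i * w i) < (SUM i:UNIV. lk g i * w i)" ..
 show ?thesis
 proof (intro exI[of _ ta] exI[of _ w] conjI ballI ta allI impI)
  fix g assume g: "g:Gs"
  show "EX nu. std nu & mdeg nu = mdeg g & timg ta nu = timg ta g & (SUM i:UNIV. lk nu i * w i) < (SUM i:UNIV. lk g i * w i)"
   using nu w nsG[OF g] g by (intro exI[of _ "nu g"]) simp
 qed (rule sep)
qed

end

section \<open>Toric ideals and their initial degenerations\<close>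

lemma hom_power: "hom d f ==> hom (k * d) (f ^ k)"
 by (induction k) (use hom_mon[of 0] in "auto intro: hom_mult")

lemma hom_prod: "(!!i. i:A ==> hom (e i) (f i)) ==> hom (sum e A) (prod f A)"
 by (induction A rule: infinite_finite_induct) (use hom_mon[of 0] in "auto intro: hom_mult")

lemma hom_subst:
 fixes h :: "'x => ('y, 'r::comm_ring_1) pol"
 assumes h: "!!i. hom 1 (h i)" and f: "hom d f"
 shows "hom d (subst_hom Const h f)"
 unfolding subst_hom_def
proof (rule hom_sum, rule hom_Const_mult)
 fix mu assume "mu:ks f"
 hence d: "d = (SUM i:ks mu. lk mu i * 1)" using f by (auto simp: hom_iff keysI mdeg_def)
 show "hom d (PROD i:ks mu. h i ^ lk mu i)" unfolding d by (rule hom_prod) (rule hom_power[OF h])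
qed

lemma toric_monomial: "(PROD i:ks mu. sg (ta i, 1 :: int) (1 :: complex) ^ lk mu i) = sg (timg ta mu, int (mdeg mu)) 1"
 for mu :: "'n::finite \<Rightarrow>\<^sub>0 nat" and ta :: "'n => real ^ 'd::finite"
proof -
 have 1: "sg (ta i, 1 :: int) (1 :: complex) ^ k = sg (of_nat k *\<^sub>R ta i, int k) 1" for i k
  by (induction k) (simp_all add: mult_single alg zero_prod_def[symmetric])
 have "(PROD i:A. sg (ta i, 1 :: int) (1 :: complex) ^ lk mu i) = sg (SUM i:A. of_nat (lk mu i) *\<^sub>R ta i, SUM i:A. int (lk mu i)) 1"
  if "finite A" for A using that
  by (induction A rule: finite_induct) (simp_all add: 1 mult_single zero_prod_def[symmetric])
 moreover have "(SUM i:ks mu. of_nat (lk mu i) *\<^sub>R ta i) = timg ta mu" unfolding timg_def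
  by (rule sum.mono_neutral_left) (auto simp: keysI)
 ultimately show ?thesis by (simp add: mdeg_def)
qed

lemma toric_hom: "rhom (subst_hom (%c. sg 0 c) (%i. sg (ta i, 1 :: int) (1 :: complex)))"
 by (rule rhom.rhom_subst) (unfold_locales, auto simp: single_add mult_single)

lemma toric_lookup:
 fixes ta :: "'n::finite => real ^ 'd::finite"
 shows "lk (subst_hom (%c. sg 0 c) (%i. sg (ta i, 1 :: int) (1 :: complex)) f) (v, j) =
  (SUM mu:ks f. if timg ta mu = v & int (mdeg mu) = j then lk f mu else 0)"
 unfolding subst_hom_def lk_sum
 by (rule sum.cong) (auto simp: toric_monomial mult_single lk_sg)

lemma toric_ideal_iff: "(f:toric_ideal ta) = (  (ALL v j. (SUM mu:ks f. if timg ta mu = v & int (mdeg mu) = j then lk f mu else 0) = 0))"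
 unfolding toric_ideal_def by (auto simp flip: toric_lookup intro!: pm_eqI)

lemma is_ideal_toric: "idl (toric_ideal ta)"
 using rhom.ideal_kernel[OF toric_hom[of ta], of "{0}"] by (simp add: toric_ideal_def ideal.subspace_single_0)

lemma hom_toric: "hideal (toric_ideal ta)"
proof (rule hom_idealI[OF is_ideal_toric])
 fix f d assume f: "f:toric_ideal ta"
 have "(SUM mu:ks (hcomp d f). if timg ta mu = v & int (mdeg mu) = j then lk (hcomp d f) mu else 0) = 0" for v j
 proof -
  have "(SUM mu:ks (hcomp d f). if timg ta mu = v & int (mdeg mu) = j then lk (hcomp d f) mu else 0) =
    (SUM mu:ks f. if timg ta mu = v & int (mdeg mu) = j then lk (hcomp d f) mu else 0)"
   by (rule sum.mono_neutral_left) (auto simp: keysI lk_hcomp split: if_splits)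
  also have "... = (if j = int d then (SUM mu:ks f. if timg ta mu = v & int (mdeg mu) = j then lk f mu else 0) else 0)"
   by (auto simp: lk_hcomp intro!: sum.cong sum.neutral)
  also have "... = 0" using f[unfolded toric_ideal_iff, rule_format, of v j] by (simp only: if_cancel)
  finally show ?thesis .
 qed
 thus "hcomp d f:toric_ideal ta" unfolding toric_ideal_iff by blast
qed

definition up :: "nat => complex poly set"
 where "up k = {p. monom 1 k dvd p}"

lemma up_ideal: "idl (up k)"
 unfolding up_def by (rule idealI) auto

lemma up_mono: "j <= k ==> up k <= up j"
proof -
 assume "j <= k"
 hence "monom (1 :: complex) j dvd monom 1 k" by (metis dvd_triv_left mult_monom le_add_diff_inverse mult_1)
 thus ?thesis unfolding up_def using dvd_trans by blast
qed

lemma monom_up: "monom 1 k:up k"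
 by (simp add: up_def)

lemma split_monomial: "k <= mdeg ka ==> EX ka1 ka2. ka = ka1 + ka2 & mdeg ka2 = k" for ka :: "'x mon"
proof (induction k)
 case 0
 thus ?case by (intro exI[of _ ka] exI[of _ 0]) simp
next
 case (Suc k)
 then obtain ka1 ka2 where ka: "ka = ka1 + ka2" "mdeg ka2 = k" by auto
 hence "mdeg ka1 ~= 0" using Suc.prems by auto
 then obtain i where i: "lk ka1 i ~= 0" by (metis lookup_zero mdeg_0 pm_eqI)
 have "ka1 = (ka1 - sg i 1) + sg i 1"
  by (rule pm_eqI) (use i in "auto simp: lk_add lk_minus lk_sg")
 hence "ka = (ka1 - sg i 1) + (sg i 1 + ka2)" unfolding ka(1) by (metis add.assoc)
 thus ?case using ka(2) by (intro exI[of _ "ka1 - sg i 1"] exI[of _ "sg i 1 + ka2"]) simp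
qed

lemma prime_zero: "prime_ideal {0 :: 'a :: idom}"
 by (auto simp: prime_ideal_def ideal.subspace_single_0)

text \<open>\<open>ta0\<close> is the labelling under which the triangulation corresponds to the
  complex, \<open>ta\<close> an arbitrary one, and \<pi> the permutation of coordinates between
  them.\<close>

locale groebner = monomial_gens std x0 Gs
 for std :: "('n::finite) mon => bool" and x0 and Gs +
 fixes ta0 ta :: "'n => real ^ 'd::finite" and w :: "'n => nat" and nu and \<pi> :: "'n => 'n"
 assumes sep: "std mu ==> std mu' ==> mdeg mu = mdeg mu' ==> timg ta0 mu = timg ta0 mu' ==> mu = mu'"
  and nu: "g:Gs ==> mdeg (nu g) = mdeg g & timg ta0 (nu g) = timg ta0 g &
   (SUM i:UNIV. lk (nu g) i * w i) < (SUM i:UNIV. lk g i * w i)"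
  and \<pi>: "bij \<pi>" and ta\<pi>: "ta (\<pi> i) = ta0 i"
begin

definition wt :: "'n mon => nat"
 where "wt mu = (SUM i:UNIV. lk mu i * w i)"

lemma wt_add: "wt (mu + ka) = wt mu + wt ka"
 by (simp add: wt_def lk_add alg sum.distrib)

definition rest :: "'n mon => 'n mon"
 where "rest mu = (mu - base mu) + nu (base mu)"

lemma rest:
 assumes "~ std mu"
 shows "mdeg (rest mu) = mdeg mu" "timg ta0 (rest mu) = timg ta0 mu" "wt (rest mu) < wt mu"
  "wt mu - wt (rest mu) = wt (base mu) - wt (nu (base mu))"
proof -
 note b = base[OF assms]
 have g: "mdeg (nu (base mu)) = mdeg (base mu)" "timg ta0 (nu (base mu)) = timg ta0 (base mu)" "wt (nu (base mu)) < wt (base mu)"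
  using nu b by (auto simp: wt_def)
 have 1: "mdeg mu = mdeg (mu - base mu) + mdeg (base mu)" "timg ta0 mu = timg ta0 (mu - base mu) + timg ta0 (base mu)"
  "wt mu = wt (mu - base mu) + wt (base mu)"
  using b by (metis mdeg_add) (metis b timg_add, metis b wt_add)
 show "mdeg (rest mu) = mdeg mu" "timg ta0 (rest mu) = timg ta0 mu" "wt (rest mu) < wt mu"
  "wt mu - wt (rest mu) = wt (base mu) - wt (nu (base mu))"
  unfolding rest_def mdeg_add timg_add wt_add 1 using g by auto
qed

text \<open>A binomial of the toric ideal homogenized by the weight: at t = 0 it is the monomial
  generator, at t = 1 the binomial itself.\<close>

definition F :: "'n mon => ('n, complex poly) pol"
 where "F g = mon g - Const (monom 1 (wt g - wt (nu g))) * mon (nu g)"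

lemma F_step:
 assumes "~ std al" "wt al <= W"
 shows "Const (monom 1 (W - wt al)) * mon al =
  Const (monom 1 (W - wt al)) * mon (al - base al) * F (base al) + Const (monom 1 (W - wt (rest al))) * mon (rest al)"
proof -
 have "(W - wt al) + (wt (base al) - wt (nu (base al))) = W - wt (rest al)"
  using rest(3,4)[OF assms(1)] assms(2) by linarith
 hence "monom (1::complex) (W - wt al) * monom 1 (wt (base al) - wt (nu (base al))) = monom 1 (W - wt (rest al))"
  by (simp add: mult_monom)
 hence "(Const (monom (1::complex) (W - wt (rest al))) :: ('n, complex poly) pol) = Const (monom 1 (W - wt al)) * Const (monom 1 (wt (base al) - wt (nu (base al))))"
  by (simp flip: Const_mult)
 moreover have "mon al = mon (al - base al) * (mon (base al) :: ('n, complex poly) pol)"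
  using base[OF assms(1)] by (metis mon_add)
 moreover have "mon (rest al) = mon (al - base al) * (mon (nu (base al)) :: ('n, complex poly) pol)"
  by (simp add: rest_def mon_add)
 ultimately show ?thesis by (simp add: F_def alg)
qed

text \<open>Division inside the weight-homogenized family. The common exponent \<open>W\<close>
  makes every step exact, and since the weight drops, all coefficients stay divisible by t^(W - wt
  al).\<close>

lemma F_reduce:
 "wt al <= W ==> EX s h. std s & mdeg s = mdeg al & timg ta0 s = timg ta0 al & (ALL e. h e:cI (up (W - wt al))) &
  Const (monom 1 (W - wt al)) * mon al = Const (monom 1 (W - wt s)) * mon s + comb h F"
proof (induction "wt al" arbitrary: al rule: less_induct)
 case less
 let ?I = "cI (up (W - wt al)) :: ('n, complex poly) pol set"
 note I = icI[OF up_ideal, of "W - wt al"]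
 show ?case
 proof (cases "std al")
  case True
  have "comb (%_. 0) F = 0" by (simp add: comb_def)
  thus ?thesis using True izero[OF I] by (intro exI[of _ al] exI[of _ "%_. 0"]) simp
 next
  case False
  note r = rest[OF False] and b = base[OF False]
  have "wt (rest al) <= W" using r(3) less(2) by linarith
  then obtain s h where sh: "std s" "mdeg s = mdeg al" "timg ta0 s = timg ta0 al" "!!e. h e:cI (up (W - wt (rest al)))"
   "Const (monom 1 (W - wt (rest al))) * mon (rest al) = Const (monom 1 (W - wt s)) * mon s + comb h F"
   using less(1)[OF r(3)] r(1,2) by metis
  define h' where "h' e = h e + (if e = base al then Const (monom 1 (W - wt al)) * mon (al - base al) else 0)" for e
  have "comb (%e. if e = base al then Const (monom 1 (W - wt al)) * mon (al - base al) else 0) F =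
    Const (monom 1 (W - wt al)) * mon (al - base al) * F (base al)"
   unfolding comb_def using b finite_Gs by (simp add: if_distrib[of "%x. x * _"] cong: if_cong)
  hence "Const (monom 1 (W - wt al)) * mon al = Const (monom 1 (W - wt s)) * mon s + comb h' F"
   unfolding F_step[OF False less(2)] sh(5) h'_def comb_add by (simp add: alg)
  moreover have "h' e:?I" for e
  proof -
   have "h e:?I" 
    by (rule subsetD[OF cI_mono[OF up_mono] sh(4)]) (use r(3) in simp)
   moreover have "Const (monom 1 (W - wt al)) * mon (al - base al):?I" by (rule cI_Const_mult[OF up_ideal monom_up])
   ultimately show ?thesis unfolding h'_def using izero[OF I] by (intro iadd[OF I]) auto
  qed
  ultimately show ?thesis using sh(1-3) by blast
 qed
qed

text \<open>A line in the space of matrices from the identity at t = 0 to the permutation \<pi> at t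
  = 1. It may meet singular matrices in between; only the infinitesimal neighbourhood of 0 and the
  point 1 are used.\<close>

definition gu :: "('n, complex poly) pol => ('n, complex poly) pol"
 where "gu = subst_hom Const (%i. Const [:1, -1:] * Var i + Const [:0, 1:] * Var (\<pi> i))"

sublocale gu: rhom gu
 unfolding gu_def by (rule rhom.rhom_subst[OF rhom_Const])

lemma gu_Const: "gu (Const a) = Const a" and gu_Var: "gu (Var i) = Const [:1, -1:] * Var i + Const [:0, 1:] * Var (\<pi> i)"
 by (simp_all add: gu_def rhom.subst_Const[OF rhom_Const] rhom.subst_Var[OF rhom_Const])

lemma gu_hom: "hom d f ==> hom d (gu f)"
proof -
 have "hom 1 (Const [:1, -1:] * Var i + Const [:0, 1:] * Var (\<pi> i) :: ('n, complex poly) pol)" for i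
  using hom_mon[of "sg i 1"] hom_mon[of "sg (\<pi> i) 1"]
  by (intro hom_add hom_Const_mult) (simp_all add: Var_mon)
 thus "hom d f ==> hom d (gu f)" unfolding gu_def by (rule hom_subst)
qed

lemma gu_cI: "idl a ==> f:cI a ==> gu f:cI a"
 unfolding gu_def subst_hom_def
 by (intro isetsum[OF icI] cI_Const_mult) (auto simp: cI_iff)

lemma up1_iff: "(p:up 1) = (poly p 0 = 0)"
 unfolding up_def mem_Collect_eq monom_1_dvd_iff' by (simp add: poly_0_coeff_0)

lemma gu_minus: "gu f - f:cI (up 1)"
proof -
 have ev0: "rhom (%p::complex poly. poly p 0)" by unfold_locales simp_all
 have "cmap (%p. poly p 0) (gu f) = cmap (%p. poly p 0) f"
 proof (rule rhom_eqI[of "%f. cmap (%p. poly p 0) (gu f)"])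
  show "rhom (%f. cmap (%p. poly p 0) (gu f))" by (rule rhom_comp[OF gu.rhom_axioms rhom.rhom_cmap[OF ev0]])
  show "rhom (cmap (%p. poly p 0) :: ('n, complex poly) pol => _)" by (rule rhom.rhom_cmap[OF ev0])
  show "cmap (%p. poly p 0) (gu (Const a)) = cmap (%p. poly p 0) (Const a)" for a by (simp add: gu_Const)
  show "cmap (%p. poly p 0) (gu (Var i)) = cmap (%p. poly p 0) (Var i)" for i
   by (simp add: gu_Var rhom.cmap_add[OF ev0] rhom.cmap_mult[OF ev0] rhom.cmap_Const[OF ev0] rhom.cmap_Var[OF ev0])
 qed
 thus ?thesis unfolding cI_iff up1_iff lk_minus
  by (metis rhom.lk_cm[OF ev0] diff_self poly_diff)
qed

definition th :: "'n mon => ('n, complex poly) pol"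
 where "th g = gu (F g)"

lemma wt_nu: "g:Gs ==> wt (nu g) < wt g" and deg_nu: "g:Gs ==> mdeg (nu g) = mdeg g"
 using nu by (auto simp: wt_def)

text \<open>The relations lift exactly over C[t]: both sides of a pair reduce to standard monomials
  with equal images, and these coincide by \<open>sep\<close>. As \<open>gu\<close> also acts on the
  multipliers, the differences between a monomial and its image, divisible by t, are moved into the
  coefficients \<open>k\<close>.\<close>

lemma gu_first_rels: "first_rels (up 1) {0} th"
 unfolding first_rels_def
proof (intro conjI ballI)
 fix g assume g: "g:Gs"
 have "F g - mon g = Const (monom 1 (wt g - wt (nu g))) * (- mon (nu g))" by (simp add: F_def)
 moreover have "monom 1 (wt g - wt (nu g)):up 1" using wt_nu[OF g] up_mono[of 1 "wt g - wt (nu g)"] monom_up by fastforce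
 ultimately have "F g - mon g:cI (up 1)" using cI_Const_mult[OF up_ideal] by metis
 from iadd[OF icI[OF up_ideal] gu_minus[of "F g"] this]
 show "th g - mon g:cI (up 1)" by (simp add: th_def)
 have "hom (mdeg g) (F g)" unfolding F_def
  using hom_mon[of g] hom_mon[of "nu g"] deg_nu[OF g] by (intro hom_minus hom_Const_mult) auto
 thus "hom (mdeg g) (th g)" unfolding th_def by (rule gu_hom)
next
 fix g g' assume g: "g:Gs" "g':Gs"
 let ?I = "cI (up 1) :: ('n, complex poly) pol set"
 note I = icI[OF up_ideal, of 1]
 define W where "W = wt ((g' - g) + g)"
 have W: "W = wt (g' - g) + wt g" "W = wt (g - g') + wt g'" 
  using arg_cong[OF pair_lcm[of g' g], of wt] unfolding W_def wt_add by simp_all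
 define al where "al = (g' - g) + nu g"
 define be where "be = (g - g') + nu g'"
 have al: "wt al < W" "W - wt al = wt g - wt (nu g)" and be: "wt be < W" "W - wt be = wt g' - wt (nu g')"
  using wt_nu[OF g(1)] wt_nu[OF g(2)] unfolding al_def be_def wt_add W(1) by (auto simp: W[symmetric]) (use W in linarith)+
 have "mdeg al = mdeg ((g' - g) + g)" "mdeg be = mdeg ((g - g') + g')" "timg ta0 al = timg ta0 ((g' - g) + g)" "timg ta0 be = timg ta0 ((g - g') + g')"
  using nu[OF g(1)] nu[OF g(2)] by (simp_all add: al_def be_def timg_add)
 hence same: "mdeg al = mdeg be" "timg ta0 al = timg ta0 be" by (simp_all only: pair_lcm[of g' g])
 obtain s h where sh: "std s" "mdeg s = mdeg al" "timg ta0 s = timg ta0 al" "!!e. h e:cI (up (W - wt al))"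
   "Const (monom 1 (W - wt al)) * mon al = Const (monom 1 (W - wt s)) * mon s + comb h F"
  using F_reduce[of al W] al(1) by (auto simp: less_imp_le)
 obtain s' h' where sh': "std s'" "mdeg s' = mdeg be" "timg ta0 s' = timg ta0 be" "!!e. h' e:cI (up (W - wt be))"
   "Const (monom 1 (W - wt be)) * mon be = Const (monom 1 (W - wt s')) * mon s' + comb h' F"
  using F_reduce[of be W] be(1) by (auto simp: less_imp_le)
 have ss: "s' = s" by (rule sep) (use sh sh' same in simp_all)
 have hI: "h e:?I" "h' e:?I" for e
  by (rule subsetD[OF cI_mono[OF up_mono] sh(4)], use al(1) in simp)
   (rule subsetD[OF cI_mono[OF up_mono] sh'(4)], use be(1) in simp)
 have "mon (g' - g) * F g - mon (g - g') * F g' = Const (monom 1 (W - wt be)) * mon be - Const (monom 1 (W - wt al)) * mon al"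
 proof -
  have "mon (g' - g) * mon g = (mon (g - g') * mon g' :: ('n, complex poly) pol)"
   unfolding mon_add[symmetric] by (rule arg_cong[OF pair_lcm])
  thus ?thesis unfolding al(2) be(2) F_def by (simp add: al_def be_def mon_add alg)
 qed
 also have "... = comb (%e. h' e - h e) F" unfolding sh(5) sh'(5) ss comb_minus by simp
 finally have "gu (mon (g' - g) * F g - mon (g - g') * F g') = gu (comb (%e. h' e - h e) F)" by simp
 hence 1: "gu (mon (g' - g)) * th g - gu (mon (g - g')) * th g' = comb (%e. gu (h' e - h e)) th"
  by (simp add: gu.diff gu.mult th_def comb_def gu.sum)
 define k where "k e = gu (h' e - h e) + ((if e = g then mon (g' - g) - gu (mon (g' - g)) else 0) -
  (if e = g' then mon (g - g') - gu (mon (g - g')) else 0))" for e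
 have "comb (%e. (if e = g then mon (g' - g) - gu (mon (g' - g)) else 0) - (if e = g' then mon (g - g') - gu (mon (g - g')) else 0)) th =
   (mon (g' - g) - gu (mon (g' - g))) * th g - (mon (g - g') - gu (mon (g - g'))) * th g'"
  unfolding comb_def left_diff_distrib using g finite_Gs
  by (simp add: sum_subtractf if_distrib[of "%x. x * _"] left_diff_distrib cong: if_cong)
 hence "mon (g' - g) * th g - mon (g - g') * th g' - comb k th = 0"
  unfolding k_def comb_add 1[symmetric] by (simp add: alg)
 moreover have "k e:?I" for e
 proof -
  have m: "mon x - gu (mon x):?I" for x using ineg[OF I gu_minus[of "mon x"]] by simp
  have "gu (h' e - h e):?I" by (intro gu_cI up_ideal iminus[OF I] hI)
  thus ?thesis unfolding k_def
   using m izero[OF I] by (intro iadd[OF I] iminus[OF I]) auto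
 qed
 ultimately show "EX h. (ALL e. h e:cI (up 1)) & mon (g' - g) * th g - mon (g - g') * th g' - comb h th:cI {0}"
  by (intro exI[of _ k]) (simp add: cI_iff)
qed

section \<open>The binomial basis of the toric ideal\<close>

definition B :: "nat => 'n mon set"
 where "B d = {mu. ~ std mu & mdeg mu = d}"

lemma finite_B: "finite (B d)"
 by (rule finite_subset[OF _ finite_mdeg[of d]]) (auto simp: B_def)

definition E :: "'n mon => 'n cpoly"
 where "E mu = mon mu - mon (rest mu)"

definition relab :: "'n cpoly => 'n cpoly"
 where "relab = subst_hom Const (%i. Var (\<pi> i))"

definition pm :: "'n mon => 'n mon"
 where "pm mu = (SUM i:ks mu. sg (\<pi> i) (lk mu i))"

text \<open>For nonstandard mu this deforms the monomial at t = 0 into its relabelled binomial at t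
  = 1 (\<open>K_1\<close>).\<close>

definition K :: "'n mon => ('n, complex poly) pol"
 where "K mu = gu (mon (mu - base mu)) * th (base mu)"

sublocale relab: rhom relab
 unfolding relab_def by (rule rhom.rhom_subst[OF rhom_Const])

lemma relab_mon: "relab (mon mu) = mon (pm mu)"
 unfolding relab_def rhom.subst_mon[OF rhom_Const] meval_def pm_def mon_sum Var_power ..

lemma lk_pm: "lk (pm mu) (\<pi> j) = lk mu j"
proof -
 have "lk (pm mu) (\<pi> j) = (SUM i:ks mu. if i = j then lk mu i else 0)"
  unfolding pm_def lk_sum lk_sg
  by (rule sum.cong) (use \<pi> in "auto simp: bij_def inj_eq")
 thus ?thesis by (simp add: keysI)
qed

lemma relab_hom: "hom d f ==> hom d (relab f)"
 unfolding relab_def using hom_mon[of "sg _ 1"] by (intro hom_subst) (simp_all add: Var_mon)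

lemma relab_toric: "(relab f:toric_ideal ta) = (f:toric_ideal ta0)"
proof -
 let ?T = "%ta :: 'n => real ^ 'd. subst_hom (%c. sg 0 c) (%i. sg (ta i, 1 :: int) (1 :: complex))"
 have e: "rhom (%c. sg (0 :: (real ^ 'd) \<times> int) (c :: complex))" by unfold_locales (auto simp: single_add mult_single)
 have "?T ta (relab f) = ?T ta0 f"
 proof (rule rhom_eqI[of "%f. ?T ta (relab f)"])
  show "rhom (%f. ?T ta (relab f))" by (rule rhom_comp[OF relab.rhom_axioms toric_hom])
  show "rhom (?T ta0)" by (rule toric_hom)
 qed (simp_all add: relab_def rhom.subst_Const[OF rhom_Const] rhom.subst_Var[OF rhom_Const] rhom.subst_Const[OF e] rhom.subst_Var[OF e] ta\<pi>)
 thus ?thesis by (simp add: toric_ideal_def)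
qed

lemma relab_surj: "hom d f ==> EX f'. hom d f' & relab f' = f"
proof -
 assume f: "hom d f"
 let ?r = "subst_hom Const (%i. Var (inv \<pi> i)) :: 'n cpoly => 'n cpoly"
 have "relab (?r f) = f"
 proof (rule rhom_eqI[of "%f. relab (?r f)" "%f. f"])
  show "rhom (%f. relab (?r f))" by (rule rhom_comp[OF rhom.rhom_subst[OF rhom_Const] relab.rhom_axioms])
  show "rhom (%f :: 'n cpoly. f)" by (rule rhom_id)
 qed (use \<pi> in "simp_all add: relab_def rhom.subst_Const[OF rhom_Const] rhom.subst_Var[OF rhom_Const] bij_def surj_f_inv_f")
 moreover have "hom d (?r f)" using hom_mon[of "sg _ 1"] by (intro hom_subst f) (simp add: Var_mon)
 ultimately show ?thesis by blast
qed

lemma K_hom: "~ std mu ==> hom (mdeg mu) (K mu)"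
proof -
 assume "~ std mu"
 note b = base[OF this]
 have "hom (mdeg (mu - base mu) + mdeg (base mu)) (K mu)"
  unfolding K_def using gu_first_rels b by (intro hom_mult gu_hom hom_mon) (auto simp: first_rels_def)
 thus ?thesis using b by (metis mdeg_add)
qed

lemma K_1: "~ std mu ==> cmap (%p. poly p 1) (K mu) = relab (E mu)"
proof -
 assume "~ std mu"
 note b = base[OF this]
 have ev1: "rhom (%p::complex poly. poly p 1)" by unfold_locales simp_all
 have 1: "cmap (%p. poly p 1) (gu f) = relab (cmap (%p. poly p 1) f)" for f
 proof (rule rhom_eqI[of "%f. cmap (%p. poly p 1) (gu f)" "%f. relab (cmap (%p. poly p 1) f)"])
  show "rhom (%f. cmap (%p. poly p 1) (gu f))" by (rule rhom_comp[OF gu.rhom_axioms rhom.rhom_cmap[OF ev1]])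
  show "rhom (%f. relab (cmap (%p. poly p 1) f))" by (rule rhom_comp[OF rhom.rhom_cmap[OF ev1] relab.rhom_axioms])
 qed (simp_all add: gu_Const gu_Var rhom.cmap_add[OF ev1] rhom.cmap_mult[OF ev1] rhom.cmap_Const[OF ev1] rhom.cmap_Var[OF ev1]
   relab_def rhom.subst_Const[OF rhom_Const] rhom.subst_Var[OF rhom_Const])
 have "cmap (%p. poly p 1) (mon (mu - base mu) * F (base mu)) = E mu"
  unfolding F_def E_def rest_def using b
  by (simp add: rhom.cmap_mult[OF ev1] rhom.cmap_mon[OF ev1] rhom.cmap_Const[OF ev1] rhom.diff[OF rhom.rhom_cmap[OF ev1]] poly_monom right_diff_distrib flip: mon_add)
 thus ?thesis unfolding K_def th_def gu.mult[symmetric] 1 by simp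
qed

lemma E_toric: "~ std mu ==> E mu:toric_ideal ta0" and E_hom: "mu:B d ==> hom d (E mu)"
proof -
 assume ns: "~ std mu"
 have e: "rhom (%c. sg (0 :: (real ^ 'd) \<times> int) (c :: complex))" by unfold_locales (auto simp: single_add mult_single)
 show "E mu:toric_ideal ta0"
  using rest[OF ns] unfolding toric_ideal_def E_def
  by (simp add: rhom.diff[OF toric_hom] rhom.subst_mon[OF e] meval_def toric_monomial)
next
 assume "mu:B d"
 thus "hom d (E mu)" using hom_mon[of mu] hom_mon[of "rest mu"] rest(1)[of mu]
  unfolding E_def B_def by (intro hom_minus) auto
qed

lemma mon_reduce:
 "EX s c. std s & mdeg s = mdeg al & mon al - mon s = (SUM mu:B (mdeg al). Const (c mu) * E mu)"
proof (induction "wt al" arbitrary: al rule: less_induct)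
 case less
 show ?case
 proof (cases "std al")
  case True
  thus ?thesis by (intro exI[of _ al] exI[of _ "%_. 0"]) simp
 next
  case False
  note r = rest[OF False]
  obtain s c where sc: "std s" "mdeg s = mdeg al" "mon (rest al) - mon s = (SUM mu:B (mdeg al). Const (c mu) * E mu)"
   using less[OF r(3)] unfolding r(1) by blast
  have "(SUM mu:B (mdeg al). Const (c mu + (if mu = al then 1 else 0)) * E mu) =
    (SUM mu:B (mdeg al). Const (c mu) * E mu) + (SUM mu:B (mdeg al). if mu = al then E mu else 0)"
   unfolding sum.distrib[symmetric] by (rule sum.cong) (auto simp: Const_add ring_distribs)
  also have "(SUM mu:B (mdeg al). if mu = al then E mu else 0) = E al" using False finite_B by (simp add: B_def)
  also have "(SUM mu:B (mdeg al). Const (c mu) * E mu) + E al = mon al - mon s"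
   using E_def[of al] unfolding sc(3)[symmetric] by simp
  finally show ?thesis using sc by (intro exI[of _ s] exI[of _ "%mu. c mu + (if mu = al then 1 else 0)"]) simp
 qed
qed

lemma toric_std_0:
 assumes f: "f:toric_ideal ta0" "stdp f" "hom d f" shows "f = 0"
proof (rule pm_eqI)
 fix mu show "lk f mu = lk 0 mu"
 proof (cases "lk f mu = 0")
  case False
  have "(SUM ka:ks f. if timg ta0 ka = timg ta0 mu & int (mdeg ka) = int d then lk f ka else 0) = (SUM ka:ks f. if ka = mu then lk f ka else 0)"
   by (rule sum.cong) (use False f(2,3) sep in "auto simp: stdp_def hom_iff keysI")
  thus ?thesis using f(1)[unfolded toric_ideal_iff, rule_format, of "timg ta0 mu" "int d"] False by (simp add: keysI)
 qed simp
qed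

text \<open>Replacing monomials by standard representatives changes an element by binomials and
  leaves a standard element of the toric ideal, which is zero.\<close>

lemma toric_span0:
 assumes f: "f:toric_ideal ta0" "hom d f"
 shows "EX c. f = (SUM mu:B d. Const (c mu) * E mu)"
proof -
 have "ALL al. EX s. EX c. std s & mdeg s = mdeg al & mon al - mon s = (SUM mu:B (mdeg al). Const (c mu) * E mu)"
  using mon_reduce by blast
 then obtain s where "ALL al. EX c. std (s al) & mdeg (s al) = mdeg al & mon al - mon (s al) = (SUM mu:B (mdeg al). Const (c mu) * E mu)"
  unfolding choice_iff by blast
 then obtain c where sc: "!!al. std (s al) & mdeg (s al) = mdeg al & mon al - mon (s al) = (SUM mu:B (mdeg al). Const (c al mu) * E mu)"
  unfolding choice_iff by blast
 have dg: "mdeg al = d" if "al:ks f" for al using f(2) that by (auto simp: hom_iff keysI)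
 define t where "t = (SUM al:ks f. Const (lk f al) * mon (s al))"
 have "f - t = (SUM al:ks f. Const (lk f al) * (mon al - mon (s al)))"
  by (subst (1) sum_sg[of f, symmetric]) (simp add: t_def sg_eq right_diff_distrib sum_subtractf)
 also have "... = (SUM al:ks f. SUM mu:B d. Const (lk f al * c al mu) * E mu)"
  by (rule sum.cong) (use sc dg in "simp_all add: sum_distrib_left Const_mult mult.assoc")
 also have "... = (SUM mu:B d. SUM al:ks f. Const (lk f al * c al mu) * E mu)" by (rule sum.swap)
 also have "... = (SUM mu:B d. Const (SUM al:ks f. lk f al * c al mu) * E mu)"
  by (simp add: sum_distrib_right rhom.sum[OF rhom_Const])
 finally have ft: "f - t = (SUM mu:B d. Const (SUM al:ks f. lk f al * c al mu) * E mu)" .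
 have "f - t:toric_ideal ta0" unfolding ft
  by (intro isetsum[OF is_ideal_toric] iscale[OF is_ideal_toric] E_toric) (simp add: B_def)
 from iminus[OF is_ideal_toric f(1) this] have "t:toric_ideal ta0" by simp
 moreover have "stdp t" unfolding t_def using sc by (intro stdp_sum stdp_Const) (simp add: stdp_def lk_mon)
 moreover have "hom d (mon (s al) :: 'n cpoly)" if "al:ks f" for al
  using hom_mon[of "s al"] sc[of al] dg[OF that] by simp
 hence "hom d t" unfolding t_def by (intro hom_sum hom_Const_mult)
 ultimately have "t = 0" by (rule toric_std_0)
 thus ?thesis using ft by auto
qed

lemma toric_span:
 assumes f: "f:hpart (toric_ideal ta) d"
 shows "EX c. f = (SUM mu:B d. Const (c mu) * relab (E mu))"
proof -
 obtain f' where f': "hom d f'" "relab f' = f" using f relab_surj by (auto simp: hpart_def)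
 hence "f':toric_ideal ta0" using f relab_toric[of f'] by (simp add: hpart_def)
 then obtain c where "f' = (SUM mu:B d. Const (c mu) * E mu)" using toric_span0 f'(1) by blast
 hence "f = (SUM mu:B d. Const (c mu) * relab (E mu))"
  using f'(2) by (auto simp: relab.sum relab.mult) (simp add: relab_def rhom.subst_Const[OF rhom_Const])
 thus ?thesis by (rule exI[of _ c])
qed

lemma relab_E_toric: "mu:B d ==> relab (E mu):hpart (toric_ideal ta) d"
 using E_toric[of mu] relab_toric relab_hom[OF E_hom[of mu d]] by (simp add: hpart_def B_def)

text \<open>A basis binomial of degree \<open>d\<close> is a monomial times a binomial of degree
  \<open>r\<close>, since the generator it comes from has degree at most \<open>r\<close>.\<close>

lemma toric_generated:
 assumes r: "!!g. g:Gs ==> mdeg g <= r" "r <= d" and f: "f:hpart (toric_ideal ta) d"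
 shows "f:igen (hpart (toric_ideal ta) r)"
proof -
 let ?I = "igen (hpart (toric_ideal ta) r)"
 have "relab (E mu):?I" if mu: "mu:B d" for mu
 proof -
  have ns: "~ std mu" "mdeg mu = d" using mu by (auto simp: B_def)
  note b = base[OF ns(1)]
  have "mdeg mu = mdeg (mu - base mu) + mdeg (base mu)" using b by (metis mdeg_add)
  hence "r - mdeg (base mu) <= mdeg (mu - base mu)" using r(2) ns(2) by linarith
  then obtain ka1 ka2 where ka: "mu - base mu = ka1 + ka2" "mdeg ka2 = r - mdeg (base mu)" using split_monomial by blast
  define f2 where "f2 = mon (ka2 + base mu) - (mon (ka2 + nu (base mu)) :: 'n cpoly)"
  have e: "rhom (%c. sg (0 :: (real ^ 'd) \<times> int) (c :: complex))" by unfold_locales (auto simp: single_add mult_single)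
  have nub: "mdeg (nu (base mu)) = mdeg (base mu)" "timg ta0 (nu (base mu)) = timg ta0 (base mu)" using nu b by blast+
  have "f2:toric_ideal ta0" unfolding toric_ideal_def f2_def
   by (simp add: rhom.diff[OF toric_hom] rhom.subst_mon[OF e] meval_def toric_monomial timg_add nub)
  moreover have "hom r f2" unfolding f2_def
   using hom_mon[of "ka2 + base mu"] hom_mon[of "ka2 + nu (base mu)"] nub ka(2) r(1)[of "base mu"] b
   by (intro hom_minus) auto
  ultimately have "relab f2:hpart (toric_ideal ta) r" by (simp add: hpart_def relab_toric relab_hom)
  hence "relab (mon ka1) * relab f2:?I" by (intro gen_scale gen_base)
  moreover have "E mu = mon ka1 * f2"
  proof -
   have "mu = ka1 + (ka2 + base mu)" using b ka(1) by (metis add.assoc)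
   hence "mon mu = mon ka1 * (mon (ka2 + base mu) :: 'n cpoly)" by (metis mon_add)
   thus ?thesis unfolding E_def rest_def f2_def ka(1) by (simp add: mon_add right_diff_distrib mult.assoc)
  qed
  ultimately show ?thesis by (simp add: relab.mult)
 qed
 moreover obtain c where c: "f = (SUM mu:B d. Const (c mu) * relab (E mu))" using toric_span[OF f] by (elim exE)
 ultimately show ?thesis unfolding c by (intro gen_sum gen_scale)
qed

text \<open>The basis binomials have distinct leading monomials for the weight, transported along
  \<pi>.\<close>

lemma toric_rank: "hrank_ge {0} (toric_ideal ta) d (card (B d))"
proof -
 obtain ms where ms: "set ms = B d" "distinct ms" using finite_distinct_list[OF finite_B] by blast
 define N where "N ka = (SUM i:UNIV. lk ka (\<pi> i) * w i)" for ka :: "'n mon"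
 have N: "N (pm mu) = wt mu" for mu by (simp add: N_def wt_def lk_pm)
 have pm_inj: "pm mu = pm mu' ==> mu = mu'" for mu mu' by (rule pm_eqI) (metis lk_pm)
 define fs where "fs = map (%mu. relab (E mu)) ms"
 have lkE: "lk (relab (E mu)) ka = (if pm mu = ka then 1 else 0) - (if pm (rest mu) = ka then 1 else 0)" for mu ka
  by (simp add: E_def relab.diff relab_mon lk_minus lk_mon)
 have r: "wt (rest mu) < wt mu" if "mu:B d" for mu using rest(3) that by (simp add: B_def)
 have "indep {0} (map lk fs)"
 proof (rule indep_leads[OF prime_zero, where N = N and mu = "%j. pm (ms ! j)"])
  fix j assume "j < length (map lk fs)"
  hence j: "j < length ms" by (simp add: fs_def)
  hence mj: "ms ! j:B d" using ms(1) nth_mem by blast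
  have ne: "pm (rest (ms ! j)) ~= pm (ms ! j)"
  proof
   assume "pm (rest (ms ! j)) = pm (ms ! j)"
   from pm_inj[OF this] show False using r[OF mj] by simp
  qed
  have fj: "map lk fs ! j = lk (relab (E (ms ! j)))" using j by (simp add: fs_def)
  show "(map lk fs ! j) (pm (ms ! j)) ~: {0}" unfolding fj lkE using ne by simp
  fix ka assume "(map lk fs ! j) ka ~: {0}"
  hence "ka = pm (ms ! j) | ka = pm (rest (ms ! j))" unfolding fj lkE by (auto split: if_splits)
  thus "ka = pm (ms ! j) | N ka < N (pm (ms ! j))" using r[OF mj] unfolding N[symmetric] by blast
 next
  fix j j' assume j: "j < length (map lk fs)" "j' < length (map lk fs)" and eq: "pm (ms ! j) = pm (ms ! j')"
  show "j = j'" using pm_inj[OF eq] ms(2) j by (simp add: fs_def nth_eq_iff_index_eq)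
 qed
 moreover have "set fs <= hpart (toric_ideal ta) d" using ms relab_E_toric by (auto simp: fs_def)
 moreover have "length fs = card (B d)" using ms distinct_card[OF ms(2)] by (simp add: fs_def)
 ultimately show ?thesis unfolding hrank_ge_def by blast
qed

end

section \<open>Gluing and extending two deformations\<close>

locale cone_gens = cone_family std x0 X m c J d0 + monomial_gens std x0 Gs
 for std :: "('n::finite) mon => bool" and x0 and X :: "('n, 'r::comm_ring_1) pol set" and m c J d0 Gs
begin

text \<open>The generators are the reduced elements of \<open>sat\<close> in all degrees. The last
  clause holds because unipotent reduction leaves a standard element of \<open>sat\<close>, zero
  modulo \<open>c\<close>; applied to pairs of generators it also provides the lifted
  relations.\<close>

lemma cone_lift:
 "EX th. first_rels m c th & (ALL g:Gs. th g:sat) &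
  (ALL f. f:sat & f:cI m --> (EX k. (ALL e. k e:cI m) & f - comb k th:cI c))"
proof -
 have "ALL g. EX f. g:Gs --> f:sat & hom (mdeg g) f & f - mon g:cI m"
  using good_all nonstd_gen[of _ 0] unfolding good_def by (metis add_0)
 hence "EX th. ALL g. g:Gs --> th g:sat & hom (mdeg g) (th g) & th g - mon g:cI m"
  by (rule choice)
 then obtain th where "ALL g. g:Gs --> th g:sat & hom (mdeg g) (th g) & th g - mon g:cI m" ..
 hence th: "th g:sat" "hom (mdeg g) (th g)" "th g - mon g:cI m" if "g:Gs" for g using that by auto
 have ze: "lifted th mu - mon mu:cI m" for mu by (rule lifted_minus_mon[OF m th(3)])
 have zeh: "hom (mdeg mu) (lifted th mu)" for mu
 proof (cases "std mu")
  case True thus ?thesis by (simp add: lifted_def hom_mon)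
 next
  case False
  have "hom (mdeg (mu - base mu) + mdeg (base mu)) (lifted th mu)"
   using False base[OF False] by (simp add: lifted_def hom_mon_mult th)
  thus ?thesis using base[OF False] by (metis mdeg_add)
 qed
 have rep: "EX k. (ALL e. k e:cI m) & f - comb k th:cI c" if f: "f:sat" "f:cI m" for f
 proof -
  obtain H where H: "H:cI m" "f - Zop (lifted th) H:cI (ipow m J)"
   using Zop_surj[OF m m ze zeh f(2), of J] by blast
  have Hc: "f - Zop (lifted th) H:cI c" using H(2) cI_mono[OF nilp] by blast
  define s where "s = rs std H"
  define G where "G = rs (%mu. ~ std mu) H"
  have HsG: "Zop (lifted th) H = s + Zop (lifted th) G"
   using Zop_add[of "lifted th" s G] rs_split[of H std] Zop_lifted_std[of s th] by (simp add: s_def G_def)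
  have "Zop (lifted th) G:sat"
  proof (rule Zop_mem[OF sat_ideal])
   fix mu assume "lk G mu ~= 0"
   hence ns: "~ std mu" by (auto simp: G_def lk_rs split: if_splits)
   thus "lifted th mu:sat" using base[OF ns] th(1) iscale[OF sat_ideal] by (simp add: lifted_def)
  qed
  moreover have "f - Zop (lifted th) H:sat" using Hc cX X_sat by blast
  ultimately have "f - (f - Zop (lifted th) H) - Zop (lifted th) G:sat"
   using iminus[OF sat_ideal iminus[OF sat_ideal f(1)]] by blast
  hence "s:sat" by (simp add: HsG)
  hence sc: "s:cI c" by (rule std_sat) (simp add: s_def)
  have "nonstdp G" by (simp add: nonstdp_def G_def lk_rs)
  then obtain k where k: "ALL a e. idl a & G:cI a --> k e:cI a" "comb k th = Zop (lifted th) G"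
   using nonstd_comb[of G th] by blast
  have "G:cI m" unfolding G_def by (rule rs_cI[OF m H(1)])
  moreover have "f - comb k th:cI c"
   using iadd[OF icI[OF c] Hc sc] by (simp add: k(2) HsG)
  ultimately show ?thesis using k(1) m by blast
 qed
 have "EX h. (ALL e. h e:cI m) & mon (g' - g) * th g - mon (g - g') * th g' - comb h th:cI c"
  if g: "g:Gs" "g':Gs" for g g'
 proof (rule rep)
  show "mon (g' - g) * th g - mon (g - g') * th g':sat"
   by (intro iminus[OF sat_ideal] iscale[OF sat_ideal] th g)
  have "mon (g' - g) * mon g = (mon (g - g') * mon g' :: ('n, 'r) pol)"
   unfolding mon_add[symmetric] by (rule arg_cong[OF pair_lcm])
  hence "mon (g' - g) * th g - mon (g - g') * th g' = mon (g' - g) * (th g - mon g) - mon (g - g') * (th g' - mon g')"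
   by (simp add: right_diff_distrib)
  also have "...:cI m"
   by (rule iminus[OF icI[OF m]]; rule iscale[OF icI[OF m]]; rule th(3)[OF g(1)] th(3)[OF g(2)])
  finally show "mon (g' - g) * th g - mon (g - g') * th g':cI m" .
 qed
 hence "first_rels m c th" unfolding first_rels_def using th by blast
 thus ?thesis using th(1) rep by blast
qed

end

section \<open>Polynomials in one parameter over the base ring\<close>

lemma rhom_map_poly:
 assumes "rhom h" shows "rhom (map_poly h)"
proof -
 interpret rhom h by fact
 show ?thesis
 proof
  show "map_poly h 1 = 1" by (simp add: map_poly_1' one)
  show "map_poly h (a + b) = map_poly h a + map_poly h b" for a b
   by (rule poly_eqI) (simp add: coeff_map_poly zero add)
  show "map_poly h (a * b) = map_poly h a * map_poly h b" for a b
   by (rule poly_eqI) (simp add: coeff_map_poly zero coeff_mult sum mult)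
 qed
qed

lemma rhom_const_poly: "rhom (%a::'a::comm_ring_1. [:a:])"
 by unfold_locales (simp_all add: one_pCons)

lemma rhom_coeff0: "rhom (%p::'a::comm_ring_1 poly. coeff p 0)"
 by unfold_locales (simp_all add: coeff_mult_0)

text \<open>The kernel of the reduction from A[t] to (A/c)[t]/t^k.\<close>

definition low_coeffs :: "nat => 'a::comm_ring_1 set => 'a poly set"
 where "low_coeffs k c = {p. ALL i<k. coeff p i:c}"

lemma is_ideal_low_coeffs: "idl c ==> idl (low_coeffs k c)"
 unfolding low_coeffs_def
proof (rule idealI)
 fix q p :: "'a poly" assume c: "idl c" and p: "p:{p. ALL i<k. coeff p i:c}"
 thus "q * p:{p. ALL i<k. coeff p i:c}"
  by (auto simp: coeff_mult intro!: isetsum[OF c] iscale[OF c])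
qed (auto simp: izero iadd)

text \<open>The ideal in question is (m, t): each of the J factors contributes either a factor from
  \<open>m\<close> or a power of t.\<close>

lemma ipow_coeffs:
 fixes m :: "'a::comm_ring_1 set"
 assumes m: "idl m"
 shows "p:ipow {p. coeff p 0:m} J ==> coeff p i:ipow m (J - i)"
proof (induction J arbitrary: p i)
 case (Suc J)
 let ?D = "{p. ALL i. coeff p i:ipow m (Suc J - i)}"
 have D: "idl ?D"
 proof (rule idealI)
  fix q p :: "'a poly" assume p: "p:?D"
  have "coeff (q * p) i:ipow m (Suc J - i)" for i
   unfolding coeff_mult
  proof (rule isetsum[OF ipow_ideal], rule iscale[OF ipow_ideal])
   fix j assume "j:{..i}"
   have "coeff p (i - j):ipow m (Suc J - (i - j))" using p by blast
   thus "coeff p (i - j):ipow m (Suc J - i)" by (rule subsetD[OF ipow_antimono, rotated]) simp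
  qed
  thus "q * p:?D" by blast
 qed (auto simp: izero[OF ipow_ideal] iadd[OF ipow_ideal] simp del: ipow.simps)
 have "{a * b |a b. a:{p. coeff p 0:m} & b:ipow {p. coeff p 0:m} J} <= ?D"
 proof safe
  fix a b :: "'a poly" and i assume a: "coeff a 0:m" and b: "b:ipow {p. coeff p 0:m} J"
  show "coeff (a * b) i:ipow m (Suc J - i)"
   unfolding coeff_mult
  proof (rule isetsum[OF ipow_ideal])
   fix j assume "j:{..i}"
   note bj = Suc.IH[OF b, of "i - j"]
   show "coeff a j * coeff b (i - j):ipow m (Suc J - i)"
   proof (cases "j = 0")
    case True
    have "coeff a 0 * coeff b i:ipow m (Suc (J - i))" using ipow_mult[OF a, of "coeff b i" "J - i"] bj True by simp
    moreover have "ipow m (Suc (J - i)) <= ipow m (Suc J - i)" by (rule ipow_antimono) simp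
    ultimately show ?thesis unfolding True by (simp del: ipow.simps add: subset_iff)
   next
    case False
    have "ipow m (J - (i - j)) <= ipow m (Suc J - i)" using False \<open>j:{..i}\<close> by (intro ipow_antimono) auto
    thus ?thesis using bj by (intro iscale[OF ipow_ideal]) blast
   qed
  qed
 qed
 hence "igen {a * b |a b. a:{p. coeff p 0:m} & b:ipow {p. coeff p 0:m} J} <= ?D"
  by (rule gen_minimal[OF _ D])
 thus ?case using Suc.prems by auto
qed simp

text \<open>Modulo \<open>m\<close> the polynomial B starts with the unit b at t^k2, so A B = 0 can
  be solved for the coefficients of A. Each pass gains one power of \<open>m\<close> and costs k2
  coefficients; k1 passes bring the constant coefficient into c + m^k1, whence the product k1 k2 in
  the truncation order.\<close>

lemma leading_term_contradiction:
 fixes A B :: "'a::comm_ring_1 poly"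
 assumes m: "idl m" and c: "idl c" and nil: "ipow m k1 <= c"
  and AB: "A * B:low_coeffs (k1 * k2 + k2 + 1) c"
  and B: "!!j. j < k2 ==> coeff B j:m" and u: "coeff B k2 - b:m" "b * b' = 1"
 shows "coeff A 0:c"
proof -
 let ?k = "k1 * k2 + k2 + 1"
 let ?I = "%a. isum c (ipow m a)"
 have I: "idl (?I a)" for a by (intro isum_ideal c ipow_ideal)
 \<comment> \<open>The outer induction counts powers of \<open>m\<close>, the inner one runs through
   the coefficients of A: entries of B below k2 supply a factor from \<open>m\<close>, those above
   meet coefficients already treated.\<close>
 have "ALL i. i + a * k2 < ?k --> coeff A i:?I a" for a
 proof (induction a)
  case 0
  have "x:?I 0" for x using isumI[of 0 c x UNIV] izero[OF c] by simp
  thus ?case by blast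
 next
  case (Suc a)
  show ?case
  proof (intro allI)
   fix i show "i + Suc a * k2 < ?k --> coeff A i:?I (Suc a)"
   proof (induction i rule: less_induct)
    case (less i)
    show ?case
    proof
    assume i: "i + Suc a * k2 < ?k"
    have mem: "coeff A (i + k2 - j) * coeff B j:?I (Suc a)" if j: "j <= i + k2" "j ~= k2" for j
    proof (cases "j < k2")
    case True
    have "coeff A (i + k2 - j):?I a" using Suc i True by simp
    thus ?thesis by (rule isum_ipow_mult[OF c _ B[OF True]])
    next
    case False
    hence "i + k2 - j < i" using j by linarith
    hence "coeff A (i + k2 - j):?I (Suc a)" using less[of "i + k2 - j"] i by simp
    thus ?thesis by (rule iright[OF I])
    qed
    have "coeff (A * B) (i + k2) = (SUM j<=i + k2. coeff A (i + k2 - j) * coeff B j)"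
    unfolding mult.commute[of A B] coeff_mult by (simp add: mult.commute)
    also have "... = coeff A i * coeff B k2 + (SUM j:{..i + k2} - {k2}. coeff A (i + k2 - j) * coeff B j)"
    by (subst sum.remove[of _ k2]) auto
    finally have eq: "coeff A i * coeff B k2 = coeff (A * B) (i + k2) - (SUM j:{..i + k2} - {k2}. coeff A (i + k2 - j) * coeff B j)"
    by simp
    have "coeff (A * B) (i + k2):c" using AB i unfolding low_coeffs_def by simp
    hence "coeff (A * B) (i + k2):?I (Suc a)" using isum_left[OF ipow_ideal, of c m "Suc a"] by blast
    hence "coeff A i * coeff B k2:?I (Suc a)" unfolding eq
    by (intro iminus[OF I] isetsum[OF I]) (use mem in auto)
    moreover have "coeff A i * (coeff B k2 - b):?I (Suc a)"
    by (rule isum_ipow_mult[OF c _ u(1)]) (use Suc i in simp)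
    ultimately have "coeff A i * coeff B k2 - coeff A i * (coeff B k2 - b):?I (Suc a)" by (rule iminus[OF I])
    hence "coeff A i * b:?I (Suc a)" by (simp add: alg del: ipow.simps)
    hence "b' * (coeff A i * b):?I (Suc a)" by (rule iscale[OF I])
    moreover have "b' * (coeff A i * b) = coeff A i" using u(2) by (metis mult.assoc mult.commute mult_1)
    ultimately show "coeff A i:?I (Suc a)" by (simp only:)
    qed
   qed
  qed
 qed
 hence "coeff A 0:?I k1" by simp
 moreover have "?I k1 <= c" by (rule isum_minimal[OF c]) (use nil in auto)
 ultimately show ?thesis by blast
qed

text \<open>\<open>th1\<close> is a family over A/c1, \<open>th2\<close> one over C[t]; both reduce
  to the monomial generators at the marked point, which is what makes them glue.\<close>

locale gluing = lifting std x0 Gs io ev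
 for std :: "'x mon => bool" and x0 :: 'x and Gs and io :: "complex => 'a::comm_ring_1" and ev +
 fixes c1 :: "'a set" and k1 k :: nat and th1 :: "'x mon => ('x, 'a) pol"
  and th2 :: "'x mon => ('x, complex poly) pol"
 assumes c1: "idl c1" "c1 <= ker" and nil: "ipow ker k1 <= c1" and T2: T2_vanishes and k: "k > 0"
  and th1: "first_rels ker c1 th1" and th2: "first_rels (up 1) {0} th2"
begin

definition "io' z = [:io z:]"
definition "ev' p = ev (coeff p 0)"

sublocale ext: lifting std x0 Gs io' ev'
proof -
 interpret io': rhom io' unfolding io'_def by (rule rhom_comp[OF io.rhom_axioms rhom_const_poly])
 interpret ev': rhom ev' unfolding ev'_def by (rule rhom_comp[OF rhom_coeff0 ev.rhom_axioms])
 show "lifting std x0 Gs io' ev'" by unfold_locales (simp add: io'_def ev'_def ev_io)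
qed

lemma ext_ker: "ext.ker = {p. coeff p 0:ker}"
 by (simp add: ext.ker_def ker_def ev'_def)

definition P0 :: "('x, 'a poly) pol => ('x, 'a) pol"
 where "P0 = cmap (%p. coeff p 0)"
definition P1 :: "('x, 'a poly) pol => ('x, complex poly) pol"
 where "P1 = cmap (map_poly ev)"
definition E0 :: "('x, 'a) pol => ('x, 'a poly) pol"
 where "E0 = cmap (%a. [:a:])"
definition E1 :: "('x, complex poly) pol => ('x, 'a poly) pol"
 where "E1 = cmap (map_poly io)"

sublocale P0: rhom P0 unfolding P0_def by (rule rhom.rhom_cmap[OF rhom_coeff0])
sublocale P1: rhom P1 unfolding P1_def by (rule rhom.rhom_cmap[OF rhom_map_poly[OF ev.rhom_axioms]])
sublocale E0: rhom E0 unfolding E0_def by (rule rhom.rhom_cmap[OF rhom_const_poly])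
sublocale E1: rhom E1 unfolding E1_def by (rule rhom.rhom_cmap[OF rhom_map_poly[OF io.rhom_axioms]])

lemma lk_P: "lk (P0 f) mu = coeff (lk f mu) 0" "lk (P1 f) mu = map_poly ev (lk f mu)"
 "lk (E0 g) mu = [:lk g mu:]" "lk (E1 h) mu = map_poly io (lk h mu)"
 by (simp_all add: P0_def P1_def E0_def E1_def lk_cmap)

lemma P_mon: "P0 (mon mu) = mon mu" "P1 (mon mu) = mon mu" "E0 (mon mu) = mon mu" "E1 (mon mu) = mon mu"
 using rhom.one[OF rhom_map_poly[OF ev.rhom_axioms]] rhom.one[OF rhom_map_poly[OF io.rhom_axioms]] rhom.one[OF rhom_const_poly, where ?'a = 'a]
 by (auto simp: lk_P lk_mon intro!: pm_eqI)

lemma P0_E0: "P0 (E0 f) = f" and P1_E1: "P1 (E1 g) = g"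
 by (rule pm_eqI; simp add: lk_P map_poly_map_poly io.zero ev.zero o_def ev_io)+

lemma P0_E1: "g:cI (up 1) ==> P0 (E1 g) = 0"
 by (rule pm_eqI) (simp add: lk_P coeff_map_poly io.zero cI_iff up_def monom_1_dvd_iff')

lemma P1_E0: "f:cI ker ==> P1 (E0 f) = 0"
 by (rule pm_eqI, rule poly_eqI)
  (simp add: lk_P cI_iff ker_def coeff_map_poly ev.zero coeff_pCons split: nat.split)

text \<open>The kernel of the map from A[t] to A/c1 and C[t]/t^k; the image of that map is their
  fibre product over C.\<close>

definition c0 :: "'a poly set"
 where "c0 = {p. coeff p 0:c1 & map_poly ev p:up k}"

lemma cI_c0: "(f:cI c0) = (P0 f:cI c1 & P1 f:cI (up k))"
 by (auto simp: cI_iff c0_def lk_P)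

lemma c0_ideal: "idl c0"
 using ideal.subspace_inter[OF rhom.ideal_kernel[OF rhom_coeff0 c1(1)] rhom.ideal_kernel[OF rhom_map_poly[OF ev.rhom_axioms] up_ideal[of k]]]
 by (simp add: c0_def Int_def)

text \<open>\<open>E0\<close> and \<open>E1\<close> are sections of the two projections; subtracting
  the monomial avoids counting the common part twice.\<close>

definition th0 :: "'x mon => ('x, 'a poly) pol"
 where "th0 g = E0 (th1 g) + E1 (th2 g - mon g)"

lemma P_th0: assumes "g:Gs" shows "P0 (th0 g) = th1 g" "P1 (th0 g) = th2 g"
proof -
 have t: "th1 g - mon g:cI ker" "th2 g - mon g:cI (up 1)" using th1 th2 assms by (auto simp: first_rels_def)
 show "P0 (th0 g) = th1 g" unfolding th0_def P0.add P0_E0 P0_E1[OF t(2)] by simp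
 have "P1 (E0 (th1 g)) = mon g" using P1_E0[OF t(1)] by (simp add: E0.diff P1.diff P_mon)
 thus "P1 (th0 g) = th2 g" unfolding th0_def P1.add P1_E1 by simp
qed

lemma P_comb: "P0 (comb h th0) = comb (%e. P0 (h e)) th1" "P1 (comb h th0) = comb (%e. P1 (h e)) th2"
 unfolding comb_def P0.sum P1.sum P0.mult P1.mult by (simp_all add: P_th0)

lemma glued: "first_rels ext.ker c0 th0"
 unfolding first_rels_def
proof (intro conjI ballI)
 fix g assume g: "g:Gs"
 have t: "th1 g - mon g:cI ker" "hom (mdeg g) (th1 g)" "hom (mdeg g) (th2 g)"
  using th1 th2 g by (auto simp: first_rels_def)
 have "P0 (th0 g - mon g):cI ker" using t(1) by (simp add: P0.diff P_th0[OF g] P_mon)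
 thus "th0 g - mon g:cI ext.ker" by (simp add: cI_iff lk_P ext_ker)
 show "hom (mdeg g) (th0 g)" unfolding th0_def E0_def E1_def
  using t(2,3) hom_mon[of g] by (intro hom_add hom_cmap hom_minus) simp_all
next
 fix g g' assume g: "g:Gs" "g':Gs"
 obtain h1 where h1: "!!e. h1 e:cI ker" "mon (g' - g) * th1 g - mon (g - g') * th1 g' - comb h1 th1:cI c1"
  using th1 g unfolding first_rels_def by blast
 obtain h2 where h2: "!!e. h2 e:cI (up 1)" "mon (g' - g) * th2 g - mon (g - g') * th2 g' - comb h2 th2:cI {0}"
  using th2 g unfolding first_rels_def by blast
 define h where "h e = E0 (h1 e) + E1 (h2 e)" for e
 have P: "P0 (h e) = h1 e" "P1 (h e) = h2 e" for e
  by (simp_all add: h_def P0.add P1.add P0_E0 P1_E1 P0_E1[OF h2(1)] P1_E0[OF h1(1)])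
 have "h e:cI ext.ker" for e using h1(1)[of e] unfolding P(1)[symmetric] by (simp add: cI_iff lk_P ext_ker)
 moreover have "mon (g' - g) * th0 g - mon (g - g') * th0 g' - comb h th0:cI c0"
 proof -
  have "cI {0} <= (cI (up k) :: ('x, complex poly) pol set)" by (rule cI_mono) (simp add: izero[OF up_ideal])
  thus ?thesis using h1(2) h2(2) g
   by (auto simp: cI_c0 P0.diff P1.diff P0.mult P1.mult P_th0 P_mon P_comb P)
 qed
 ultimately show "EX h. (ALL e. h e:cI ext.ker) & mon (g' - g) * th0 g - mon (g - g') * th0 g' - comb h th0:cI c0" by blast
qed

lemma nil_low: "ipow ext.ker (k1 + k) <= low_coeffs k c1"
proof
 fix p assume p: "p:ipow ext.ker (k1 + k)"
 have "coeff p i:c1" if "i < k" for i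
 proof -
  have "coeff p i:ipow ker (k1 + k - i)" using ipow_coeffs[OF is_ideal_ker, of p "k1 + k" i] p unfolding ext_ker by blast
  moreover have "ipow ker (k1 + k - i) <= ipow ker k1" using that by (intro ipow_antimono) simp
  ultimately show ?thesis using nil by blast
 qed
 thus "p:low_coeffs k c1" by (simp add: low_coeffs_def)
qed

text \<open>T2 = 0 carries the glued family from the fibre product to (A/c1)[t]/t^k. Finitely many
  steps are enough, because (ker, t)^(k1 + k) already vanishes in that ring.\<close>

lemma extended: "EX th. first_rels ext.ker (low_coeffs k c1) th & (ALL g:Gs. th g - th0 g:cI c0)"
proof (rule ext.lift_chain[OF c0_ideal _ is_ideal_low_coeffs[OF c1(1)] _ _ T2 glued])
 show "c0 <= ext.ker" using c1(2) by (auto simp: c0_def ext_ker)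
 show "low_coeffs k c1 <= c0"
  using k c1(2) by (auto simp: low_coeffs_def c0_def up_def monom_1_dvd_iff' coeff_map_poly ev.zero ker_def)
qed (rule nil_low)

text \<open>The given tuples are combinations of \<open>th1\<close> and of \<open>th2\<close>; these
  combinations, glued coefficientwise, are formed with the extended generators. The resulting forms
  lie in the ideal of those generators, which contains no standard polynomial other than 0 modulo
  \<open>low_coeffs k c1\<close>.\<close>

lemma extended_forms:
 fixes t1 :: "nat => ('x, 'a) pol" and t2 and mus :: "nat => 'x mon"
 assumes mus: "!!j. j < N ==> ~ std (mus j)"
  and t1: "!!j. j < N ==> hom r (t1 j)"
   "!!j. j < N ==> EX h. (ALL e. h e:cI ker) & t1 j - mon (mus j - base (mus j)) * th1 (base (mus j)) - comb h th1:cI c1"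
  and t2: "!!j. j < N ==> hom r (t2 j)"
   "!!j. j < N ==> EX b. b - mon (mus j - base (mus j)):cI (up 1) & t2 j = b * th2 (base (mus j))"
 shows "EX es. (ALL j<N. hom r (es j) & P0 (es j) - t1 j:cI c1 & P1 (es j) - t2 j:cI (up k)) &
  (ALL h s. stdp s & s = (SUM j<N. h j * es j) --> s:cI (low_coeffs k c1))"
proof -
 obtain th where th: "first_rels ext.ker (low_coeffs k c1) th" "ALL g:Gs. th g - th0 g:cI c0" using extended by blast
 have thh: "hom (mdeg g) (th g)" if "g:Gs" for g using th(1) that by (auto simp: first_rels_def)
 have "ALL j. EX e. j < N --> hom r e & P0 e - t1 j:cI c1 & P1 e - t2 j:cI (up k) & (EX a. e = comb a th)"
 proof (intro allI)
  fix j show "EX e. j < N --> hom r e & P0 e - t1 j:cI c1 & P1 e - t2 j:cI (up k) & (EX a. e = comb a th)"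
  proof (cases "j < N")
   case True
   let ?g = "base (mus j)" and ?ka = "mus j - base (mus j)"
   have g: "?g:Gs" using base[OF mus[OF True]] by blast
   obtain h where h: "!!e. h e:cI ker" "t1 j - mon ?ka * th1 ?g - comb h th1:cI c1" using t1(2)[OF True] by blast
   obtain b where b: "b - mon ?ka:cI (up 1)" "t2 j = b * th2 ?g" using t2(2)[OF True] by blast
   define a where "a e = E0 (h e) + (if e = ?g then E1 (b - mon ?ka) + mon ?ka else 0)" for e
   have Pa: "P0 (a e) = h e + (if e = ?g then mon ?ka else 0)" "P1 (a e) = (if e = ?g then b else 0)" for e
    by (simp_all add: a_def P0.add P1.add P0_E0 P1_E1 P0_E1[OF b(1)] P1_E0[OF h(1)] P_mon P0.zero P1.zero)
   have single: "comb (%e. if e = ?g then x else 0) et = x * et ?g" for x and et :: "_ => ('x, 'z::comm_ring_1) pol"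
    unfolding comb_def using g finite_Gs by (simp add: if_distrib[of "%x. x * _"] cong: if_cong)
   have "comb a th - comb a th0 = (SUM g:Gs. a g * (th g - th0 g))"
    by (simp add: comb_def right_diff_distrib sum_subtractf)
   also have "...:cI c0"
    by (rule isetsum[OF icI[OF c0_ideal]], rule iscale[OF icI[OF c0_ideal]]) (use th(2) in blast)
   finally have d: "P0 (comb a th) - P0 (comb a th0):cI c1" "P1 (comb a th) - P1 (comb a th0):cI (up k)"
    by (simp_all add: cI_c0 P0.diff P1.diff)
   have "P0 (comb a th0) = comb h th1 + mon ?ka * th1 ?g" unfolding P_comb Pa comb_add single ..
   hence 1: "P0 (comb a th) - t1 j:cI c1"
    using iminus[OF icI[OF c1(1)] d(1) h(2)] by (simp add: alg)
   have "P1 (comb a th0) = t2 j" unfolding P_comb Pa single b(2) ..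
   hence 2: "P1 (comb a th) - t2 j:cI (up k)" using d(2) by simp
   \<comment> \<open>Since the generators are homogeneous, the component of degree \<open>r\<close>
     is again a combination of them.\<close>
   define a' where "a' e = (if mdeg e <= r then hcomp (r - mdeg e) (a e) else 0)" for e
   have "hcomp r (comb a th) = comb a' th" unfolding comb_def hcomp_sum
   proof (rule sum.cong)
    fix e assume e: "e:Gs"
    show "hcomp r (a e * th e) = a' e * th e"
    using hcomp_mult_hom[OF thh[OF e], of r "a e"] hcomp_mult_0[OF thh[OF e], of r "a e"]
    by (cases "mdeg e <= r") (simp_all add: a'_def)
   qed simp
   moreover have "P0 (hcomp r (comb a th)) - t1 j:cI c1"
    using hcomp_cI[OF c1(1) 1, of r] t1(1)[OF True] by (simp add: hcomp_minus P0_def hcomp_cmap hcomp_hom[of r "t1 j"])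
   moreover have "P1 (hcomp r (comb a th)) - t2 j:cI (up k)"
    using hcomp_cI[OF up_ideal 2, of r] t2(1)[OF True] by (simp add: hcomp_minus P1_def hcomp_cmap hcomp_hom[of r "t2 j"])
   ultimately show ?thesis using hom_hcomp[of r "comb a th"] by (intro exI[of _ "hcomp r (comb a th)"]) auto
  qed simp
 qed
 hence "EX es. ALL j. j < N --> hom r (es j) & P0 (es j) - t1 j:cI c1 & P1 (es j) - t2 j:cI (up k) & (EX a. es j = comb a th)"
  by (rule choice)
 then obtain es where es: "ALL j. j < N --> hom r (es j) & P0 (es j) - t1 j:cI c1 & P1 (es j) - t2 j:cI (up k) & (EX a. es j = comb a th)" ..
 have "ALL j. EX a. j < N --> es j = comb a th" using es by blast
 hence "EX a. ALL j. j < N --> es j = comb (a j) th" by (rule choice)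
 then obtain a where a: "ALL j. j < N --> es j = comb (a j) th" ..
 have "s:cI (low_coeffs k c1)" if s: "stdp s" "s = (SUM j<N. h j * es j)" for h s
 proof -
  have "s = (SUM j<N. SUM g:Gs. h j * (a j g * th g))" unfolding s(2)
   by (rule sum.cong) (use a in "simp_all add: comb_def sum_distrib_left")
  also have "... = (SUM g:Gs. SUM j<N. h j * (a j g * th g))" by (rule sum.swap)
  also have "... = comb (%g. SUM j<N. h j * a j g) th" by (simp add: comb_def sum_distrib_right mult.assoc)
  finally have eq: "s - comb (%g. SUM j<N. h j * a j g) th = 0" by simp
  have "s - comb (%g. SUM j<N. h j * a j g) th:cI (low_coeffs k c1)"
   unfolding eq by (rule izero[OF icI[OF is_ideal_low_coeffs[OF c1(1)]]])
  thus ?thesis by (rule std_in_comb[OF is_ideal_low_coeffs[OF c1(1)] ext.is_ideal_ker th(1) nil_low s(1)])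
 qed
 thus ?thesis using es by blast
qed

end

section \<open>The universal tuple of forms\<close>

lemma rhom_cong:
 fixes F G :: "('x, 'a::comm_ring_1) pol => 'b::comm_ring_1"
 assumes F: "rhom F" and G: "rhom G" and c: "idl c" and C: "!!a. F (Const a) - G (Const a):c"
  and V: "!!i. F (Var i) - G (Var i):c"
 shows "F f - G f:c"
proof -
 interpret F: rhom F by fact
 interpret G: rhom G by fact
 have mult: "F (x * y) - G (x * y):c" if "F x - G x:c" "F y - G y:c" for x y
 proof -
  have "F x * (F y - G y) + G y * (F x - G x):c" by (intro iadd[OF c] iscale[OF c] that)
  thus ?thesis by (simp add: F.mult G.mult alg)
 qed
 have one: "F 1 - G 1:c" by (simp add: F.one G.one izero[OF c])
 have pw: "F (Var i ^ k) - G (Var i ^ k):c" for i k by (induction k) (simp_all only: power_0 power_Suc one mult[OF V])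
 have pr: "F (PROD i:A. Var i ^ k i) - G (PROD i:A. Var i ^ k i):c" for A and k :: "'x => nat"
  by (induction A rule: infinite_finite_induct) (simp_all only: prod.infinite prod.empty prod.insert one mult[OF pw] not_False_eq_True)
 have mon: "mon mu = (PROD i:ks mu. Var i ^ lk mu i)" for mu :: "'x mon"
 proof -
  have "mu = (SUM i:ks mu. sg i (lk mu i))"
   by (rule pm_eqI) (simp add: lk_sum lk_sg keysI)
  thus ?thesis by (metis (mono_tags, lifting) Var_power mon_sum prod.cong)
 qed
 show ?thesis
 proof (induction f rule: poly_induct)
  case (single mu a)
  show ?case unfolding sg_eq mon by (rule mult[OF C pr])
 next
  case (add f g)
  from iadd[OF c add] show ?case by (simp add: F.add G.add alg)
 qed
qed

lemma ideal_gen_image_iff: "(f:igen (g ` {..<N::nat})) = ((EX h. f = (SUM j<N. h j * g j)))"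
proof
 assume "f:igen (g ` {..<N})"
 thus "EX h. f = (SUM j<N. h j * g j)"
 proof (induction rule: gen_induct)
  case base
  show ?case by (rule exI[of _ "%_. 0"]) simp
 next
  case (step c x y)
  then obtain h i where h: "y = (SUM j<N. h j * g j)" "x = g i" "i < N" by blast
  have "(SUM j<N. (h j + (if j = i then c else 0)) * g j) = (SUM j<N. h j * g j) + (SUM j<N. if j = i then c * g j else 0)"
   unfolding sum.distrib[symmetric] by (rule sum.cong) (auto simp: ring_distribs)
  thus ?case using h by (intro exI[of _ "%j. h j + (if j = i then c else 0)"]) (simp add: add.commute)
 qed
qed (auto intro!: gen_sum gen_scale intro: gen_base)

locale universal = monomial_gens std x0 Gs for std :: "('n::finite) mon => bool" and x0 and Gs +
 fixes r N M :: nat and mm mus :: "nat => 'n mon"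
 assumes mm: "bij_betw mm {..<M} {mu. mdeg mu = r}" and mus: "bij_betw mus {..<N} {mu. ~ std mu & mdeg mu = r}"
  and Gs_le: "!!g. g:Gs ==> mdeg g <= r"
begin

text \<open>The forms are universal of degree \<open>r\<close>: the base variable with index j M + l
  is the coefficient of form j at the monomial \<open>mm l\<close>.\<close>

definition gen :: "nat => ('n, base_ring) pol"
 where "gen j = (SUM l<M. Const (Var (j * M + l)) * mon (mm l))"

definition X0 :: "('n, base_ring) pol set"
 where "X0 = igen (gen ` {..<N})"

text \<open>The point of the parameter space defined by a tuple \<open>t\<close> over an algebra;
  base variables that are not coefficients go to 0.\<close>

definition spec :: "(complex => 's::comm_ring_1) => (nat => ('n, 's) pol) => base_ring => 's"
 where "spec emb t = subst_hom emb (%i. if i < N * M then lk (t (i div M)) (mm (i mod M)) else 0)"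

lemma rhom_spec: "rhom emb ==> rhom (spec emb t)"
 unfolding spec_def by (rule rhom.rhom_subst)

lemma spec_Const: "rhom emb ==> spec emb t (Const a) = emb a"
 and spec_Var: "rhom emb ==> spec emb t (Var i) = (if i < N * M then lk (t (i div M)) (mm (i mod M)) else 0)"
 unfolding spec_def by (simp_all add: rhom.subst_Const rhom.subst_Var)

lemma gen_hom: "hom r (gen j)"
 unfolding gen_def
proof (rule hom_sum)
 fix l assume "l:{..<M}"
 hence "mdeg (mm l) = r" using mm by (auto simp: bij_betw_def)
 thus "hom r (Const (Var (j * M + l)) * mon (mm l) :: ('n, base_ring) pol)"
  using hom_mon[of "mm l"] by (intro hom_Const_mult) simp
qed

lemma X0_hom: "hideal X0"
 unfolding X0_def by (rule hom_ideal_gen) (use gen_hom in blast)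

lemma spec_gen:
 assumes e: "rhom emb" and j: "j < N" and t: "hom r (t j)"
 shows "cmap (spec emb t) (gen j) = t j"
proof -
 note s = rhom_spec[OF e, of t]
 have d: "(j * M + l) div M = j" "(j * M + l) mod M = l" "j * M + l < N * M" if "l < M" for l
 proof -
  show "(j * M + l) div M = j" "(j * M + l) mod M = l" using that by simp_all
  have "j * M + l < Suc j * M" using that by simp
  also have "... <= N * M" using j by (intro mult_right_mono) auto
  finally show "j * M + l < N * M" .
 qed
 have "cmap (spec emb t) (gen j) = (SUM l<M. sg (mm l) (lk (t j) (mm l)))"
  unfolding gen_def rhom.sum[OF rhom.rhom_cmap[OF s]]
  by (rule sum.cong) (simp_all add: rhom.cmap_mult[OF s] rhom.cmap_Const[OF s] rhom.cmap_mon[OF s] spec_Var[OF e] d sg_eq)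
 also have "... = (SUM mu:{mu. mdeg mu = r}. sg mu (lk (t j) mu))" by (rule sum.reindex_bij_betw[OF mm])
 also have "... = (SUM mu:ks (t j). sg mu (lk (t j) mu))"
  by (rule sum.mono_neutral_right[OF finite_mdeg]) (use t in "auto simp: hom_iff keysI")
 finally show ?thesis by (simp add: sum_sg)
qed

lemma spec_comp:
 assumes h: "rhom h" and e: "rhom emb"
 shows "h (spec emb t f) = spec (%z. h (emb z)) (%j. cmap h (t j)) f"
proof (rule rhom_eqI[of "%f. h (spec emb t f)"])
 note he = rhom_comp[OF e h]
 show "rhom (%f. h (spec emb t f))" by (rule rhom_comp[OF rhom_spec[OF e] h])
 show "rhom (spec (%z. h (emb z)) (%j. cmap h (t j)))" by (rule rhom_spec[OF he])
 show "h (spec emb t (Const a)) = spec (%z. h (emb z)) (%j. cmap h (t j)) (Const a)" for a by (simp add: spec_Const[OF e] spec_Const[OF he])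
 show "h (spec emb t (Var i)) = spec (%z. h (emb z)) (%j. cmap h (t j)) (Var i)" for i
  by (simp add: spec_Var[OF e] spec_Var[OF he] rhom.lk_cm[OF h] rhom.zero[OF h])
qed

lemma spec_cong:
 assumes e: "rhom emb" and c: "idl c" and t: "!!j. j < N ==> t j - t' j:cI c"
 shows "spec emb t f - spec emb t' f:c"
proof (rule rhom_cong[OF rhom_spec[OF e] rhom_spec[OF e] c])
 show "spec emb t (Var i) - spec emb t' (Var i):c" for i
  using t[of "i div M"] izero[OF c] by (auto simp: spec_Var[OF e] cI_iff lk_minus less_mult_imp_div_less)
qed (simp add: spec_Const[OF e] izero[OF c])

definition p0 :: "base_ring set"
 where "p0 = igen ({lk F mu | F mu. F:X0 & stdp F} Un {Var i | i. ~ i < N * M})"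

lemma spec_p0:
 assumes e: "rhom emb" and c: "idl c" and t: "!!j. j < N ==> hom r (t j)"
  and std: "ALL h s. stdp s & s = (SUM j<N. h j * t j) --> s:cI c" and f: "f:p0"
 shows "spec emb t f:c"
proof -
 note s = rhom_spec[OF e, of t]
 have "p0 <= {f. spec emb t f:c}" unfolding p0_def
 proof (rule gen_minimal[OF _ rhom.ideal_kernel[OF s c]], safe)
  fix F mu assume F: "F:X0" "stdp F"
  obtain h where h: "F = (SUM j<N. h j * gen j)" using F(1) unfolding X0_def ideal_gen_image_iff by blast
  have "cmap (spec emb t) F = (SUM j<N. cmap (spec emb t) (h j) * t j)"
   unfolding h rhom.sum[OF rhom.rhom_cmap[OF s]] rhom.cmap_mult[OF s] by (rule sum.cong) (simp_all add: spec_gen[OF e _ t])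
  moreover have "stdp (cmap (spec emb t) F)" using F(2) by (auto simp: stdp_def rhom.lk_cm[OF s]) (metis rhom.zero[OF s])
  ultimately have "cmap (spec emb t) F:cI c"
   using std[rule_format, of "cmap (spec emb t) F" "%j. cmap (spec emb t) (h j)"] by simp
  thus "spec emb t (lk F mu):c" by (simp add: cI_iff rhom.lk_cm[OF s])
 next
  fix i assume "~ i < N * M"
  thus "spec emb t (Var i):c" using izero[OF c] by (simp add: spec_Var[OF e])
 qed
 thus ?thesis using f by blast
qed

text \<open>Both branches are integral, so the products of an \<open>f\<close> nonzero on the first
  and a \<open>g\<close> nonzero on the second form a multiplicative set. An extended tuple over
  A[t] shows that it misses \<open>p0\<close>; a prime over \<open>p0\<close> avoiding it consists
  of functions that vanish on both branches.\<close>

lemma common_prime: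
 fixes s1 :: "nat => complex" and t1 :: "nat => ('n, base_ring) pol" and t2 :: "nat => ('n, complex poly) pol"
 defines "m == {f. peval s1 f = 0}"
 assumes T2: T2_vanishes and p1: "noeth p1" "prime_ideal p1" "p1 <= m"
  and t1: "!!j. j < N ==> hom r (t1 j)"
  and H1: "!!k. EX th. first_rels m (isum p1 (ipow m k)) th & (ALL j<N. EX h. (ALL e. h e:cI m) &
   t1 j - mon (mus j - base (mus j)) * th (base (mus j)) - comb h th:cI (isum p1 (ipow m k)))"
  and th2: "first_rels (up 1) {0} th2"
  and t2: "!!j. j < N ==> hom r (t2 j)"
   "!!j. j < N ==> EX b. b - mon (mus j - base (mus j)):cI (up 1) & t2 j = b * th2 (base (mus j))"
 shows "EX q. prime_ideal q & p0 <= q & (ALL f:q. spec Const t1 f:p1) & (ALL f:q. spec (%z. [:z:]) t2 f = 0)"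
proof -
 interpret R: alg_retract Const "peval s1"
 proof -
  interpret C: rhom "Const :: complex => base_ring" by (rule rhom_Const)
  interpret E: rhom "peval s1" by (rule rhom_peval)
  show "alg_retract Const (peval s1)" by unfold_locales simp
 qed
 have ker: "R.ker = m" by (simp add: R.ker_def m_def)
 note mI = R.is_ideal_ker[unfolded ker]
 let ?s1 = "spec Const t1" and ?s2 = "spec (%z. [:z:]) t2"
 interpret s1: rhom ?s1 by (rule rhom_spec[OF rhom_Const])
 interpret s2: rhom ?s2 by (rule rhom_spec[OF rhom_const_poly])
 define S where "S = {f * g | f g. ?s1 f ~: p1 & ?s2 g ~= 0}"
 have no: "f * g ~: p0" if f: "?s1 f ~: p1" and g: "?s2 g ~= 0" for f g
 proof
  assume fg: "f * g:p0"
  \<comment> \<open>Membership in p1 + m^k for all k would give (1 - a) s1(f) in \<open>p1\<close>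
    with a in \<open>m\<close> by Krull's theorem, impossible for a prime contained in
    \<open>m\<close>.\<close>
  have "EX k1. ?s1 f ~: isum p1 (ipow m k1)"
  proof (rule ccontr)
   assume "\<nexists>k1. ?s1 f ~: isum p1 (ipow m k1)"
   then obtain a where a: "a:m" "(1 - a) * ?s1 f:p1" using krull_intersection[OF p1(1) mI p1(3)] by blast
   hence "1 - a:m" using f prime_mult_iff[OF p1(2)] p1(3) by blast
   thus False using a(1) unfolding m_def by (simp add: R.ev.hom_simps)
  qed
  then obtain k1 where k1: "?s1 f ~: isum p1 (ipow m k1)" by blast
  define c1 where "c1 = isum p1 (ipow m k1)"
  note p1I = primeD(1)[OF p1(2)]
  have c1: "idl c1" "ipow m k1 <= c1" unfolding c1_def by (intro isum_ideal p1I ipow_ideal) (rule isum_right[OF p1I])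
  have cm: "c1 <= m"
  proof (cases k1)
   case 0
   hence "c1 = UNIV" using c1(2) by auto
   thus ?thesis using k1 unfolding c1_def by blast
  next
   case (Suc k)
   have "ipow m (Suc k) <= m" unfolding ipow.simps
    by (rule gen_minimal[OF _ mI]) (use iright[OF mI] in blast)
   thus ?thesis unfolding c1_def Suc by (intro isum_minimal[OF mI p1(3)])
  qed
  \<comment> \<open>The order of vanishing of \<open>g\<close> at t = 0 along the second branch; it
    fixes the order \<open>k\<close> to which the families have to be extended.\<close>
  define k2 where "k2 = (LEAST j. coeff (?s2 g) j ~= 0)"
  have "EX j. coeff (?s2 g) j ~= 0" using g by (metis leading_coeff_0_iff)
  hence k2: "coeff (?s2 g) k2 ~= 0" "!!j. j < k2 ==> coeff (?s2 g) j = 0"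
   unfolding k2_def by (rule LeastI_ex) (use not_less_Least in blast)
  define k where "k = k1 * k2 + k2 + 1"
  obtain th1 where th1: "first_rels m c1 th1" "ALL j<N. EX h. (ALL e. h e:cI m) &
    t1 j - mon (mus j - base (mus j)) * th1 (base (mus j)) - comb h th1:cI c1" using H1[of k1] unfolding c1_def by blast
  interpret G: gluing std x0 Gs Const "peval s1" c1 k1 k th1 th2
   by unfold_locales (use c1 cm T2 th1(1) th2 in "simp_all add: ker k_def")
  have "EX es. (ALL j<N. hom r (es j) & G.P0 (es j) - t1 j:cI c1 & G.P1 (es j) - t2 j:cI (up k)) &
   (ALL h s. stdp s & s = (SUM j<N. h j * es j) --> s:cI (low_coeffs k c1))"
  proof (rule G.extended_forms[OF _ t1 _ t2])
   show "~ std (mus j)" if "j < N" for j using mus that by (auto simp: bij_betw_def)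
   show "EX h. (ALL e. h e:cI R.ker) & t1 j - mon (mus j - base (mus j)) * th1 (base (mus j)) - comb h th1:cI c1" if "j < N" for j
    using th1(2) that unfolding ker by blast
  qed
  then obtain es where es: "!!j. j < N ==> hom r (es j)" "!!j. j < N ==> G.P0 (es j) - t1 j:cI c1"
   "!!j. j < N ==> G.P1 (es j) - t2 j:cI (up k)" and std: "ALL h s. stdp s & s = (SUM j<N. h j * es j) --> s:cI (low_coeffs k c1)"
   by blast
  note io' = G.ext.io.rhom_axioms
  let ?E = "spec G.io' es"
  have "?E (f * g):low_coeffs k c1" by (rule spec_p0[OF io' is_ideal_low_coeffs[OF c1(1)] es(1) std fg])
  hence AB: "?E f * ?E g:low_coeffs k c1" by (simp add: rhom.mult[OF rhom_spec[OF io']])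
  have A: "coeff (?E f) 0 = spec Const (%j. G.P0 (es j)) f" unfolding spec_comp[OF rhom_coeff0 io'] by (simp add: G.io'_def G.P0_def)
  have "coeff (?E f) 0 - ?s1 f:c1" unfolding A by (rule spec_cong[OF rhom_Const c1(1) es(2)])
  hence nA: "coeff (?E f) 0 ~: c1" using k1 iminus[OF c1(1), of "coeff (?E f) 0" "coeff (?E f) 0 - ?s1 f"] by (auto simp: c1_def)
  have io1: "map_poly (peval s1) (G.io' z) = [:z:]" for z
   by (rule poly_eqI) (simp add: G.io'_def coeff_map_poly R.ev.zero coeff_pCons split: nat.split)
  have B: "map_poly (peval s1) (?E g) = spec (%z. [:z:]) (%j. G.P1 (es j)) g"
   unfolding spec_comp[OF rhom_map_poly[OF R.ev.rhom_axioms] io'] io1 G.P1_def ..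
  have "map_poly (peval s1) (?E g) - ?s2 g:up k" unfolding B by (rule spec_cong[OF rhom_const_poly up_ideal es(3)])
  hence Bj: "peval s1 (coeff (?E g) j) = coeff (?s2 g) j" if "j < k" for j
   using that by (simp add: up_def monom_1_dvd_iff' coeff_map_poly R.ev.zero)
  define b where "b = coeff (?s2 g) k2"
  have "coeff (?E f) 0:c1"
  proof (rule leading_term_contradiction[OF mI c1])
   show "?E f * ?E g:low_coeffs (k1 * k2 + k2 + 1) c1" using AB by (simp add: k_def)
   show "coeff (?E g) j:m" if "j < k2" for j using Bj[of j] k2(2)[OF that] that by (simp add: m_def k_def)
   show "coeff (?E g) k2 - Const b:m" using Bj[of k2] by (simp add: m_def k_def b_def R.ev.diff)
   show "Const b * Const (1 / b) = 1" using k2(1) by (simp add: b_def flip: Const_mult)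
  qed
  thus False using nA by blast
 qed
 have p0: "idl p0" unfolding p0_def by (rule gen_ideal)
 have one: "?s1 1 ~: p1" "?s2 1 ~= 0" using primeD(2)[OF p1(2)] by (simp_all add: s1.one s2.one)
 have "x * y:S" if "x:S" "y:S" for x y
 proof -
  obtain f g where f: "x = f * g" "?s1 f ~: p1" "?s2 g ~= 0" using \<open>x:S\<close> unfolding S_def by blast
  obtain f' g' where g: "y = f' * g'" "?s1 f' ~: p1" "?s2 g' ~= 0" using \<open>y:S\<close> unfolding S_def by blast
  note fg = f g
  have "x * y = (f * f') * (g * g')" by (simp add: fg mult_ac)
  moreover have "?s1 (f * f') ~: p1" "?s2 (g * g') ~= 0" using fg prime_mult_iff[OF p1(2)] by (simp_all add: s1.mult s2.mult)
  ultimately show ?thesis unfolding S_def by blast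
 qed
 moreover have "1:S" unfolding S_def using one by (intro CollectI exI[of _ 1]) simp
 moreover have "p0 Int S = {}" using no unfolding S_def by blast
 ultimately obtain q where q: "prime_ideal q" "p0 <= q" "q Int S = {}" using prime_avoiding[OF p0, of S] by blast
 have "?s1 f:p1" if "f:q" for f
 proof (rule ccontr)
  assume "?s1 f ~: p1"
  hence "f * 1:S" unfolding S_def using one(2) by blast
  thus False using that q(3) by auto
 qed
 moreover have "?s2 f = 0" if "f:q" for f
 proof (rule ccontr)
  assume "?s2 f ~= 0"
  hence "1 * f:S" unfolding S_def using one(1) by blast
  thus False using that q(3) by auto
 qed
 ultimately show ?thesis using q(1,2) by blast
qed

end

section \<open>Localization of the family\<close>

text \<open>A matrix congruent to the identity modulo \<open>m\<close> becomes invertible after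
  inverting one element outside \<open>m\<close>; one index is eliminated at a time without
  division.\<close>

lemma eliminate:
 fixes ze :: "'i => 'i => 'r::comm_ring_1"
 assumes m: "prime_ideal m"
 shows "finite A ==> (!!i j. i:A ==> j:A ==> ze i j - (if i = j then 1 else 0):m) ==>
  EX b a. b ~: m & (ALL j:A. b * y j = (SUM i:A. a i * ze i j))"
proof (induction A arbitrary: ze y rule: finite_induct)
 case empty
 thus ?case using primeD(2)[OF m] by (intro exI[of _ 1]) auto
next
 case (insert k A)
 note mI = primeD(1)[OF m]
 define ze' where "ze' i j = ze k k * ze i j - ze i k * ze k j" for i j
 define y' where "y' j = ze k k * y j - y k * ze k j" for j
 have kk: "ze k k - 1:m" using insert.prems[of k k] by simp
 have "ze' i j - (if i = j then 1 else 0):m" if ij: "i:A" "j:A" for i j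
 proof -
  have "i ~= k" using insert.hyps ij by blast
  hence "ze i k:m" using insert.prems[of i k] ij by auto
  hence "ze k k * (ze i j - (if i = j then 1 else 0)) + (if i = j then 1 else 0) * (ze k k - 1) - ze k j * ze i k:m"
   using insert.prems[of i j] ij kk by (intro iminus[OF mI iadd[OF mI iscale[OF mI] iscale[OF mI]] iscale[OF mI]]) auto
  thus ?thesis by (simp add: ze'_def alg)
 qed
 from insert.IH[of ze' y', OF this] obtain b a where ba: "b ~: m" "ALL j:A. b * y' j = (SUM i:A. a i * ze' i j)" by blast
 define a' where "a' i = (if i = k then b * y k - (SUM i:A. a i * ze i k) else a i * ze k k)" for i
 have sum: "(SUM i:insert k A. a' i * ze i j) = (b * y k - (SUM i:A. a i * ze i k)) * ze k j + (SUM i:A. a i * ze k k * ze i j)" for j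
 proof -
  have "(SUM i:A. a' i * ze i j) = (SUM i:A. a i * ze k k * ze i j)"
   by (rule sum.cong) (use insert.hyps in "auto simp: a'_def")
  thus ?thesis using insert.hyps by (simp add: a'_def)
 qed
 have "b * ze k k * y j = (SUM i:insert k A. a' i * ze i j)" if j: "j:insert k A" for j
 proof (cases "j = k")
  case True
  thus ?thesis unfolding sum by (simp add: alg sum_distrib_left)
 next
  case False
  hence "b * y' j = (SUM i:A. a i * ze' i j)" using ba(2) j by blast
  thus ?thesis unfolding sum y'_def ze'_def
   by (simp add: alg sum_subtractf sum_distrib_left sum_distrib_right)
 qed
 moreover have "ze k k ~: m"
 proof
  assume "ze k k:m"
  from iminus[OF mI this kk] show False using primeD(2)[OF m] by simp
 qed
 hence "b * ze k k ~: m" using ba(1) prime_mult_iff[OF m] by blast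
 ultimately show ?case by blast
qed

lemma poly_closure:
 assumes "!!a. P (Const a)" "!!i. P (Var i)" and add: "!!f g. P f ==> P g ==> P (f + g)" and mult: "!!f g. P f ==> P g ==> P (f * g)"
 shows "P f"
proof (induction f rule: poly_induct)
 case (single mu a)
 have one: "P 1" using assms(1)[of 1] by simp
 have pw: "P (mon (sg i k))" for i k
  unfolding Var_power[symmetric] by (induction k) (simp_all add: one mult assms(2))
 have "P (PROD i:A. mon (sg i (k i)))" for A k
  by (induction A rule: infinite_finite_induct) (simp_all add: one mult pw)
 moreover have "(SUM i:ks mu. sg i (lk mu i)) = mu"
  by (rule pm_eqI) (simp add: lk_sum lk_sg keysI)
 ultimately have "P (mon mu)" unfolding mon_sum[symmetric] by metis
 thus ?case unfolding sg_eq by (intro mult assms(1))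
qed (rule add)

text \<open>The r-th power of a variable lifts every component to degrees at least \<open>r\<close>,
  where the two ideals agree.\<close>

lemma Proj_sub_truncate:
 assumes J: "hideal J" and I: "idl I" "I <= J" and d: "!!d. d >= r ==> hpart J d <= I"
 shows "Proj_sub I = Proj_sub J"
proof
 show "Proj_sub I <= Proj_sub J" unfolding Proj_sub_def using I(2) by blast
 note JI = homogeneousD[OF J]
 show "Proj_sub J <= Proj_sub I" unfolding Proj_sub_def
 proof safe
  fix f and i assume f: "ALL i. EX k. Var i ^ k * f:J"
  then obtain k where k: "Var i ^ k * f:J" by blast
  define g where "g = Var i ^ k * f"
  have g: "Var i ^ r * hcomp e g:I" for e
  proof -
   have "Var i ^ r * hcomp e g:J" unfolding g_def by (rule iscale[OF JI hom_ideal_hcomp[OF J k]])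
   moreover have "hom (r + e) (Var i ^ r * hcomp e g)"
    using hom_mon_mult[OF hom_hcomp, of "sg i r" e g] by (simp add: Var_power)
   ultimately show ?thesis using d[of "r + e"] by (auto simp: hpart_def)
  qed
  have "(SUM e<=pdeg g. Var i ^ r * hcomp e g):I" by (intro isetsum[OF I(1)] g)
  hence "Var i ^ (r + k) * f:I" by (simp add: sum_hcomp_pdeg g_def power_add mult.assoc flip: sum_distrib_left)
  thus "EX k. Var i ^ k * f:I" by blast
 qed
qed

lemma evaluation_prime: "prime_ideal {f. peval z f = 0}" for z :: "'x => 'a::idom"
 using rhom.prime_kernel[OF rhom_peval prime_zero, of z] by simp

lemma cmap_peval_Const [simp]: "cmap (peval z) (cmap Const f) = f"
 by (rule pm_eqI) (simp add: rhom.lk_cm[OF rhom_peval] lk_cmap)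

text \<open>The residue field of the point is C, so ranks modulo its maximal ideal are ranks of
  specialized forms; constants lift the coefficients of a relation.\<close>

lemma hrank_eval:
 fixes X :: "('n, ('y, complex) pol) pol set"
 shows "hpart J d <= cmap (peval z) ` hpart X d ==> hrank_ge {0} J d n ==> hrank_ge {f. peval z f = 0} X d n"
  and "cmap (peval z) ` hpart X d <= hpart J d ==> hrank_ge {f. peval z f = 0} X d n ==> hrank_ge {0} J d n"
proof -
 interpret ev: rhom "peval z" by (rule rhom_peval)
 let ?e = "cmap (peval z) :: ('n, ('y, complex) pol) pol => _"
 have lc: "lc (%j. peval z (u j)) (map lk (map ?e fs)) i = peval z (lc u (map lk fs) i)" for u fs i
  by (simp add: lc_def ev.sum ev.mult ev.lk_cm)
 have ind: "(indep {0} (map lk (map ?e fs))) = (indep {f. peval z f = 0} (map lk fs))" for fs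
 proof
  assume i: "indep {0} (map lk (map ?e fs))"
  have "peval z (u j) = 0" if "ALL i. lc u (map lk fs) i:{f. peval z f = 0}" "j < length fs" for u j
   using indepD[OF i, of "%j. peval z (u j)" j] lc[of u fs] that by simp
  thus "indep {f. peval z f = 0} (map lk fs)"
   unfolding indep_def by simp
 next
  assume i: "indep {f. peval z f = 0} (map lk fs)"
  have "v j:{0}" if "ALL i. lc v (map lk (map ?e fs)) i:{0}" "j < length fs" for v j
   using indepD[OF i, of "%j. Const (v j)" j] lc[of "%j. Const (v j)" fs] that by simp
  thus "indep {0} (map lk (map ?e fs))" unfolding indep_def by simp
 qed
 show "hrank_ge {f. peval z f = 0} X d n" if J: "hpart J d <= ?e ` hpart X d" and r: "hrank_ge {0} J d n"
 proof -
  obtain fs where fs: "set fs <= hpart J d" "length fs = n" "indep {0} (map lk fs)" using r unfolding hrank_ge_def by blast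
  hence "fs:map ?e ` lists (hpart X d)" unfolding lists_image[symmetric] using J by blast
  then obtain gs where "fs = map ?e gs" "set gs <= hpart X d" by blast
  thus ?thesis unfolding hrank_ge_def using fs(2,3) ind[of gs] by (intro exI[of _ gs]) simp
 qed
 show "hrank_ge {0} J d n" if J: "?e ` hpart X d <= hpart J d" and r: "hrank_ge {f. peval z f = 0} X d n"
 proof -
  obtain gs where gs: "set gs <= hpart X d" "length gs = n" "indep {f. peval z f = 0} (map lk gs)" using r unfolding hrank_ge_def by blast
  thus ?thesis unfolding hrank_ge_def using J ind[of gs] by (intro exI[of _ "map ?e gs"]) auto
 qed
qed

text \<open>\<open>zW\<close> is the monomial point, where the universal forms become the
  nonstandard monomials of degree \<open>r\<close>; it lies on the zero set of
  \<open>q\<close>.\<close>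

locale common_family = universal std x0 Gs r N M mm mus
 for std :: "('n::finite) mon => bool" and x0 Gs r N M mm mus +
 fixes q :: "base_ring set" and zW
 assumes q: "prime_ideal q" and p0q: "p0 <= q" and W: "!!f. f:q ==> peval zW f = 0"
  and Wgen: "!!j. j < N ==> cmap (peval zW) (gen j) = mon (mus j)"
begin

abbreviation "nd d == card {mu. ~ std mu & mdeg mu = d}"

lemmas qI = primeD(1)[OF q]
lemmas X0I = X0_hom[unfolded homogeneous_ideal_def, THEN conjunct1]

text \<open>X0 contains lifts \<open>ze mu\<close> of all nonstandard monomials of degree
  \<open>d\<close>, and their matrix of nonstandard coefficients is the identity at the monomial
  point. An element of X0 can thus be freed of nonstandard terms up to a denominator nonzero at that
  point, and the standard remainder has its coefficients in \<open>p0\<close>.\<close>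

lemma rank_q:
 assumes d: "d >= r" shows "hrank_le q X0 d (nd d)"
proof -
 let ?B = "{mu. ~ std mu & mdeg mu = d}" and ?m = "{f. peval zW f = 0}"
 note m = evaluation_prime[of zW]
 have fin: "finite ?B" by (rule finite_subset[OF _ finite_mdeg[of d]]) auto
 have "EX ze. mu:?B --> ze:hpart X0 d & cmap (peval zW) ze = mon mu" for mu
 proof (cases "mu:?B")
  case True
  hence ns: "~ std mu" "mdeg mu = d" by auto
  note b = base[OF ns(1)]
  have "mdeg mu = mdeg (mu - base mu) + mdeg (base mu)" using b by (metis mdeg_add)
  hence "r - mdeg (base mu) <= mdeg (mu - base mu)" using d ns(2) by linarith
  then obtain ka1 ka2 where ka: "mu - base mu = ka1 + ka2" "mdeg ka2 = r - mdeg (base mu)" using split_monomial by blast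
  have mu: "mu = ka1 + (ka2 + base mu)" using b ka(1) by (metis add.assoc)
  have "ka2 + base mu:{mu. ~ std mu & mdeg mu = r}" using b nonstd_gen Gs_le[of "base mu"] ka(2) by auto
  hence "ka2 + base mu:mus ` {..<N}" by (simp only: bij_betw_imp_surj_on[OF mus])
  then obtain j where j: "j < N" "mus j = ka2 + base mu" by (elim imageE) simp
  have "mon ka1 * gen j:X0" unfolding X0_def using j(1) by (intro gen_scale gen_base) blast
  moreover have "mdeg ka1 + r = d" using mu ns(2) Gs_le[of "base mu"] b ka(2) by (metis le_add_diff_inverse2 mdeg_add)
  hence "hom d (mon ka1 * gen j)" using hom_mon_mult[OF gen_hom, of ka1 j] by simp
  moreover have "cmap (peval zW) (mon ka1 * gen j) = mon mu"
   using mu by (metis Wgen[OF j(1)] j(2) mon_add rhom.cmap_mon[OF rhom_peval] rhom.cmap_mult[OF rhom_peval])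
  ultimately show ?thesis by (auto simp: hpart_def)
 qed (rule exI, blast)
 hence "EX ze. ALL mu. mu:?B --> ze mu:hpart X0 d & cmap (peval zW) (ze mu) = mon mu" by (intro choice) blast
 then obtain ze where "ALL mu. mu:?B --> ze mu:hpart X0 d & cmap (peval zW) (ze mu) = mon mu" ..
 hence ze: "ze mu:X0" "hom d (ze mu)" "cmap (peval zW) (ze mu) = mon mu" if "mu:?B" for mu
  using that by (auto simp: hpart_def)
 have zem: "lk (ze mu) ka - (if mu = ka then 1 else 0):?m" if "mu:?B" for mu ka
  using arg_cong[OF ze(3)[OF that], of "%f. lk f ka"]
  by (simp add: rhom.lk_cm[OF rhom_peval] lk_mon rhom.hom_simps[OF rhom_peval])
 have "length fs <= card ?B" if fs: "set fs <= hpart X0 d" "indep q (map lk fs)" for fs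
 proof -
  have "length (map lk fs) <= card ?B"
  proof (rule indep_span_bound[OF q fin fs(2), where F = "%mu. lk (ze mu)"])
   fix l assume "l < length (map lk fs)"
   hence "fs ! l:hpart X0 d" and l: "map lk fs ! l = lk (fs ! l)" using fs(1) nth_mem by auto
   hence y: "fs ! l:X0" "hom d (fs ! l)" by (auto simp: hpart_def)
   obtain b a where ba: "b ~: ?m" "ALL j:?B. b * lk (fs ! l) j = (SUM i:?B. a i * lk (ze i) j)"
    using eliminate[OF m fin zem, of "lk (fs ! l)"] by blast
   define G where "G = Const b * fs ! l - (SUM i:?B. Const (a i) * ze i)"
   have lG: "lk G k = b * lk (fs ! l) k - (SUM i:?B. a i * lk (ze i) k)" for k
    by (simp add: G_def lk_minus lk_sum lk_Const)
   have "G:X0" unfolding G_def by (intro iminus[OF X0I] isetsum[OF X0I] iscale[OF X0I] y ze)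
   have "hom d G" unfolding G_def by (intro hom_minus hom_sum hom_Const_mult y ze)
   hence "mdeg k = d" if "lk G k ~= 0" for k using that by (simp add: hom_iff keysI)
   moreover have "lk G k = 0" if "k:?B" for k using bspec[OF ba(2) that] by (simp add: lG)
   ultimately have "stdp G" unfolding stdp_def by blast
   with \<open>G:X0\<close> have "lk G k:p0" for k unfolding p0_def by (intro gen_base UnI1 CollectI exI[of _ G] exI[of _ k]) simp
   hence "lk G k:q" for k using p0q by blast
   thus "EX u r. u ~: q & (ALL k. u * (map lk fs ! l) k - (SUM j:?B. r j * lk (ze j) k):q)"
    unfolding l using lG ba(1) W by (intro exI[of _ b] exI[of _ a]) auto
  qed
  thus ?thesis by simp
 qed
 thus ?thesis unfolding hrank_le_def by blast
qed

lemma rank_at_point: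
 assumes t: "!!j. j < N ==> cmap (peval z) (gen j) = t j" and J: "hpart J d <= igen (t ` {..<N})" and rk: "hrank_ge {0} J d n"
 shows "hrank_ge {f. peval z f = 0} X0 d n"
proof (rule hrank_eval(1)[OF _ rk], rule subsetI)
 fix f assume "f:hpart J d"
 hence f: "hom d f" "f:igen (t ` {..<N})" using J by (auto simp: hpart_def)
 interpret ev: rhom "peval z" by (rule rhom_peval)
 interpret evc: rhom "cmap (peval z) :: ('n, base_ring) pol => _" by (rule ev.rhom_cmap)
 obtain h where h: "f = (SUM j<N. h j * t j)" using f(2) unfolding ideal_gen_image_iff by (elim exE)
 define F where "F = (SUM j<N. cmap Const (h j) * gen j)"
 have "cmap (peval z) F = f" unfolding F_def h evc.sum ev.cmap_mult by (simp add: t)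
 hence "cmap (peval z) (hcomp d F) = f" using hcomp_cmap[of "peval z" d F] f(1) by (simp add: ev.zero hcomp_hom)
 moreover have "F:X0" unfolding X0_def F_def ideal_gen_image_iff by (rule exI) (rule refl)
 hence "hcomp d F:hpart X0 d" by (simp add: hpart_def hom_ideal_hcomp[OF X0_hom])
 ultimately show "f:cmap (peval z) ` hpart X0 d" by blast
qed

lemma noeth_q: "noeth q"
proof (rule noeth_affine_base)
 have "{i. Var i ~: q} <= {..<N * M}"
 proof safe
  fix i assume i: "Var i ~: q"
  show "i < N * M"
  proof (rule ccontr)
   assume "~ i < N * M"
   hence "Var i:p0" unfolding p0_def by (intro gen_base) blast
   thus False using i p0q by blast
  qed
 qed
 thus "affine_base q" unfolding affine_base_def using qI finite_subset by blast
qed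

text \<open>The base is V(q) without the zeros of \<open>de\<close>, made affine by the new
  coordinate \<open>Var 0\<close> = 1/de, the old variables being shifted by one. The rank is
  constant there, which gives flatness through \<open>FL\<close>. Membership is decided in a
  fraction field by clearing powers of \<open>de\<close>.\<close>

lemma localized_family:
 assumes deq: "de ~: q" and de: "!!P d. prime_ideal P ==> q <= P ==> de ~: P ==> d >= r ==> hrank_ge P X0 d (nd d)"
 shows "EX p X. prime_ideal p & flat_family p X & (ALL z t. (ALL f:q. peval z f = 0) --> peval z de ~= 0 -->
  (ALL j<N. cmap (peval z) (gen j) = t j) --> (EX z'. z':base_points p & fibre X z' = Proj_sub (igen (t ` {..<N}))))"
proof -
 define Fr where "Fr a = Fract a 1" for a :: base_ring
 interpret Fr: rhom Fr by unfold_locales (simp_all add: Fr_def One_fract_def)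
 have Fr_inj: "(Fr a = Fr b) = (a = b)" for a b by (simp add: Fr_def eq_fract)
 have de0: "de ~= 0" using deq izero[OF qI] by blast
 note emb = rhom_comp[OF rhom_Const Fr.rhom_axioms]
 \<comment> \<open>\<open>ph\<close> realizes the localization inside the fraction field,
   \<open>sh\<close> embeds the old coordinate ring, and \<open>pt z\<close> is the point of the new
   base over \<open>z\<close>.\<close>
 define ph where "ph = subst_hom (%z. Fr (Const z)) (case_nat (Fract 1 de) (%i. Fr (Var i)))"
 interpret ph: rhom ph unfolding ph_def by (rule rhom.rhom_subst[OF emb])
 define sh :: "base_ring => base_ring" where "sh = subst_hom Const (%i. Var (Suc i))"
 interpret sh: rhom sh unfolding sh_def by (rule rhom.rhom_subst[OF rhom_Const])
 define pt where "pt z = case_nat (1 / peval z de) z" for z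
 have sh_gen: "sh (Const a) = Const a" "sh (Var i) = Var (Suc i)" for a i
  by (simp_all add: sh_def rhom.subst_Const[OF rhom_Const] rhom.subst_Var[OF rhom_Const])
 have ph_gen: "ph (Const a) = Fr (Const a)" "ph (Var 0) = Fract 1 de" "ph (Var (Suc i)) = Fr (Var i)" for a i
  by (simp_all add: ph_def rhom.subst_Const[OF emb] rhom.subst_Var[OF emb])
 have phsh: "ph (sh f) = Fr f" for f
  by (rule rhom_eqI[of "%f. ph (sh f)"]) (simp_all add: rhom_comp[OF sh.rhom_axioms ph.rhom_axioms] Fr.rhom_axioms sh_gen ph_gen)
 have pt_sh: "peval (pt z) (sh f) = peval z f" for z f
  by (rule rhom_eqI[of "%f. peval (pt z) (sh f)"]) (simp_all add: rhom_comp[OF sh.rhom_axioms rhom_peval] rhom_peval sh_gen pt_def)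
 have phde: "ph (Var 0) * Fr de = 1" using de0 by (simp add: ph_gen Fr_def One_fract_def eq_fract)
 have frac: "EX k a. ph f * Fr de ^ k = Fr a & (ALL z. peval z de ~= 0 --> peval (pt z) f * peval z de ^ k = peval z a)" for f
 proof (induction f rule: poly_closure)
  case (1 a)
  show ?case by (intro exI[of _ 0] exI[of _ "Const a"]) (simp add: ph_gen)
 next
  case (2 i)
  show ?case
  proof (cases i)
   case 0
   show ?thesis unfolding 0 by (intro exI[of _ 1] exI[of _ 1]) (simp add: phde Fr.one pt_def rhom.one[OF rhom_peval])
  next
   case (Suc j)
   show ?thesis unfolding Suc by (intro exI[of _ 0] exI[of _ "Var j"]) (simp add: ph_gen pt_def)
  qed
 next
  case (3 f g)
  then obtain k a l b where ab: "ph f * Fr de ^ k = Fr a" "ph g * Fr de ^ l = Fr b"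
   "!!z. peval z de ~= 0 ==> peval (pt z) f * peval z de ^ k = peval z a" "!!z. peval z de ~= 0 ==> peval (pt z) g * peval z de ^ l = peval z b" by blast
  show ?case
  proof (intro exI[of _ "k + l"] exI[of _ "a * de ^ l + b * de ^ k"] conjI allI impI)
   show "ph (f + g) * Fr de ^ (k + l) = Fr (a * de ^ l + b * de ^ k)"
    by (simp add: ph.add Fr.add Fr.mult Fr.power power_add ring_distribs flip: ab(1,2))
   show "peval (pt z) (f + g) * peval z de ^ (k + l) = peval z (a * de ^ l + b * de ^ k)" if "peval z de ~= 0" for z
    by (simp add: rhom.hom_simps[OF rhom_peval] power_add ring_distribs flip: ab(3)[OF that] ab(4)[OF that])
  qed
 next
  case (4 f g)
  then obtain k a l b where ab: "ph f * Fr de ^ k = Fr a" "ph g * Fr de ^ l = Fr b"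
   "!!z. peval z de ~= 0 ==> peval (pt z) f * peval z de ^ k = peval z a" "!!z. peval z de ~= 0 ==> peval (pt z) g * peval z de ^ l = peval z b" by blast
  show ?case
  proof (intro exI[of _ "k + l"] exI[of _ "a * b"] conjI allI impI)
   show "ph (f * g) * Fr de ^ (k + l) = Fr (a * b)" by (simp add: ph.mult Fr.mult power_add mult_ac flip: ab(1,2))
   show "peval (pt z) (f * g) * peval z de ^ (k + l) = peval z (a * b)" if "peval z de ~= 0" for z
    by (simp add: rhom.hom_simps[OF rhom_peval] power_add mult_ac flip: ab(3)[OF that] ab(4)[OF that])
  qed
 qed
 have pw: "de ^ k ~: q" for k using deq prime_ideal_power[OF q] by blast
 \<comment> \<open>The preimage of the extension of \<open>q\<close> to the localization;
   \<open>p_iff\<close> shows that membership does not depend on the chosen numerator.\<close>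
 define p where "p = {f. EX k a. a:q & ph f * Fr de ^ k = Fr a}"
 have p_iff: "(f:p) = (a:q)" if fa: "ph f * Fr de ^ k = Fr a" for f k a
 proof
  assume "f:p"
  then obtain l b where b: "b:q" "ph f * Fr de ^ l = Fr b" unfolding p_def by blast
  have "Fr (a * de ^ l) = Fr (b * de ^ k)" by (simp add: Fr.mult Fr.power mult_ac flip: fa b(2))
  hence "a * de ^ l:q" unfolding Fr_inj using iright[OF qI b(1)] by simp
  thus "a:q" using pw prime_mult_iff[OF q] by blast
 qed (use fa p_def in blast)
 have pI: "idl p"
 proof (rule idealI)
  show "0:p" using p_iff[of 0 0 0] izero[OF qI] by (simp add: ph.zero Fr.zero)
 next
  fix f g assume fg: "f:p" "g:p"
  obtain k a l b where ab: "a:q" "ph f * Fr de ^ k = Fr a" "b:q" "ph g * Fr de ^ l = Fr b" using fg unfolding p_def by blast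
  have "ph (f + g) * Fr de ^ (k + l) = Fr (a * de ^ l + b * de ^ k)"
   by (simp add: ph.add Fr.add Fr.mult Fr.power power_add ring_distribs flip: ab(2,4))
  moreover have "a * de ^ l + b * de ^ k:q" by (intro iadd[OF qI] iright[OF qI] ab)
  ultimately show "f + g:p" using p_iff by blast
 next
  fix c f assume "f:p"
  then obtain k a where a: "a:q" "ph f * Fr de ^ k = Fr a" unfolding p_def by blast
  obtain l b where b: "ph c * Fr de ^ l = Fr b" using frac by blast
  have "ph (c * f) * Fr de ^ (l + k) = Fr (b * a)" by (simp add: ph.mult Fr.mult power_add mult_ac flip: a(2) b)
  thus "c * f:p" using p_iff iscale[OF qI a(1)] by blast
 qed
 have p: "prime_ideal p" unfolding prime_ideal_def
 proof (intro conjI pI allI impI)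
  show "1 ~: p" using p_iff[of 1 0 1] primeD(2)[OF q] by (simp add: ph.one Fr.one)
  fix f g assume fg: "f * g:p"
  obtain k a where a: "ph f * Fr de ^ k = Fr a" using frac by blast
  obtain l b where b: "ph g * Fr de ^ l = Fr b" using frac by blast
  have "ph (f * g) * Fr de ^ (k + l) = Fr (a * b)" by (simp add: ph.mult Fr.mult power_add mult_ac flip: a b)
  hence "a * b:q" using p_iff fg by blast
  thus "f:p | g:p" using p_iff[OF a] p_iff[OF b] prime_mult_iff[OF q] by blast
 qed
 have ker_p: "f:p" if "ph f = 0" for f using p_iff[of f 0 0] that izero[OF qI] by (simp add: Fr.zero)
 have sh_p: "sh f:p" if "f:q" for f using p_iff[of "sh f" 0 f] that by (simp add: phsh)
 have clear0: "EX e a'. sh de ^ e * a - sh a':p" for a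
 proof -
  obtain k a' where "ph a * Fr de ^ k = Fr a'" using frac by blast
  hence "ph (sh de ^ k * a - sh a') = 0" by (simp add: ph.diff ph.mult ph.power phsh mult.commute)
  thus ?thesis using ker_p by blast
 qed
 let ?sc = "cmap sh :: ('n, base_ring) pol => _"
 interpret sc: rhom ?sc by (rule sh.rhom_cmap)
 let ?D = "%e. Const (sh de ^ e) :: ('n, base_ring) pol"
 note cp = icI[OF pI]
 have D: "?D e = ?sc (Const (de ^ e))" for e by (simp add: sh.cmap_Const sh.power)
 have clear: "EX e F'. ?D e * F - ?sc F':cI p" for F
 proof (induction F rule: poly_induct)
  case (single mu a)
  obtain e a' where e: "sh de ^ e * a - sh a':p" using clear0 by blast
  have "?D e * sg mu a - ?sc (sg mu a') = sg mu (sh de ^ e * a - sh a')"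
   by (simp add: sh.cmap_single Const_def mult_single single_diff)
  thus ?case using e izero[OF pI] by (intro exI[of _ e] exI[of _ "sg mu a'"]) (simp add: cI_iff lk_sg)
 next
  case (add f g)
  then obtain e f' l g' where fg: "?D e * f - ?sc f':cI p" "?D l * g - ?sc g':cI p" by blast
  have "?D l * (?D e * f - ?sc f') + ?D e * (?D l * g - ?sc g'):cI p"
   by (intro iadd[OF cp] iscale[OF cp] fg)
  hence "?D (e + l) * (f + g) - ?sc (Const (de ^ l) * f' + Const (de ^ e) * g'):cI p"
   by (simp add: sc.add sh.cmap_mult D[symmetric] power_add Const_mult alg)
  thus ?case by blast
 qed
 define X where "X = igen (?sc ` gen ` {..<N} Un Const ` p)"
 have XI: "idl X" unfolding X_def by (rule gen_ideal)
 have Xh: "hideal X" unfolding X_def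
 proof (rule hom_ideal_gen)
  fix f assume "f:?sc ` gen ` {..<N} Un Const ` p"
  thus "EX d. hom d f"
   using hom_cmap[of sh, OF sh.zero gen_hom] hom_Const_mult[OF hom_mon[of 0]] by fastforce
 qed
 have pX: "cI p <= X" unfolding cI_eq_ideal_gen[OF pI] X_def by (rule ideal.span_mono) blast
 have scX: "?sc f:X" if "f:X0" for f
 proof -
  obtain h where "f = (SUM j<N. h j * gen j)" using \<open>f:X0\<close> unfolding X0_def ideal_gen_image_iff by (elim exE)
  hence "?sc f = (SUM j<N. ?sc (h j) * ?sc (gen j))" by (simp add: sc.sum sh.cmap_mult)
  thus ?thesis unfolding X_def by (auto intro!: gen_sum gen_scale intro: gen_base)
 qed
 have clearX: "EX e F'. F':X0 & ?D e * F - ?sc F':cI p" if "F:X" for F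
 proof -
  let ?T = "{F. EX e F'. F':X0 & ?D e * F - ?sc F':cI p}"
  have "idl ?T"
  proof (rule idealI)
   show "0:?T" using izero[OF X0I] izero[OF cp] by (auto simp: sc.zero intro!: exI[of _ 0])
  next
   fix f g assume "f:?T" "g:?T"
   then obtain e f' l g' where fg: "f':X0" "?D e * f - ?sc f':cI p" "g':X0" "?D l * g - ?sc g':cI p" by blast
   have "?D l * (?D e * f - ?sc f') + ?D e * (?D l * g - ?sc g'):cI p"
    by (intro iadd[OF cp] iscale[OF cp] fg)
   hence "?D (e + l) * (f + g) - ?sc (Const (de ^ l) * f' + Const (de ^ e) * g'):cI p"
    by (simp add: sc.add sh.cmap_mult D[symmetric] power_add Const_mult alg)
   moreover have "Const (de ^ l) * f' + Const (de ^ e) * g':X0"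
    by (intro iadd[OF X0I] iscale[OF X0I] fg)
   ultimately show "f + g:?T" by blast
  next
   fix c f assume "f:?T"
   then obtain e f' where f: "f':X0" "?D e * f - ?sc f':cI p" by blast
   obtain l c' where c: "?D l * c - ?sc c':cI p" using clear by blast
   have "(?D l * c) * (?D e * f - ?sc f') + ?sc f' * (?D l * c - ?sc c'):cI p"
    by (intro iadd[OF cp] iscale[OF cp] f c)
   hence "?D (l + e) * (c * f) - ?sc (c' * f'):cI p"
    by (simp add: sh.cmap_mult power_add Const_mult alg)
   thus "c * f:?T" using iscale[OF X0I f(1), of c'] by blast
  qed
  moreover have "?sc ` gen ` {..<N} Un Const ` p <= ?T"
  proof safe
   fix j assume "j < N"
   hence "gen j:X0" unfolding X0_def by (auto intro: gen_base)
   thus "EX e F'. F':X0 & ?D e * ?sc (gen j) - ?sc F':cI p"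
    using izero[OF cp] by (intro exI[of _ 0] exI[of _ "gen j"]) simp
  next
   fix a assume "a:p"
   hence "Const a * 1:cI p" by (rule cI_Const_mult[OF pI])
   thus "EX e F'. F':X0 & ?D e * Const a - ?sc F':cI p"
    using izero[OF X0I] by (intro exI[of _ 0] exI[of _ 0]) (simp add: sc.zero)
  qed
  ultimately have "X <= ?T" unfolding X_def by (rule gen_minimal[rotated])
  thus ?thesis using that by blast
 qed
 have "FL p X" unfolding FL_def
 proof (intro allI impI, elim conjE)
  fix c F d i assume c: "idl c" "p <= c" and F: "F:X" "hom d F" "F:cI c"
  \<comment> \<open>Multiplication by x_i^r brings the form into the degrees where the rank is
    known.\<close>
  define G where "G = Var i ^ r * F"
  have G: "G:X" "G:cI c" "hom (r + d) G"
   unfolding G_def using F hom_mon_mult[OF F(2), of "sg i r"]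
   by (auto intro: iscale[OF XI] iscale[OF icI[OF c(1)]] simp: Var_power)
  obtain e F1 where F1: "F1:X0" "?D e * G - ?sc F1:cI p" using clearX[OF G(1)] by blast
  define F' where "F' = hcomp (r + d) F1"
  have F': "F':hpart X0 (r + d)" using hom_ideal_hcomp[OF X0_hom F1(1)] by (simp add: hpart_def F'_def)
  have rel: "?D e * G - ?sc F':cI p"
   using hcomp_cI[OF pI F1(2), of "r + d"] G(3) by (simp add: hcomp_minus hcomp_Const_mult hcomp_hom hcomp_cmap[of sh, OF sh.zero] F'_def)
  define c' where "c' = {f. sh f:c}"
  have c': "idl c'" "q <= c'" unfolding c'_def using sh.ideal_kernel[OF c(1)] sh_p c(2) by auto
  have "?D e * G - (?D e * G - ?sc F'):cI c"
   by (rule iminus[OF icI[OF c(1)] iscale[OF icI[OF c(1)] G(2)] subsetD[OF cI_mono[OF c(2)] rel]])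
  hence "F':cI c'" by (simp add: cI_iff c'_def sh.lk_cm)
  from flat_of_constant_rank[OF q X0I rank_q de c' F' this]
  obtain k where k: "Const (de ^ k) * F':isum (pro c' X0) (cI q)" by auto
  let ?W = "isum (pro c X) (cI p)"
  have W: "idl ?W" by (rule isum_ideal[OF pro_ideal cp])
  obtain A B where AB: "A:pro c' X0" "B:cI q" "Const (de ^ k) * F' = A + B" using k unfolding isum_def by blast
  have "pro c' X0 <= {A. ?sc A:pro c X}"
   by (rule pro_minimal[OF sc.ideal_kernel[OF pro_ideal]]) (auto simp: sh.cmap_mult sh.cmap_Const c'_def intro: pro_base scX)
  hence "?sc A:?W" using AB(1) isum_left[OF cp] by blast
  moreover have "?sc B:?W" using AB(2) sh_p isum_right[OF pro_ideal[of c X], of "cI p"] by (auto simp: cI_iff sh.lk_cm)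
  ultimately have "?sc (Const (de ^ k) * F'):?W" unfolding AB(3) sc.add by (rule iadd[OF W])
  moreover have "?D k * (?D e * G - ?sc F'):?W"
   using iscale[OF cp rel] isum_right[OF pro_ideal[of c X], of "cI p"] by blast
  ultimately have "?D k * (?D e * G - ?sc F') + ?sc (Const (de ^ k) * F'):?W" by (rule iadd[OF W, rotated])
  hence DG: "?D (k + e) * G:?W" by (simp add: sh.cmap_mult D[symmetric] power_add Const_mult alg)
  \<comment> \<open>Multiplication by a power of \<open>Var 0\<close> undoes the power of
    \<open>de\<close> modulo \<open>p\<close>.\<close>
  have "ph (1 - Var 0 ^ (k + e) * sh de ^ (k + e)) = 0"
   using phde by (simp add: ph.diff ph.one ph.mult ph.power phsh flip: power_mult_distrib)
  hence "Const (1 - Var 0 ^ (k + e) * sh de ^ (k + e)) * G:cI p" by (intro cI_Const_mult[OF pI] ker_p)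
  hence "Const (1 - Var 0 ^ (k + e) * sh de ^ (k + e)) * G:?W" using isum_right[OF pro_ideal[of c X], of "cI p"] by blast
  from iadd[OF W this iscale[OF W DG, of "Const (Var 0 ^ (k + e))"]]
  have "G:?W" by (simp add: Const_minus Const_mult alg)
  thus "EX k. Var i ^ k * F:?W" unfolding G_def by blast
 qed
 hence fl: "flat_quotient p smul (igen (X Un {Var i - 1}))" for i by (rule flat_chartI[OF _ Xh pI pX])
 have "{i. Var i ~: p} <= {..N * M}"
 proof safe
  fix i assume i: "Var i ~: p"
  show "i <= N * M"
  proof (cases i)
   case (Suc j)
   have "j < N * M"
   proof (rule ccontr)
    assume "~ j < N * M"
    hence "Var j:p0" unfolding p0_def by (intro gen_base) blast
    hence "Var j:q" using p0q by blast
    thus False using sh_p[of "Var j"] i by (simp add: sh_gen Suc)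
   qed
   thus ?thesis by (simp add: Suc)
  qed simp
 qed
 hence "affine_base p" unfolding affine_base_def using pI finite_subset by blast
 hence flat: "flat_family p X" unfolding flat_family_def using Xh fl pX by (auto simp: X_def intro: gen_base)
 have "EX z'. z':base_points p & fibre X z' = Proj_sub (igen (t ` {..<N}))"
  if z: "ALL f:q. peval z f = 0" "peval z de ~= 0" "ALL j<N. cmap (peval z) (gen j) = t j" for z t
 proof (intro exI[of _ "pt z"] conjI)
  have van: "peval (pt z) f = 0" if f: "f:p" for f
  proof -
   obtain k a where a: "ph f * Fr de ^ k = Fr a" "peval (pt z) f * peval z de ^ k = peval z a" using frac z(2) by blast
   have "a:q" using p_iff[OF a(1)] f by blast
   thus ?thesis using a(2) z(1,2) by simp
  qed
  thus "pt z:base_points p" by (simp add: base_points_def)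
  interpret ev: rhom "peval (pt z)" by (rule rhom_peval)
  interpret evc: rhom "cmap (peval (pt z)) :: ('n, base_ring) pol => _" by (rule ev.rhom_cmap)
  have gz: "cmap (peval (pt z)) (?sc (gen j)) = t j" if "j < N" for j
  proof -
   have "cmap (peval (pt z)) (?sc (gen j)) = cmap (peval z) (gen j)"
    by (rule pm_eqI) (simp add: ev.lk_cm sh.lk_cm rhom.lk_cm[OF rhom_peval] pt_sh)
   thus ?thesis using z(3) that by simp
  qed
  let ?I = "igen (t ` {..<N})"
  have "X <= {F. cmap (peval (pt z)) F:?I}" unfolding X_def
  proof (rule gen_minimal[OF _ evc.ideal_kernel[OF gen_ideal]], safe)
   show "cmap (peval (pt z)) (?sc (gen j)):?I" if "j < N" for j using gz[OF that] that by (auto intro: gen_base)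
   show "cmap (peval (pt z)) (Const a):?I" if "a:p" for a using van[OF that] by (simp add: ev.cmap_Const ideal.span_zero)
  qed
  moreover have "f:cmap (peval (pt z)) ` X" if "f:?I" for f
  proof -
   obtain h where h: "f = (SUM j<N. h j * t j)" using \<open>f:?I\<close> unfolding ideal_gen_image_iff by (elim exE)
   define F where "F = (SUM j<N. cmap Const (h j) * ?sc (gen j))"
   hence "cmap (peval (pt z)) F = f" unfolding F_def h evc.sum ev.cmap_mult by (simp add: gz)
   moreover have "F:X" unfolding F_def X_def by (auto intro!: gen_sum gen_scale intro: gen_base)
   ultimately show ?thesis by blast
  qed
  ultimately have "cmap (peval (pt z)) ` X = ?I" by blast
  thus "fibre X (pt z) = Proj_sub ?I" by (simp add: fibre_def cmap_def)
 qed
 thus ?thesis using p flat by blast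
qed

lemma family_through:
 assumes V: "ALL f:q. peval zV f = 0" "!!j. j < N ==> cmap (peval zV) (gen j) = tV j"
  "!!d. d >= r ==> hpart JV d <= igen (tV ` {..<N})" "!!d. d >= r ==> hrank_ge {0} JV d (nd d)"
  and T: "ALL f:q. peval zT f = 0" "!!j. j < N ==> cmap (peval zT) (gen j) = tT j"
  "!!d. d >= r ==> hpart JT d <= igen (tT ` {..<N})" "!!d. d >= r ==> hrank_ge {0} JT d (nd d)"
 shows "EX p X t s. prime_ideal p & flat_family p X & t:base_points p & s:base_points p &
  fibre X t = Proj_sub (igen (tV ` {..<N})) & fibre X s = Proj_sub (igen (tT ` {..<N}))"
proof -
 have ex: "EX de. peval z de ~= 0 & (ALL P. prime_ideal P & q <= P & de ~: P --> (ALL d>=r. hrank_ge P X0 d (nd d)))"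
  if z: "ALL f:q. peval z f = 0" "!!j. j < N ==> cmap (peval z) (gen j) = t j"
   "!!d. d >= r ==> hpart J d <= igen (t ` {..<N})" "!!d. d >= r ==> hrank_ge {0} J d (nd d)" for z t J
  using open_rank[OF noeth_q evaluation_prime[of z] _ X0I rank_at_point[OF z(2-4)]] z(1) by blast
 obtain deV where deV: "peval zV deV ~= 0" "ALL P. prime_ideal P & q <= P & deV ~: P --> (ALL d>=r. hrank_ge P X0 d (nd d))"
  using ex[OF V] by blast
 obtain deT where deT: "peval zT deT ~= 0" "ALL P. prime_ideal P & q <= P & deT ~: P --> (ALL d>=r. hrank_ge P X0 d (nd d))"
  using ex[OF T] by blast
 \<comment> \<open>If each of the two functions vanishes at the point belonging to the other, their
   sum is nonzero at both points, and off a prime containing both it cannot be.\<close>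
 have "EX de. peval zV de ~= 0 & peval zT de ~= 0 & (ALL P. idl P --> de ~: P --> deV ~: P | deT ~: P)"
 proof (cases "peval zT deV = 0")
  case False thus ?thesis using deV(1) by blast
 next
  case T0: True
  show ?thesis
  proof (cases "peval zV deT = 0")
   case False thus ?thesis using deT(1) by blast
  next
   case True
   thus ?thesis using T0 deV(1) deT(1)
    by (intro exI[of _ "deV + deT"]) (auto simp: rhom.hom_simps[OF rhom_peval] intro: iadd)
  qed
 qed
 then obtain de where de: "peval zV de ~= 0" "peval zT de ~= 0" "!!P. idl P ==> de ~: P ==> deV ~: P | deT ~: P" by blast
 have "hrank_ge P X0 d (nd d)" if "prime_ideal P" "q <= P" "de ~: P" "d >= r" for P d
  using de(3)[OF primeD(1)[OF that(1)] that(3)] deV(2) deT(2) that by blast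
 moreover have "de ~: q" using V(1) de(1) by blast
 ultimately have "EX p X. prime_ideal p & flat_family p X & (ALL z t. (ALL f:q. peval z f = 0) --> peval z de ~= 0 -->
  (ALL j<N. cmap (peval z) (gen j) = t j) --> (EX z'. z':base_points p & fibre X z' = Proj_sub (igen (t ` {..<N}))))"
  by (intro localized_family) 
 then obtain p X where pX: "prime_ideal p" "flat_family p X" and pts: "!!z t. (ALL f:q. peval z f = 0) ==> peval z de ~= 0 ==>
  (ALL j<N. cmap (peval z) (gen j) = t j) ==> EX z'. z':base_points p & fibre X z' = Proj_sub (igen (t ` {..<N}))"
  by blast
 show ?thesis using pX pts[OF V(1) de(1), of tV] pts[OF T(1) de(2), of tT] V(2) T(2) by blast
qed

end

section \<open>Families degenerating to a cone\<close>

lemma hom_image: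
 assumes X: "hideal X"
 shows "hideal (cmap (peval z) ` X)"
proof (rule hom_idealI)
 interpret ev: rhom "peval z" by (rule rhom_peval)
 note XI = homogeneousD[OF X]
 show "idl (cmap (peval z) ` X)"
 proof (rule idealI)
  show "0:cmap (peval z) ` X" using izero[OF XI] rhom.zero[OF ev.rhom_cmap] by (metis imageI)
  show "f + g:cmap (peval z) ` X" if "f:cmap (peval z) ` X" "g:cmap (peval z) ` X" for f g
   using that iadd[OF XI] by (auto simp: ev.cmap_add[symmetric])
  show "c * f:cmap (peval z) ` X" if f: "f:cmap (peval z) ` X" for c f
  proof -
   obtain F where "F:X" "f = cmap (peval z) F" using f by blast
   hence "c * f = cmap (peval z) (cmap Const c * F)" by (simp add: ev.cmap_mult)
   thus ?thesis using iscale[OF XI \<open>F:X\<close>] by blast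
  qed
 qed
 show "hcomp d f:cmap (peval z) ` X" if "f:cmap (peval z) ` X" for f d
  using that hom_ideal_hcomp[OF X] by (auto simp: hcomp_cmap[of "peval z", OF ev.zero])
qed

lemma complex_gens:
 assumes J: "hideal (J :: ('n::finite) cpoly set)"
 shows "EX F e. finite F & F <= J & (ALL f:F. hom (e f) f) & J = igen F"
proof -
 have "cI {0} = {0 :: 'n cpoly}" by (auto simp: cI_iff poly_mapping_eq_iff fun_eq_iff)
 moreover have z: "0:J" using J izero by (auto simp: homogeneous_ideal_def)
 ultimately obtain F e where F: "finite F" "F <= J" "ALL f:F. hom (e f) f" "J = igen (cI {0} Un F)"
  using hom_gens[OF noeth_field J] by auto
 thus ?thesis using z \<open>cI {0} = {0 :: 'n cpoly}\<close> by (intro exI[of _ "insert 0 F"] exI[of _ e]) simp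
qed

lemma hpart_gens_mem:
 assumes F: "finite F" "!!f. f:F ==> hom (e f) f" and g: "g:hpart (igen F) d" and W: "idl W"
  and mem: "!!f ka. f:F ==> mdeg ka + e f = d ==> mon ka * f:W"
 shows "g:W"
proof -
 obtain h where h: "g = (SUM f:F. h f * f)" using g ideal.span_finite[OF F(1)] unfolding hpart_def by auto
 have "hcomp d (h f * f):W" if f: "f:F" for f
 proof (cases "e f <= d")
  case True
  have "hcomp (d - e f) (h f) * f:W" by (rule hom_mult_mem[OF W _ hom_hcomp]) (use mem[OF f] True in auto)
  moreover have "hcomp d (h f * f) = hcomp (d - e f) (h f) * f"
   by (rule hcomp_mult_hom[OF F(2)[OF f] True])
  ultimately show ?thesis by simp
 next
  case False
  thus ?thesis using hcomp_mult_0[OF F(2)[OF f], of d "h f"] izero[OF W] by simp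
 qed
 hence "hcomp d g:W" unfolding h hcomp_sum by (rule isetsum[OF W])
 thus ?thesis using g hcomp_hom[of d g d] by (simp add: hpart_def)
qed

lemma gen_large:
 assumes J: "hideal (J :: ('n::finite) cpoly set)"
 shows "EX r0. ALL r>=r0. ALL d>=r. hpart J d <= igen (hpart J r)"
proof -
 obtain F e where F: "finite F" "F <= J" "!!f. f:F ==> hom (e f) f" "J = igen F" using complex_gens[OF J] by blast
 note JI = homogeneousD[OF J]
 show ?thesis
 proof (intro exI[of _ "SUM f:F. e f"] allI impI subsetI)
  fix r d g assume r: "(SUM f:F. e f) <= r" "r <= d" and g: "g:hpart J d"
  show "g:igen (hpart J r)"
  proof (rule hpart_gens_mem[OF F(1,3) _ gen_ideal])
   show "g:hpart (igen F) d" using g F(4) by simp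
   fix f and ka :: "'n mon" assume f: "f:F" "mdeg ka + e f = d"
   have le: "e f <= r" using r(1) member_le_sum[of f F e] F(1) f(1) by simp
   have "r - e f <= mdeg ka" using f(2) r(2) by linarith
   then obtain ka1 ka2 where ka: "ka = ka1 + ka2" "mdeg ka2 = r - e f" using split_monomial by blast
   have "mon ka2 * f:hpart J r"
    using hom_mon_mult[OF F(3)[OF f(1)], of ka2] le F(2) f(1) iscale[OF JI] by (auto simp: hpart_def ka(2))
   thus "mon ka * f:igen (hpart J r)"
    unfolding ka(1) mon_add mult.assoc by (intro gen_scale gen_base)
  qed
 qed
qed

lemma hom_Proj_sub:
 assumes J: "hideal J" shows "hideal (Proj_sub J)"
proof -
 note JI = homogeneousD[OF J]
 show ?thesis
 proof (rule hom_idealI)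
  show "idl (Proj_sub J)"
  proof (rule idealI; unfold Proj_sub_def mem_Collect_eq; intro allI)
   show "EX k. Var i ^ k * 0:J" for i using izero[OF JI] by simp
   show "EX k. Var i ^ k * (c * f):J" if f: "ALL i. EX k. Var i ^ k * f:J" for c f i
    using iscale[OF JI, of _ c] spec[OF f, of i] by (metis mult.left_commute)
   fix f g i assume "ALL i. EX k. Var i ^ k * f:J" "ALL i. EX k. Var i ^ k * g:J"
   then obtain k l where "Var i ^ k * f:J" "Var i ^ l * g:J" by blast
   hence "Var i ^ l * (Var i ^ k * f) + Var i ^ k * (Var i ^ l * g):J"
    by (intro iadd[OF JI iscale[OF JI] iscale[OF JI]])
   thus "EX k. Var i ^ k * (f + g):J" by (intro exI[of _ "k + l"]) (simp add: power_add alg)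
  qed
  fix f d assume f: "f:Proj_sub J"
  show "hcomp d f:Proj_sub J" unfolding Proj_sub_def mem_Collect_eq
  proof
   fix i obtain k where "Var i ^ k * f:J" using f unfolding Proj_sub_def by blast
   from hom_ideal_hcomp[OF J this, of "k + d"] show "EX k. Var i ^ k * hcomp d f:J"
    using hcomp_mon_mult[of "sg i k" d f] by (auto simp: Var_power)
  qed
 qed
qed

text \<open>The K-th power of each variable brings the finitely many generators of the saturation
  into \<open>J\<close>, and a monomial of degree at least \<open>CARD('n) * K\<close> contains one
  of these powers.\<close>

lemma sat_large:
 assumes J: "hideal (J :: ('n::finite) cpoly set)"
 shows "EX r0. ALL d>=r0. hpart (Proj_sub J) d <= J"
proof -
 obtain F e where F: "finite F" "F <= Proj_sub J" "!!f. f:F ==> hom (e f) f" "Proj_sub J = igen F"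
  using complex_gens[OF hom_Proj_sub[OF J]] by blast
 note JI = homogeneousD[OF J]
 have "ALL fi. EX k. fst fi:F --> Var (snd fi) ^ k * fst fi:J" using F(2) unfolding Proj_sub_def by blast
 then obtain k where "ALL fi. fst fi:F --> Var (snd fi) ^ k fi * fst fi:J" using choice by metis
 hence k: "Var i ^ k (f, i) * f:J" if "f:F" for f i using that by force
 define K where "K = (SUM fi:F \<times> UNIV. k fi)"
 have kK: "Var i ^ K * f:J" if f: "f:F" for f i
 proof -
  have "k (f, i) <= K" unfolding K_def using f F(1) by (intro member_le_sum) auto
  hence "Var i ^ K * f = Var i ^ (K - k (f, i)) * (Var i ^ k (f, i) * f)" by (simp add: mult.assoc[symmetric] flip: power_add)
  thus ?thesis using iscale[OF JI k[OF f]] by simp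
 qed
 show ?thesis
 proof (intro exI[of _ "(SUM f:F. e f) + CARD('n) * K"] allI impI subsetI)
  fix d g assume d: "(SUM f:F. e f) + CARD('n) * K <= d" and g: "g:hpart (Proj_sub J) d"
  show "g:J"
  proof (rule hpart_gens_mem[OF F(1,3) _ JI])
   show "g:hpart (igen F) d" using g F(4) by simp
   fix f and ka :: "'n mon" assume f: "f:F" "mdeg ka + e f = d"
   have "e f <= (SUM f:F. e f)" using member_le_sum[of f F e] F(1) f(1) by simp
   hence "CARD('n) * K <= mdeg ka" using f(2) d by linarith
   then obtain i nu where "ka = sg i K + nu" by (rule big_monomial)
   hence "mon ka * f = mon nu * (Var i ^ K * f)" by (simp add: mon_add Var_power mult_ac)
   thus "mon ka * f:J" using iscale[OF JI kK[OF f(1)]] by simp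
  qed
 qed
qed

lemma fibre_large:
 fixes X :: "('n::finite, base_ring) pol set"
 assumes X: "hideal X"
 shows "EX r0. ALL d>=r0. hpart (fibre X z) d = cmap (peval z) ` hpart X d"
proof -
 let ?J = "cmap (peval z) ` X"
 note J = hom_image[OF X, of z]
 obtain r0 where r0: "!!d. d >= r0 ==> hpart (Proj_sub ?J) d <= ?J" using sat_large[OF J] by blast
 have "hpart (fibre X z) d = cmap (peval z) ` hpart X d" if d: "d >= r0" for d
 proof
  show "hpart (fibre X z) d <= cmap (peval z) ` hpart X d"
  proof
   fix f assume "f:hpart (fibre X z) d"
   hence f: "f:hpart (Proj_sub ?J) d" by (simp add: fibre_def cmap_def)
   then obtain F where "F:X" "f = cmap (peval z) F" using r0[OF d] by blast
   hence "f = cmap (peval z) (hcomp d F)" "hcomp d F:hpart X d"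
    using f hom_ideal_hcomp[OF X] hcomp_hom[of d f d] by (simp_all add: hpart_def flip: hcomp_cmap[of "peval z", OF rhom.zero[OF rhom_peval]])
   thus "f:cmap (peval z) ` hpart X d" by blast
  qed
  show "cmap (peval z) ` hpart X d <= hpart (fibre X z) d"
   by (auto simp: hpart_def fibre_def Proj_sub_def cmap_def[symmetric] hom_cmap[of "peval z", OF rhom.zero[OF rhom_peval]] intro!: exI[of _ 0])
 qed
 thus ?thesis by blast
qed

lemma basis_spans:
 fixes V :: "'n cpoly set"
 assumes V: "hrank_ge {0} V d n" "hrank_le {0} V d n"
 obtains fs where "length fs = n" "set fs <= hpart V d" "hpart V d <= igen (set fs)"
proof -
 obtain fs where fs: "set fs <= hpart V d" "length fs = n" "indep {0} (map lk fs)" using V(1) unfolding hrank_ge_def by blast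
 have "f:igen (set fs)" if f: "f:hpart V d" for f
 proof -
  have "~ length (f # fs) <= n" using fs(2) by simp
  hence "~ indep {0} (map lk (f # fs))" using V(2) fs(1) f unfolding hrank_le_def by (metis insert_subset list.simps(15))
  then obtain u j where u: "!!i. lc u (map lk (f # fs)) i = 0" "j < Suc n" "u j ~= 0" using fs(2) by (auto simp: indep_def)
  define g where "g = (SUM j<n. Const (u (Suc j)) * fs ! j)"
  have eq: "Const (u 0) * f + g = 0"
   using u(1) lk_lc[of "%j. u (Suc j)" fs] by (intro pm_eqI) (simp add: g_def fs(2) lk_add lk_Const)
  have "u 0 ~= 0"
  proof
   assume 0: "u 0 = 0"
   have "lc (%j. u (Suc j)) (map lk fs) i = 0" for i using eq lk_lc[of "%j. u (Suc j)" fs i] by (simp add: 0 g_def fs(2))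
   hence "u (Suc j) = 0" if "j < n" for j using indepD[OF fs(3), of "%j. u (Suc j)" j] that fs(2) by simp
   thus False using u(2,3) 0 by (cases j) auto
  qed
  have "f = Const (1 / u 0) * (Const (u 0) * f)" using \<open>u 0 ~= 0\<close> by (simp add: mult.assoc[symmetric] flip: Const_mult)
  also have "Const (u 0) * f = - g" using eq by (simp add: add_eq_0_iff2)
  finally have "f = - Const (1 / u 0) * g" by simp
  moreover have "g:igen (set fs)" unfolding g_def using fs(2) by (intro gen_sum gen_scale gen_base) auto
  ultimately show ?thesis by (simp add: gen_scale ideal.span_neg)
 qed
 thus ?thesis using that fs by blast
qed

text \<open>A family over an integral base with two marked closed points: the fibre at
  \<open>s\<close> is the monomial cone, the fibre at \<open>t\<close> is the variety to be
  degenerated.\<close>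

locale special_family = monomial_gens std x0 Gs for std :: "('n::finite) mon => bool" and x0 and Gs +
 fixes p :: "base_ring set" and X :: "('n, base_ring) pol set" and s t :: "nat => complex"
 assumes p: "prime_ideal p" and flat: "flat_family p X" and s: "s:base_points p" and t: "t:base_points p"
  and special: "fibre X s = {f. nonstdp f}"
begin

abbreviation "m == {f. peval s f = 0}"

abbreviation "V == fibre X t"

lemma X: "hideal X" and pI: "idl p" and XI: "idl X" and pX: "cI p <= X" and noeth: "noeth p" and pm: "p <= m"
proof -
 show X: "hideal X" and pI: "idl p" using flat p by (simp_all add: flat_family_def prime_ideal_def)
 thus XI: "idl X" by (simp add: homogeneous_ideal_def)
 show "cI p <= X" unfolding cI_eq_ideal_gen[OF pI] by (rule gen_minimal[OF _ XI]) (use flat in "simp add: flat_family_def")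
 show "noeth p" using flat by (intro noeth_affine_base) (simp add: flat_family_def)
 show "p <= m" using s by (auto simp: base_points_def)
qed

abbreviation "nd d == card {mu. ~ std mu & mdeg mu = d}"

lemma rank_special: "hrank_ge {0} (fibre X s) d (nd d)" and rank_special_le: "hrank_le {0} (fibre X s) d (nd d)"
proof -
 let ?B = "{mu :: 'n mon. ~ std mu & mdeg mu = d}"
 have fin: "finite ?B" by (rule finite_subset[OF _ finite_mdeg[of d]]) auto
 obtain ms where ms: "set ms = ?B" "distinct ms" using finite_distinct_list[OF fin] by blast
 have "indep {0} (map lk (map mon ms :: 'n cpoly list))" unfolding indep_def
 proof (intro allI impI)
  fix u j assume u: "ALL i. lc u (map lk (map mon ms :: 'n cpoly list)) i:{0}" and j: "j < length (map lk (map mon ms :: 'n cpoly list))"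
  have "lc u (map lk (map mon ms :: 'n cpoly list)) (ms ! j) = (SUM l<length ms. if l = j then u l else 0)"
   unfolding lc_def length_map using j nth_eq_iff_index_eq[OF ms(2)] by (intro sum.cong) (auto simp: lk_mon)
  thus "u j:{0}" using u j by simp
 qed
 moreover have "set (map mon ms :: 'n cpoly list) <= hpart (fibre X s) d"
  using ms(1) hom_mon by (auto simp: special hpart_def nonstdp_def lk_mon split: if_splits)
 moreover have "length (map mon ms :: 'n cpoly list) = nd d" using ms distinct_card[OF ms(2)] by simp
 ultimately show "hrank_ge {0} (fibre X s) d (nd d)" unfolding hrank_ge_def by blast
 show "hrank_le {0} (fibre X s) d (nd d)" unfolding hrank_le_def
 proof (intro allI impI, elim conjE)
  fix fs assume fs: "set fs <= hpart (fibre X s) d" "indep {0} (map lk fs)"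
  have "length (map lk fs) <= card ?B"
   by (rule indep_length_le[OF prime_zero fin _ fs(2)]) (use fs(1) in "auto simp: special hpart_def nonstdp_def hom_iff")
  thus "length fs <= card ?B" by simp
 qed
qed

lemma hrank_le_iff: "(hrank_le P Y d n) = (~ hrank_ge P Y d (Suc n))"
proof
 show "hrank_le P Y d n ==> ~ hrank_ge P Y d (Suc n)" unfolding hrank_le_def hrank_ge_def by (metis Suc_n_not_le_n)
 assume n: "~ hrank_ge P Y d (Suc n)"
 show "hrank_le P Y d n" unfolding hrank_le_def
 proof (intro allI impI, elim conjE)
  fix fs assume "set fs <= hpart Y d" "indep P (map lk fs)"
  hence "hrank_ge P Y d (length fs)" unfolding hrank_ge_def by blast
  thus "length fs <= n" using hrank_ge_le[of P Y d "length fs" "Suc n"] n by (meson not_less_eq_eq)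
 qed
qed

text \<open>The Hilbert function is constant in a flat family: the two semicontinuity results,
  applied at \<open>s\<close> and at \<open>t\<close>, pin the rank at each point to the generic
  one. The torsion statement at \<open>s\<close> is kept for the infinitesimal analysis.\<close>

lemma large_degrees:
 "EX d0. ALL d>=d0. (ALL F. F:hpart X d --> F:cI m --> F:isum (pro m X) (cI p)) &
  hpart (fibre X s) d = cmap (peval s) ` hpart X d & hpart V d = cmap (peval t) ` hpart X d &
  hrank_ge {0} V d (nd d) & hrank_le {0} V d (nd d)"
proof -
 have ch: "flat_quotient p smul (igen (X Un {Var i - 1}))" for i using flat by (simp add: flat_family_def)
 note tor = torsion_bound[OF noeth ch X pX]
 let ?n = "{f. peval t f = 0}"
 have pn: "p <= ?n" using t by (auto simp: base_points_def)
 note m = evaluation_prime[of s] and n = evaluation_prime[of t]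
 obtain d1 where d1: "!!d F. d1 <= d ==> F:hpart X d ==> F:cI m ==> F:isum (pro m X) (cI p)" using tor[OF primeD(1)[OF m] pm] by blast
 obtain d2 where d2: "!!d F. d2 <= d ==> F:hpart X d ==> F:cI ?n ==> F:isum (pro ?n X) (cI p)" using tor[OF primeD(1)[OF n] pn] by blast
 obtain d3 where d3: "!!d. d >= d3 ==> hpart (fibre X s) d = cmap (peval s) ` hpart X d" using fibre_large[OF X, of s] by blast
 obtain d4 where d4: "!!d. d >= d4 ==> hpart V d = cmap (peval t) ` hpart X d" using fibre_large[OF X, of t] by blast
 show ?thesis
 proof (intro exI[of _ "d1 + d2 + d3 + d4"] allI impI)
  fix d assume d: "d1 + d2 + d3 + d4 <= d"
  hence le: "d1 <= d" "d2 <= d" "d3 <= d" "d4 <= d" by simp_all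
  note d1 = d1[OF le(1)] and d2 = d2[OF le(2)] and S = d3[OF le(3)] and V = d4[OF le(4)]
  have ge: "hrank_ge p X d (nd d)"
   by (rule hrank_ge_mono[OF m p pm hrank_eval(1)[OF _ rank_special]]) (simp add: S)
  have "hrank_le m X d (nd d)" using rank_special_le hrank_eval(2)[of s X d "fibre X s" "Suc (nd d)"] S by (auto simp: hrank_le_iff)
  from hrank_le_specialize[OF noeth p X pX m pm d1 this] have "hrank_le p X d (nd d)" .
  hence le: "~ hrank_ge p X d (Suc (nd d))" by (simp add: hrank_le_iff)
  have "hrank_ge {0} V d (nd d)"
  proof (cases "nd d")
   case 0
   thus ?thesis unfolding hrank_ge_def by (intro exI[of _ "[]"]) (simp add: indep_def)
  next
   case (Suc k)
   have "hrank_ge ?n X d (Suc k)"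
   proof (rule ccontr)
    assume "~ hrank_ge ?n X d (Suc k)"
    hence "hrank_le ?n X d k" by (simp add: hrank_le_iff)
    from hrank_le_specialize[OF noeth p X pX n pn d2 this] have "hrank_le p X d k" .
    thus False using ge Suc by (simp add: hrank_le_iff)
   qed
   thus ?thesis unfolding Suc by (rule hrank_eval(2)[rotated]) (simp add: V)
  qed
  moreover have "hrank_le {0} V d (nd d)"
   using le hrank_ge_mono[OF n p pn hrank_eval(1)[of V d t X "Suc (nd d)"]] by (auto simp: hrank_le_iff V)
  ultimately show "(ALL F. F:hpart X d --> F:cI m --> F:isum (pro m X) (cI p)) &
   hpart (fibre X s) d = cmap (peval s) ` hpart X d & hpart V d = cmap (peval t) ` hpart X d &
   hrank_ge {0} V d (nd d) & hrank_le {0} V d (nd d)" using d1 S V by blast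
 qed
qed


text \<open>The forms have two tasks, to become the monomials at \<open>s\<close> and to generate
  the fibre at \<open>t\<close>. Lifts for the two tasks are interpolated by a function on the base
  with value 1 at \<open>s\<close> and 0 at \<open>t\<close>; if the points coincide, the first task
  implies the second.\<close>

lemma forms:
 assumes S: "hpart (fibre X s) r = cmap (peval s) ` hpart X r" and T: "hpart V r = cmap (peval t) ` hpart X r"
  and rk: "hrank_ge {0} V r N" "hrank_le {0} V r N" and mus: "bij_betw mus {..<N} {mu. ~ std mu & mdeg mu = r}"
 shows "EX G. (ALL j<N. G j:hpart X r & cmap (peval s) (G j) = mon (mus j)) &
  hpart V r <= igen ((%j. cmap (peval t) (G j)) ` {..<N})"
proof -
 have ns: "~ std (mus j)" "mdeg (mus j) = r" if "j < N" for j using mus that by (auto simp: bij_betw_def)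
 have "EX G. j < N --> G:hpart X r & cmap (peval s) G = mon (mus j)" for j
 proof (cases "j < N")
  case True
  have "(mon (mus j) :: 'n cpoly):hpart (fibre X s) r"
   using ns[OF True] hom_mon[of "mus j"] by (auto simp: special hpart_def nonstdp_def lk_mon split: if_splits)
  thus ?thesis unfolding S by (metis imageE)
 qed simp
 then obtain G where G: "!!j. j < N ==> G j:hpart X r" "!!j. j < N ==> cmap (peval s) (G j) = mon (mus j)" using choice by metis
 show ?thesis
 proof (cases "s = t")
  case True
  have "f:igen ((%j. cmap (peval t) (G j)) ` {..<N})" if f: "f:hpart V r" for f
  proof -
   let ?I = "igen ((%j. cmap (peval t) (G j)) ` {..<N})"
   have "(SUM mu:ks f. Const (lk f mu) * mon mu):?I"
   proof (intro gen_sum gen_scale gen_base)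
    fix mu assume "mu:ks f"
    hence "mu:mus ` {..<N}" unfolding bij_betw_imp_surj_on[OF mus]
    using f special by (auto simp: True hpart_def nonstdp_def hom_iff keysI)
    thus "mon mu:(%j. cmap (peval t) (G j)) ` {..<N}" using G(2) True by force
   qed
   thus ?thesis by (simp add: sum_sg flip: sg_eq)
  qed
  thus ?thesis using G by blast
 next
  case False
  then obtain i where i: "s i ~= t i" by blast
  define q :: base_ring where "q = Const (1 / (s i - t i)) * (Var i - Const (t i))"
  have q: "peval s q = 1" "peval t q = 0" using i by (simp_all add: q_def rhom.hom_simps[OF rhom_peval])
  obtain fs where fs: "length fs = N" "set fs <= hpart V r" "hpart V r <= igen (set fs)" using basis_spans[OF rk] by metis
  have "EX F. j < N --> F:hpart X r & cmap (peval t) F = fs ! j" for j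
  proof (cases "j < N")
   case True
   hence "fs ! j:hpart V r" using fs(1,2) nth_mem by blast
   thus ?thesis unfolding T by (metis imageE)
  qed simp
  then obtain F where F: "!!j. j < N ==> F j:hpart X r" "!!j. j < N ==> cmap (peval t) (F j) = fs ! j" using choice by metis
  define H where "H j = Const q * G j + Const (1 - q) * F j" for j
  have H: "H j:hpart X r" if "j < N" for j
   unfolding H_def using G(1)[OF that] F(1)[OF that]
   by (auto simp: hpart_def intro: hom_add hom_Const_mult iadd[OF XI] iscale[OF XI])
  have e: "cmap (peval z) (H j) = Const (peval z q) * cmap (peval z) (G j) + Const (1 - peval z q) * cmap (peval z) (F j)" for z j
   by (simp add: H_def rhom.cmap_add[OF rhom_peval] rhom.cmap_mult[OF rhom_peval] rhom.cmap_Const[OF rhom_peval] rhom.hom_simps[OF rhom_peval])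
  have "(%j. cmap (peval t) (H j)) ` {..<N} = set fs" unfolding set_conv_nth fs(1) using F(2) by (auto simp: e q image_iff)
  moreover have "cmap (peval s) (H j) = mon (mus j)" if "j < N" for j using G(2)[OF that] by (simp add: e q)
  ultimately show ?thesis using H fs(3) by (intro exI[of _ H]) simp
 qed
qed

text \<open>\<open>cone_lift\<close> is applied to X + c for c = p + m^k, the restriction of the
  family to an infinitesimal neighbourhood of \<open>s\<close>. For k = 0 this \<open>c\<close> is
  the whole ring and not contained in \<open>m\<close>, hence the separate case.\<close>

lemma deformed:
 assumes d0: "!!d F. d >= r ==> F:hpart X d ==> F:cI m ==> F:isum (pro m X) (cI p)"
  and S: "!!d. d >= r ==> hpart (fibre X s) d = cmap (peval s) ` hpart X d"
  and G: "!!j. j < N ==> G j:X & ~ std (mus j) & cmap (peval s) (G j) = mon (mus j)"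
 shows "EX th. first_rels m (isum p (ipow m k)) th & (ALL j<N. EX h. (ALL e. h e:cI m) &
   G j - mon (mus j - base (mus j)) * th (base (mus j)) - comb h th:cI (isum p (ipow m k)))"
proof -
 note mI = primeD(1)[OF evaluation_prime[of s]]
 define c where "c = isum p (ipow m k)"
 have cI': "idl c" "p <= c" "ipow m k <= c" unfolding c_def by (rule isum_ideal[OF pI ipow_ideal] isum_left[OF ipow_ideal] isum_right[OF pI])+
 note cc = icI[OF cI'(1)] and cm0 = icI[OF mI]
 interpret ev: rhom "peval s" by (rule rhom_peval)
 have m_iff: "(f:cI m) = (cmap (peval s) f = 0)" for f :: "('n, base_ring) pol"
  by (auto simp: cI_iff poly_mapping_eq_iff fun_eq_iff ev.lk_cm)
 show ?thesis
 proof (cases k)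
  case 0
  hence "c = UNIV" using cI'(3) by auto
  hence "cI c = (UNIV :: ('n, base_ring) pol set)" by (simp add: cI_iff set_eq_iff)
  thus ?thesis unfolding c_def[symmetric] first_rels_def using hom_mon izero[OF cm0]
   by (intro exI[of _ mon] conjI ballI allI impI exI[of _ "%_. 0"]) simp_all
 next
  case (Suc k')
  have "ipow m (Suc k') <= m" unfolding ipow.simps
   by (rule gen_minimal[OF _ mI]) (use iright[OF mI] in blast)
  hence cm: "c <= m" unfolding c_def Suc by (intro isum_minimal[OF mI pm])
  let ?X = "isum X (cI c)"
  have hX: "hideal ?X"
  proof (rule hom_idealI[OF isum_ideal[OF XI cc]])
   show "hcomp d f:?X" if "f:?X" for f d
    using that hom_ideal_hcomp[OF X] hcomp_cI[OF cI'(1)] by (auto simp: isum_def hcomp_add) blast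
  qed
  interpret cone_gens std x0 ?X m c k r Gs
  proof unfold_locales
   show "hideal ?X" "cI c <= ?X" "idl m" "idl c" "c <= m" "ipow m k <= c"
    using hX isum_right[OF XI] mI cI' cm by auto
   show "F:isum (pro m ?X) (cI c)" if d: "d >= r" and F: "F:hpart ?X d" "F:cI m" for d F
   proof -
    obtain A B where AB: "A:X" "B:cI c" "F = A + B" using F(1) unfolding hpart_def isum_def by blast
    have Fd: "F = hcomp d A + hcomp d B" using F(1) hcomp_hom[of d F d] by (simp add: hpart_def AB(3) hcomp_add)
    have B: "hcomp d B:cI c" by (rule hcomp_cI[OF cI'(1) AB(2)])
    have "hcomp d A:cI m" using iminus[OF cm0 F(2) subsetD[OF cI_mono[OF cm] B]] Fd by simp
    moreover have "hcomp d A:hpart X d" by (simp add: hpart_def hom_ideal_hcomp[OF X AB(1)])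
    ultimately have "hcomp d A:isum (pro m X) (cI p)" using d0[OF d] by blast
    then obtain A' B' where A': "A':pro m X" "B':cI p" "hcomp d A = A' + B'" unfolding isum_def by blast
    have "A':pro m ?X" using pro_mono[OF isum_left[OF cc]] A'(1) by blast
    moreover have "B' + hcomp d B:cI c" using iadd[OF cc subsetD[OF cI_mono[OF cI'(2)] A'(2)] B] .
    ultimately show ?thesis using isumI[of A' "pro m ?X" "B' + hcomp d B" "cI c"] by (simp add: Fd A'(3) add.assoc)
   qed
   show "EX f:hpart ?X (mdeg mu). f - mon mu:cI m" if mu: "~ std mu" "r <= mdeg mu" for mu
   proof -
    have "(mon mu :: 'n cpoly):hpart (fibre X s) (mdeg mu)"
    using mu(1) hom_mon by (auto simp: special hpart_def nonstdp_def lk_mon split: if_splits)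
    then obtain f where "f:hpart X (mdeg mu)" "cmap (peval s) f = mon mu" unfolding S[OF mu(2)] by (metis imageE)
    thus ?thesis using isum_left[OF cc]
    by (intro bexI[of _ f]) (auto simp: m_iff rhom.diff[OF ev.rhom_cmap] ev.cmap_mon hpart_def)
   qed
   show "lk f mu:m" if f: "f:?X" and mu: "std mu" for f mu
   proof -
    obtain A B where AB: "A:X" "B:cI c" "f = A + B" using f unfolding isum_def by blast
    have "cmap (peval s) A:fibre X s" using AB(1) by (auto simp: fibre_def Proj_sub_def cmap_def[symmetric] intro!: exI[of _ 0])
    hence "lk (cmap (peval s) A) mu = 0" using mu by (auto simp: special nonstdp_def)
    moreover have "lk B mu:m" using AB(2) cm by (auto simp: cI_iff)
    ultimately show ?thesis by (simp add: AB(3) lk_add ev.add ev.lk_cm)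
   qed
  qed
  obtain th where th: "first_rels m c th" "!!g. g:Gs ==> th g:sat"
   "!!f. f:sat ==> f:cI m ==> EX k. (ALL e. k e:cI m) & f - comb k th:cI c" using cone_lift by blast
  have "EX h. (ALL e. h e:cI m) & G j - mon (mus j - base (mus j)) * th (base (mus j)) - comb h th:cI c" if j: "j < N" for j
  proof (rule th(3))
   have b: "base (mus j):Gs" "mon (mus j - base (mus j)) * mon (base (mus j)) = (mon (mus j) :: ('n, base_ring) pol)"
    using base[of "mus j"] G[OF j] by (simp_all flip: mon_add)
   have "G j:sat" using G[OF j] X_sat isum_left[OF cc] by blast
   thus "G j - mon (mus j - base (mus j)) * th (base (mus j)):sat"
    by (rule iminus[OF sat_ideal _ iscale[OF sat_ideal th(2)[OF b(1)]]])
   have "th (base (mus j)) - mon (base (mus j)):cI m" using th(1) b(1) by (simp add: first_rels_def)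
   hence "cmap (peval s) (th (base (mus j))) = mon (base (mus j))" by (simp add: m_iff rhom.diff[OF ev.rhom_cmap] ev.cmap_mon)
   moreover have "cmap (peval s) (mon (mus j - base (mus j)) * mon (base (mus j))) = (mon (mus j) :: 'n cpoly)" unfolding b(2) by (rule ev.cmap_mon)
   ultimately show "G j - mon (mus j - base (mus j)) * th (base (mus j)):cI m"
    using G[OF j] by (simp add: m_iff rhom.diff[OF ev.rhom_cmap] ev.cmap_mult ev.cmap_mon)
  qed
  thus ?thesis unfolding c_def[symmetric] using th(1) by blast
 qed
qed

end

section \<open>Degenerations to toric varieties\<close>

locale toric_special_family = special_family std x0 Gs p X s t + groebner std x0 Gs ta0 ta w nu \<pi>
 for std :: "('n::finite) mon => bool" and x0 Gs p X s t and ta0 ta :: "'n => real ^ 'd::finite" and w nu \<pi>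
begin

text \<open>The first branch carries the forms \<open>G\<close> of the given family, the second the
  deformed monomials \<open>K (mus j)\<close>, which run from the monomial point at t = 0 to
  generators of the toric ideal at t = 1. The common prime puts the far ends of both on one integral
  base.\<close>

lemma toric_family:
 assumes T2: T2_vanishes and VP: "Proj_sub V = V"
 shows "EX p' X' t' s'. prime_ideal p' & flat_family p' X' & t':base_points p' & s':base_points p' &
  fibre X' t' = V & fibre X' s' = Proj_sub (toric_ideal ta)"
proof -
 obtain d0 where "ALL d>=d0. (ALL F. F:hpart X d --> F:cI m --> F:isum (pro m X) (cI p)) &
  hpart (fibre X s) d = cmap (peval s) ` hpart X d & hpart V d = cmap (peval t) ` hpart X d &
  hrank_ge {0} V d (nd d) & hrank_le {0} V d (nd d)" using large_degrees by (elim exE)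
 hence d0: "F:hpart X d ==> F:cI m ==> F:isum (pro m X) (cI p)"
  "hpart (fibre X s) d = cmap (peval s) ` hpart X d" "hpart V d = cmap (peval t) ` hpart X d"
  "hrank_ge {0} V d (nd d)" "hrank_le {0} V d (nd d)" if "d0 <= d" for d F using that by blast+
 have hV: "hideal V" unfolding fibre_def cmap_def[symmetric] by (rule hom_Proj_sub[OF hom_image[OF X]])
 hence VI: "idl V" by (simp add: homogeneous_ideal_def)
 obtain r1 where r1: "ALL r>=r1. ALL d>=r. hpart V d <= igen (hpart V r)" using gen_large[OF hV] by (elim exE)
 \<comment> \<open>The degree has to exceed the bound for constant rank, the bound for generation of
   \<open>V\<close> and the degrees of all monomial generators; the sum does so.\<close>
 define r where "r = d0 + r1 + (SUM g:Gs. mdeg g)"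
 have rr: "d0 <= d" if "r <= d" for d using that by (simp add: r_def)
 have Gsr: "mdeg g <= r" if "g:Gs" for g using member_le_sum[of g Gs mdeg] finite_Gs that by (simp add: r_def)
 define M where "M = card {mu :: 'n mon. mdeg mu = r}"
 define N where "N = nd r"
 obtain mm where mm: "bij_betw mm {..<M} {mu :: 'n mon. mdeg mu = r}"
  using ex_bij_betw_nat_finite[OF finite_mdeg[of r]] unfolding M_def atLeast0LessThan by (elim exE)
 have "finite {mu :: 'n mon. ~ std mu & mdeg mu = r}" by (rule finite_subset[OF _ finite_mdeg[of r]]) auto
 then obtain mus where mus: "bij_betw mus {..<N} {mu. ~ std mu & mdeg mu = r}"
  using ex_bij_betw_nat_finite unfolding N_def atLeast0LessThan by blast
 have ns: "~ std (mus j)" "mdeg (mus j) = r" if "j < N" for j using mus that by (auto simp: bij_betw_def)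
 interpret universal std x0 Gs r N M mm mus using mm mus Gsr by unfold_locales
 obtain G where "(ALL j<N. G j:hpart X r & cmap (peval s) (G j) = mon (mus j)) &
  hpart V r <= igen ((%j. cmap (peval t) (G j)) ` {..<N})"
  using forms[OF d0(2)[OF rr[OF order_refl]] d0(3)[OF rr[OF order_refl]] d0(4,5)[OF rr[OF order_refl], folded N_def] mus] by (elim exE)
 hence G0: "ALL j<N. G j:hpart X r & cmap (peval s) (G j) = mon (mus j)"
  and GV: "hpart V r <= igen ((%j. cmap (peval t) (G j)) ` {..<N})" by blast+
 have G: "G j:X" "hom r (G j)" "cmap (peval s) (G j) = mon (mus j)" "cmap (peval t) (G j):V" if "j < N" for j
  using d0(3)[OF rr[OF order_refl]] G0 that by (auto simp: hpart_def)
 have hG: "hom r (cmap (peval z) (G j))" if "j < N" for j z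
  by (rule hom_cmap[of "peval z", OF rhom.zero[OF rhom_peval] G(2)[OF that]])
 have ev1: "rhom (%p::complex poly. poly p 1)" by unfold_locales simp_all
 have "EX q. prime_ideal q & p0 <= q & (ALL f:q. spec Const G f:p) & (ALL f:q. spec (%z. [:z:]) (%j. K (mus j)) f = 0)"
 proof (rule common_prime[OF T2 noeth p pm])
  show "hom r (G j)" "hom r (K (mus j))" if "j < N" for j using G(2)[OF that] K_hom[OF ns(1)[OF that]] ns(2)[OF that] by simp_all
  show "EX th. first_rels m (isum p (ipow m k)) th & (ALL j<N. EX h. (ALL e. h e:cI m) &
   G j - mon (mus j - base (mus j)) * th (base (mus j)) - comb h th:cI (isum p (ipow m k)))" for k
  proof (rule deformed[where r = r])
   show "F:isum (pro m X) (cI p)" if "r <= d" "F:hpart X d" "F:cI m" for d F by (rule d0(1)[OF rr[OF that(1)] that(2,3)])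
   show "hpart (fibre X s) d = cmap (peval s) ` hpart X d" if "r <= d" for d by (rule d0(2)[OF rr[OF that]])
  qed (use G(1,3) ns(1) in simp)
  show "first_rels (up 1) {0} th" by (rule gu_first_rels)
  show "EX b. b - mon (mus j - base (mus j)):cI (up 1) & K (mus j) = b * th (base (mus j))" for j
   unfolding K_def by (intro exI[of _ "gu (mon (mus j - base (mus j)))"] conjI gu_minus refl)
 qed
 then obtain q where q: "prime_ideal q" "p0 <= q" "!!f. f:q ==> spec Const G f:p" "!!f. f:q ==> spec (%z. [:z:]) (%j. K (mus j)) f = 0" by blast
 define pt where "pt u i = (if i < N * M then lk (u (i div M)) (mm (i mod M)) else 0)" for u :: "nat => 'n cpoly" and i
 have pt: "peval (pt u) = spec (%c. c) u" for u unfolding spec_def pt_def ..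
 have gen_pt: "cmap (peval (pt u)) (gen j) = u j" if "j < N" "hom r (u j)" for u j
  unfolding pt by (rule spec_gen[of _ _ u, OF rhom_id that])
 have q_pt: "peval (pt (%j. cmap (peval z) (G j))) f = 0" if "f:q" "z:base_points p" for z f
  using spec_comp[OF rhom_peval rhom_Const, of z G f] q(3)[OF that(1)] that(2) by (simp add: pt base_points_def)
 define tT where "tT j = relab (E (mus j))" for j
 have tT: "cmap (%p. poly p 1) (K (mus j)) = tT j" if "j < N" for j using K_1[OF ns(1)[OF that]] by (simp add: tT_def)
 have tTt: "tT j:hpart (toric_ideal ta) r" if "j < N" for j unfolding tT_def using ns[OF that] by (intro relab_E_toric) (simp add: B_def)
 have ptT: "peval (pt tT) f = 0" if "f:q" for f
 proof -
  have "spec (%c. c) (%j. cmap (%p. poly p 1) (K (mus j))) f = 0"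
   using spec_comp[OF ev1 rhom_const_poly, of "%j. K (mus j)" f] q(4)[OF that] by simp
  moreover have "pt (%j. cmap (%p. poly p 1) (K (mus j))) = pt tT"
   by (rule ext) (simp add: pt_def tT less_mult_imp_div_less)
  ultimately show ?thesis by (simp flip: pt)
 qed
 interpret cf: common_family std x0 Gs r N M mm mus q "pt (%j. cmap (peval s) (G j))"
 proof
  show "cmap (peval (pt (%j. cmap (peval s) (G j)))) (gen j) = mon (mus j)" if "j < N" for j
   using gen_pt[of j "%j. cmap (peval s) (G j)"] hG[OF that, of s] G(3)[OF that] that by simp
 qed (use q(1,2) q_pt[OF _ s] in auto)
 let ?tV = "%j. cmap (peval t) (G j)"
 have V1: "hpart V d <= igen (?tV ` {..<N})" if d: "r <= d" for d
 proof -
  have "igen (hpart V r) <= igen (?tV ` {..<N})" by (rule gen_minimal[OF GV gen_ideal])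
  moreover have "hpart V d <= igen (hpart V r)" using r1 d by (simp add: r_def)
  ultimately show ?thesis by blast
 qed
 have T1: "hpart (toric_ideal ta) d <= igen (tT ` {..<N})" if d: "r <= d" for d
 proof -
  have "f:igen (tT ` {..<N})" if f: "f:hpart (toric_ideal ta) r" for f
  proof -
   obtain c where c: "f = (SUM mu:B r. Const (c mu) * relab (E mu))" using toric_span[OF f] by blast
   show ?thesis unfolding c
   proof (intro gen_sum gen_scale gen_base)
    fix mu assume "mu:B r"
    hence "mu:mus ` {..<N}" unfolding bij_betw_imp_surj_on[OF mus] by (simp add: B_def)
    thus "relab (E mu):tT ` {..<N}" by (auto simp: tT_def)
   qed
  qed
  hence "igen (hpart (toric_ideal ta) r) <= igen (tT ` {..<N})" by (intro gen_minimal[OF _ gen_ideal]) blast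
  thus ?thesis using toric_generated[OF Gsr d] by blast
 qed
 have "EX p X t s. prime_ideal p & flat_family p X & t:base_points p & s:base_points p &
  fibre X t = Proj_sub (igen (?tV ` {..<N})) & fibre X s = Proj_sub (igen (tT ` {..<N}))"
 proof (rule cf.family_through[OF _ _ V1 _ _ _ T1])
  show "ALL f:q. peval (pt ?tV) f = 0" "ALL f:q. peval (pt tT) f = 0" using q_pt[OF _ t] ptT by blast+
  show "cmap (peval (pt ?tV)) (gen j) = ?tV j" "cmap (peval (pt tT)) (gen j) = tT j" if "j < N" for j
   using gen_pt[OF that, of ?tV] gen_pt[OF that, of tT] hG[OF that] tTt[OF that] by (simp_all add: hpart_def)
  show "hrank_ge {0} V d (nd d)" "hrank_ge {0} (toric_ideal ta) d (nd d)" if "r <= d" for d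
   using d0(4)[OF rr[OF that]] toric_rank[of d] by (simp_all add: B_def)
 qed
 moreover have "Proj_sub (igen (?tV ` {..<N})) = Proj_sub V"
  by (rule Proj_sub_truncate[OF hV gen_ideal gen_minimal[OF _ VI] V1]) (use G(4) in blast)
 moreover have "Proj_sub (igen (tT ` {..<N})) = Proj_sub (toric_ideal ta)"
  by (rule Proj_sub_truncate[OF hom_toric gen_ideal gen_minimal[OF _ is_ideal_toric] T1])
   (use tTt in "auto simp: hpart_def")
 ultimately show ?thesis unfolding VP by simp
qed

end

theorem proposition2p3:
  fixes V :: "('n::finite) cpoly set"
    and H U :: "'n cpoly set set"
    and K :: "('v::finite) set set"
    and n m :: nat
    and \<sigma> :: "'v + nat \<Rightarrow> 'n"
    and Q :: "(real ^ 'd::finite) set"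
    and T :: "(real ^ 'd) set set"
  assumes "smooth_Fano V"
    and "general_member H U V"
    and "combinatorial_sphere n K"
    and "T2 (SR_ideal K) = {T2_coboundaries (SR_ideal K)}"
    and "bij_betw \<sigma> (\<Union>(join K (full_simplex m))) UNIV"
    and "degenerates U V (Proj_sub (SR_ideal ((\<lambda>s. \<sigma> ` s) ` join K (full_simplex m))))"
    and "lattice_polytope Q"
    and "regular_triangulation T Q"
    and "unimodular T"
    and "complex_iso (vertex_complex T) (join K (full_simplex m))"
  shows "(\<exists>\<tau> :: 'n \<Rightarrow> real ^ 'd. bij_betw \<tau> UNIV (Q \<inter> lattice)) \<and>
    (\<forall>\<tau> :: 'n \<Rightarrow> real ^ 'd. bij_betw \<tau> UNIV (Q \<inter> lattice) \<longrightarrow>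
      degenerates U V (Proj_sub (toric_ideal \<tau>)))"
proof -
 obtain h where h: "triangulates T Q"
  "vertex_complex T = {{u:Q Int lattice. c \<bullet> u + b = h u} | c b. ALL u:Q Int lattice. c \<bullet> u + b <= h u}"
  using assms(8) unfolding regular_triangulation_def by (elim conjE exE)
 interpret J: toric_join K m \<sigma> Q T h
  by unfold_locales (use assms(3,5,7,9,10) h in "simp_all add: combinatorial_sphere_def")
 obtain ta0 and w :: "'n => nat" where "bij_betw ta0 UNIV (Q Int lattice) &
  (ALL mu nu. J.std mu --> J.std nu --> mdeg mu = mdeg nu --> timg ta0 mu = timg ta0 nu --> mu = nu) &
  (ALL g:J.Gs. EX nu. J.std nu & mdeg nu = mdeg g & timg ta0 nu = timg ta0 g &
   (SUM i:UNIV. lk nu i * w i) < (SUM i:UNIV. lk g i * w i))" using J.toric_data by (elim exE)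
 hence ta0: "bij_betw ta0 UNIV (Q Int lattice)"
  and sep: "!!mu nu. J.std mu ==> J.std nu ==> mdeg mu = mdeg nu ==> timg ta0 mu = timg ta0 nu ==> mu = nu"
  and "ALL g. EX nu. g:J.Gs --> mdeg nu = mdeg g & timg ta0 nu = timg ta0 g &
   (SUM i:UNIV. lk nu i * w i) < (SUM i:UNIV. lk g i * w i)" by blast+
 from choice[OF this(3)] obtain nu where nu: "!!g. g:J.Gs ==> mdeg (nu g) = mdeg g & timg ta0 (nu g) = timg ta0 g &
   (SUM i:UNIV. lk (nu g) i * w i) < (SUM i:UNIV. lk g i * w i)" by blast
 obtain p X B s t where d: "prime_ideal p" "flat_family p X" "openin (base_zariski p) B" "t:B" "fibre X t = V"
  "s:base_points p" "fibre X s = Proj_sub (SR_ideal J.L)"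
  using assms(6) unfolding degenerates_def J.L_def by blast
 have "topspace (base_zariski p) <= base_points p" unfolding base_zariski_def by (simp add: topology_generated_by_topspace) blast
 hence t: "t:base_points p" using openin_subset[OF d(3)] d(4) by blast
 \<comment> \<open>The Stanley--Reisner ideal of the join is already saturated: multiplication by a
   simplex coordinate shifts coefficients without affecting standardness.\<close>
 have "J.nonstdp f" if f: "f:Proj_sub (SR_ideal J.L)" for f
 proof -
  obtain k where k: "J.nonstdp (Var (\<sigma> (Inr 0)) ^ k * f)" using f unfolding Proj_sub_def J.SR_L by blast
  show ?thesis unfolding J.nonstdp_def
  proof (intro allI impI)
   fix mu assume "lk f mu ~= 0"
   hence "lk (Var (\<sigma> (Inr 0)) ^ k * f) (sg (\<sigma> (Inr 0)) k + mu) ~= 0" by (simp add: Var_power lk_mon_mult)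
   hence "~ J.std (sg (\<sigma> (Inr 0)) k + mu)" using k unfolding J.nonstdp_def by blast
   thus "~ J.std mu" using J.std_cone_power[of mu k] by (simp add: add.commute)
  qed
 qed
 moreover have "f:Proj_sub (SR_ideal J.L)" if "J.nonstdp f" for f
  using that unfolding Proj_sub_def J.SR_L[symmetric] by (auto intro: exI[of _ 0])
 ultimately have special: "fibre X s = {f. J.nonstdp f}" unfolding d(7) by blast
 have Vc: "Proj_sub V = V" and VU: "V:U" and U: "hilbert_open U"
  using assms(1,2) by (auto simp: smooth_Fano_def smooth_variety_def projective_variety_def closed_subschemes_def general_member_def openin_hilbert_space)
 have "degenerates U V (Proj_sub (toric_ideal ta))" if ta: "bij_betw ta UNIV (Q Int lattice)" for ta :: "'n => real ^ 'd"
 proof -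
  define \<pi> where "\<pi> i = inv ta (ta0 i)" for i
  have ta\<pi>: "ta (\<pi> i) = ta0 i" for i using ta ta0 unfolding \<pi>_def bij_betw_def by (metis f_inv_into_f rangeI)
  have "inj \<pi>" using ta\<pi> ta0 by (metis bij_betw_imp_inj_on injD injI)
  hence "bij \<pi>" by (simp add: bij_def finite_UNIV_inj_surj)
  then interpret F: toric_special_family J.std "\<sigma> (Inr 0)" J.Gs p X s t ta0 ta w nu \<pi>
   by unfold_locales (use d t special sep nu ta\<pi> in auto)
  obtain p' X' t' s' where f: "prime_ideal p'" "flat_family p' X'" "t':base_points p'" "s':base_points p'"
   "fibre X' t' = V" "fibre X' s' = Proj_sub (toric_ideal ta)"
   using F.toric_family[OF J.T2_vanishes_join[OF assms(4)]] Vc unfolding d(5) by blast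
  let ?B = "{b:base_points p'. fibre X' b:U}"
  have "openin (base_zariski p') ?B" using U f(2) unfolding hilbert_open_def by blast
  thus ?thesis unfolding degenerates_def using f VU
   by (intro exI[of _ p'] exI[of _ X'] exI[of _ ?B] exI[of _ s'] exI[of _ t']) simp
 qed
 thus ?thesis using ta0 by blast
qed

end
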